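(* Let $\Omega\subset\mathbb{R}^n$ be a bounded, connected, open set. Let $v\in L^1(\Omega)$ be a non-negative measurable weight, and let $Q$ be a measurable function on $\Omega$ with values in the symmetric, non-negative definite $n\times n$ real matrices such that, for some constant $c$ independent of $x$ and $\xi$, $$\langle Q(x)\xi,\xi\rangle=|\sqrt{Q(x)}\,\xi|^2\le c\,v(x)|\xi|^2\qquad (x\in\Omega,\ \xi\in\mathbb{R}^n).$$ Let $N\in\mathbb{N}$, let $F\in L^2(v,\Omega)$ and $\mathbf{G},\mathbf{H}\in L^2(v,\Omega,\mathbb{R}^N)$, and let $\mathbf{R}=(R_1,\dots,R_N)$ and $\mathbf{S}=(S_1,\dots,S_N)$ be $N$-tuples of degenerate subunit vector fields with respect to $v$ and $Q$. Assume the compatibility condition $$\int_\Omega(\mathbf{G}\cdot\mathbf{S}\varphi+F\varphi)\,v\,dx\ge 0\qquad\text{for every non-negative }\varphi\in \mathrm{Lip}_0(\Omega).$$ Let $L$ be the operator given formally by $$Lu=-v^{-1}\operatorname{div}(Q\nabla u)+\mathbf{H}\cdot\mathbf{R}u+\mathbf{S}'\mathbf{G}u+Fu.$$ Suppose that one of the following is true: (1) for some $\sigma>1$ there is a constant $S(\sigma)>0$ such that $$\Big(\int_\Omega|\varphi|^{2\sigma}\,v\,dx\Big)^{\frac1{2\sigma}}\le S(\sigma)\Big(\int_\Omega|\sqrt{Q}\nabla\varphi|^2\,dx\Big)^{\frac12}\qquad\text{for every }\varphi\in \mathrm{Lip}_0(\Omega),$$ and for some $q>2\sigma'$ (where $\tfrac1\sigma+\tfrac1{\sigma'}=1$)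 we have $\mathbf{G},\mathbf{H}\in L^q(v,\Omega,\mathbb{R}^N)$ and $F\in L^{q/2}(v,\Omega)$; (2) for some $\sigma>0$, with $A(t)=t^2\log(e+t)^\sigma$, there is a constant $S(A)>0$ such that $$\|\varphi\|_{L^A(v,\Omega)}\le S(A)\Big(\int_\Omega|\sqrt{Q}\nabla\varphi|^2\,dx\Big)^{\frac12}\qquad\text{for every }\varphi\in \mathrm{Lip}_0(\Omega),$$ and, for some $0<\lambda<1$, $\mathbf{G},\mathbf{H}\in L^C(v,\Omega,\mathbb{R}^N)$ and $F\in L^D(v,\Omega)$, where $C(t)=\exp\big(t^{\frac{2}{\lambda\sigma}}\big)-1$ and $D(t)=\exp\big(t^{\frac{1}{\lambda\sigma}}\big)-1$; (3) there is a constant $S(2,1)>0$ such that $$\Big(\int_\Omega|\varphi|^{2}\,v\,dx\Big)^{\frac1{2}}\le S(2,1)\Big(\int_\Omega|\sqrt{Q}\nabla\varphi|^2\,dx\Big)^{\frac12}\qquad\text{for every }\varphi\in \mathrm{Lip}_0(\Omega),$$ $F\in L^\infty(v,\Omega)$, $\mathbf{G},\mathbf{H}\in L^\infty(v,\Omega,\mathbb{R}^N)$, and $$\max\big(C(\mathbf{R}),C(\mathbf{S})\big)\,S(2,1)\,\big(\|\mathbf{G}\|_{L^\infty(v,\Omega)}+\|\mathbf{H}\|_{L^\infty(v,\Omega)}\big)<1.$$ Let $u\in QH^{1,2}(v,\Omega)$. If $Lu\le 0$ in $\Omega$ (in the degenerate weak sense), then $$\sup_\Omega u\le\sup_{\partial\Omega}u^+.$$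 If $Lu\ge 0$ in $\Omega$ (in the degenerate weak sense), then $$\inf_\Omega u\ge\inf_{\partial\Omega}u^-.$$
   Context: **Function spaces.** $\mathrm{Lip}_{loc}(\Omega)$ is the set of locally Lipschitz functions on $\Omega$, and $\mathrm{Lip}_0(\Omega)$ the set of Lipschitz functions with compact support in $\Omega$. $L^p(v,\Omega)$ is the Lebesgue space with respect to the measure $v\,dx$; $L^p(v,\Omega,\mathbb{R}^N)$ is its $\mathbb{R}^N$-valued version (norm of $|\mathbf{G}|$). For a Young function $A$, $L^A(v,\Omega)$ is the Orlicz space with Luxemburg norm $\|\varphi\|_{L^A(v,\Omega)}=\inf\{\lambda>0:\int_\Omega A(|\varphi|/\lambda)\,v\,dx\le1\}$, and similarly for vector-valued functions. $QL^2(\Omega)$ is the space of measurable $\mathbf{g}:\Omega\to\mathbb{R}^n$ with $\|\mathbf{g}\|_{QL^2(\Omega)}^2=\int_\Omega|\sqrt{Q}\,\mathbf{g}|^2\,dx<\infty$, where $\mathbf{g}$ and $\mathbf{h}$ are identified if $\|\mathbf{g}-\mathbf{h}\|_{QL^2(\Omega)}=0$; it is a Banach space. Put $\|\varphi\|_{QH^1(v,\Omega)}=\|\varphi\|_{L^2(v,\Omega)}+\|\nabla\varphi\|_{QL^2(\Omega)}$. $QH^{1,2}(v,\Omega)$ (also written $QH^1(v,\Omega)$) is the completion in this norm of $\{\varphi\in\mathrm{Lip}_{loc}(\Omega):\|\varphi\|_{QH^1(v,\Omega)}<\infty\}$, and $QH^{1,2}_0(v,\Omega)$ (also written $QH^1_0(v,\Omega)$)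 is the completion of $\mathrm{Lip}_0(\Omega)$. Both are identified with closed subspaces of $L^2(v,\Omega)\oplus QL^2(\Omega)$: an element is a pair $(u,\mathbf{g})$ for which there are functions $\varphi_k$ in the space being completed with $\varphi_k\to u$ in $L^2(v,\Omega)$ and $\nabla\varphi_k\to\mathbf{g}$ in $QL^2(\Omega)$. One writes $\nabla u$ for $\mathbf{g}$ and $u$ for the pair $(u,\nabla u)$, although $\mathbf{g}$ need not be determined by $u$. **Subunit vector fields.** For measurable $\mathbf{v}:\Omega\to\mathbb{R}^n$, the vector field $V=\mathbf{v}\cdot\nabla$ is a degenerate subunit vector field with respect to $v$ and $Q$ if there is a constant $C(V)>0$ with $\|V\varphi\|_{L^2(v,\Omega)}\le C(V)\|\varphi\|_{QH^1(v,\Omega)}$ for all $\varphi\in\mathrm{Lip}_0(\Omega)$. For a pair $(u,\nabla u)$, $Vu$ means $\mathbf{v}\cdot\nabla u$. For an $N$-tuple $\mathbf{S}=(S_1,\dots,S_N)$ of such fields, $\mathbf{S}\varphi=(S_1\varphi,\dots,S_N\varphi)$, and $C(\mathbf{S})$ denotes a constant with $\|\mathbf{S}\varphi\|_{L^2(v,\Omega)}\le C(\mathbf{S})\|\varphi\|_{QH^1(v,\Omega)}$ for all $\varphi\in\mathrm{Lip}_0(\Omega)$; likewise $C(\mathbf{R})$. The formal adjoint is $V'\varphi=-\frac1v\operatorname{div}(\mathbf{v}\varphi v)$, and $\mathbf{S}'\mathbf{G}u=\sum_{i=1}^N S_i'(G_iu)$. **Weak inequalities.** For $(u,\nabla u)\in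 QH^{1,2}(v,\Omega)$, $Lu\le0$ (respectively $Lu\ge0$) in $\Omega$ means that for every non-negative $\varphi\in\mathrm{Lip}_0(\Omega)$, $$\int_\Omega\nabla\varphi\cdot Q\nabla u\,dx+\int_\Omega\varphi\,\mathbf{H}\cdot\mathbf{R}u\,v\,dx+\int_\Omega u\,\mathbf{G}\cdot\mathbf{S}\varphi\,v\,dx+\int_\Omega F\varphi u\,v\,dx\le0\quad(\text{respectively}\ \ge0).$$ **Suprema and boundary values.** $\sup_\Omega u$ and $\inf_\Omega u$ are the essential supremum and infimum with respect to the measure $v\,dx$. Here $u^+=\max(u,0)$ and $u^-=\min(u,0)$. Boundary values are understood in the Sobolev sense: $$\sup_{\partial\Omega}u^+=\inf\{k\ge0:\ ((u-k)^+,\ \chi_{\{u>k\}}\nabla u)\in QH^{1,2}_0(v,\Omega)\}$$ (with $\inf\emptyset=+\infty$), and $\inf_{\partial\Omega}u^-=-\sup_{\partial\Omega}(-u)^+$. *)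

theory Defs
  imports "HOL-Analysis.Analysis" "HOL-Probability.Essential_Supremum"
begin

section \<open>Lebesgue and Orlicz spaces\<close>

text \<open>The measure \<open>v dx\<close> on \<open>\<Omega>\<close>.\<close>

definition wmeasure :: "(real^'n) set \<Rightarrow> (real^'n \<Rightarrow> real) \<Rightarrow> (real^'n) measure" where
  "wmeasure \<Omega> v = density (lebesgue_on \<Omega>) (\<lambda>x. ennreal (v x))"

text \<open>The exponent \<open>p\<close> is finite and positive. The Bochner integral is \<open>0\<close> on non-integrable functions,
  so \<open>Lp_norm\<close> is only meaningful on \<open>Lp\<close>.\<close>

definition Lp :: "'a measure \<Rightarrow> real \<Rightarrow> ('a \<Rightarrow> 'b::euclidean_space) set" where
  "Lp M p = {f. f \<in> borel_measurable M \<and> integrable M (\<lambda>x. norm (f x) powr p)}"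

definition Lp_norm :: "'a measure \<Rightarrow> real \<Rightarrow> ('a \<Rightarrow> 'b::euclidean_space) \<Rightarrow> real" where
  "Lp_norm M p f = (\<integral>x. norm (f x) powr p \<partial>M) powr (1 / p)"

definition Linf_norm :: "'a measure \<Rightarrow> ('a \<Rightarrow> 'b::euclidean_space) \<Rightarrow> ennreal" where
  "Linf_norm M f = esssup M (\<lambda>x. ennreal (norm (f x)))"

definition Linf :: "'a measure \<Rightarrow> ('a \<Rightarrow> 'b::euclidean_space) set" where
  "Linf M = {f. f \<in> borel_measurable M \<and> Linf_norm M f < top}"

text \<open>The Luxemburg norm is infinite exactly when no \<open>\<lambda>\<close> is admissible.\<close>

definition Orlicz_norm :: "'a measure \<Rightarrow> (real \<Rightarrow> real) \<Rightarrow> ('a \<Rightarrow> 'b::euclidean_space) \<Rightarrow> ennreal" where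
  "Orlicz_norm M A f =
     Inf {ennreal l | l. 0 < l \<and> (\<integral>\<^sup>+x. ennreal (A (norm (f x) / l)) \<partial>M) \<le> 1}"

definition Orlicz :: "'a measure \<Rightarrow> (real \<Rightarrow> real) \<Rightarrow> ('a \<Rightarrow> 'b::euclidean_space) set" where
  "Orlicz M A = {f. f \<in> borel_measurable M \<and> Orlicz_norm M A f < top}"

definition essinf :: "'a measure \<Rightarrow> ('a \<Rightarrow> ereal) \<Rightarrow> ereal" where
  "essinf M f = Sup {z. AE x in M. z \<le> f x}"

section \<open>Lipschitz functions and gradients\<close>

text \<open>Functions on \<open>\<Omega>\<close> are total functions whose values outside \<open>\<Omega>\<close> are irrelevant.\<close>

definition Lip_loc :: "(real^'n) set \<Rightarrow> (real^'n \<Rightarrow> real) set" where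
  "Lip_loc \<Omega> = {f. \<forall>x\<in>\<Omega>. \<exists>e>0. \<exists>L. L-lipschitz_on (cball x e \<inter> \<Omega>) f}"

definition Lip0 :: "(real^'n) set \<Rightarrow> (real^'n \<Rightarrow> real) set" where
  "Lip0 \<Omega> = {f. (\<exists>L. L-lipschitz_on \<Omega> f) \<and>
      compact (closure {x\<in>\<Omega>. f x \<noteq> 0}) \<and> closure {x\<in>\<Omega>. f x \<noteq> 0} \<subseteq> \<Omega>}"

text \<open>By Rademacher's theorem the default value \<open>0\<close> is used on a null set only
  when \<open>f\<close> is locally Lipschitz.\<close>

definition grad :: "(real^'n \<Rightarrow> real) \<Rightarrow> real^'n \<Rightarrow> real^'n" where
  "grad f x = (if \<exists>D. GDERIV f x :> D then (THE D. GDERIV f x :> D) else 0)"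

section \<open>Degenerate Sobolev spaces\<close>

definition sym_nonneg :: "real^'n^'n \<Rightarrow> bool" where
  "sym_nonneg A \<longleftrightarrow> transpose A = A \<and> (\<forall>\<xi>. 0 \<le> (A *v \<xi>) \<bullet> \<xi>)"

text \<open>A symmetric non-negative definite matrix has exactly one such square root.\<close>

definition mat_sqrt :: "real^'n^'n \<Rightarrow> real^'n^'n" where
  "mat_sqrt A = (SOME B. sym_nonneg B \<and> B ** B = A)"

definition QL2 :: "(real^'n) set \<Rightarrow> (real^'n \<Rightarrow> real^'n^'n) \<Rightarrow> (real^'n \<Rightarrow> real^'n) set" where
  "QL2 \<Omega> Q = {g. g \<in> borel_measurable (lebesgue_on \<Omega>) \<and>
      integrable (lebesgue_on \<Omega>) (\<lambda>x. (norm (mat_sqrt (Q x) *v g x))\<^sup>2)}"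

definition QL2_norm :: "(real^'n) set \<Rightarrow> (real^'n \<Rightarrow> real^'n^'n) \<Rightarrow> (real^'n \<Rightarrow> real^'n) \<Rightarrow> real" where
  "QL2_norm \<Omega> Q g = sqrt (\<integral>x. (norm (mat_sqrt (Q x) *v g x))\<^sup>2 \<partial>lebesgue_on \<Omega>)"

definition QH1_norm ::
    "(real^'n) set \<Rightarrow> (real^'n \<Rightarrow> real) \<Rightarrow> (real^'n \<Rightarrow> real^'n^'n) \<Rightarrow> (real^'n \<Rightarrow> real) \<Rightarrow> real" where
  "QH1_norm \<Omega> v Q \<phi> = Lp_norm (wmeasure \<Omega> v) 2 \<phi> + QL2_norm \<Omega> Q (grad \<phi>)"

definition QH1_finite ::
    "(real^'n) set \<Rightarrow> (real^'n \<Rightarrow> real) \<Rightarrow> (real^'n \<Rightarrow> real^'n^'n) \<Rightarrow> (real^'n \<Rightarrow> real) set" where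
  "QH1_finite \<Omega> v Q = {\<phi>. \<phi> \<in> Lp (wmeasure \<Omega> v) 2 \<and> grad \<phi> \<in> QL2 \<Omega> Q}"

text \<open>The completion of a class \<open>X\<close> of functions, as the closure of \<open>{(\<phi>, \<nabla>\<phi>) | \<phi> \<in> X}\<close> in
  \<open>L\<^sup>2(v,\<Omega>) \<oplus> QL\<^sup>2(\<Omega>)\<close>. Its elements are pairs of representatives.\<close>

definition QH_completion ::
    "(real^'n) set \<Rightarrow> (real^'n \<Rightarrow> real) \<Rightarrow> (real^'n \<Rightarrow> real^'n^'n) \<Rightarrow> (real^'n \<Rightarrow> real) set
      \<Rightarrow> ((real^'n \<Rightarrow> real) \<times> (real^'n \<Rightarrow> real^'n)) set" where
  "QH_completion \<Omega> v Q X = {(u, g). u \<in> Lp (wmeasure \<Omega> v) 2 \<and> g \<in> QL2 \<Omega> Q \<and>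
     (\<exists>\<phi> :: nat \<Rightarrow> real^'n \<Rightarrow> real. (\<forall>k. \<phi> k \<in> X) \<and>
        (\<lambda>k. Lp_norm (wmeasure \<Omega> v) 2 (\<lambda>x. \<phi> k x - u x)) \<longlonglongrightarrow> 0 \<and>
        (\<lambda>k. QL2_norm \<Omega> Q (\<lambda>x. grad (\<phi> k) x - g x)) \<longlonglongrightarrow> 0)}"

definition QH12 ::
    "(real^'n) set \<Rightarrow> (real^'n \<Rightarrow> real) \<Rightarrow> (real^'n \<Rightarrow> real^'n^'n)
      \<Rightarrow> ((real^'n \<Rightarrow> real) \<times> (real^'n \<Rightarrow> real^'n)) set" where
  "QH12 \<Omega> v Q = QH_completion \<Omega> v Q (Lip_loc \<Omega> \<inter> QH1_finite \<Omega> v Q)"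

text \<open>In \<open>QH12_0\<close> finiteness of the norm is not required separately: it holds on \<open>Lip0 \<Omega>\<close>
  when \<open>v\<close> is integrable and \<open>Q \<le> c v\<close>.\<close>

definition QH12_0 ::
    "(real^'n) set \<Rightarrow> (real^'n \<Rightarrow> real) \<Rightarrow> (real^'n \<Rightarrow> real^'n^'n)
      \<Rightarrow> ((real^'n \<Rightarrow> real) \<times> (real^'n \<Rightarrow> real^'n)) set" where
  "QH12_0 \<Omega> v Q = QH_completion \<Omega> v Q (Lip0 \<Omega>)"

section \<open>Subunit vector fields\<close>

text \<open>\<open>vf V g\<close> is \<open>V \<cdot> g\<close>; it is used with \<open>g = grad \<phi>\<close> and with the second component of a pair.
  The bounds below include that the left-hand side is finite.\<close>

definition vf :: "(real^'n \<Rightarrow> real^'n) \<Rightarrow> (real^'n \<Rightarrow> real^'n) \<Rightarrow> real^'n \<Rightarrow> real" where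
  "vf V g x = V x \<bullet> g x"

definition vfs :: "('m \<Rightarrow> real^'n \<Rightarrow> real^'n) \<Rightarrow> (real^'n \<Rightarrow> real^'n) \<Rightarrow> real^'n \<Rightarrow> real^'m" where
  "vfs R g x = (\<chi> i. vf (R i) g x)"

definition subunit ::
    "(real^'n) set \<Rightarrow> (real^'n \<Rightarrow> real) \<Rightarrow> (real^'n \<Rightarrow> real^'n^'n) \<Rightarrow> (real^'n \<Rightarrow> real^'n) \<Rightarrow> bool" where
  "subunit \<Omega> v Q V \<longleftrightarrow> V \<in> borel_measurable (lebesgue_on \<Omega>) \<and>
     (\<exists>C>0. \<forall>\<phi>\<in>Lip0 \<Omega>. vf V (grad \<phi>) \<in> Lp (wmeasure \<Omega> v) 2 \<and>
        Lp_norm (wmeasure \<Omega> v) 2 (vf V (grad \<phi>)) \<le> C * QH1_norm \<Omega> v Q \<phi>)"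

definition subunit_const ::
    "(real^'n) set \<Rightarrow> (real^'n \<Rightarrow> real) \<Rightarrow> (real^'n \<Rightarrow> real^'n^'n)
      \<Rightarrow> ('m::finite \<Rightarrow> real^'n \<Rightarrow> real^'n) \<Rightarrow> real \<Rightarrow> bool" where
  "subunit_const \<Omega> v Q R C \<longleftrightarrow> 0 < C \<and>
     (\<forall>\<phi>\<in>Lip0 \<Omega>. vfs R (grad \<phi>) \<in> Lp (wmeasure \<Omega> v) 2 \<and>
        Lp_norm (wmeasure \<Omega> v) 2 (vfs R (grad \<phi>)) \<le> C * QH1_norm \<Omega> v Q \<phi>)"

section \<open>Weak inequalities and boundary values\<close>

definition weak_form ::
    "(real^'n) set \<Rightarrow> (real^'n \<Rightarrow> real) \<Rightarrow> (real^'n \<Rightarrow> real^'n^'n)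
      \<Rightarrow> (real^'n \<Rightarrow> real) \<Rightarrow> (real^'n \<Rightarrow> real^'m) \<Rightarrow> (real^'n \<Rightarrow> real^'m)
      \<Rightarrow> ('m::finite \<Rightarrow> real^'n \<Rightarrow> real^'n) \<Rightarrow> ('m \<Rightarrow> real^'n \<Rightarrow> real^'n)
      \<Rightarrow> (real^'n \<Rightarrow> real) \<times> (real^'n \<Rightarrow> real^'n) \<Rightarrow> (real^'n \<Rightarrow> real) \<Rightarrow> real" where
  "weak_form \<Omega> v Q F G H R S = (\<lambda>(u, Du) \<phi>.
      (\<integral>x. grad \<phi> x \<bullet> (Q x *v Du x) \<partial>lebesgue_on \<Omega>)
    + (\<integral>x. \<phi> x * (H x \<bullet> vfs R Du x) \<partial>wmeasure \<Omega> v)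
    + (\<integral>x. u x * (G x \<bullet> vfs S (grad \<phi>) x) \<partial>wmeasure \<Omega> v)
    + (\<integral>x. F x * \<phi> x * u x \<partial>wmeasure \<Omega> v))"

text \<open>\<open>weak_le0\<close> and \<open>weak_ge0\<close> are \<open>Lu \<le> 0\<close> and \<open>Lu \<ge> 0\<close> for
  \<open>Lu = -v\<^sup>-\<^sup>1 div (Q \<nabla>u) + H \<cdot> Ru + S'Gu + Fu\<close>.\<close>

definition weak_le0 ::
    "(real^'n) set \<Rightarrow> (real^'n \<Rightarrow> real) \<Rightarrow> (real^'n \<Rightarrow> real^'n^'n)
      \<Rightarrow> (real^'n \<Rightarrow> real) \<Rightarrow> (real^'n \<Rightarrow> real^'m) \<Rightarrow> (real^'n \<Rightarrow> real^'m)
      \<Rightarrow> ('m::finite \<Rightarrow> real^'n \<Rightarrow> real^'n) \<Rightarrow> ('m \<Rightarrow> real^'n \<Rightarrow> real^'n)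
      \<Rightarrow> (real^'n \<Rightarrow> real) \<times> (real^'n \<Rightarrow> real^'n) \<Rightarrow> bool" where
  "weak_le0 \<Omega> v Q F G H R S w \<longleftrightarrow>
     (\<forall>\<phi>\<in>Lip0 \<Omega>. (\<forall>x\<in>\<Omega>. 0 \<le> \<phi> x) \<longrightarrow> weak_form \<Omega> v Q F G H R S w \<phi> \<le> 0)"

definition weak_ge0 ::
    "(real^'n) set \<Rightarrow> (real^'n \<Rightarrow> real) \<Rightarrow> (real^'n \<Rightarrow> real^'n^'n)
      \<Rightarrow> (real^'n \<Rightarrow> real) \<Rightarrow> (real^'n \<Rightarrow> real^'m) \<Rightarrow> (real^'n \<Rightarrow> real^'m)
      \<Rightarrow> ('m::finite \<Rightarrow> real^'n \<Rightarrow> real^'n) \<Rightarrow> ('m \<Rightarrow> real^'n \<Rightarrow> real^'n)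
      \<Rightarrow> (real^'n \<Rightarrow> real) \<times> (real^'n \<Rightarrow> real^'n) \<Rightarrow> bool" where
  "weak_ge0 \<Omega> v Q F G H R S w \<longleftrightarrow>
     (\<forall>\<phi>\<in>Lip0 \<Omega>. (\<forall>x\<in>\<Omega>. 0 \<le> \<phi> x) \<longrightarrow> 0 \<le> weak_form \<Omega> v Q F G H R S w \<phi>)"

definition bdry_sup_pos ::
    "(real^'n) set \<Rightarrow> (real^'n \<Rightarrow> real) \<Rightarrow> (real^'n \<Rightarrow> real^'n^'n)
      \<Rightarrow> (real^'n \<Rightarrow> real) \<times> (real^'n \<Rightarrow> real^'n) \<Rightarrow> ereal" where
  "bdry_sup_pos \<Omega> v Q = (\<lambda>(u, Du). Inf {ereal k | k. 0 \<le> k \<and>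
     ((\<lambda>x. max (u x - k) 0), (\<lambda>x. if u x > k then Du x else 0)) \<in> QH12_0 \<Omega> v Q})"

definition bdry_inf_neg ::
    "(real^'n) set \<Rightarrow> (real^'n \<Rightarrow> real) \<Rightarrow> (real^'n \<Rightarrow> real^'n^'n)
      \<Rightarrow> (real^'n \<Rightarrow> real) \<times> (real^'n \<Rightarrow> real^'n) \<Rightarrow> ereal" where
  "bdry_inf_neg \<Omega> v Q = (\<lambda>(u, Du). - bdry_sup_pos \<Omega> v Q ((\<lambda>x. - u x), (\<lambda>x. - Du x)))"

end

theory Submission
  imports Defs
begin

text \<open>
  A subunit field is bounded pointwise by the degenerate norm \<open>|\<surd>Q \<xi>| / \<surd>v\<close>, as oscillating test functions
  show. For \<open>t\<close> above the boundary supremum, testing \<open>Lu \<le> 0\<close> with \<open>(u - t)\<^sup>+\<close> and the compatibility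
  condition with \<open>u (u - t)\<^sup>+\<close> removes \<open>F\<close>, and with \<open>K = |G| + |H|\<close> leaves
  \<open>\<integral>\<^bsub>u>t\<^esub> |\<surd>Q \<nabla>u|\<^sup>2 dx \<le> C \<integral>\<^bsub>u>t\<^esub> (u - t) K |\<surd>Q \<nabla>u| \<surd>v dx\<close>. These test functions are only reached through
  truncations \<open>\<psi>(u)\<close> and cutoffs \<open>\<Theta>\<close>, the latter made from the \<open>Lip\<^sub>0\<close> approximants of \<open>(u - k)\<^sup>+\<close>.
  Each of the three alternatives gives
  \<open>\<integral>\<^sub>B K\<^sup>2 \<phi>\<^sup>2 v dx \<le> (\<theta> + \<integral>\<^sub>B Z v dx) \<integral> |\<surd>Q \<nabla>\<phi>|\<^sup>2 dx\<close> with \<open>C\<^sup>2 \<theta> < 1\<close> and \<open>Z\<close> integrable. As \<open>t\<close> increases to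
  the essential supremum \<open>m\<close>, the sets \<open>B = {t < u < m}\<close> shrink to a null set, so the energy above level \<open>t\<close> is
  eventually bounded by a fraction of itself; it vanishes, and the Sobolev inequality gives \<open>u \<le> t < m\<close>.
\<close>

section \<open>Differentiability of Lipschitz functions\<close>

text \<open>The subunit condition is a mean square bound on \<open>Lip0\<close> that includes a
  zeroth-order term, whereas the weak form applies the fields to the second member of a pair, which
  is not a gradient. The bound at almost every point, for all vectors, makes \<open>Ru\<close> and
  \<open>Su\<close> estimable; it has no zeroth-order term, so in the third alternative only
  \<open>C * K\<close> times the norms has to be small. Chain and product rules for
  \<open>grad\<close> rest on almost everywhere differentiability, proved here from one-sided
  derivates. Two obstacles shape the rest. In the \<open>G\<close> term the unbounded factor
  \<open>u\<close> meets \<open>\<rho> (U n)\<close> and not \<open>\<rho> (u)\<close>; it is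
  controlled only through the Sobolev inequality for \<open>u \<Theta>\<close>, with
  \<open>\<Theta>\<close> in \<open>Lip0\<close>. This is why the compatibility condition is
  subtracted while \<open>\<Theta>\<close> is still fixed. And \<open>\<nabla>u\<close> is not
  determined by \<open>u\<close>, so neither its vanishing on level sets nor a chain rule for
  functions with corners can be taken for granted: all truncations are \<open>C\<^sup>1\<close>, and
  the corner at \<open>t\<close> appears only in a limit of the inequalities.\<close>

lemma null_if_compact_null:
  fixes S :: "'a::euclidean_space set"
  assumes S: "S \<in> sets lebesgue"
    and K: "\<And>K. compact K \<Longrightarrow> K \<subseteq> S \<Longrightarrow> emeasure lebesgue K = 0"
  shows "S \<in> null_sets lebesgue"
proof -
  have "emeasure lebesgue (S \<inter> cball 0 (real n)) = 0" for n :: nat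
  proof -
    let ?S = "S \<inter> cball 0 (real n)"
    have Sm: "?S \<in> sets lebesgue" using S by auto
    have "emeasure lebesgue ?S \<le> ennreal e" if "e > 0" for e
    proof -
      obtain T where T: "closed T" "T \<subseteq> ?S" "?S - T \<in> lmeasurable" "emeasure lebesgue (?S - T) < ennreal e"
        using sets_lebesgue_inner_closed[OF Sm \<open>e > 0\<close>] .
      have "compact T"
        using T by (metis bounded_cball bounded_subset compact_eq_bounded_closed le_inf_iff)
      then have "emeasure lebesgue T = 0" using K[of T] T(2) by blast
      moreover have "emeasure lebesgue ?S \<le> emeasure lebesgue T + emeasure lebesgue (?S - T)"
      proof -
        have "?S = T \<union> (?S - T)" using T by auto
        then show ?thesis
          using emeasure_subadditive[of T lebesgue "?S - T"] T by (auto dest: fmeasurableD)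
      qed
      ultimately show ?thesis using T(4) by auto
    qed
    then show ?thesis
      by (metis bot.extremum_unique ennreal_0 ennreal_le_epsilon add_0 bot_ennreal)
  qed
  then have "(\<Union>n. S \<inter> cball 0 (real n)) \<in> null_sets lebesgue"
    using S by (intro null_sets_UN null_setsI) auto
  moreover have "(\<Union>n. S \<inter> cball 0 (real n)) = S"
    by (auto simp: real_arch_simple)
  ultimately show ?thesis by simp
qed

section \<open>One-sided derivates of functions of one real variable\<close>

text \<open>Continuous induction. The points of \<open>[c, d]\<close> where \<open>\<Phi>\<close> is
  at least \<open>\<Phi> c\<close> form a closed set; its supremum must be \<open>d\<close>, since
  otherwise the step hypothesis produces a larger element. This takes the place of a Vitali
  covering: one good step to the right of every point is enough.\<close>

lemma le_if_right_steps:
  fixes \<Phi> :: "real \<Rightarrow> real"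
  assumes cont: "continuous_on {c..d} \<Phi>" and "c \<le> d"
    and step: "\<And>x. c \<le> x \<Longrightarrow> x < d \<Longrightarrow> \<exists>y. x < y \<and> y \<le> d \<and> \<Phi> x \<le> \<Phi> y"
  shows "\<Phi> c \<le> \<Phi> d"
proof -
  define T where "T = {x\<in>{c..d}. \<Phi> x \<in> {\<Phi> c..}}"
  have "T = {c..d} \<inter> \<Phi> -` {\<Phi> c..}" by (auto simp: T_def)
  then have "closed T"
    using continuous_closed_preimage[OF cont, of "{\<Phi> c..}"] by auto
  have "c \<in> T" using \<open>c \<le> d\<close> by (auto simp: T_def)
  have bdd: "bdd_above T" by (auto simp: T_def intro!: bdd_aboveI[of _ d])
  have s: "Sup T \<in> T" using closed_contains_Sup[of T] \<open>closed T\<close> \<open>c \<in> T\<close> bdd by auto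
  have "Sup T = d"
  proof (rule ccontr)
    assume "Sup T \<noteq> d"
    then have "Sup T < d" "c \<le> Sup T" using s by (auto simp: T_def)
    then obtain y where "Sup T < y" "y \<le> d" "\<Phi> (Sup T) \<le> \<Phi> y" using step by blast
    then have "y \<in> T" using s by (auto simp: T_def)
    then have "y \<le> Sup T" using bdd by (rule cSup_upper)
    then show False using \<open>Sup T < y\<close> by simp
  qed
  then show ?thesis using s by (auto simp: T_def)
qed

text \<open>Follow \<open>F x - q * |K \<inter> [c, x]|\<close> from \<open>c\<close> to
  \<open>d\<close>. At a point of \<open>K\<close> there is a step on which \<open>F\<close> gains
  at least \<open>q h\<close> and the measure at most \<open>h\<close>; off the closed set
  \<open>K\<close> the measure is locally constant and \<open>F\<close> does not decrease. So a step
  to the right is possible from everywhere.\<close>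

lemma right_derivate_measure_bound:
  fixes F :: "real \<Rightarrow> real"
  assumes mono: "mono F" and cont: "continuous_on UNIV F" and "compact K" and "0 \<le> q"
    and K: "\<And>x \<delta>. x \<in> K \<Longrightarrow> 0 < \<delta> \<Longrightarrow> \<exists>h. 0 < h \<and> h < \<delta> \<and> F (x + h) - F x \<ge> q * h"
    and "c \<le> d"
  shows "q * measure lborel (K \<inter> {c..d}) \<le> F d - F c"
proof -
  define W where "W x = measure lborel (K \<inter> {c..x})" for x
  have fm: "K \<inter> {a..b} \<in> fmeasurable lborel" for a b
    using \<open>compact K\<close> by (intro fmeasurable_compact compact_Int) auto
  have fm': "{a..b} \<in> fmeasurable lborel" for a b :: real
    by (intro fmeasurable_compact) auto
  note fms = fm[THEN fmeasurableD] fm'[THEN fmeasurableD]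
  have Wmono: "W x \<le> W y" if "x \<le> y" for x y
    unfolding W_def using that fm by (intro measure_mono_fmeasurable) (use fms in auto)
  have Wstep: "W y \<le> W x + (y - x)" if "x \<le> y" for x y
  proof -
    have "W y \<le> measure lborel ((K \<inter> {c..x}) \<union> {x..y})"
      unfolding W_def using that fm fm'
      by (intro measure_mono_fmeasurable) (use fms in \<open>auto intro: fmeasurable.Un\<close>)
    also have "\<dots> \<le> W x + measure lborel {x..y}"
      unfolding W_def using fm[of c x] fm'[of x y] by (intro measure_Un_le) (use fms in auto)
    finally show ?thesis using that by simp
  qed
  have "continuous_on UNIV W"
  proof (rule lipschitz_on_continuous_on)
    show "1-lipschitz_on UNIV W"
    proof (rule lipschitz_onI)
      fix x y :: real
      show "dist (W x) (W y) \<le> 1 * dist x y"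
        using Wstep[of x y] Wstep[of y x] Wmono[of x y] Wmono[of y x]
        by (cases "x \<le> y") (auto simp: dist_real_def)
    qed simp
  qed
  define \<Phi> where "\<Phi> x = F x - q * W x" for x
  have "\<Phi> c \<le> \<Phi> d"
  proof (rule le_if_right_steps[where \<Phi>=\<Phi>])
    show "continuous_on {c..d} \<Phi>" unfolding \<Phi>_def
      by (intro continuous_intros continuous_on_subset[OF cont] continuous_on_subset[OF \<open>continuous_on UNIV W\<close>]) auto
    fix x assume x: "c \<le> x" "x < d"
    show "\<exists>y. x < y \<and> y \<le> d \<and> \<Phi> x \<le> \<Phi> y"
    proof (cases "x \<in> K")
      case True
      then obtain h where h: "0 < h" "h < d - x" "F (x + h) - F x \<ge> q * h"
        using K[of x "d - x"] x by auto
      have "q * W (x + h) \<le> q * (W x + h)"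
        using Wstep[of x "x + h"] h \<open>0 \<le> q\<close> by (intro mult_left_mono) auto
      then show ?thesis using h by (intro exI[of _ "x + h"]) (auto simp: \<Phi>_def algebra_simps)
    next
      case False
      then have "x \<in> - K" "open (- K)" using \<open>compact K\<close> by (auto simp: compact_imp_closed)
      then obtain e where e: "e > 0" "ball x e \<subseteq> - K" by (meson openE)
      define y where "y = min (x + e / 2) d"
      have y: "x < y" "y \<le> d" using x e by (auto simp: y_def)
      have zx: "z \<le> x" if "z \<in> K" "z \<le> y" for z
      proof (rule ccontr)
        assume "\<not> z \<le> x"
        then have "z \<in> ball x e" using that e(1) by (auto simp: y_def dist_real_def)
        then show False using e(2) that by auto
      qed
      have "z \<in> K \<inter> {c..y} \<longleftrightarrow> z \<in> K \<inter> {c..x}" for z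
        using zx[of z] y(1) by (simp only: Int_iff atLeastAtMost_iff) (meson less_imp_le order_trans)
      then have "K \<inter> {c..y} = K \<inter> {c..x}" by (rule set_eqI)
      then have "W y = W x" by (simp add: W_def)
      moreover have "F x \<le> F y" using y(1) by (intro monoD[OF mono]) simp
      ultimately show ?thesis using y by (intro exI[of _ y]) (auto simp: \<Phi>_def)
    qed
  qed fact
  moreover have "W c = 0"
  proof -
    have "W c \<le> measure lborel {c..c}" unfolding W_def using fm'[of c c] fm[of c c] by (intro measure_mono_fmeasurable) (auto simp: fmeasurableD)
    then show ?thesis by (simp add: W_def measure_le_0_iff)
  qed
  ultimately show ?thesis by (simp add: \<Phi>_def W_def)
qed

text \<open>A density argument by hand: cover \<open>K\<close> by short cells inside an open
  \<open>U\<close> that hardly exceeds it, and add the assumed bound over the cells to obtain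
  \<open>|K| \<le> \<theta> |U|\<close>.\<close>

lemma compact_null_if_density_below_1:
  fixes K :: "real set"
  assumes "compact K" and "\<theta> < 1"
    and K: "\<And>c d. c \<le> d \<Longrightarrow> measure lborel (K \<inter> {c..d}) \<le> \<theta> * (d - c)"
  shows "measure lborel K = 0"
proof (rule ccontr)
  assume neq: "measure lborel K \<noteq> 0"
  have fmK: "K \<in> fmeasurable lborel" using \<open>compact K\<close> by (rule fmeasurable_compact)
  have pos: "measure lborel K > 0" using neq by (simp add: zero_less_measure_iff)
  have th0: "0 \<le> \<theta>" using order_trans[OF measure_nonneg K[of 0 1]] by simp
  have "K \<in> sets lebesgue" using fmK by (auto dest: fmeasurableD)
  \<comment> \<open>With this margin \<open>|K| \<le> \<theta> (|K| + e)\<close> turns into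
    \<open>e \<le> \<theta> e\<close>, which contradicts \<open>\<theta> < 1\<close>.\<close>
  define e where "e = (1 - \<theta>) * measure lborel K"
  have "e > 0" using pos \<open>\<theta> < 1\<close> by (simp add: e_def)
  obtain U where U: "open U" "K \<subseteq> U" "U - K \<in> lmeasurable" "emeasure lebesgue (U - K) < ennreal e"
    using sets_lebesgue_outer_open[OF \<open>K \<in> sets lebesgue\<close> \<open>e > 0\<close>] .
  have fmU: "U \<in> lmeasurable"
  proof -
    have "U = K \<union> (U - K)" using U by auto
    moreover have "K \<in> lmeasurable" using \<open>compact K\<close> by (simp add: lmeasurable_compact)
    ultimately show ?thesis using U(3) by (metis fmeasurable.Un)
  qed
  have mU: "measure lebesgue U < measure lebesgue K + e"
  proof -
    have "measure lebesgue (U - K) < e"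
      using U(3,4) \<open>e > 0\<close> by (simp add: emeasure_eq_measure2 ennreal_less_iff)
    moreover have "measure lebesgue (U - K) = measure lebesgue U - measure lebesgue K"
      using U fmU \<open>compact K\<close> by (intro measurable_measure_Diff) (auto simp: lmeasurable_compact intro!: fmeasurableD)
    ultimately show ?thesis by simp
  qed
  obtain \<delta> where \<delta>: "\<delta> > 0" "\<And>x y. x \<in> K \<Longrightarrow> dist x y < \<delta> \<Longrightarrow> y \<in> U"
  proof (cases "K = {} \<or> U = UNIV")
    case True
    then show ?thesis using that[of 1] by auto
  next
    case False
    then have "setdist K (- U) > 0"
      using \<open>compact K\<close> U by (subst setdist_gt_0_compact_closed) auto
    then show ?thesis
      using that[of "setdist K (- U)"] setdist_le_dist[of _ K _ "- U"] by fastforce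
  qed
  \<comment> \<open>Half-open cells partition the line, so their measures add up exactly; the length
    \<open>\<delta>/2\<close> keeps every cell that meets \<open>K\<close> within distance
    \<open>\<delta>\<close> of \<open>K\<close>, hence inside \<open>U\<close>.\<close>
  define I where "I i = {real_of_int i * (\<delta>/2) ..< (real_of_int i + 1) * (\<delta>/2)}" for i
  have I: "x \<in> I \<lfloor>x / (\<delta>/2)\<rfloor>" for x
  proof -
    have "real_of_int \<lfloor>x / (\<delta>/2)\<rfloor> \<le> x / (\<delta>/2)" "x / (\<delta>/2) < real_of_int \<lfloor>x / (\<delta>/2)\<rfloor> + 1" by linarith+
    then have "real_of_int \<lfloor>x / (\<delta>/2)\<rfloor> * (\<delta>/2) \<le> x" "x < (real_of_int \<lfloor>x / (\<delta>/2)\<rfloor> + 1) * (\<delta>/2)"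
      using \<delta> by (simp_all only: pos_le_divide_eq pos_divide_less_eq half_gt_zero)
    then show ?thesis by (simp only: I_def atLeastLessThan_iff)
  qed
  have I_iff: "x \<in> I i \<longleftrightarrow> i = \<lfloor>x / (\<delta>/2)\<rfloor>" for x i
  proof
    assume "x \<in> I i"
    then have "real_of_int i \<le> x / (\<delta>/2)" "x / (\<delta>/2) < real_of_int i + 1"
      using \<delta> by (auto simp: I_def field_simps)
    then show "i = \<lfloor>x / (\<delta>/2)\<rfloor>" by linarith
  qed (use I in auto)
  define J where "J = (\<lambda>x. \<lfloor>x / (\<delta>/2)\<rfloor>) ` K"
  have "finite J"
  proof -
    obtain R where R: "\<And>x. x \<in> K \<Longrightarrow> \<bar>x\<bar> \<le> R" using \<open>compact K\<close> compact_imp_bounded[of K] by (auto simp: bounded_iff)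
    have "J \<subseteq> {\<lfloor>(-R) / (\<delta>/2)\<rfloor> .. \<lfloor>R / (\<delta>/2)\<rfloor>}"
    proof -
      have "\<lfloor>(-R) / (\<delta>/2)\<rfloor> \<le> \<lfloor>x / (\<delta>/2)\<rfloor> \<and> \<lfloor>x / (\<delta>/2)\<rfloor> \<le> \<lfloor>R / (\<delta>/2)\<rfloor>" if "x \<in> K" for x
        using R[OF that] \<delta>(1) by (intro conjI floor_mono divide_right_mono) auto
      then show ?thesis by (auto simp: J_def)
    qed
    then show ?thesis by (rule finite_subset) simp
  qed
  have fmI: "I i \<in> fmeasurable lborel" for i
    using \<delta>(1) by (auto simp: I_def fmeasurable_def emeasure_lborel_Ico mult_right_mono divide_right_mono)
  have KI: "K = (\<Union>i\<in>J. K \<inter> I i)" using I by (auto simp: J_def)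
  have "measure lborel K \<le> (\<Sum>i\<in>J. measure lborel (K \<inter> I i))"
    by (subst KI, rule measure_UNION_le) (use \<open>finite J\<close> fmK fmI in \<open>auto intro: fmeasurableD\<close>)
  also have "\<dots> \<le> (\<Sum>i\<in>J. \<theta> * measure lborel (I i))"
  proof (rule sum_mono)
    fix i
    have "measure lborel (K \<inter> I i) \<le> measure lborel (K \<inter> {real_of_int i * (\<delta>/2) .. (real_of_int i + 1) * (\<delta>/2)})"
      using \<open>compact K\<close> fmK fmI
      by (intro measure_mono_fmeasurable fmeasurable_compact compact_Int) (auto simp: I_def intro: fmeasurableD)
    also have "\<dots> \<le> \<theta> * measure lborel (I i)"
      using K[of "real_of_int i * (\<delta>/2)" "(real_of_int i + 1) * (\<delta>/2)"] \<delta> by (simp add: I_def)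
    finally show "measure lborel (K \<inter> I i) \<le> \<theta> * measure lborel (I i)" .
  qed
  also have "\<dots> = \<theta> * measure lborel (\<Union>i\<in>J. I i)"
  proof -
    have "measure lborel (\<Union>i\<in>J. I i) = (\<Sum>i\<in>J. measure lborel (I i))"
      using \<open>finite J\<close> fmI by (intro measure_finite_Union) (auto simp: disjoint_family_on_def I_iff fmeasurable_def less_top)
    then show ?thesis by (simp add: sum_distrib_left)
  qed
  also have "\<dots> \<le> \<theta> * measure lebesgue U"
  proof -
    have "(\<Union>i\<in>J. I i) \<subseteq> U"
    proof
      fix y assume "y \<in> (\<Union>i\<in>J. I i)"
      then obtain x where x: "x \<in> K" "\<lfloor>x / (\<delta>/2)\<rfloor> = \<lfloor>y / (\<delta>/2)\<rfloor>" by (auto simp: J_def I_iff)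
      have "\<bar>x / (\<delta>/2) - y / (\<delta>/2)\<bar> < 1" using x(2) by linarith
      then have "\<bar>x - y\<bar> / (\<delta>/2) < 1" using \<delta>(1) by (simp only: diff_divide_distrib[symmetric] abs_divide)
      then have "dist x y < \<delta>" using \<delta> by (auto simp: dist_real_def field_simps)
      then show "y \<in> U" using \<delta> x by auto
    qed
    moreover have "(\<Union>i\<in>J. I i) \<in> sets borel" using \<open>finite J\<close> by (auto simp: I_def)
    ultimately have "measure lborel (\<Union>i\<in>J. I i) \<le> measure lebesgue U"
      using fmU measure_mono_fmeasurable[of "\<Union>i\<in>J. I i" U lebesgue] by (simp add: measure_completion)
    then show ?thesis using th0 by (rule mult_left_mono)
  qed
  finally have *: "measure lborel K \<le> \<theta> * measure lebesgue U" .
  have "measure lebesgue K = measure lborel K" using fmeasurableD[OF fmK] by (rule measure_completion)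
  then have U2: "measure lebesgue U < measure lborel K + e" using mU by simp
  have "\<theta> * measure lebesgue U \<le> \<theta> * (measure lborel K + e)" using U2 th0 by (intro mult_left_mono) auto
  with * have "measure lborel K \<le> \<theta> * measure lborel K + \<theta> * e" by (simp add: algebra_simps)
  then have "e \<le> \<theta> * e" by (simp add: e_def algebra_simps)
  then show False using \<open>e > 0\<close> \<open>\<theta> < 1\<close> by (simp add: mult_le_cancel_right1)
qed

text \<open>The union over \<open>h\<close> is uncountable, but a union of open sets is open; only
  the quantifier over \<open>\<delta>\<close> has to be made countable, through
  \<open>\<delta> = 1/(n+1)\<close>.\<close>

lemma Gdelta_frequently_right:
  fixes g :: "real \<Rightarrow> 'a::topological_space \<Rightarrow> real"
  assumes "\<And>h. continuous_on UNIV (g h)"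
  shows "{x. \<forall>\<delta>>0. \<exists>h. 0 < h \<and> h < \<delta> \<and> 0 < g h x} \<in> sets borel"
proof -
  have "{x. \<forall>\<delta>>0. \<exists>h. 0 < h \<and> h < \<delta> \<and> 0 < g h x}
      = (\<Inter>n::nat. \<Union>h\<in>{0<..<1 / real (Suc n)}. {x. 0 < g h x})" (is "?A = ?B")
  proof (intro equalityI subsetI)
    fix x assume x: "x \<in> ?B"
    show "x \<in> ?A"
    proof (intro CollectI allI impI)
      fix \<delta> :: real assume "\<delta> > 0"
      then obtain n where "1 / real (Suc n) < \<delta>" using nat_approx_posE by blast
      moreover from x have "x \<in> (\<Union>h\<in>{0<..<1 / real (Suc n)}. {x. 0 < g h x})" by blast
      then obtain h where "0 < h" "h < 1 / real (Suc n)" "0 < g h x" by auto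
      ultimately show "\<exists>h. 0 < h \<and> h < \<delta> \<and> 0 < g h x" by (intro exI[of _ h]) auto
    qed
  next
    fix x assume x: "x \<in> ?A"
    show "x \<in> ?B"
    proof (rule INT_I)
      fix n :: nat
      have "0 < 1 / real (Suc n)" by simp
      with x obtain h where "0 < h" "h < 1 / real (Suc n)" "0 < g h x" by blast
      then show "x \<in> (\<Union>h\<in>{0<..<1 / real (Suc n)}. {x. 0 < g h x})" by auto
    qed
  qed
  moreover have "open (\<Union>h\<in>{0<..<1 / real (Suc n)}. {x. 0 < g h x})" for n
    using assms by (intro open_UN ballI open_Collect_less continuous_on_const) auto
  ultimately show ?thesis by auto
qed

text \<open>The upper right derivate is at least \<open>q\<close> and the lower right derivate at most \<open>p\<close>.\<close>

definition derivate_gap :: "('a::real_normed_vector \<Rightarrow> real) \<Rightarrow> 'a \<Rightarrow> real \<Rightarrow> real \<Rightarrow> 'a set" where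
  "derivate_gap f v p q =
     {x. (\<forall>\<delta>>0. \<exists>h. 0 < h \<and> h < \<delta> \<and> 0 < f (x + h *\<^sub>R v) - f x - q * h) \<and>
         (\<forall>\<delta>>0. \<exists>h. 0 < h \<and> h < \<delta> \<and> 0 < p * h - (f (x + h *\<^sub>R v) - f x))}"

lemma derivate_gap_borel:
  fixes f :: "'a::euclidean_space \<Rightarrow> real"
  assumes "continuous_on UNIV f"
  shows "derivate_gap f v p q \<in> sets borel"
proof -
  have *: "continuous_on UNIV (\<lambda>x. f (x + h *\<^sub>R v))" for h
    by (rule continuous_on_compose2[OF assms]) (auto intro!: continuous_intros)
  have "{x. \<forall>\<delta>>0. \<exists>h. 0 < h \<and> h < \<delta> \<and> 0 < f (x + h *\<^sub>R v) - f x - q * h} \<in> sets borel"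
    by (rule Gdelta_frequently_right) (intro continuous_intros * assms)
  moreover have "{x. \<forall>\<delta>>0. \<exists>h. 0 < h \<and> h < \<delta> \<and> 0 < p * h - (f (x + h *\<^sub>R v) - f x)} \<in> sets borel"
    by (rule Gdelta_frequently_right) (intro continuous_intros * assms)
  ultimately have "{x. \<forall>\<delta>>0. \<exists>h. 0 < h \<and> h < \<delta> \<and> 0 < f (x + h *\<^sub>R v) - f x - q * h} \<inter>
     {x. \<forall>\<delta>>0. \<exists>h. 0 < h \<and> h < \<delta> \<and> 0 < p * h - (f (x + h *\<^sub>R v) - f x)} \<in> sets borel"
    by (rule sets.Int)
  then show ?thesis unfolding derivate_gap_def by (simp add: Int_def)
qed

text \<open>On an interval of length \<open>l\<close> a compact part of the gap has measure at most \<open>2 L l / (2 L + q - p)\<close>: add the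
  bounds for the increasing functions \<open>F x + L x\<close> and \<open>L x - F x\<close>.\<close>

lemma derivate_gap_null_real:
  fixes F :: "real \<Rightarrow> real"
  assumes lip: "L-lipschitz_on UNIV F" and "p < q"
  shows "derivate_gap F 1 p q \<in> null_sets lborel"
proof -
  let ?E = "derivate_gap F 1 p q"
  have cont: "continuous_on UNIV F" using lip by (rule lipschitz_on_continuous_on)
  have E: "?E \<in> sets borel" using cont by (rule derivate_gap_borel)
  have up: "F y - F x \<le> L * (y - x)" and lo: "F y - F x \<ge> - L * (y - x)" if "x \<le> y" for x y
    using lipschitz_onD[OF lip, of y x] that by (auto simp: dist_real_def abs_le_iff algebra_simps)
  have "L \<ge> 0" using lip by (rule lipschitz_on_nonneg)
  have "?E \<in> null_sets lebesgue"
  proof (rule null_if_compact_null)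
    show "?E \<in> sets lebesgue" using E by auto
    fix K assume K: "compact K" "K \<subseteq> ?E"
    show "emeasure lebesgue K = 0"
    proof (cases "K = {}")
      case False
      then obtain x where "x \<in> K" by auto
      then have "x \<in> ?E" using K by auto
      then obtain h h' where h: "0 < h" "0 < F (x + h) - F x - q * h" "0 < h'" "0 < p * h' - (F (x + h') - F x)"
        unfolding derivate_gap_def by (auto dest!: spec[of _ 1])
      have "F (x + h) - F x \<le> L * h" using up[of x "x + h"] h(1) by simp
      then have "q * h < L * h" using h(2) by linarith
      \<comment> \<open>A point of \<open>K\<close> confines the gap to
        \<open>-L < p < q < L\<close>, so the rates \<open>q + L\<close> and \<open>L - p\<close>
        used below for the two increasing functions are non-negative.\<close>
      then have "q < L" using h(1) by (simp only: mult_less_cancel_right_pos)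
      have "- L * h' < p * h'" using lo[of x "x + h'"] h by simp
      then have "- L < p" using h by (simp only: mult_less_cancel_right_pos)
      define \<theta> where "\<theta> = 2 * L / (2 * L + (q - p))"
      have den: "2 * L + (q - p) > 0" using \<open>L \<ge> 0\<close> \<open>p < q\<close> by simp
      have "measure lborel K = 0"
      proof (rule compact_null_if_density_below_1[OF \<open>compact K\<close>])
        show "\<theta> < 1" using den \<open>p < q\<close> by (simp add: \<theta>_def)
        fix c d :: real assume "c \<le> d"
        have "(q + L) * measure lborel (K \<inter> {c..d}) \<le> (F d + L * d) - (F c + L * c)"
        proof (rule right_derivate_measure_bound[where F = "\<lambda>x. F x + L * x"])
          show "mono (\<lambda>x. F x + L * x)" by (rule monoI) (use lo in \<open>force simp: algebra_simps\<close>)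
          show "continuous_on UNIV (\<lambda>x. F x + L * x)" by (intro continuous_intros cont)
          show "0 \<le> q + L" using \<open>- L < p\<close> \<open>p < q\<close> by simp
          fix x \<delta> :: real assume "x \<in> K" "0 < \<delta>"
          then have "\<exists>h>0. h < \<delta> \<and> 0 < F (x + h *\<^sub>R 1) - F x - q * h"
            using K(2) unfolding derivate_gap_def by blast
          then obtain h where "0 < h" "h < \<delta>" "0 < F (x + h) - F x - q * h"
            by auto
          then show "\<exists>h>0. h < \<delta> \<and> (q + L) * h \<le> F (x + h) + L * (x + h) - (F x + L * x)"
            by (intro exI[of _ h]) (auto simp: algebra_simps)
        qed fact+
        moreover have "(L - p) * measure lborel (K \<inter> {c..d}) \<le> (L * d - F d) - (L * c - F c)"
        proof (rule right_derivate_measure_bound[where F = "\<lambda>x. L * x - F x"])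
          show "mono (\<lambda>x. L * x - F x)" by (rule monoI) (use up in \<open>force simp: algebra_simps\<close>)
          show "continuous_on UNIV (\<lambda>x. L * x - F x)" by (intro continuous_intros cont)
          show "0 \<le> L - p" using \<open>q < L\<close> \<open>p < q\<close> by simp
          fix x \<delta> :: real assume "x \<in> K" "0 < \<delta>"
          then have "\<exists>h>0. h < \<delta> \<and> 0 < p * h - (F (x + h *\<^sub>R 1) - F x)"
            using K(2) unfolding derivate_gap_def by blast
          then obtain h where "0 < h" "h < \<delta>" "0 < p * h - (F (x + h) - F x)"
            by auto
          then show "\<exists>h>0. h < \<delta> \<and> (L - p) * h \<le> L * (x + h) - F (x + h) - (L * x - F x)"
            by (intro exI[of _ h]) (auto simp: algebra_simps)
        qed fact+
        ultimately have "(2 * L + (q - p)) * measure lborel (K \<inter> {c..d}) \<le> 2 * L * (d - c)"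
          by (simp add: algebra_simps)
        then show "measure lborel (K \<inter> {c..d}) \<le> \<theta> * (d - c)"
          using den by (simp add: \<theta>_def field_simps)
      qed
      moreover have "K \<in> fmeasurable lborel" using K by (simp add: fmeasurable_compact)
      ultimately have "emeasure lborel K = 0" by (simp add: emeasure_eq_measure2)
      then show ?thesis using K by (simp add: compact_imp_closed)
    qed simp
  qed
  then show ?thesis using E by (auto simp: null_sets_def)
qed

section \<open>Directional derivatives of Lipschitz functions\<close>

text \<open>Fubini on the pairs \<open>(x, s)\<close> with \<open>x + s v\<close> in the gap and
  \<open>s\<close> in \<open>[0, 1]\<close>: for fixed \<open>x\<close> the slice is a gap of the
  Lipschitz function \<open>s \<mapsto> f (x + s v)\<close>, hence null; for fixed \<open>s\<close>
  translation invariance returns the measure of the gap. No coordinates adapted to \<open>v\<close>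
  are chosen, and \<open>v = 0\<close> is included.\<close>

lemma derivate_gap_null:
  fixes f :: "'a::euclidean_space \<Rightarrow> real"
  assumes lip: "L-lipschitz_on UNIV f" and "p < q"
  shows "derivate_gap f v p q \<in> null_sets lborel"
proof -
  let ?E = "derivate_gap f v p q"
  have E[measurable]: "?E \<in> sets borel"
    by (rule derivate_gap_borel) (rule lipschitz_on_continuous_on[OF lip])
  have slice: "(\<integral>\<^sup>+s. indicator {0..1} s * indicator ?E (x + s *\<^sub>R v) \<partial>lborel) = 0" for x
  proof -
    have "(L * norm v)-lipschitz_on UNIV (\<lambda>s. f (x + s *\<^sub>R v))"
    proof (rule lipschitz_onI)
      fix s t :: real
      have "dist (f (x + s *\<^sub>R v)) (f (x + t *\<^sub>R v)) \<le> L * dist (x + s *\<^sub>R v) (x + t *\<^sub>R v)"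
        by (rule lipschitz_onD[OF lip]) auto
      also have "\<dots> = L * norm v * dist s t"
        by (simp add: dist_norm flip: scaleR_diff_left)
      finally show "dist (f (x + s *\<^sub>R v)) (f (x + t *\<^sub>R v)) \<le> L * norm v * dist s t" .
    qed (use lipschitz_on_nonneg[OF lip] in auto)
    from derivate_gap_null_real[OF this \<open>p < q\<close>]
    have "AE s in lborel. s \<notin> derivate_gap (\<lambda>s. f (x + s *\<^sub>R v)) 1 p q" by (rule AE_not_in)
    moreover have iff: "x + s *\<^sub>R v \<in> ?E \<longleftrightarrow> s \<in> derivate_gap (\<lambda>s. f (x + s *\<^sub>R v)) 1 p q" for s
      by (simp add: derivate_gap_def scaleR_add_left add.assoc)
    ultimately have "AE s in lborel. indicator {0..1} s * indicator ?E (x + s *\<^sub>R v) = (0::ennreal)"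
      by (elim eventually_mono) (simp add: indicator_def iff)
    then have "(\<integral>\<^sup>+s. indicator {0..1} s * indicator ?E (x + s *\<^sub>R v) \<partial>lborel) = (\<integral>\<^sup>+s. 0 \<partial>(lborel :: real measure))"
      by (rule nn_integral_cong_AE)
    then show ?thesis by simp
  qed
  have trans: "(\<integral>\<^sup>+x. indicator ?E (x + s *\<^sub>R v) \<partial>lborel) = emeasure lborel ?E" for s :: real
  proof -
    have "emeasure lborel ?E = (\<integral>\<^sup>+x. indicator ?E x \<partial>lborel)" by simp
    also have "\<dots> = (\<integral>\<^sup>+x. indicator ?E x \<partial>distr lborel borel ((+) (s *\<^sub>R v)))"
      by (simp add: lborel_distr_plus)
    also have "\<dots> = (\<integral>\<^sup>+x. indicator ?E (s *\<^sub>R v + x) \<partial>lborel)"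
      by (subst nn_integral_distr) auto
    finally show ?thesis by (simp add: add.commute)
  qed
  have "emeasure lborel ?E = (\<integral>\<^sup>+s. indicator {0..1::real} s * emeasure lborel ?E \<partial>lborel)"
    by (simp add: nn_integral_multc)
  also have "\<dots> = (\<integral>\<^sup>+s. \<integral>\<^sup>+x. indicator {0..1::real} s * indicator ?E (x + s *\<^sub>R v) \<partial>lborel \<partial>lborel)"
    by (subst nn_integral_cmult) (auto simp: trans)
  also have "\<dots> = (\<integral>\<^sup>+x. \<integral>\<^sup>+s. indicator {0..1::real} s * indicator ?E (x + s *\<^sub>R v) \<partial>lborel \<partial>lborel)"
    by (rule lborel_pair.Fubini') measurable
  also have "\<dots> = 0" by (simp add: slice)
  finally show ?thesis using E by auto
qed

text \<open>If the lower and upper limits of the right difference quotient differ, two rationals fit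
  between them and \<open>x\<close> lies in one of countably many null gaps. The quotients are
  bounded by \<open>L * norm v\<close>, so the common value is finite.\<close>

lemma right_directional_derivative_exists:
  fixes f :: "'a::euclidean_space \<Rightarrow> real"
  assumes lip: "L-lipschitz_on UNIV f"
  shows "AE x in lborel. \<exists>l. ((\<lambda>h. (f (x + h *\<^sub>R v) - f x) / h) \<longlongrightarrow> l) (at_right 0)"
proof -
  have "AE x in lborel. \<forall>p\<in>\<rat>. \<forall>q\<in>\<rat>. p < q \<longrightarrow> x \<notin> derivate_gap f v p q"
    by (intro AE_ball_countable[THEN iffD2] countable_rat ballI AE_impI AE_not_in derivate_gap_null[OF lip])
  then show ?thesis
  proof eventually_elim
    fix x assume x: "\<forall>p\<in>\<rat>. \<forall>q\<in>\<rat>. p < q \<longrightarrow> x \<notin> derivate_gap f v p q"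
    define Qt where "Qt h = (f (x + h *\<^sub>R v) - f x) / h" for h
    define B where "B = L * norm v"
    have Qt: "\<bar>Qt h\<bar> \<le> B" if "h > 0" for h
    proof -
      have "\<bar>f (x + h *\<^sub>R v) - f x\<bar> \<le> L * dist (x + h *\<^sub>R v) x"
        using lipschitz_onD[OF lip, of "x + h *\<^sub>R v" x] by (simp add: dist_real_def)
      then show ?thesis using that by (simp add: Qt_def B_def dist_norm field_simps)
    qed
    let ?F = "at_right (0::real)"
    have Qt': "Qt h \<le> B" "- B \<le> Qt h" if "h > 0" for h
      using Qt[OF that] by linarith+
    have pos: "\<forall>\<^sub>F h in ?F. 0 < h" by (simp add: eventually_at_right_less)
    let ?ls = "Limsup ?F (\<lambda>h. ereal (Qt h))" and ?li = "Liminf ?F (\<lambda>h. ereal (Qt h))"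
    have le: "?li \<le> ?ls" by (rule Liminf_le_Limsup) simp
    have "\<not> ?li < ?ls"
    proof
      assume "?li < ?ls"
      then obtain p where p: "?li < ereal (real_of_rat p)" "ereal (real_of_rat p) < ?ls" using ereal_dense3 by blast
      then obtain q where q: "ereal (real_of_rat p) < ereal (real_of_rat q)" "ereal (real_of_rat q) < ?ls" using ereal_dense3 by blast
      have 1: "\<exists>h. 0 < h \<and> h < \<delta> \<and> real_of_rat q < Qt h" if "\<delta> > 0" for \<delta>
      proof (rule ccontr)
        assume "\<nexists>h. 0 < h \<and> h < \<delta> \<and> real_of_rat q < Qt h"
        then have "\<forall>\<^sub>F h in ?F. ereal (Qt h) \<le> ereal (real_of_rat q)"
          unfolding eventually_at_right_field using that by (intro exI[of _ \<delta>]) force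
        then have "?ls \<le> ereal (real_of_rat q)" by (rule Limsup_bounded)
        with q(2) show False by simp
      qed
      have 2: "\<exists>h. 0 < h \<and> h < \<delta> \<and> real_of_rat p > Qt h" if "\<delta> > 0" for \<delta>
      proof (rule ccontr)
        assume "\<nexists>h. 0 < h \<and> h < \<delta> \<and> real_of_rat p > Qt h"
        then have "\<forall>\<^sub>F h in ?F. ereal (real_of_rat p) \<le> ereal (Qt h)"
          unfolding eventually_at_right_field using that by (intro exI[of _ \<delta>]) force
        then have "ereal (real_of_rat p) \<le> ?li" by (rule Liminf_bounded)
        with p(1) show False by simp
      qed
      have "x \<in> derivate_gap f v (real_of_rat p) (real_of_rat q)"
        unfolding derivate_gap_def
      proof (intro CollectI conjI allI impI)
        fix \<delta> :: real assume \<delta>: "\<delta> > 0"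
        show "\<exists>h>0. h < \<delta> \<and> 0 < f (x + h *\<^sub>R v) - f x - real_of_rat q * h"
          using 1[OF \<delta>] by (auto simp: Qt_def field_simps)
        show "\<exists>h>0. h < \<delta> \<and> 0 < real_of_rat p * h - (f (x + h *\<^sub>R v) - f x)"
          using 2[OF \<delta>] by (auto simp: Qt_def field_simps)
      qed
      moreover have "real_of_rat p < real_of_rat q" using q(1) by simp
      ultimately show False using x by (auto simp: Rats_def)
    qed
    with le have eq: "?li = ?ls" by simp
    have "?ls \<le> ereal B"
      by (rule Limsup_bounded) (use pos in eventually_elim, use Qt' in simp)
    moreover have "ereal (-B) \<le> ?li"
      by (rule Liminf_bounded) (use pos in eventually_elim, use Qt' in simp)
    ultimately obtain l where l: "?ls = ereal l" using eq by (cases "?ls") auto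
    have "((\<lambda>h. ereal (Qt h)) \<longlongrightarrow> ereal l) ?F"
      by (rule Liminf_eq_Limsup) (use l eq in auto)
    then have "(Qt \<longlongrightarrow> l) ?F" by simp
    then show "\<exists>l. ((\<lambda>h. (f (x + h *\<^sub>R v) - f x) / h) \<longlongrightarrow> l) ?F"
      unfolding Qt_def by blast
  qed
qed

text \<open>The fundamental lemma of the calculus of variations as an inequality: Lipschitz cutoffs
  shrinking to a compact subset of the negativity set show that \<open>h\<close> has non-negative
  integral there. Tests by squares \<open>\<zeta>\<^sup>2\<close> are assumed because the subunit
  condition, being quadratic, yields exactly these.\<close>

lemma nonneg_AE_if_test_nonneg:
  fixes h :: "'a::euclidean_space \<Rightarrow> real"
  assumes "open \<Omega>" and h[measurable]: "h \<in> borel_measurable lebesgue"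
    and int: "\<And>K. compact K \<Longrightarrow> K \<subseteq> \<Omega> \<Longrightarrow> set_integrable lebesgue K h"
    and test: "\<And>\<zeta> L T. L-lipschitz_on UNIV \<zeta> \<Longrightarrow> (\<And>x. 0 \<le> \<zeta> x \<and> \<zeta> x \<le> 1) \<Longrightarrow> compact T \<Longrightarrow> T \<subseteq> \<Omega>
                \<Longrightarrow> (\<And>x. x \<notin> T \<Longrightarrow> \<zeta> x = 0) \<Longrightarrow> 0 \<le> (\<integral>x. (\<zeta> x)\<^sup>2 * h x \<partial>lebesgue)"
  shows "AE x in lebesgue. x \<in> \<Omega> \<longrightarrow> 0 \<le> h x"
proof -
  define S where "S = {x\<in>\<Omega>. h x < 0}"
  have Omega[measurable]: "\<Omega> \<in> sets lebesgue" using \<open>open \<Omega>\<close> by auto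
  have "S = \<Omega> \<inter> {x\<in>space lebesgue. h x < 0}" by (auto simp: S_def)
  moreover have "{x\<in>space lebesgue. h x < 0} \<in> sets lebesgue" by measurable
  ultimately have S: "S \<in> sets lebesgue" using Omega by auto
  have "S \<in> null_sets lebesgue"
  proof (rule null_if_compact_null[OF S])
    fix K assume K: "compact K" "K \<subseteq> S"
    show "emeasure lebesgue K = 0"
    proof (cases "K = {}")
      case False
      have KO: "K \<subseteq> \<Omega>" using K by (auto simp: S_def)
      have Km[measurable]: "K \<in> sets lebesgue" using K by (simp add: compact_imp_closed)
      obtain e where e: "e > 0" "{x. infdist x K \<le> e} \<subseteq> \<Omega>" "compact {x. infdist x K \<le> e}"
      proof -
        obtain e where e: "e > 0" "{x. infdist x K \<le> e} \<subseteq> \<Omega>"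
          by (rule compact_in_open_separated[OF False K(1) \<open>open \<Omega>\<close> KO])
        then show thesis using that compact_infdist_le[OF False K(1) e(1)] by simp
      qed
      define T where "T = {x. infdist x K \<le> e}"
      \<comment> \<open>The slope has two parts: \<open>1/e\<close> makes \<open>\<zeta> n\<close>
        vanish outside \<open>T\<close> for every \<open>n\<close>, and the growing \<open>n\<close>
        makes it converge to the indicator of \<open>K\<close>.\<close>
      define \<zeta> where "\<zeta> n x = max 0 (1 - (real n + 1/e) * infdist x K)" for n :: nat and x
      have \<zeta>T: "\<zeta> n x = 0" if "x \<notin> T" for n x
      proof -
        have "infdist x K > e" using that by (auto simp: T_def)
        then have "1 \<le> (1/e) * infdist x K" using e(1) by (simp add: field_simps)
        also have "\<dots> \<le> (real n + 1/e) * infdist x K" by (intro mult_right_mono) (auto simp: infdist_nonneg)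
        finally show ?thesis by (simp add: \<zeta>_def)
      qed
      have \<zeta>01: "0 \<le> \<zeta> n x \<and> \<zeta> n x \<le> 1" for n x
        using e(1) by (auto simp: \<zeta>_def infdist_nonneg intro!: mult_nonneg_nonneg)
      have lip: "(real n + 1/e)-lipschitz_on UNIV (\<zeta> n)" for n
      proof (rule lipschitz_onI)
        fix x y
        have "\<bar>infdist x K - infdist y K\<bar> \<le> dist x y"
          using infdist_triangle_abs by blast
        then have "(real n + 1/e) * \<bar>infdist x K - infdist y K\<bar> \<le> (real n + 1/e) * dist x y"
          using e(1) by (intro mult_left_mono) auto
        moreover have "\<bar>(real n + 1/e) * infdist x K - (real n + 1/e) * infdist y K\<bar> = (real n + 1/e) * \<bar>infdist x K - infdist y K\<bar>"
          using e(1) by (simp add: right_diff_distrib[symmetric] abs_mult)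
        moreover have "\<bar>\<zeta> n x - \<zeta> n y\<bar> \<le> \<bar>(real n + 1/e) * infdist x K - (real n + 1/e) * infdist y K\<bar>"
          unfolding \<zeta>_def by linarith
        ultimately show "dist (\<zeta> n x) (\<zeta> n y) \<le> (real n + 1/e) * dist x y"
          by (simp add: dist_real_def)
      qed (use e(1) in auto)
      have cT: "compact T" "T \<subseteq> \<Omega>" using e by (auto simp: T_def)
      have Tm[measurable]: "T \<in> sets lebesgue" using cT by (simp add: compact_imp_closed)
      have \<zeta>m[measurable]: "\<zeta> n \<in> borel_measurable lebesgue" for n
      proof (rule measurable_completion)
        show "\<zeta> n \<in> borel_measurable lborel"
          using borel_measurable_continuous_onI[OF lipschitz_on_continuous_on[OF lip[of n]]] by simp
      qed
      have lim: "(\<lambda>n. \<zeta> n x) \<longlonglongrightarrow> indicator K x" for x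
      proof (cases "x \<in> K")
        case True then show ?thesis by (simp add: \<zeta>_def)
      next
        case False
        then have "infdist x K > 0"
          using K(1) \<open>K \<noteq> {}\<close> by (simp add: infdist_pos_not_in_closed compact_imp_closed)
        then obtain N where N: "1 < real N * infdist x K" using reals_Archimedean3 by blast
        have "\<zeta> n x = 0" if "n \<ge> N" for n
        proof -
          have "real N * infdist x K \<le> (real n + 1/e) * infdist x K"
            using that e(1) by (intro mult_right_mono) (auto simp: infdist_nonneg add_increasing2)
          then show ?thesis using N by (simp add: \<zeta>_def)
        qed
        then have "\<forall>\<^sub>F n in sequentially. \<zeta> n x = 0" by (auto simp: eventually_sequentially)
        then show ?thesis using False by (simp add: tendsto_eventually)
      qed
      have "(\<lambda>n. \<integral>x. (\<zeta> n x)\<^sup>2 * h x \<partial>lebesgue) \<longlonglongrightarrow> (\<integral>x. indicator K x * h x \<partial>lebesgue)"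
      proof (rule integral_dominated_convergence[where w = "\<lambda>x. norm (indicator T x *\<^sub>R h x)"])
        show "integrable lebesgue (\<lambda>x. norm (indicator T x *\<^sub>R h x))"
          using int[OF cT] unfolding set_integrable_def by (rule integrable_norm)
        have "(\<lambda>n. (\<zeta> n x)\<^sup>2 * h x) \<longlonglongrightarrow> (indicator K x)\<^sup>2 * h x" for x
          by (intro tendsto_intros lim)
        moreover have "(indicator K x :: real)\<^sup>2 = indicator K x" for x by (simp add: indicator_def)
        ultimately show "AE x in lebesgue. (\<lambda>n. (\<zeta> n x)\<^sup>2 * h x) \<longlonglongrightarrow> indicator K x * h x"
          by simp
        fix n
        show "AE x in lebesgue. norm ((\<zeta> n x)\<^sup>2 * h x) \<le> norm (indicator T x *\<^sub>R h x)"
        proof (intro AE_I2)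
          fix x
          have "(\<zeta> n x)\<^sup>2 \<le> 1" using \<zeta>01[of n x] by (simp add: power_le_one)
          then show "norm ((\<zeta> n x)\<^sup>2 * h x) \<le> norm (indicator T x *\<^sub>R h x)"
            using \<zeta>T[of x n] by (cases "x \<in> T") (auto simp: abs_mult intro: mult_left_le_one_le)
        qed
      qed auto
      then have "0 \<le> (\<integral>x. indicator K x * h x \<partial>lebesgue)"
        by (rule LIMSEQ_le_const) (use test[OF lip \<zeta>01 cT \<zeta>T] in auto)
      moreover have intK: "integrable lebesgue (\<lambda>x. indicator K x * (- h x))"
        using int[OF K(1) KO] by (simp add: set_integrable_def)
      moreover have nn: "0 \<le> indicator K x * (- h x)" for x
        using K(2) by (auto simp: indicator_def S_def)
      ultimately have "(\<integral>x. indicator K x * (- h x) \<partial>lebesgue) = 0"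
        using Bochner_Integration.integral_nonneg[of lebesgue "\<lambda>x. indicator K x * (- h x)", OF nn]
        by (simp only: mult_minus_right Bochner_Integration.integral_minus)
      then have "AE x in lebesgue. indicator K x * (- h x) = 0"
        using integral_nonneg_eq_0_iff_AE[OF intK] nn by simp
      then have "AE x in lebesgue. x \<notin> K"
        by (rule eventually_mono) (use K(2) in \<open>auto simp: indicator_def S_def split: if_splits\<close>)
      then show ?thesis using Km AE_iff_null_sets by blast
    qed simp
  qed
  then have "AE x in lebesgue. x \<notin> S" by (rule AE_not_in)
  then show ?thesis by (rule eventually_mono) (auto simp: S_def)
qed

text \<open>The limit runs over \<open>h = 1/(n+1)\<close> only, so that measurability is immediate;
  it agrees with the right directional derivative wherever the latter exists.\<close>

definition rdir_deriv :: "('a::real_normed_vector \<Rightarrow> real) \<Rightarrow> 'a \<Rightarrow> 'a \<Rightarrow> real" where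
  "rdir_deriv f v x = lim (\<lambda>n. (f (x + (1 / real (Suc n)) *\<^sub>R v) - f x) * real (Suc n))"

lemma rdir_deriv_LIMSEQ:
  fixes f :: "'a::real_normed_vector \<Rightarrow> real"
  assumes "((\<lambda>h. (f (x + h *\<^sub>R v) - f x) / h) \<longlongrightarrow> l) (at_right 0)"
  shows "(\<lambda>n. (f (x + (1 / real (Suc n)) *\<^sub>R v) - f x) * real (Suc n)) \<longlonglongrightarrow> l" "rdir_deriv f v x = l"
proof -
  have "filterlim (\<lambda>n. 1 / real (Suc n)) (at_right 0) sequentially"
    using LIMSEQ_Suc[OF lim_1_over_n[where 'a = real]] by (simp add: filterlim_at)
  from filterlim_compose[OF assms this]
  show "(\<lambda>n. (f (x + (1 / real (Suc n)) *\<^sub>R v) - f x) * real (Suc n)) \<longlonglongrightarrow> l" by simp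
  then show "rdir_deriv f v x = l" unfolding rdir_deriv_def by (rule limI)
qed

lemma rdir_deriv_tendsto_AE:
  fixes f :: "'a::euclidean_space \<Rightarrow> real"
  assumes "L-lipschitz_on UNIV f"
  shows "AE x in lborel. ((\<lambda>h. (f (x + h *\<^sub>R v) - f x) / h) \<longlongrightarrow> rdir_deriv f v x) (at_right 0)"
  using right_directional_derivative_exists[OF assms, of v]
  by (rule eventually_mono) (use rdir_deriv_LIMSEQ(2) in blast)

lemma rdir_deriv_measurable [measurable]:
  fixes f :: "'a::euclidean_space \<Rightarrow> real"
  assumes "continuous_on UNIV f"
  shows "rdir_deriv f v \<in> borel_measurable borel"
proof -
  have [measurable]: "f \<in> borel_measurable borel" using assms by (rule borel_measurable_continuous_onI)
  show ?thesis unfolding rdir_deriv_def by measurable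
qed

lemma rdir_deriv_scale:
  fixes f :: "'a::real_normed_vector \<Rightarrow> real"
  assumes "((\<lambda>h. (f (x + h *\<^sub>R v) - f x) / h) \<longlongrightarrow> l) (at_right 0)" and "0 < r"
  shows "((\<lambda>h. (f (x + h *\<^sub>R (r *\<^sub>R v)) - f x) / h) \<longlongrightarrow> r * l) (at_right 0)"
proof -
  have "filterlim (\<lambda>h. h * r) (at_right 0) (at_right (0::real))"
    unfolding filterlim_at
  proof
    show "((\<lambda>h. h * r) \<longlongrightarrow> 0) (at_right 0)" by (auto intro!: tendsto_eq_intros)
    show "\<forall>\<^sub>F h in at_right 0. h * r \<in> {0<..} \<and> h * r \<noteq> 0"
      using eventually_at_right_less[of "0::real"] by eventually_elim (use \<open>0 < r\<close> in auto)
  qed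
  from tendsto_mult[OF tendsto_const[of r] filterlim_compose[OF assms(1) this]]
  have "((\<lambda>h. r * ((f (x + (h * r) *\<^sub>R v) - f x) / (h * r))) \<longlongrightarrow> r * l) (at_right 0)" .
  moreover have "r * ((f (x + (h * r) *\<^sub>R v) - f x) / (h * r)) = (f (x + h *\<^sub>R (r *\<^sub>R v)) - f x) / h" for h
    using \<open>0 < r\<close> by simp
  ultimately show ?thesis by simp
qed

text \<open>The quotient in direction \<open>v + w\<close> is the one in direction \<open>v\<close>
  at \<open>x\<close> plus the one in direction \<open>w\<close> at \<open>x + t v\<close>. In an
  integral against a test function the shift of the base point moves to the test function by
  translation invariance, and it disappears as \<open>t\<close> tends to \<open>0\<close> because
  \<open>\<zeta>\<close> is continuous. So \<open>g\<close> integrates to zero against all tests,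
  and both \<open>g\<close> and \<open>-g\<close> are non-negative almost everywhere.\<close>

lemma rdir_deriv_add_AE:
  fixes f :: "'a::euclidean_space \<Rightarrow> real"
  assumes lip: "L-lipschitz_on UNIV f"
  shows "AE x in lborel. rdir_deriv f (v + w) x = rdir_deriv f v x + rdir_deriv f w x"
proof -
  have cont: "continuous_on UNIV f" by (rule lipschitz_on_continuous_on[OF lip])
  then have fm[measurable]: "f \<in> borel_measurable borel" by (rule borel_measurable_continuous_onI)
  note dm[measurable] = rdir_deriv_measurable[OF cont]
  define t where "t n = 1 / real (Suc n)" for n
  have t: "0 < t n" "t n \<le> 1" for n by (auto simp: t_def)
  define Qt where "Qt v n x = (f (x + t n *\<^sub>R v) - f x) * real (Suc n)" for v n x
  have Qt_m[measurable]: "Qt v n \<in> borel_measurable borel" for v n unfolding Qt_def by measurable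
  have Qt_bd: "\<bar>Qt v n x\<bar> \<le> L * norm v" for v n x
  proof -
    have "\<bar>f (x + t n *\<^sub>R v) - f x\<bar> \<le> L * (t n * norm v)"
      using lipschitz_onD[OF lip, of "x + t n *\<^sub>R v" x] t[of n] by (simp add: dist_norm)
    then have "\<bar>f (x + t n *\<^sub>R v) - f x\<bar> * real (Suc n) \<le> L * (t n * norm v) * real (Suc n)"
      by (rule mult_right_mono) simp
    then show ?thesis by (simp add: Qt_def abs_mult t_def)
  qed
  have Qt_lim: "AE x in lborel. (\<lambda>n. Qt v n x) \<longlonglongrightarrow> rdir_deriv f v x" for v
    using rdir_deriv_tendsto_AE[OF lip, of v]
    by (rule eventually_mono) (use rdir_deriv_LIMSEQ(1) in \<open>auto simp: Qt_def t_def\<close>)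
  have d_bd: "AE x in lborel. \<bar>rdir_deriv f v x\<bar> \<le> L * norm v" for v
    using Qt_lim[of v]
  proof eventually_elim
    case (elim x)
    from tendsto_rabs[OF this] show ?case by (rule LIMSEQ_le_const2) (use Qt_bd in auto)
  qed
  define g where "g x = rdir_deriv f (v + w) x - rdir_deriv f v x - rdir_deriv f w x" for x
  have gm[measurable]: "g \<in> borel_measurable borel" unfolding g_def by measurable
  have g_bd: "AE x in lborel. \<bar>g x\<bar> \<le> L * norm (v + w) + L * norm v + L * norm w"
    using d_bd[of "v + w"] d_bd[of v] d_bd[of w] by eventually_elim (auto simp: g_def abs_le_iff)
  have gint: "set_integrable lborel K g" if "compact K" for K
    unfolding set_integrable_def
  proof (rule integrableI_bounded_set_indicator[where B = "L * norm (v + w) + L * norm v + L * norm w"])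
    show "K \<in> sets lborel" using that by (auto simp: compact_imp_closed)
    show "emeasure lborel K < \<infinity>" using that by (rule emeasure_compact_finite)
  qed (use g_bd in \<open>auto elim: eventually_mono\<close>)
  have zero: "(\<integral>x. \<zeta> x * g x \<partial>lborel) = 0"
    if \<zeta>: "continuous_on UNIV \<zeta>" "\<And>x. 0 \<le> \<zeta> x \<and> \<zeta> x \<le> 1" "compact T" "\<And>x. x \<notin> T \<Longrightarrow> \<zeta> x = 0" for \<zeta> :: "'a \<Rightarrow> real" and T
  proof -
    note c\<zeta> = \<zeta>(1)
    then have \<zeta>m[measurable]: "\<zeta> \<in> borel_measurable borel" by (rule borel_measurable_continuous_onI)
    obtain R0 where R0: "\<And>x. x \<in> T \<Longrightarrow> norm x \<le> R0" using compact_imp_bounded[OF \<zeta>(3)] by (auto simp: bounded_iff)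
    \<comment> \<open>This ball contains the supports of all translates
      \<open>\<zeta> (x - s v)\<close> with \<open>0 \<le> s \<le> 1\<close>; a multiple of its
      indicator dominates the integrands uniformly in \<open>n\<close>.\<close>
    define B where "B = cball (0::'a) (R0 + norm v)"
    have \<zeta>B: "\<bar>\<zeta> (x - s *\<^sub>R v)\<bar> \<le> indicator B x" if "0 \<le> s" "s \<le> 1" for x s
    proof (cases "x - s *\<^sub>R v \<in> T")
      case True
      have "norm x \<le> norm (x - s *\<^sub>R v) + norm (s *\<^sub>R v)" by (metis diff_add_cancel norm_triangle_ineq)
      also have "\<dots> \<le> R0 + norm v" using R0[OF True] that by (intro add_mono) (auto intro: mult_left_le_one_le)
      finally show ?thesis using \<zeta>(2)[of "x - s *\<^sub>R v"] by (auto simp: B_def)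
    qed (use \<zeta>(4) in auto)
    have fin: "emeasure lborel B < \<infinity>" unfolding B_def by (rule emeasure_compact_finite[OF compact_cball])
    have Bm[measurable]: "B \<in> sets borel" by (auto simp: B_def)
    have Bint: "integrable lborel (\<lambda>x. c * indicator B x :: real)" for c
      using fin by (intro integrable_mult_right) (simp add: integrable_indicator_iff)
    have conv: "(\<lambda>n. \<integral>x. \<zeta> (x - s n *\<^sub>R v) * Qt u n x \<partial>lborel) \<longlonglongrightarrow> (\<integral>x. \<zeta> x * rdir_deriv f u x \<partial>lborel)"
      and convi: "integrable lborel (\<lambda>x. \<zeta> (x - s n *\<^sub>R v) * Qt u n x)"
      and convi': "integrable lborel (\<lambda>x. \<zeta> x * rdir_deriv f u x)"
      if s: "\<And>n. 0 \<le> s n \<and> s n \<le> 1" "s \<longlonglongrightarrow> 0" for s u n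
    proof -
      have lim: "AE x in lborel. (\<lambda>n. \<zeta> (x - s n *\<^sub>R v) * Qt u n x) \<longlonglongrightarrow> \<zeta> x * rdir_deriv f u x"
        using Qt_lim[of u]
      proof eventually_elim
        case (elim x)
        have "(\<lambda>n. x - s n *\<^sub>R v) \<longlonglongrightarrow> x - 0 *\<^sub>R v" by (intro tendsto_intros s)
        then have "(\<lambda>n. \<zeta> (x - s n *\<^sub>R v)) \<longlonglongrightarrow> \<zeta> x"
          using continuous_on_tendsto_compose[OF c\<zeta>] by simp
        then show ?case by (intro tendsto_mult elim)
      qed
      have dom: "AE x in lborel. norm (\<zeta> (x - s n *\<^sub>R v) * Qt u n x) \<le> (L * norm u) * indicator B x" for n
        using mult_mono[OF \<zeta>B Qt_bd] s lipschitz_on_nonneg[OF lip]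
        by (intro AE_I2) (simp add: abs_mult mult.commute)
      show "(\<lambda>n. \<integral>x. \<zeta> (x - s n *\<^sub>R v) * Qt u n x \<partial>lborel) \<longlonglongrightarrow> (\<integral>x. \<zeta> x * rdir_deriv f u x \<partial>lborel)"
        by (rule integral_dominated_convergence[OF _ _ Bint lim dom]) measurable
      show "integrable lborel (\<lambda>x. \<zeta> (x - s n *\<^sub>R v) * Qt u n x)"
        by (rule integrable_dominated_convergence2[OF _ _ Bint lim dom]) measurable
      show "integrable lborel (\<lambda>x. \<zeta> x * rdir_deriv f u x)"
        by (rule integrable_dominated_convergence[OF _ _ Bint lim dom]) measurable
    qed
    have t0: "t \<longlonglongrightarrow> 0" unfolding t_def by (intro LIMSEQ_Suc lim_1_over_n)
    have z: "\<And>n. 0 \<le> (0::real) \<and> 0 \<le> (1::real)" "(\<lambda>n::nat. 0::real) \<longlonglongrightarrow> 0" by auto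
    have tt: "\<And>n. 0 \<le> t n \<and> t n \<le> 1" using t by (simp add: less_imp_le)
    have split: "(\<integral>x. \<zeta> x * Qt (v + w) n x \<partial>lborel)
        = (\<integral>x. \<zeta> x * Qt v n x \<partial>lborel) + (\<integral>x. \<zeta> (x - t n *\<^sub>R v) * Qt w n x \<partial>lborel)" for n
    proof -
      have eq: "\<zeta> x * Qt (v + w) n x = \<zeta> x * Qt v n x + \<zeta> ((t n *\<^sub>R v + x) - t n *\<^sub>R v) * Qt w n (t n *\<^sub>R v + x)" for x
        by (simp add: Qt_def algebra_simps)
      have sh: "integrable lborel (\<lambda>x. k (t n *\<^sub>R v + x))" "(\<integral>x. k (t n *\<^sub>R v + x) \<partial>lborel) = (\<integral>x. k x \<partial>lborel)"
        if "integrable lborel k" for k :: "'a \<Rightarrow> real"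
      proof -
        have km[measurable]: "k \<in> borel_measurable borel" using that by auto
        have "integrable (distr lborel borel ((+) (t n *\<^sub>R v))) k" using that by (simp add: lborel_distr_plus)
        then show "integrable lborel (\<lambda>x. k (t n *\<^sub>R v + x))" by (subst (asm) integrable_distr_eq) auto
        have "(\<integral>x. k x \<partial>lborel) = (\<integral>x. k x \<partial>distr lborel borel ((+) (t n *\<^sub>R v)))" by (simp add: lborel_distr_plus)
        also have "\<dots> = (\<integral>x. k (t n *\<^sub>R v + x) \<partial>lborel)" by (subst integral_distr) auto
        finally show "(\<integral>x. k (t n *\<^sub>R v + x) \<partial>lborel) = (\<integral>x. k x \<partial>lborel)" by simp
      qed
      note i2 = convi[OF tt t0, where n = n and u = w]
      have i1: "integrable lborel (\<lambda>x. \<zeta> x * Qt v n x)" using convi[OF z, where n = n and u = v] by simp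
      show ?thesis
        unfolding eq using Bochner_Integration.integral_add[OF i1 sh(1)[OF i2]] sh(2)[OF i2] by simp
    qed
    have "(\<lambda>n. \<integral>x. \<zeta> x * Qt (v + w) n x \<partial>lborel) \<longlonglongrightarrow> (\<integral>x. \<zeta> x * rdir_deriv f (v + w) x \<partial>lborel)"
      using conv[OF z, where u = "v + w"] by simp
    moreover have "(\<lambda>n. \<integral>x. \<zeta> x * Qt (v + w) n x \<partial>lborel) \<longlonglongrightarrow>
        (\<integral>x. \<zeta> x * rdir_deriv f v x \<partial>lborel) + (\<integral>x. \<zeta> x * rdir_deriv f w x \<partial>lborel)"
      unfolding split using tendsto_add[OF conv[OF z, where u = v] conv[OF tt t0, where u = w]] by simp
    ultimately have "(\<integral>x. \<zeta> x * rdir_deriv f (v + w) x \<partial>lborel)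
        = (\<integral>x. \<zeta> x * rdir_deriv f v x \<partial>lborel) + (\<integral>x. \<zeta> x * rdir_deriv f w x \<partial>lborel)"
      by (rule LIMSEQ_unique)
    moreover have "(\<integral>x. \<zeta> x * g x \<partial>lborel) = (\<integral>x. \<zeta> x * rdir_deriv f (v + w) x \<partial>lborel)
        - (\<integral>x. \<zeta> x * rdir_deriv f v x \<partial>lborel) - (\<integral>x. \<zeta> x * rdir_deriv f w x \<partial>lborel)"
      unfolding g_def right_diff_distrib using convi'[OF z] by simp
    ultimately show ?thesis by simp
  qed
  have pm: "AE x in lebesgue. x \<in> UNIV \<longrightarrow> 0 \<le> k x"
    if k[measurable]: "k \<in> borel_measurable borel" "\<And>K. compact K \<Longrightarrow> set_integrable lborel K k"
      "\<And>\<zeta> T. continuous_on UNIV \<zeta> \<Longrightarrow> (\<And>x. 0 \<le> \<zeta> x \<and> \<zeta> x \<le> 1) \<Longrightarrow> compact T \<Longrightarrow> (\<And>x. x \<notin> T \<Longrightarrow> \<zeta> x = 0) \<Longrightarrow> (\<integral>x. \<zeta> x * k x \<partial>lborel) = 0"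
    for k :: "'a \<Rightarrow> real"
  proof (rule nonneg_AE_if_test_nonneg)
    show "k \<in> borel_measurable lebesgue" using k(1) by (intro measurable_completion) simp
    show "set_integrable lebesgue K k" if "compact K" for K
      using k(2)[OF that] that unfolding set_integrable_def
      by (subst integrable_completion) (auto simp: compact_imp_closed intro!: borel_measurable_scaleR)
    fix \<zeta> :: "'a \<Rightarrow> real" and L and T :: "'a set"
    assume *: "L-lipschitz_on UNIV \<zeta>" "\<And>x. 0 \<le> \<zeta> x \<and> \<zeta> x \<le> 1" "compact T" "\<And>x. x \<notin> T \<Longrightarrow> \<zeta> x = 0"
    have c: "continuous_on UNIV (\<lambda>x. (\<zeta> x)\<^sup>2)"
      using lipschitz_on_continuous_on[OF *(1)] by (intro continuous_intros)
    then have [measurable]: "(\<lambda>x. (\<zeta> x)\<^sup>2) \<in> borel_measurable borel"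
      by (rule borel_measurable_continuous_onI)
    have "(\<integral>x. (\<zeta> x)\<^sup>2 * k x \<partial>lebesgue) = (\<integral>x. (\<zeta> x)\<^sup>2 * k x \<partial>lborel)"
      by (rule integral_completion) measurable
    also have "\<dots> = 0"
      by (rule k(3)[OF c _ *(3)]) (use *(2,4) in \<open>auto simp: power_le_one\<close>)
    finally show "0 \<le> (\<integral>x. (\<zeta> x)\<^sup>2 * k x \<partial>lebesgue)" by simp
  qed simp
  have "AE x in lebesgue. x \<in> UNIV \<longrightarrow> 0 \<le> g x" by (rule pm[OF gm gint zero]) auto
  moreover have "AE x in lebesgue. x \<in> UNIV \<longrightarrow> 0 \<le> - g x"
    by (rule pm) (use gint zero in \<open>auto simp: set_integrable_def\<close>)
  ultimately have "AE x in lebesgue. g x = 0" by eventually_elim auto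
  then have "AE x in lborel. g x = 0" by (simp add: AE_completion_iff)
  then show ?thesis by (rule eventually_mono) (simp add: g_def)
qed

lemma rdir_deriv_zero [simp]: "rdir_deriv f 0 x = 0"
  unfolding rdir_deriv_def by (simp add: limI)

text \<open>For \<open>r > 0\<close> the variable \<open>h\<close> is rescaled. For
  \<open>r < 0\<close> a right derivative says nothing about the other side, so additivity is
  applied to \<open>r v\<close> and \<open>-r v\<close>, whose sum is \<open>0\<close>.\<close>

lemma rdir_deriv_scale_AE:
  fixes f :: "'a::euclidean_space \<Rightarrow> real"
  assumes lip: "L-lipschitz_on UNIV f"
  shows "AE x in lborel. rdir_deriv f (r *\<^sub>R v) x = r * rdir_deriv f v x"
proof -
  have pos: "AE x in lborel. rdir_deriv f (s *\<^sub>R v) x = s * rdir_deriv f v x" if "s > 0" for s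
    using rdir_deriv_tendsto_AE[OF lip, of v]
    by (rule eventually_mono) (rule rdir_deriv_LIMSEQ(2)[OF rdir_deriv_scale[OF _ that]])
  consider "r > 0" | "r = 0" | "r < 0" by linarith
  then show ?thesis
  proof cases
    case 3
    have "AE x in lborel. rdir_deriv f ((- r) *\<^sub>R v) x = - r * rdir_deriv f v x" using 3 by (intro pos) simp
    moreover have "AE x in lborel. rdir_deriv f (r *\<^sub>R v + (- r) *\<^sub>R v) x = rdir_deriv f (r *\<^sub>R v) x + rdir_deriv f ((- r) *\<^sub>R v) x"
      by (rule rdir_deriv_add_AE[OF lip])
    ultimately show ?thesis by eventually_elim simp
  qed (use pos in auto)
qed

lemma rdir_deriv_sum_AE:
  fixes f :: "'a::euclidean_space \<Rightarrow> real"
  assumes lip: "L-lipschitz_on UNIV f" and "finite B"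
  shows "AE x in lborel. rdir_deriv f (\<Sum>b\<in>B. c b *\<^sub>R b) x = (\<Sum>b\<in>B. c b * rdir_deriv f b x)"
  using \<open>finite B\<close>
proof (induction B)
  case (insert b B)
  have "AE x in lborel. rdir_deriv f (c b *\<^sub>R b + (\<Sum>b\<in>B. c b *\<^sub>R b)) x
      = rdir_deriv f (c b *\<^sub>R b) x + rdir_deriv f (\<Sum>b\<in>B. c b *\<^sub>R b) x"
    by (rule rdir_deriv_add_AE[OF lip])
  with insert.IH rdir_deriv_scale_AE[OF lip, of "c b" b]
  show ?case by eventually_elim (use insert.hyps in simp)
qed simp

text \<open>Finitely many directions of \<open>D\<close> are \<open>\<eta>\<close>-dense on the unit
  sphere, which makes the limits uniform in the direction; the Lipschitz bound and linearity of
  \<open>v \<bullet> G\<close> carry the estimate from a nearby direction to the given one at a cost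
  of \<open>(L + norm G) \<eta>\<close>.\<close>

lemma GDERIV_if_dense_directions:
  fixes f :: "'a::euclidean_space \<Rightarrow> real"
  assumes lip: "L-lipschitz_on UNIV f"
    and dense: "\<And>X. open X \<Longrightarrow> X \<noteq> {} \<Longrightarrow> \<exists>d\<in>D. d \<in> X"
    and lim: "\<And>v. v \<in> D \<Longrightarrow> ((\<lambda>h. (f (x + h *\<^sub>R v) - f x) / h) \<longlongrightarrow> v \<bullet> G) (at_right 0)"
  shows "GDERIV f x :> G"
  unfolding gderiv_def has_derivative_at_alt
proof (intro conjI allI impI)
  show "bounded_linear (\<lambda>h. h \<bullet> G)" by (rule bounded_linear_inner_left)
  fix e :: real assume "e > 0"
  define M where "M = L + norm G"
  have "L \<ge> 0" using lip by (rule lipschitz_on_nonneg)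
  have "M \<ge> 0" using \<open>L \<ge> 0\<close> by (simp add: M_def)
  \<comment> \<open>\<open>M \<eta> \<le> e / 2\<close> pays for replacing the direction, the other
    \<open>e / 2\<close> for the difference quotient; the added \<open>1\<close> covers
    \<open>M = 0\<close>.\<close>
  define \<eta> where "\<eta> = e / (2 * (M + 1))"
  have "\<eta> > 0" using \<open>e > 0\<close> \<open>M \<ge> 0\<close> by (simp add: \<eta>_def)
  have M\<eta>: "M * \<eta> \<le> e / 2"
  proof -
    have "M * \<eta> = (e / 2) * (M / (M + 1))" by (simp add: \<eta>_def)
    also have "\<dots> \<le> (e / 2) * 1" using \<open>e > 0\<close> \<open>M \<ge> 0\<close> by (intro mult_left_mono) auto
    finally show ?thesis by simp
  qed
  have cov: "sphere (0::'a) 1 \<subseteq> (\<Union>v\<in>D. ball v \<eta>)"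
  proof
    fix \<xi> :: 'a
    obtain v where "v \<in> D" "v \<in> ball \<xi> \<eta>" using dense[of "ball \<xi> \<eta>"] \<open>\<eta> > 0\<close> by auto
    then show "\<xi> \<in> (\<Union>v\<in>D. ball v \<eta>)" by (auto simp: dist_commute)
  qed
  obtain F where F: "F \<subseteq> D" "finite F" "sphere (0::'a) 1 \<subseteq> (\<Union>v\<in>F. ball v \<eta>)"
  proof (rule compactE_image[OF compact_sphere _ cov])
    fix C' assume "C' \<subseteq> D" "finite C'" "sphere (0::'a) 1 \<subseteq> (\<Union>v\<in>C'. ball v \<eta>)"
    then show thesis by (rule that)
  qed simp
  have "\<forall>v\<in>F. \<forall>\<^sub>F h in at_right 0. dist ((f (x + h *\<^sub>R v) - f x) / h) (v \<bullet> G) < e / 2"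
    using F(1) \<open>e > 0\<close> by (intro ballI tendstoD[OF lim]) auto
  then have "\<forall>\<^sub>F h in at_right 0. \<forall>v\<in>F. dist ((f (x + h *\<^sub>R v) - f x) / h) (v \<bullet> G) < e / 2"
    using F(2) by (simp add: eventually_ball_finite)
  then obtain d where d: "d > 0" "\<And>h v. 0 < h \<Longrightarrow> h < d \<Longrightarrow> v \<in> F \<Longrightarrow> dist ((f (x + h *\<^sub>R v) - f x) / h) (v \<bullet> G) < e / 2"
    unfolding eventually_at_right_field by auto
  show "\<exists>d>0. \<forall>y. norm (y - x) < d \<longrightarrow> norm (f y - f x - (y - x) \<bullet> G) \<le> e * norm (y - x)"
  proof (intro exI[of _ d] conjI allI impI)
    fix y assume y: "norm (y - x) < d"
    show "norm (f y - f x - (y - x) \<bullet> G) \<le> e * norm (y - x)"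
    proof (cases "y = x")
      case False
      define h where "h = norm (y - x)"
      define \<xi> where "\<xi> = (1/h) *\<^sub>R (y - x)"
      have h: "0 < h" "h < d" using y False by (auto simp: h_def)
      have yx: "y = x + h *\<^sub>R \<xi>" using h by (simp add: \<xi>_def)
      have "norm \<xi> = 1" using h by (simp add: \<xi>_def h_def)
      then obtain v where v: "v \<in> F" "norm (\<xi> - v) < \<eta>" using F(3) by (auto simp: subset_iff dist_norm norm_minus_commute)
      have 1: "\<bar>f (x + h *\<^sub>R \<xi>) - f (x + h *\<^sub>R v)\<bar> \<le> L * (h * \<eta>)"
      proof -
        have "\<bar>f (x + h *\<^sub>R \<xi>) - f (x + h *\<^sub>R v)\<bar> \<le> L * norm (h *\<^sub>R \<xi> - h *\<^sub>R v)"
          using lipschitz_onD[OF lip, of "x + h *\<^sub>R \<xi>" "x + h *\<^sub>R v"] by (simp add: dist_norm)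
        also have "\<dots> = L * (h * norm (\<xi> - v))" using h by (simp flip: scaleR_diff_right)
        also have "\<dots> \<le> L * (h * \<eta>)" using v h \<open>L \<ge> 0\<close> by (intro mult_left_mono) auto
        finally show ?thesis .
      qed
      have 2: "\<bar>f (x + h *\<^sub>R v) - f x - h * (v \<bullet> G)\<bar> \<le> h * (e / 2)"
      proof -
        have "f (x + h *\<^sub>R v) - f x - h * (v \<bullet> G) = h * ((f (x + h *\<^sub>R v) - f x) / h - v \<bullet> G)"
          using h by (simp add: field_simps)
        then have "\<bar>f (x + h *\<^sub>R v) - f x - h * (v \<bullet> G)\<bar> = h * dist ((f (x + h *\<^sub>R v) - f x) / h) (v \<bullet> G)"
          using h by (simp add: abs_mult dist_real_def)
        also have "\<dots> \<le> h * (e / 2)" using d(2)[OF h v(1)] h by (intro mult_left_mono) auto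
        finally show ?thesis .
      qed
      have 3: "\<bar>h * (v \<bullet> G) - h * (\<xi> \<bullet> G)\<bar> \<le> h * (norm G * \<eta>)"
      proof -
        have "\<bar>h * (v \<bullet> G) - h * (\<xi> \<bullet> G)\<bar> = h * \<bar>(v - \<xi>) \<bullet> G\<bar>"
          using h by (simp add: abs_mult inner_diff_left flip: right_diff_distrib)
        also have "\<bar>(v - \<xi>) \<bullet> G\<bar> \<le> norm (v - \<xi>) * norm G" by (rule Cauchy_Schwarz_ineq2)
        also have "\<dots> \<le> norm G * \<eta>"
          using v(2) mult_left_mono[of "norm (v - \<xi>)" \<eta> "norm G"] by (simp add: norm_minus_commute mult.commute)
        finally show ?thesis using h by (simp add: mult_left_mono)
      qed
      have "\<bar>f y - f x - (y - x) \<bullet> G\<bar> \<le> L * (h * \<eta>) + h * (e / 2) + h * (norm G * \<eta>)"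
      proof -
        have "(y - x) \<bullet> G = h * (\<xi> \<bullet> G)" unfolding yx by simp
        then show ?thesis using 1 2 3 unfolding yx by linarith
      qed
      also have "\<dots> = h * (M * \<eta> + e / 2)" by (simp add: M_def algebra_simps)
      also have "\<dots> \<le> h * e" using M\<eta> h by (intro mult_left_mono) auto
      finally show ?thesis by (simp add: h_def mult.commute)
    qed simp
  qed fact
qed

text \<open>One null set serves a countable dense set of directions. Outside it the right
  derivatives in these directions exist and, by almost everywhere linearity, equal
  \<open>v \<bullet> G\<close> with \<open>G\<close> assembled from the basis directions.\<close>

theorem Rademacher_UNIV:
  fixes f :: "'a::euclidean_space \<Rightarrow> real"
  assumes lip: "L-lipschitz_on UNIV f"
  shows "AE x in lborel. \<exists>D. GDERIV f x :> D"
proof -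
  obtain D :: "'a set" where D: "countable D" "\<And>X. open X \<Longrightarrow> X \<noteq> {} \<Longrightarrow> \<exists>d\<in>D. d \<in> X"
    using countable_dense_setE by blast
  have "AE x in lborel. \<forall>v\<in>D. ((\<lambda>h. (f (x + h *\<^sub>R v) - f x) / h) \<longlongrightarrow> rdir_deriv f v x) (at_right 0)
      \<and> rdir_deriv f v x = v \<bullet> (\<Sum>b\<in>Basis. rdir_deriv f b x *\<^sub>R b)"
  proof (intro AE_ball_countable[THEN iffD2] D(1) ballI)
    fix v
    have "AE x in lborel. rdir_deriv f (\<Sum>b\<in>Basis. (v \<bullet> b) *\<^sub>R b) x = (\<Sum>b\<in>Basis. (v \<bullet> b) * rdir_deriv f b x)"
      by (rule rdir_deriv_sum_AE[OF lip]) simp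
    with rdir_deriv_tendsto_AE[OF lip, of v]
    show "AE x in lborel. ((\<lambda>h. (f (x + h *\<^sub>R v) - f x) / h) \<longlongrightarrow> rdir_deriv f v x) (at_right 0)
      \<and> rdir_deriv f v x = v \<bullet> (\<Sum>b\<in>Basis. rdir_deriv f b x *\<^sub>R b)"
      by eventually_elim (simp add: euclidean_representation inner_sum_right mult.commute)
  qed
  then show ?thesis
  proof eventually_elim
    case (elim x)
    let ?G = "\<Sum>b\<in>Basis. rdir_deriv f b x *\<^sub>R b"
    have "GDERIV f x :> ?G"
    proof (rule GDERIV_if_dense_directions[OF lip D(2)])
      fix v assume "v \<in> D"
      with elim have A: "((\<lambda>h. (f (x + h *\<^sub>R v) - f x) / h) \<longlongrightarrow> rdir_deriv f v x) (at_right 0)"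
        and B: "rdir_deriv f v x = v \<bullet> ?G" by blast+
      show "((\<lambda>h. (f (x + h *\<^sub>R v) - f x) / h) \<longlongrightarrow> v \<bullet> ?G) (at_right 0)"
        using A unfolding B .
    qed
    then show ?case by blast
  qed
qed

section \<open>Locally Lipschitz functions on an open set\<close>

text \<open>The extension is the infimum of the cones \<open>f y + L * dist x y\<close> with
  \<open>y\<close> in \<open>S\<close>; each cone is \<open>L\<close>-Lipschitz, and so is their
  infimum.\<close>

lemma McShane_extension:
  fixes f :: "'a::metric_space \<Rightarrow> real"
  assumes lip: "L-lipschitz_on S f"
  obtains F where "L-lipschitz_on UNIV F" "\<And>x. x \<in> S \<Longrightarrow> F x = f x"
proof (cases "S = {}")
  case True
  have "L-lipschitz_on UNIV (\<lambda>_::'a. 0::real)" using lipschitz_on_nonneg[OF lip] by (intro lipschitz_onI) auto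
  then show ?thesis using that True by blast
next
  case False
  then obtain y0 where y0: "y0 \<in> S" by auto
  have "L \<ge> 0" using lip by (rule lipschitz_on_nonneg)
  define F where "F x = Inf ((\<lambda>y. f y + L * dist x y) ` S)" for x
  have lower: "f y0 - L * dist x y0 \<le> f y + L * dist x y" if "y \<in> S" for x y
  proof -
    have "f y0 - f y \<le> L * dist y0 y" using lipschitz_onD[OF lip y0 that] by (simp add: dist_real_def)
    also have "\<dots> \<le> L * (dist x y0 + dist x y)"
      using \<open>L \<ge> 0\<close> dist_triangle3[of y0 y x] by (intro mult_left_mono) auto
    finally show ?thesis by (simp add: algebra_simps)
  qed
  have bdd: "bdd_below ((\<lambda>y. f y + L * dist x y) ` S)" for x
    using lower by (intro bdd_belowI2) auto
  have step: "F x \<le> F z + L * dist x z" for x z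
  proof -
    have "F x - L * dist x z \<le> F z" unfolding F_def[of z]
    proof (rule cINF_greatest[OF False])
      fix y assume "y \<in> S"
      have "F x \<le> f y + L * dist x y" unfolding F_def using bdd \<open>y \<in> S\<close> by (rule cINF_lower)
      also have "\<dots> \<le> f y + L * (dist x z + dist z y)"
        using \<open>L \<ge> 0\<close> by (intro add_left_mono mult_left_mono dist_triangle) auto
      finally show "F x - L * dist x z \<le> f y + L * dist z y" by (simp add: algebra_simps)
    qed
    then show ?thesis by simp
  qed
  show ?thesis
  proof (rule that)
    show "L-lipschitz_on UNIV F"
    proof (rule lipschitz_onI[OF _ \<open>L \<ge> 0\<close>])
      fix x y
      show "dist (F x) (F y) \<le> L * dist x y"
        using step[of x y] step[of y x] by (simp add: dist_real_def abs_le_iff dist_commute)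
    qed
    fix x assume "x \<in> S"
    have "F x \<le> f x" using cINF_lower[OF bdd[of x] \<open>x \<in> S\<close>] by (simp add: F_def)
    moreover have "f x \<le> F x" unfolding F_def
    proof (rule cINF_greatest[OF False])
      fix y assume "y \<in> S"
      show "f x \<le> f y + L * dist x y"
        using lipschitz_onD[OF lip \<open>x \<in> S\<close> \<open>y \<in> S\<close>] by (simp add: dist_real_def)
    qed
    ultimately show "F x = f x" by simp
  qed
qed

lemma GDERIV_cong_open:
  assumes "GDERIV f x :> D" "open U" "x \<in> U" "\<And>y. y \<in> U \<Longrightarrow> f y = g y"
  shows "GDERIV g x :> D"
  using assms unfolding gderiv_def by (blast intro: has_derivative_transform_within_open)

lemma Lip_loc_ballE:
  assumes "f \<in> Lip_loc \<Omega>" "open \<Omega>" "x \<in> \<Omega>"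
  obtains e L where "e > 0" "cball x e \<subseteq> \<Omega>" "L-lipschitz_on (cball x e) f"
proof -
  obtain e1 L where 1: "e1 > 0" "L-lipschitz_on (cball x e1 \<inter> \<Omega>) f"
    using assms by (auto simp: Lip_loc_def)
  obtain e2 where 2: "e2 > 0" "cball x e2 \<subseteq> \<Omega>" using assms open_contains_cball by blast
  have "cball x (min e1 e2) \<subseteq> cball x e1 \<inter> \<Omega>" using 2 by auto
  then show ?thesis
    using 1 2 that[of "min e1 e2" L] by (auto intro: lipschitz_on_subset)
qed

text \<open>The Lindelof property reduces the claim to countably many balls on which
  \<open>f\<close> is Lipschitz; on each of them an extension to the whole space is differentiable
  almost everywhere and coincides with \<open>f\<close> near every point of the open ball.\<close>

theorem Lip_loc_differentiable_AE:
  assumes f: "f \<in> Lip_loc \<Omega>" and "open \<Omega>"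
  shows "AE x in lebesgue. x \<in> \<Omega> \<longrightarrow> (\<exists>D. GDERIV f x :> D)"
proof -
  define \<B> where "\<B> = {ball x e | x e. 0 < e \<and> cball x e \<subseteq> \<Omega> \<and> (\<exists>L. L-lipschitz_on (cball x e) f)}"
  have "\<And>U. U \<in> \<B> \<Longrightarrow> open U" by (auto simp: \<B>_def)
  then obtain \<C> where C: "\<C> \<subseteq> \<B>" "countable \<C>" "\<Union>\<C> = \<Union>\<B>" using Lindelof by metis
  have "\<Omega> \<subseteq> \<Union>\<B>"
  proof
    fix x assume "x \<in> \<Omega>"
    obtain e L where "e > 0" "cball x e \<subseteq> \<Omega>" "L-lipschitz_on (cball x e) f" by (rule Lip_loc_ballE[OF f \<open>open \<Omega>\<close> \<open>x \<in> \<Omega>\<close>])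
    then show "x \<in> \<Union>\<B>" by (intro UnionI[of "ball x e"]) (auto simp: \<B>_def)
  qed
  have "AE x in lebesgue. \<forall>U\<in>\<C>. x \<in> U \<longrightarrow> (\<exists>D. GDERIV f x :> D)"
  proof (intro AE_ball_countable[THEN iffD2] C(2) ballI)
    fix U assume "U \<in> \<C>"
    then obtain y e L where U: "U = ball y e" "L-lipschitz_on (cball y e) f"
      using C(1) by (auto simp: \<B>_def)
    obtain F where F: "L-lipschitz_on UNIV F" "\<And>x. x \<in> cball y e \<Longrightarrow> F x = f x"
      using McShane_extension[OF U(2)] by blast
    have "AE x in lebesgue. \<exists>D. GDERIV F x :> D"
      using Rademacher_UNIV[OF F(1)] by (simp add: AE_completion_iff)
    then show "AE x in lebesgue. x \<in> U \<longrightarrow> (\<exists>D. GDERIV f x :> D)"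
    proof eventually_elim
      case (elim x)
      then obtain D where D: "GDERIV F x :> D" by blast
      show ?case
      proof
        assume "x \<in> U"
        then have "GDERIV f x :> D" using D F(2) U(1) by (intro GDERIV_cong_open[OF D, of U]) auto
        then show "\<exists>D. GDERIV f x :> D" by blast
      qed
    qed
  qed
  then show ?thesis
  proof eventually_elim
    case (elim x)
    show ?case
    proof
      assume "x \<in> \<Omega>"
      then have "x \<in> \<Union>\<C>" using C(3) \<open>\<Omega> \<subseteq> \<Union>\<B>\<close> by auto
      then obtain U where "U \<in> \<C>" "x \<in> U" by auto
      with elim show "\<exists>D. GDERIV f x :> D" by blast
    qed
  qed
qed

lemma GDERIV_unique: "GDERIV f x :> D \<Longrightarrow> GDERIV f x :> D' \<Longrightarrow> D = D'"
  unfolding gderiv_def by (drule (1) has_derivative_unique) (simp add: fun_eq_iff vector_eq_ldot)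

lemma grad_eqI: "GDERIV f x :> D \<Longrightarrow> grad f x = D"
  unfolding grad_def by (auto intro: the_equality GDERIV_unique)

lemma Lip_loc_continuous_on: "f \<in> Lip_loc \<Omega> \<Longrightarrow> open \<Omega> \<Longrightarrow> continuous_on \<Omega> f"
proof (rule continuous_at_imp_continuous_on, rule ballI)
  fix x assume f: "f \<in> Lip_loc \<Omega>" "open \<Omega>" "x \<in> \<Omega>"
  obtain e L where e: "e > 0" "L-lipschitz_on (cball x e) f" by (rule Lip_loc_ballE[OF f])
  have "continuous_on (ball x e) f"
    by (rule continuous_on_subset[OF lipschitz_on_continuous_on[OF e(2)]]) auto
  then show "isCont f x" using e(1) by (simp add: continuous_on_eq_continuous_at)
qed

lemma borel_measurable_lebesgue_cong_AE:
  fixes f g :: "'a::euclidean_space \<Rightarrow> 'b::topological_space"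
  assumes f: "f \<in> borel_measurable lebesgue" and "AE x in lebesgue. f x = g x"
  shows "g \<in> borel_measurable lebesgue"
proof (rule measurableI)
  fix A :: "'b set" assume "A \<in> sets borel"
  then have "f -` A \<inter> space lebesgue \<in> sets lebesgue" using f by (rule measurable_sets[rotated])
  then show "g -` A \<inter> space lebesgue \<in> sets lebesgue"
    by (rule completion.in_sets_AE[rotated]) (use assms(2) in \<open>auto elim: eventually_mono\<close>)
qed simp

lemma GDERIV_directional:
  assumes "GDERIV F x :> D"
  shows "((\<lambda>h. (F (x + h *\<^sub>R b) - F x) / h) \<longlongrightarrow> b \<bullet> D) (at_right 0)"
proof -
  have "((\<lambda>h. F (x + h *\<^sub>R b)) has_derivative (\<lambda>h. (h *\<^sub>R b) \<bullet> D)) (at 0)"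
    by (rule has_derivative_compose[where g = F and f = "\<lambda>h. x + h *\<^sub>R b", simplified])
       (use assms in \<open>auto simp: gderiv_def intro!: derivative_eq_intros\<close>)
  then have "((\<lambda>h. F (x + h *\<^sub>R b)) has_real_derivative (b \<bullet> D)) (at 0)"
    by (simp add: has_field_derivative_def mult_commute_abs)
  then have "((\<lambda>h. (F (x + h *\<^sub>R b) - F x) / h) \<longlongrightarrow> b \<bullet> D) (at 0)"
    by (simp add: DERIV_def)
  then show ?thesis by (rule tendsto_within_subset) simp
qed

text \<open>\<open>grad\<close> is a definite description, so nothing about measurability can be
  read off. It agrees almost everywhere with a Borel function, the limits of difference quotients
  along the basis, and Lebesgue measurability survives changes on null sets.\<close>

lemma grad_measurable:
  fixes f :: "real^'n \<Rightarrow> real"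
  assumes f: "f \<in> Lip_loc \<Omega>" and "open \<Omega>"
  shows "grad f \<in> borel_measurable (lebesgue_on \<Omega>)"
proof -
  have Om[measurable]: "\<Omega> \<in> sets borel" using \<open>open \<Omega>\<close> by simp
  \<comment> \<open>Extended by zero, the function is Borel on the whole space, so the shifted
    points in the quotients may leave \<open>\<Omega>\<close>; derivatives at points of the open set
    are unaffected.\<close>
  define F where "F x = (if x \<in> \<Omega> then f x else 0)" for x
  have Fm[measurable]: "F \<in> borel_measurable borel"
    unfolding F_def using Lip_loc_continuous_on[OF f \<open>open \<Omega>\<close>] Om
    by (intro borel_measurable_continuous_on_if) auto
  define g where "g x = (if x \<in> \<Omega> then (\<Sum>b\<in>Basis. lim (\<lambda>n. (F (x + (1 / real (Suc n)) *\<^sub>R b) - F x) * real (Suc n)) *\<^sub>R b) else 0)" for x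
  have [measurable]: "g \<in> borel_measurable borel" unfolding g_def by measurable
  have eq: "g x = grad f x" if "x \<in> \<Omega>" "GDERIV f x :> D" for x D
  proof -
    have D: "GDERIV F x :> D" using that \<open>open \<Omega>\<close> by (intro GDERIV_cong_open[OF that(2), of \<Omega>]) (auto simp: F_def)
    have "lim (\<lambda>n. (F (x + (1 / real (Suc n)) *\<^sub>R b) - F x) * real (Suc n)) = b \<bullet> D" for b
      by (intro limI rdir_deriv_LIMSEQ(1) GDERIV_directional D)
    then have "g x = D" using that(1) by (simp add: g_def euclidean_representation inner_commute[of _ D])
    then show ?thesis using grad_eqI[OF that(2)] by simp
  qed
  have "AE x in lebesgue. g x = indicator \<Omega> x *\<^sub>R grad f x"
    using Lip_loc_differentiable_AE[OF f \<open>open \<Omega>\<close>]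
  proof eventually_elim
    case (elim x)
    then show ?case using eq[of x] by (cases "x \<in> \<Omega>") (auto simp: g_def)
  qed
  moreover have "g \<in> borel_measurable lebesgue" by (intro measurable_completion) simp
  ultimately have "(\<lambda>x. indicator \<Omega> x *\<^sub>R grad f x) \<in> borel_measurable lebesgue"
    by (rule borel_measurable_lebesgue_cong_AE[rotated])
  then show ?thesis using Om by (subst borel_measurable_restrict_space_iff) auto
qed

section \<open>Square roots of matrices\<close>

text \<open>\<open>e\<close> maximises the Rayleigh quotient on the unit sphere of \<open>S\<close>.
  Moving from \<open>e\<close> along the residual \<open>r = f e - l e\<close> produces a
  first-order gain \<open>2 t (r \<bullet> r)\<close>, which maximality bounds by a term of second
  order in \<open>t\<close>; hence \<open>r = 0\<close>.\<close>

lemma selfadjoint_eigenvector: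
  fixes f :: "'a::euclidean_space \<Rightarrow> 'a"
  assumes lin: "linear f" and sa: "\<And>x y. f x \<bullet> y = x \<bullet> f y"
    and S: "subspace S" "S \<noteq> {0}" "\<And>x. x \<in> S \<Longrightarrow> f x \<in> S"
  obtains e l where "e \<in> S" "norm e = 1" "f e = l *\<^sub>R e"
proof -
  have "0 \<in> S" using S(1) by (rule subspace_0)
  then obtain s where s: "s \<in> S" "s \<noteq> 0" using S(2) by auto
  let ?K = "S \<inter> sphere 0 1"
  have cpt: "compact ?K" using closed_subspace[OF S(1)] by (intro closed_Int_compact) auto
  have "(1 / norm s) *\<^sub>R s \<in> ?K" using s S(1) by (auto intro: subspace_scale)
  then have ne: "?K \<noteq> {}" by auto
  have bl: "bounded_linear f" using lin by (simp add: linear_conv_bounded_linear)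
  have "continuous_on ?K (\<lambda>x. f x \<bullet> x)"
    by (intro continuous_intros linear_continuous_on bl)
  then obtain e where e: "e \<in> ?K" "\<And>y. y \<in> ?K \<Longrightarrow> f y \<bullet> y \<le> f e \<bullet> e"
    using continuous_attains_sup[OF cpt ne] by blast
  define l where "l = f e \<bullet> e"
  have eS: "e \<in> S" "norm e = 1" using e(1) by auto
  have le: "f y \<bullet> y \<le> l * (y \<bullet> y)" if "y \<in> S" for y
  proof (cases "y = 0")
    case False
    let ?z = "(1 / norm y) *\<^sub>R y"
    have "?z \<in> ?K" using that False S(1) by (auto intro: subspace_scale)
    then have "f ?z \<bullet> ?z \<le> l" unfolding l_def by (rule e(2))
    moreover have "f ?z \<bullet> ?z = (f y \<bullet> y) / (y \<bullet> y)"
      using False by (simp add: linear_scale[OF lin] dot_square_norm power2_eq_square)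
    ultimately have "(f y \<bullet> y) / (y \<bullet> y) \<le> l" by linarith
    then show ?thesis using False by (simp add: divide_le_eq)
  qed (simp add: linear_0[OF lin])
  define r where "r = f e - l *\<^sub>R e"
  have rS: "r \<in> S" unfolding r_def using eS S by (intro subspace_diff subspace_scale) auto
  have "r = 0"
  proof (rule ccontr)
    assume "r \<noteq> 0"
    have er: "f r \<bullet> e = r \<bullet> r + l * (e \<bullet> r)"
    proof -
      have "f r \<bullet> e = r \<bullet> f e" by (rule sa)
      also have "f e = r + l *\<^sub>R e" by (simp add: r_def)
      finally show ?thesis by (simp add: inner_add_right inner_commute)
    qed
    have fer: "f e \<bullet> r = r \<bullet> r + l * (e \<bullet> r)" using er sa[of e r] by (simp add: inner_commute)
    have ineq: "2 * t * (r \<bullet> r) \<le> t\<^sup>2 * (l * (r \<bullet> r) - f r \<bullet> r)" for t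
    proof -
      have "e + t *\<^sub>R r \<in> S" using eS rS S(1) by (intro subspace_add subspace_scale) auto
      from le[OF this] have "f (e + t *\<^sub>R r) \<bullet> (e + t *\<^sub>R r) \<le> l * ((e + t *\<^sub>R r) \<bullet> (e + t *\<^sub>R r))" .
      then have "f e \<bullet> e + t * (f e \<bullet> r) + t * (f r \<bullet> e) + t * t * (f r \<bullet> r) \<le> l * (e \<bullet> e + 2 * t * (e \<bullet> r) + t * t * (r \<bullet> r))"
        by (simp add: linear_add[OF lin] linear_scale[OF lin] inner_add_left inner_add_right inner_commute[of r e] algebra_simps)
      moreover have "e \<bullet> e = 1" using eS by (simp add: dot_square_norm)
      ultimately show ?thesis by (simp add: er fer l_def[symmetric] power2_eq_square algebra_simps)
    qed
    \<comment> \<open>\<open>A\<close> is a positive bound of the second-order coefficient, and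
      \<open>t = (r \<bullet> r) / A\<close> turns the inequality into
      \<open>2 (r \<bullet> r) \<le> r \<bullet> r\<close>.\<close>
    define A where "A = \<bar>l * (r \<bullet> r) - f r \<bullet> r\<bar> + 1"
    define t where "t = (r \<bullet> r) / A"
    have rr: "r \<bullet> r > 0" using \<open>r \<noteq> 0\<close> by simp
    have "A > 0" by (simp add: A_def)
    have "t > 0" using rr \<open>A > 0\<close> by (simp add: t_def)
    have "2 * t * (r \<bullet> r) \<le> t\<^sup>2 * A" using ineq[of t] by (rule order_trans) (intro mult_left_mono, auto simp: A_def)
    then have "2 * (r \<bullet> r) \<le> t * A" using \<open>t > 0\<close> by (simp add: power2_eq_square)
    then show False using rr \<open>A > 0\<close> by (simp add: t_def)
  qed
  then have "f e = l *\<^sub>R e" by (simp add: r_def)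
  with eS show ?thesis using that by blast
qed

text \<open>The spectral theorem as an induction on \<open>dim S\<close>: split off a unit
  eigenvector \<open>e\<close>, take the root \<open>g\<close> on the orthogonal complement of
  \<open>e\<close> in \<open>S\<close>, and add \<open>sqrt l\<close> times the projection onto
  \<open>e\<close>. The clause that the root vanishes on vectors orthogonal to the subspace gives
  \<open>g e = 0\<close>, so \<open>h (h x)\<close> contains no mixed terms.\<close>

lemma selfadjoint_nonneg_sqrt:
  fixes f :: "'a::euclidean_space \<Rightarrow> 'a"
  assumes lin: "linear f" and sa: "\<And>x y. f x \<bullet> y = x \<bullet> f y" and nn: "\<And>x. 0 \<le> f x \<bullet> x"
    and S: "subspace S" "\<And>x. x \<in> S \<Longrightarrow> f x \<in> S"
  shows "\<exists>g. linear g \<and> (\<forall>x y. g x \<bullet> y = x \<bullet> g y) \<and> (\<forall>x. 0 \<le> g x \<bullet> x) \<and> (\<forall>x\<in>S. g (g x) = f x) \<and>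
             (\<forall>x. (\<forall>y\<in>S. x \<bullet> y = 0) \<longrightarrow> g x = 0)"
  using S
proof (induction "dim S" arbitrary: S rule: less_induct)
  case less
  show ?case
  proof (cases "S = {0}")
    case True
    then show ?thesis by (intro exI[of _ "\<lambda>_. 0"]) (auto simp: linear_0[OF lin] linear_iff)
  next
    case False
    obtain e l where e: "e \<in> S" "norm e = 1" "f e = l *\<^sub>R e"
      using selfadjoint_eigenvector[OF lin sa less.prems(1) False less.prems(2)] by blast
    have ee: "e \<bullet> e = 1" using e(2) by (simp add: dot_square_norm)
    have "l \<ge> 0" using nn[of e] e(3) ee by simp
    define T where "T = {x\<in>S. x \<bullet> e = 0}"
    have T: "subspace T" using less.prems(1)
      by (auto simp: T_def subspace_def inner_add_left)
    have fT: "f x \<in> T" if "x \<in> T" for x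
      using that less.prems(2) sa[of x e] e(3) by (auto simp: T_def)
    have "e \<notin> T" using ee by (auto simp: T_def)
    moreover have "T \<subseteq> S" by (auto simp: T_def)
    ultimately have "T \<subset> S" using e(1) by blast
    then have "dim T < dim S"
      using dim_psubset[of T S] span_eq_iff T less.prems(1) by metis
    then obtain g where g: "linear g" "\<And>x y. g x \<bullet> y = x \<bullet> g y" "\<And>x. 0 \<le> g x \<bullet> x"
        "\<And>x. x \<in> T \<Longrightarrow> g (g x) = f x" "\<And>x. (\<forall>y\<in>T. x \<bullet> y = 0) \<Longrightarrow> g x = 0"
      using less.hyps[OF _ T fT] by blast
    define h where "h x = g x + (sqrt l * (x \<bullet> e)) *\<^sub>R e" for x
    have ge: "g e = 0" by (rule g(5)) (auto simp: T_def inner_commute)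
    have ge': "g x \<bullet> e = 0" for x using g(2)[of x e] ge by simp
    have hh: "h (h x) = g (g x) + (l * (x \<bullet> e)) *\<^sub>R e" for x
      using \<open>l \<ge> 0\<close>
      by (simp add: h_def linear_add[OF g(1)] linear_scale[OF g(1)] ge ge' inner_add_left ee)
    show ?thesis
    proof (intro exI[of _ h] conjI allI ballI impI)
      show "linear h" unfolding h_def
        by (intro linearI) (simp_all add: linear_add[OF g(1)] linear_scale[OF g(1)] inner_add_left algebra_simps)
      fix x y
      show "h x \<bullet> y = x \<bullet> h y" using g(2)[of x y] by (simp add: h_def inner_add_left inner_add_right inner_commute)
      show "0 \<le> h x \<bullet> x" using g(3)[of x] \<open>l \<ge> 0\<close>
        by (simp add: h_def inner_add_left inner_commute[of e] mult.assoc)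
    next
      fix x assume x: "x \<in> S"
      define y where "y = x - (x \<bullet> e) *\<^sub>R e"
      have y: "y \<in> T" using x e(1) less.prems(1) ee
        by (auto simp: y_def T_def inner_diff_left intro!: subspace_diff subspace_scale)
      have xy: "x = y + (x \<bullet> e) *\<^sub>R e" by (simp add: y_def)
      have "g (g x) = g (g y)"
        by (subst xy) (simp add: linear_add[OF g(1)] linear_scale[OF g(1)] ge)
      then have "h (h x) = f y + (l * (x \<bullet> e)) *\<^sub>R e" using g(4)[OF y] hh by simp
      also have "\<dots> = f x"
        by (subst (2) xy) (simp add: linear_add[OF lin] linear_scale[OF lin] e(3) mult.commute)
      finally show "h (h x) = f x" .
    next
      fix x assume x: "\<forall>y\<in>S. x \<bullet> y = 0"
      then have "g x = 0" by (intro g(5)) (auto simp: T_def)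
      then show "h x = 0" using x e(1) by (simp add: h_def)
    qed
  qed
qed

lemma sym_nonneg_symmetric:
  fixes A :: "real^'n^'n"
  assumes "sym_nonneg A"
  shows "(A *v x) \<bullet> y = x \<bullet> (A *v y)"
proof -
  have "A *v x = x v* A" using assms transpose_matrix_vector[of A x] by (simp add: sym_nonneg_def)
  then show ?thesis by (simp add: dot_lmul_matrix)
qed

text \<open>Shows that the choice in \<open>mat_sqrt\<close> is never made from an empty set, so
  \<open>mat_sqrt\<close> is a genuine root on symmetric non-negative matrices.\<close>

lemma sym_nonneg_mat_sqrt:
  fixes A :: "real^'n^'n"
  assumes "sym_nonneg A"
  shows "sym_nonneg (mat_sqrt A) \<and> mat_sqrt A ** mat_sqrt A = A"
proof -
  have tr: "(A *v x) \<bullet> y = x \<bullet> (A *v y)" for x y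
    using assms by (rule sym_nonneg_symmetric)
  have nn: "0 \<le> (A *v x) \<bullet> x" for x using assms by (simp add: sym_nonneg_def)
  obtain g where g: "linear g" "\<And>x y. g x \<bullet> y = x \<bullet> g y" "\<And>x. 0 \<le> g x \<bullet> x" "\<And>x. g (g x) = A *v x"
    using selfadjoint_nonneg_sqrt[OF matrix_vector_mul_linear[of A] tr nn, of UNIV] by auto
  have B: "matrix g *v x = g x" for x using g(1) by (simp add: matrix_works linear_matrix_vector_mul_eq)
  have "transpose (matrix g) = matrix g"
  proof (rule matrix_eq[THEN iffD2], rule allI)
    fix x
    have "(transpose (matrix g) *v x) \<bullet> y = (matrix g *v x) \<bullet> y" for y
      using dot_lmul_matrix[of x "matrix g" y] g(2)[of x y]
      by (simp add: B transpose_matrix_vector)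
    then have "\<forall>y. (transpose (matrix g) *v x) \<bullet> y = (matrix g *v x) \<bullet> y" by (rule allI)
    then show "transpose (matrix g) *v x = matrix g *v x" by (simp only: vector_eq_rdot)
  qed
  moreover have "matrix g ** matrix g = A"
    by (rule matrix_eq[THEN iffD2]) (simp add: B g(4) flip: matrix_vector_mul_assoc)
  ultimately have "sym_nonneg (matrix g) \<and> matrix g ** matrix g = A"
    using g(3) by (simp add: sym_nonneg_def B)
  then show ?thesis unfolding mat_sqrt_def by (rule someI)
qed

text \<open>This identity removes \<open>mat_sqrt\<close> from integrands:
  \<open>\<xi> \<bullet> (A *v \<xi>)\<close> is polynomial in the entries of \<open>A\<close>, so
  measurability in \<open>x\<close> comes from that of \<open>Q\<close> itself.\<close>

lemma norm_mat_sqrt: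
  fixes A :: "real^'n^'n"
  assumes "sym_nonneg A"
  shows "(norm (mat_sqrt A *v \<xi>))\<^sup>2 = \<xi> \<bullet> (A *v \<xi>)"
proof -
  have "(norm (mat_sqrt A *v \<xi>))\<^sup>2 = (mat_sqrt A *v \<xi>) \<bullet> (mat_sqrt A *v \<xi>)"
    by (simp add: dot_square_norm)
  also have "\<dots> = \<xi> \<bullet> (mat_sqrt A *v (mat_sqrt A *v \<xi>))"
    using sym_nonneg_mat_sqrt[OF assms] by (intro sym_nonneg_symmetric) simp
  finally show ?thesis using sym_nonneg_mat_sqrt[OF assms] by (simp add: matrix_vector_mul_assoc)
qed

section \<open>Calculus of Lipschitz functions\<close>

lemma lipschitz_imp_Lip_loc: "L-lipschitz_on UNIV f \<Longrightarrow> f \<in> Lip_loc \<Omega>"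
  unfolding Lip_loc_def using zero_less_one by (blast intro: lipschitz_on_subset)

lemma Lip0_imp_Lip_loc: "f \<in> Lip0 \<Omega> \<Longrightarrow> f \<in> Lip_loc \<Omega>"
proof -
  assume "f \<in> Lip0 \<Omega>"
  then obtain L where "L-lipschitz_on \<Omega> f" by (auto simp: Lip0_def)
  then have "L-lipschitz_on (cball x 1 \<inter> \<Omega>) f" for x by (rule lipschitz_on_subset) auto
  then show ?thesis unfolding Lip_loc_def using zero_less_one by blast
qed

lemma Lip_loc_compose:
  assumes "M-lipschitz_on UNIV \<psi>" "f \<in> Lip_loc \<Omega>"
  shows "(\<lambda>x. \<psi> (f x)) \<in> Lip_loc \<Omega>"
  unfolding Lip_loc_def
proof (intro CollectI ballI)
  fix x assume "x \<in> \<Omega>"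
  then obtain e L where e: "e > 0" "L-lipschitz_on (cball x e \<inter> \<Omega>) f" using assms(2) by (auto simp: Lip_loc_def)
  have "M-lipschitz_on (f ` (cball x e \<inter> \<Omega>)) \<psi>" by (rule lipschitz_on_subset[OF assms(1)]) simp
  from lipschitz_on_compose2[OF e(2) this]
  show "\<exists>e>0. \<exists>L. L-lipschitz_on (cball x e \<inter> \<Omega>) (\<lambda>x. \<psi> (f x))" using e(1) by blast
qed

lemma lipschitz_on_mult_real:
  fixes f g :: "'a::metric_space \<Rightarrow> real"
  assumes f: "L-lipschitz_on S f" "\<And>x. x \<in> S \<Longrightarrow> \<bar>f x\<bar> \<le> A"
    and g: "M-lipschitz_on S g" "\<And>x. x \<in> S \<Longrightarrow> \<bar>g x\<bar> \<le> B"
    and "0 \<le> A" "0 \<le> B"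
  shows "(A * M + B * L)-lipschitz_on S (\<lambda>x. f x * g x)"
proof (rule lipschitz_onI)
  fix x y assume xy: "x \<in> S" "y \<in> S"
  have "f x * g x - f y * g y = f x * (g x - g y) + g y * (f x - f y)" by (simp add: algebra_simps)
  then have "\<bar>f x * g x - f y * g y\<bar> \<le> \<bar>f x\<bar> * \<bar>g x - g y\<bar> + \<bar>g y\<bar> * \<bar>f x - f y\<bar>"
    by (metis abs_mult abs_triangle_ineq)
  also have "\<dots> \<le> A * (M * dist x y) + B * (L * dist x y)"
    using lipschitz_onD[OF f(1) xy] lipschitz_onD[OF g(1) xy] f(2) g(2) xy assms(5,6)
    by (intro add_mono mult_mono) (auto simp: dist_real_def)
  finally show "dist (f x * g x) (f y * g y) \<le> (A * M + B * L) * dist x y"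
    by (simp add: dist_real_def algebra_simps)
qed (use assms lipschitz_on_nonneg[OF f(1)] lipschitz_on_nonneg[OF g(1)] in auto)

lemma Lip_loc_mult:
  assumes f: "f \<in> Lip_loc \<Omega>" and g: "g \<in> Lip_loc \<Omega>"
  shows "(\<lambda>x. f x * g x) \<in> Lip_loc \<Omega>"
  unfolding Lip_loc_def
proof (intro CollectI ballI)
  fix x assume x: "x \<in> \<Omega>"
  obtain e1 L where e1: "e1 > 0" "L-lipschitz_on (cball x e1 \<inter> \<Omega>) f" using f x by (auto simp: Lip_loc_def)
  obtain e2 M where e2: "e2 > 0" "M-lipschitz_on (cball x e2 \<inter> \<Omega>) g" using g x by (auto simp: Lip_loc_def)
  define e where "e = min e1 e2"
  have e: "e > 0" "L-lipschitz_on (cball x e \<inter> \<Omega>) f" "M-lipschitz_on (cball x e \<inter> \<Omega>) g"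
    using e1 e2 by (auto simp: e_def intro: lipschitz_on_subset)
  have bd: "\<bar>h y\<bar> \<le> \<bar>h x\<bar> + K * e" if "K-lipschitz_on (cball x e \<inter> \<Omega>) h" "y \<in> cball x e \<inter> \<Omega>" for h K y
  proof -
    have "\<bar>h y - h x\<bar> \<le> K * dist y x"
      using lipschitz_onD[OF that(1,2), of x] x e(1) by (simp add: dist_real_def)
    also have "\<dots> \<le> K * e" using that lipschitz_on_nonneg[OF that(1)]
      by (intro mult_left_mono) (auto simp: dist_commute)
    finally show ?thesis by linarith
  qed
  have "((\<bar>f x\<bar> + L * e) * M + (\<bar>g x\<bar> + M * e) * L)-lipschitz_on (cball x e \<inter> \<Omega>) (\<lambda>x. f x * g x)"
    using e lipschitz_on_nonneg[OF e(2)] lipschitz_on_nonneg[OF e(3)]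
    by (intro lipschitz_on_mult_real bd) auto
  then show "\<exists>e>0. \<exists>L. L-lipschitz_on (cball x e \<inter> \<Omega>) (\<lambda>x. f x * g x)" using e(1) by blast
qed

text \<open>\<open>Lip0\<close> asks for one Lipschitz constant on a set that need not be convex.
  Extended by zero, the function is locally Lipschitz on the whole space, because it vanishes near
  every point outside \<open>K\<close>, and local constants become a global one on the compact
  closure of \<open>\<Omega>\<close>.\<close>

lemma Lip_loc_compact_support_imp_Lip0:
  assumes f: "f \<in> Lip_loc \<Omega>" and "open \<Omega>" "bounded \<Omega>"
    and K: "compact K" "K \<subseteq> \<Omega>" "\<And>x. x \<in> \<Omega> \<Longrightarrow> x \<notin> K \<Longrightarrow> f x = 0"
  shows "f \<in> Lip0 \<Omega>"
proof -
  define g where "g x = (if x \<in> \<Omega> then f x else 0)" for x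
  have g0: "g x = 0" if "x \<notin> K" for x using K(3) that by (auto simp: g_def)
  \<comment> \<open>\<open>local_lipschitz\<close> speaks of time-dependent maps; the time set is
    the single point \<open>0\<close>.\<close>
  have "local_lipschitz {0::real} UNIV (\<lambda>_. g)"
    unfolding local_lipschitz_def
  proof (intro ballI)
    fix x and t :: real
    have "\<exists>u>0. \<exists>L. L-lipschitz_on (cball x u) g"
    proof (cases "x \<in> \<Omega>")
      case True
      obtain e L where e: "e > 0" "cball x e \<subseteq> \<Omega>" "L-lipschitz_on (cball x e) f"
        by (rule Lip_loc_ballE[OF f \<open>open \<Omega>\<close> True])
      have "L-lipschitz_on (cball x e) g"
        by (rule lipschitz_on_transform[OF e(3)]) (use e(2) in \<open>auto simp: g_def\<close>)
      then show ?thesis using e(1) by blast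
    next
      case False
      then have "x \<in> - K" "open (- K)" using K by (auto simp: compact_imp_closed)
      then obtain e where e: "e > 0" "cball x e \<subseteq> - K" by (meson open_contains_cball)
      have "0-lipschitz_on (cball x e) g"
        by (rule lipschitz_onI) (use e(2) g0 in \<open>auto simp: subset_iff\<close>)
      then show ?thesis using e(1) by blast
    qed
    then show "\<exists>u>0. \<exists>L. \<forall>t\<in>cball t u \<inter> {0}. L-lipschitz_on (cball x u \<inter> UNIV) g" by auto
  qed
  then have ll: "local_lipschitz {0::real} (closure \<Omega>) (\<lambda>_::real. g)" by (rule local_lipschitz_subset) auto
  obtain L where "L-lipschitz_on (closure \<Omega>) g"
  proof (rule local_lipschitz_compact_implies_lipschitz[OF ll])
    show "compact (closure \<Omega>)" using \<open>bounded \<Omega>\<close> by (simp add: compact_closure)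
    fix L :: real assume "\<And>t. t \<in> {0::real} \<Longrightarrow> L-lipschitz_on (closure \<Omega>) g"
    then show thesis by (intro that) simp
  qed simp_all
  then have "L-lipschitz_on \<Omega> g" by (rule lipschitz_on_subset) (rule closure_subset)
  then have 1: "L-lipschitz_on \<Omega> f" by (rule lipschitz_on_transform) (simp only: g_def if_True)
  have 2: "closure {x\<in>\<Omega>. f x \<noteq> 0} \<subseteq> K"
  proof (rule closure_minimal)
    show "{x\<in>\<Omega>. f x \<noteq> 0} \<subseteq> K" using K(3) by blast
    show "closed K" using K(1) by (rule compact_imp_closed)
  qed
  have 3: "compact (closure {x\<in>\<Omega>. f x \<noteq> 0})"
    using compact_Int_closed[OF K(1) closed_closure, of "{x\<in>\<Omega>. f x \<noteq> 0}"] 2 by (simp only: inf.absorb2)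
  show ?thesis unfolding Lip0_def mem_Collect_eq
    by (intro conjI exI[of _ L] 1 3 order_trans[OF 2 K(2)])
qed

lemma Lip0_mult:
  assumes f: "f \<in> Lip0 \<Omega>" and g: "g \<in> Lip_loc \<Omega>" and "open \<Omega>" "bounded \<Omega>"
  shows "(\<lambda>x. f x * g x) \<in> Lip0 \<Omega>"
proof (rule Lip_loc_compact_support_imp_Lip0[where K = "closure {x\<in>\<Omega>. f x \<noteq> 0}"])
  show "f x * g x = 0" if "x \<in> \<Omega>" "x \<notin> closure {x\<in>\<Omega>. f x \<noteq> 0}" for x
    using that closure_subset[of "{x\<in>\<Omega>. f x \<noteq> 0}"] by auto
  show "(\<lambda>x. f x * g x) \<in> Lip_loc \<Omega>" using Lip0_imp_Lip_loc[OF f] g by (rule Lip_loc_mult)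
  show "compact (closure {x\<in>\<Omega>. f x \<noteq> 0})" "closure {x\<in>\<Omega>. f x \<noteq> 0} \<subseteq> \<Omega>"
    using f unfolding Lip0_def by blast+
qed fact+

lemma Lip0_compose:
  assumes f: "f \<in> Lip0 \<Omega>" and \<psi>: "M-lipschitz_on UNIV \<psi>" "\<psi> 0 = 0" and "open \<Omega>" "bounded \<Omega>"
  shows "(\<lambda>x. \<psi> (f x)) \<in> Lip0 \<Omega>"
proof (rule Lip_loc_compact_support_imp_Lip0[where K = "closure {x\<in>\<Omega>. f x \<noteq> 0}"])
  show "\<psi> (f x) = 0" if "x \<in> \<Omega>" "x \<notin> closure {x\<in>\<Omega>. f x \<noteq> 0}" for x
    using that closure_subset[of "{x\<in>\<Omega>. f x \<noteq> 0}"] \<psi>(2) by auto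
  show "(\<lambda>x. \<psi> (f x)) \<in> Lip_loc \<Omega>" by (rule Lip_loc_compose[OF \<psi>(1) Lip0_imp_Lip_loc[OF f]])
  show "compact (closure {x\<in>\<Omega>. f x \<noteq> 0})" "closure {x\<in>\<Omega>. f x \<noteq> 0} \<subseteq> \<Omega>"
    using f unfolding Lip0_def by blast+
qed fact+

lemma Lip0_bounded:
  assumes f: "f \<in> Lip0 \<Omega>" and "open \<Omega>"
  obtains B where "0 < B" "\<And>x. x \<in> \<Omega> \<Longrightarrow> \<bar>f x\<bar> \<le> B"
proof -
  let ?K = "closure {x\<in>\<Omega>. f x \<noteq> 0}"
  have "continuous_on ?K f"
    using Lip_loc_continuous_on[OF Lip0_imp_Lip_loc[OF f] \<open>open \<Omega>\<close>] f
    by (auto simp: Lip0_def intro: continuous_on_subset)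
  then have "bounded (f ` ?K)" using f by (intro compact_imp_bounded compact_continuous_image) (auto simp: Lip0_def)
  then obtain B where B: "B > 0" "\<And>x. x \<in> ?K \<Longrightarrow> \<bar>f x\<bar> \<le> B" by (auto simp: bounded_pos)
  have "\<bar>f x\<bar> \<le> B" if "x \<in> \<Omega>" for x
    using B that closure_subset[of "{x\<in>\<Omega>. f x \<noteq> 0}"] by (cases "f x = 0") auto
  with B(1) show ?thesis by (rule that)
qed

text \<open>The derivative in the direction of the gradient \<open>D\<close> itself is
  \<open>D \<bullet> D\<close>, while the Lipschitz condition bounds it by
  \<open>L * norm D\<close>. Where no gradient exists the default \<open>0\<close> satisfies the
  bound.\<close>

lemma Lip0_grad_bounded:
  assumes f: "f \<in> Lip0 \<Omega>" and "open \<Omega>"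
  obtains L where "0 \<le> L" "\<And>x. x \<in> \<Omega> \<Longrightarrow> norm (grad f x) \<le> L"
proof -
  obtain L where L: "L-lipschitz_on \<Omega> f" using f by (auto simp: Lip0_def)
  have "L \<ge> 0" using L by (rule lipschitz_on_nonneg)
  have "norm (grad f x) \<le> L" if x: "x \<in> \<Omega>" for x
  proof (cases "\<exists>D. GDERIV f x :> D")
    case True
    then obtain D where D: "GDERIV f x :> D" by blast
    have "D \<bullet> D \<le> L * norm D"
    proof (rule tendsto_upperbound[OF GDERIV_directional[OF D, of D]])
      obtain e where e: "e > 0" "ball x e \<subseteq> \<Omega>" using \<open>open \<Omega>\<close> x by (meson openE)
      have "\<forall>\<^sub>F h in at_right 0. h < e / (norm D + 1)"
        using e(1) by (intro order_tendstoD(2)[OF tendsto_ident_at]) (simp add: add_nonneg_pos)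
      with eventually_at_right_less[of "0::real"]
      show "\<forall>\<^sub>F h in at_right 0. (f (x + h *\<^sub>R D) - f x) / h \<le> L * norm D"
      proof eventually_elim
        case (elim h)
        have "h * norm D \<le> h * (norm D + 1)" using elim by (intro mult_left_mono) auto
        also have "\<dots> < e" using elim by (simp add: pos_less_divide_eq add_nonneg_pos)
        finally have "x + h *\<^sub>R D \<in> \<Omega>" using elim e(2) by (auto simp: subset_iff dist_norm)
        then have "f (x + h *\<^sub>R D) - f x \<le> L * (h * norm D)"
          using lipschitz_onD[OF L, of "x + h *\<^sub>R D" x] x elim by (simp add: dist_norm)
        then show ?case using elim by (simp add: divide_le_eq algebra_simps)
      qed
    qed simp
    then have "norm D * norm D \<le> L * norm D" by (simp add: dot_square_norm power2_eq_square)
    then have "norm D \<le> L" using \<open>L \<ge> 0\<close> by (cases "D = 0") auto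
    then show ?thesis using grad_eqI[OF D] by simp
  qed (use \<open>L \<ge> 0\<close> in \<open>simp add: grad_def\<close>)
  with \<open>L \<ge> 0\<close> show ?thesis by (rule that)
qed

lemma grad_mult_AE:
  assumes f: "f \<in> Lip_loc \<Omega>" and g: "g \<in> Lip_loc \<Omega>" and "open \<Omega>"
  shows "AE x in lebesgue. x \<in> \<Omega> \<longrightarrow> grad (\<lambda>x. f x * g x) x = f x *\<^sub>R grad g x + g x *\<^sub>R grad f x"
  using Lip_loc_differentiable_AE[OF f \<open>open \<Omega>\<close>] Lip_loc_differentiable_AE[OF g \<open>open \<Omega>\<close>]
proof eventually_elim
  case (elim x)
  show ?case
  proof
    assume "x \<in> \<Omega>"
    then obtain D E where D: "GDERIV f x :> D" and E: "GDERIV g x :> E" using elim by blast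
    have "GDERIV (\<lambda>x. f x * g x) x :> f x *\<^sub>R E + g x *\<^sub>R D" using D E by (rule GDERIV_mult)
    then show "grad (\<lambda>x. f x * g x) x = f x *\<^sub>R grad g x + g x *\<^sub>R grad f x"
      using grad_eqI D E by metis
  qed
qed

text \<open>Differentiability of \<open>\<psi>\<close> at every point is demanded because
  \<open>f\<close> may stay at a single level on a set of positive measure. All truncations below
  are \<open>C\<^sup>1\<close> for this reason.\<close>

lemma grad_compose_AE:
  assumes f: "f \<in> Lip_loc \<Omega>" and \<psi>: "\<And>s. (\<psi> has_real_derivative \<rho> s) (at s)" and "open \<Omega>"
  shows "AE x in lebesgue. x \<in> \<Omega> \<longrightarrow> grad (\<lambda>x. \<psi> (f x)) x = \<rho> (f x) *\<^sub>R grad f x"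
  using Lip_loc_differentiable_AE[OF f \<open>open \<Omega>\<close>]
proof eventually_elim
  case (elim x)
  show ?case
  proof
    assume "x \<in> \<Omega>"
    then obtain D where D: "GDERIV f x :> D" using elim by blast
    have "GDERIV (\<lambda>x. \<psi> (f x)) x :> \<rho> (f x) *\<^sub>R D" using D \<psi> by (rule GDERIV_DERIV_compose)
    then show "grad (\<lambda>x. \<psi> (f x)) x = \<rho> (f x) *\<^sub>R grad f x" using grad_eqI D by metis
  qed
qed

lemma lipschitz_if_derivative_bounded:
  assumes "\<And>s. (\<psi> has_real_derivative \<rho> s) (at s)" "\<And>s. \<bar>\<rho> s\<bar> \<le> M"
  shows "M-lipschitz_on UNIV (\<psi> :: real \<Rightarrow> real)"
proof (rule bounded_derivative_imp_lipschitz)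
  show "(\<psi> has_derivative (\<lambda>h. h * \<rho> s)) (at s within UNIV)" for s
    using assms(1)[of s] by (simp add: has_field_derivative_def mult_commute_abs)
  show "onorm (\<lambda>h. h * \<rho> s) \<le> M" for s
  proof (rule onorm_bound)
    show "0 \<le> M" using assms(2)[of 0] by linarith
    show "norm (h * \<rho> s) \<le> M * norm h" for h
      using mult_right_mono[OF assms(2)[of s], of "\<bar>h\<bar>"] by (simp add: abs_mult mult.commute)
  qed
  show "0 \<le> M" using assms(2)[of 0] by linarith
qed auto

section \<open>Null sequences in mean square\<close>

lemma integrable_mult_L2:
  fixes f g :: "'a \<Rightarrow> real"
  assumes [measurable]: "f \<in> borel_measurable M" "g \<in> borel_measurable M"
    and f: "integrable M (\<lambda>x. (f x)\<^sup>2)" and g: "integrable M (\<lambda>x. (g x)\<^sup>2)"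
  shows "integrable M (\<lambda>x. f x * g x)"
proof (rule Bochner_Integration.integrable_bound[OF Bochner_Integration.integrable_add[OF f g]])
  have "\<bar>a * b\<bar> \<le> a\<^sup>2 + b\<^sup>2" for a b :: real
  proof -
    have "2 * \<bar>a * b\<bar> \<le> a\<^sup>2 + b\<^sup>2"
      using sum_squares_bound[of "\<bar>a\<bar>" "\<bar>b\<bar>"] by (simp add: abs_mult mult.assoc)
    then show ?thesis using abs_ge_zero[of "a * b"] by linarith
  qed
  then show "AE x in M. norm (f x * g x) \<le> norm ((f x)\<^sup>2 + (g x)\<^sup>2)" by simp
qed measurable

lemma integrable_square_add:
  fixes f g :: "'a \<Rightarrow> real"
  assumes [measurable]: "f \<in> borel_measurable M" "g \<in> borel_measurable M"
    and f: "integrable M (\<lambda>x. (f x)\<^sup>2)" and g: "integrable M (\<lambda>x. (g x)\<^sup>2)"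
  shows "integrable M (\<lambda>x. (f x + g x)\<^sup>2)"
  unfolding power2_sum using integrable_mult_L2[OF assms] f g by (simp add: mult.assoc)

lemma Cauchy_Schwarz_integral:
  fixes f g :: "'a \<Rightarrow> real"
  assumes [measurable]: "f \<in> borel_measurable M" "g \<in> borel_measurable M"
    and f: "integrable M (\<lambda>x. (f x)\<^sup>2)" and g: "integrable M (\<lambda>x. (g x)\<^sup>2)"
  shows "(\<integral>x. \<bar>f x * g x\<bar> \<partial>M)\<^sup>2 \<le> (\<integral>x. (f x)\<^sup>2 \<partial>M) * (\<integral>x. (g x)\<^sup>2 \<partial>M)"
proof -
  have fg: "integrable M (\<lambda>x. \<bar>f x * g x\<bar>)" using integrable_mult_L2[OF assms] by (rule integrable_abs)
  have "(\<integral>\<^sup>+x. ennreal \<bar>f x\<bar> * ennreal \<bar>g x\<bar> \<partial>M)\<^sup>2 \<le> (\<integral>\<^sup>+x. (ennreal \<bar>f x\<bar>)\<^sup>2 \<partial>M) * (\<integral>\<^sup>+x. (ennreal \<bar>g x\<bar>)\<^sup>2 \<partial>M)"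
    by (rule Cauchy_Schwarz_nn_integral) measurable
  moreover have "(\<integral>\<^sup>+x. ennreal \<bar>f x\<bar> * ennreal \<bar>g x\<bar> \<partial>M) = ennreal (\<integral>x. \<bar>f x * g x\<bar> \<partial>M)"
    using nn_integral_eq_integral[OF fg] by (simp add: abs_mult ennreal_mult)
  moreover have "(\<integral>\<^sup>+x. (ennreal \<bar>f x\<bar>)\<^sup>2 \<partial>M) = ennreal (\<integral>x. (f x)\<^sup>2 \<partial>M)"
    using nn_integral_eq_integral[OF f] by (simp add: ennreal_power)
  moreover have "(\<integral>\<^sup>+x. (ennreal \<bar>g x\<bar>)\<^sup>2 \<partial>M) = ennreal (\<integral>x. (g x)\<^sup>2 \<partial>M)"
    using nn_integral_eq_integral[OF g] by (simp add: ennreal_power)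
  ultimately show ?thesis
    by (simp add: ennreal_power flip: ennreal_mult)
qed

text \<open>Null sequences of scalar functions: applied to \<open>\<phi> k x - u x\<close> this is
  convergence in \<open>L\<^sup>2(v)\<close>, applied to
  \<open>nrm x (grad (\<phi> k) x - g x)\<close> it is convergence in \<open>QL\<^sup>2\<close>. One
  calculus serves both.\<close>

definition L2_null :: "'a measure \<Rightarrow> (nat \<Rightarrow> 'a \<Rightarrow> real) \<Rightarrow> bool" where
  "L2_null M r \<longleftrightarrow> (\<forall>n. r n \<in> borel_measurable M \<and> integrable M (\<lambda>x. (r n x)\<^sup>2)) \<and>
     (\<lambda>n. \<integral>x. (r n x)\<^sup>2 \<partial>M) \<longlonglongrightarrow> 0"

lemma L2_nullD:
  assumes "L2_null M r"
  shows "r n \<in> borel_measurable M" "integrable M (\<lambda>x. (r n x)\<^sup>2)" "(\<lambda>n. \<integral>x. (r n x)\<^sup>2 \<partial>M) \<longlonglongrightarrow> 0"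
  using assms by (auto simp: L2_null_def)

lemma L2_null_bound:
  assumes r: "L2_null M r" and s: "\<And>n. s n \<in> borel_measurable M"
    and le: "\<And>n. AE x in M. \<bar>s n x\<bar> \<le> K * \<bar>r n x\<bar>"
  shows "L2_null M s"
proof -
  note rm[measurable] = L2_nullD(1)[OF r] and sm[measurable] = s
  have le2: "AE x in M. (s n x)\<^sup>2 \<le> K\<^sup>2 * (r n x)\<^sup>2" for n
    using le[of n]
  proof eventually_elim
    case (elim x)
    then have "\<bar>s n x\<bar>\<^sup>2 \<le> (K * \<bar>r n x\<bar>)\<^sup>2" by (intro power_mono) auto
    then show ?case by (simp add: power_mult_distrib)
  qed
  have int: "integrable M (\<lambda>x. K\<^sup>2 * (r n x)\<^sup>2)" for n using L2_nullD(2)[OF r] by simp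
  have si: "integrable M (\<lambda>x. (s n x)\<^sup>2)" for n
    by (rule Bochner_Integration.integrable_bound[OF int[of n]]) (use le2[of n] in \<open>auto elim: eventually_mono\<close>)
  have lim: "(\<lambda>n. K\<^sup>2 * (\<integral>x. (r n x)\<^sup>2 \<partial>M)) \<longlonglongrightarrow> 0"
    using tendsto_mult[OF tendsto_const[of "K\<^sup>2"] L2_nullD(3)[OF r]] by simp
  have "(\<lambda>n. \<integral>x. (s n x)\<^sup>2 \<partial>M) \<longlonglongrightarrow> 0"
  proof (rule tendsto_sandwich[OF _ _ tendsto_const lim])
    show "\<forall>\<^sub>F n in sequentially. 0 \<le> (\<integral>x. (s n x)\<^sup>2 \<partial>M)" by simp
    have "(\<integral>x. (s n x)\<^sup>2 \<partial>M) \<le> (\<integral>x. K\<^sup>2 * (r n x)\<^sup>2 \<partial>M)" for n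
      by (rule integral_mono_AE[OF si int le2])
    then show "\<forall>\<^sub>F n in sequentially. (\<integral>x. (s n x)\<^sup>2 \<partial>M) \<le> K\<^sup>2 * (\<integral>x. (r n x)\<^sup>2 \<partial>M)" by simp
  qed
  then show ?thesis using si s by (simp add: L2_null_def)
qed

lemma L2_null_add:
  assumes r: "L2_null M r" and s: "L2_null M s"
  shows "L2_null M (\<lambda>n x. r n x + s n x)"
proof -
  note [measurable] = L2_nullD(1)[OF r] L2_nullD(1)[OF s]
  have i: "integrable M (\<lambda>x. (r n x + s n x)\<^sup>2)" for n
    by (rule integrable_square_add[OF L2_nullD(1)[OF r] L2_nullD(1)[OF s] L2_nullD(2)[OF r] L2_nullD(2)[OF s]])
  have j: "integrable M (\<lambda>x. 2 * (r n x)\<^sup>2 + 2 * (s n x)\<^sup>2)" for n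
    using L2_nullD(2)[OF r] L2_nullD(2)[OF s] by simp
  have le: "(a + b)\<^sup>2 \<le> 2 * a\<^sup>2 + 2 * b\<^sup>2" for a b :: real
    using sum_squares_bound[of a b] by (simp add: power2_sum)
  have lim: "(\<lambda>n. 2 * (\<integral>x. (r n x)\<^sup>2 \<partial>M) + 2 * (\<integral>x. (s n x)\<^sup>2 \<partial>M)) \<longlonglongrightarrow> 0"
    using tendsto_add[OF tendsto_mult[OF tendsto_const[of 2] L2_nullD(3)[OF r]] tendsto_mult[OF tendsto_const[of 2] L2_nullD(3)[OF s]]]
    by simp
  have "(\<lambda>n. \<integral>x. (r n x + s n x)\<^sup>2 \<partial>M) \<longlonglongrightarrow> 0"
  proof (rule tendsto_sandwich[OF _ _ tendsto_const lim])
    have "(\<integral>x. (r n x + s n x)\<^sup>2 \<partial>M) \<le> (\<integral>x. 2 * (r n x)\<^sup>2 + 2 * (s n x)\<^sup>2 \<partial>M)" for n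
      by (rule integral_mono[OF i j]) (rule le)
    then show "\<forall>\<^sub>F n in sequentially. (\<integral>x. (r n x + s n x)\<^sup>2 \<partial>M) \<le> 2 * (\<integral>x. (r n x)\<^sup>2 \<partial>M) + 2 * (\<integral>x. (s n x)\<^sup>2 \<partial>M)"
      using L2_nullD(2)[OF r] L2_nullD(2)[OF s] by simp
  qed simp
  then show ?thesis using i by (simp add: L2_null_def)
qed

lemma L2_null_subseq:
  assumes "L2_null M r" "strict_mono \<tau>"
  shows "L2_null M (\<lambda>n. r (\<tau> n))"
  using assms LIMSEQ_subseq_LIMSEQ[OF L2_nullD(3)[OF assms(1)] assms(2)] by (simp add: L2_null_def o_def)

lemma L2_null_AE_subseq:
  assumes r: "L2_null M r"
  obtains \<tau> :: "nat \<Rightarrow> nat" where "strict_mono \<tau>" "AE x in M. (\<lambda>n. r (\<tau> n) x) \<longlonglongrightarrow> 0"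
proof -
  have "\<exists>\<tau>::nat \<Rightarrow> nat. strict_mono \<tau> \<and> (AE x in M. (\<lambda>n. (r (\<tau> n) x)\<^sup>2) \<longlonglongrightarrow> 0)"
    by (rule tendsto_L1_AE_subseq) (use L2_nullD[OF r] in auto)
  then obtain \<tau> :: "nat \<Rightarrow> nat" where t: "strict_mono \<tau>" "AE x in M. (\<lambda>n. (r (\<tau> n) x)\<^sup>2) \<longlonglongrightarrow> 0" by blast
  have "AE x in M. (\<lambda>n. r (\<tau> n) x) \<longlonglongrightarrow> 0"
    using t(2)
  proof eventually_elim
    case (elim x)
    from tendsto_real_sqrt[OF this] show ?case by (simp add: tendsto_rabs_zero_iff)
  qed
  with t(1) show ?thesis by (rule that)
qed

lemma L2_null_dominated:
  assumes s: "\<And>n. s n \<in> borel_measurable M" and lim: "AE x in M. (\<lambda>n. s n x) \<longlonglongrightarrow> 0"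
    and w[measurable]: "w \<in> borel_measurable M" and wi: "integrable M (\<lambda>x. (w x)\<^sup>2)"
    and le: "\<And>n. AE x in M. \<bar>s n x\<bar> \<le> w x"
  shows "L2_null M s"
proof -
  note [measurable] = s
  have le2: "AE x in M. norm ((s n x)\<^sup>2) \<le> (w x)\<^sup>2" for n
    using le[of n]
  proof eventually_elim
    case (elim x)
    then have "\<bar>s n x\<bar>\<^sup>2 \<le> (w x)\<^sup>2" by (intro power_mono) auto
    then show ?case by simp
  qed
  have lim2: "AE x in M. (\<lambda>n. (s n x)\<^sup>2) \<longlonglongrightarrow> 0"
    using lim
  proof eventually_elim
    case (elim x)
    from tendsto_power[OF this, of 2] show ?case by simp
  qed
  have "(\<lambda>n. \<integral>x. (s n x)\<^sup>2 \<partial>M) \<longlonglongrightarrow> (\<integral>x. 0 \<partial>M)"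
    by (rule integral_dominated_convergence[OF _ _ wi lim2 le2]) measurable
  moreover have "integrable M (\<lambda>x. (s n x)\<^sup>2)" for n
    by (rule integrable_dominated_convergence2[OF _ _ wi lim2 le2]) measurable
  ultimately show ?thesis by (simp add: L2_null_def)
qed

text \<open>The limit \<open>X\<close> is merely integrable; it is the difference that is split into
  a null sequence and a fixed square integrable factor, to which Cauchy-Schwarz applies.\<close>

lemma L2_null_integral_tendsto:
  fixes X :: "'a \<Rightarrow> real"
  assumes r: "L2_null M r" and w[measurable]: "w \<in> borel_measurable M" and wi: "integrable M (\<lambda>x. (w x)\<^sup>2)"
    and Xn[measurable]: "\<And>n. Xn n \<in> borel_measurable M" and X: "integrable M X"
    and le: "\<And>n. AE x in M. \<bar>Xn n x - X x\<bar> \<le> \<bar>r n x * w x\<bar>"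
  shows "integrable M (Xn n)" "(\<lambda>n. \<integral>x. Xn n x \<partial>M) \<longlonglongrightarrow> (\<integral>x. X x \<partial>M)"
proof -
  note rm[measurable] = L2_nullD(1)[OF r] and [measurable] = borel_measurable_integrable[OF X]
  have rw: "integrable M (\<lambda>x. \<bar>r n x * w x\<bar>)" for n
    by (rule integrable_abs[OF integrable_mult_L2[OF rm w L2_nullD(2)[OF r] wi]])
  have d: "integrable M (\<lambda>x. Xn n x - X x)" for n
    by (rule Bochner_Integration.integrable_bound[OF rw[of n]]) (use le[of n] in \<open>auto elim: eventually_mono\<close>)
  have "integrable M (\<lambda>x. (Xn n x - X x) + X x)" for n using d X by (rule Bochner_Integration.integrable_add)
  then show i: "integrable M (Xn n)" for n by simp
  have bd: "\<bar>(\<integral>x. Xn n x \<partial>M) - (\<integral>x. X x \<partial>M)\<bar> \<le> sqrt ((\<integral>x. (r n x)\<^sup>2 \<partial>M) * (\<integral>x. (w x)\<^sup>2 \<partial>M))" for n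
  proof -
    have "\<bar>(\<integral>x. Xn n x \<partial>M) - (\<integral>x. X x \<partial>M)\<bar> = \<bar>\<integral>x. Xn n x - X x \<partial>M\<bar>" using i X by simp
    also have "\<dots> \<le> (\<integral>x. \<bar>Xn n x - X x\<bar> \<partial>M)" by (rule integral_abs_bound)
    also have "\<dots> \<le> (\<integral>x. \<bar>r n x * w x\<bar> \<partial>M)"
      by (rule integral_mono_AE[OF integrable_abs[OF d] rw le])
    also have "\<dots> \<le> sqrt ((\<integral>x. (r n x)\<^sup>2 \<partial>M) * (\<integral>x. (w x)\<^sup>2 \<partial>M))"
      by (rule real_le_rsqrt) (rule Cauchy_Schwarz_integral[OF rm w L2_nullD(2)[OF r] wi])
    finally show ?thesis .
  qed
  have "(\<lambda>n. sqrt ((\<integral>x. (r n x)\<^sup>2 \<partial>M) * (\<integral>x. (w x)\<^sup>2 \<partial>M))) \<longlonglongrightarrow> 0"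
    using tendsto_real_sqrt[OF tendsto_mult[OF L2_nullD(3)[OF r] tendsto_const[of "\<integral>x. (w x)\<^sup>2 \<partial>M"]]] by simp
  then have "(\<lambda>n. (\<integral>x. Xn n x \<partial>M) - (\<integral>x. X x \<partial>M)) \<longlonglongrightarrow> 0"
    by (rule Lim_null_comparison[rotated]) (use bd in simp)
  then show "(\<lambda>n. \<integral>x. Xn n x \<partial>M) \<longlonglongrightarrow> (\<integral>x. X x \<partial>M)" by (simp add: LIM_zero_iff)
qed

text \<open>Expanding around \<open>w\<close>, the square \<open>e\<^sup>2\<close> consists of the
  square of a null sequence, a term linear in \<open>e - w\<close>, and \<open>w\<^sup>2\<close>; in
  the linear term \<open>w\<close> itself is the fixed square integrable factor.\<close>

lemma L2_null_energy_tendsto: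
  fixes e :: "nat \<Rightarrow> 'a \<Rightarrow> real"
  assumes r: "L2_null M r" and em[measurable]: "\<And>n. e n \<in> borel_measurable M"
    and w[measurable]: "w \<in> borel_measurable M" and wi: "integrable M (\<lambda>x. (w x)\<^sup>2)"
    and le: "\<And>n. AE x in M. \<bar>e n x - w x\<bar> \<le> \<bar>r n x\<bar>"
  shows "integrable M (\<lambda>x. (e n x)\<^sup>2)" "(\<lambda>n. \<integral>x. (e n x)\<^sup>2 \<partial>M) \<longlonglongrightarrow> (\<integral>x. (w x)\<^sup>2 \<partial>M)"
proof -
  have d: "L2_null M (\<lambda>n x. e n x - w x)"
    by (rule L2_null_bound[OF r, where K = 1]) (use le in auto)
  have i: "integrable M (\<lambda>x. (e n x)\<^sup>2)" for n
    using integrable_square_add[OF L2_nullD(1)[OF d] w L2_nullD(2)[OF d] wi, of n] by simp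
  then show "integrable M (\<lambda>x. (e n x)\<^sup>2)" .
  have 1: "(\<lambda>n. \<integral>x. (e n x - w x) * w x + (w x)\<^sup>2 \<partial>M) \<longlonglongrightarrow> (\<integral>x. (w x)\<^sup>2 \<partial>M)"
    by (rule L2_null_integral_tendsto(2)[OF d w wi _ wi]) (auto simp: w)
  have ewi: "integrable M (\<lambda>x. (e n x - w x) * w x)" for n
    by (rule integrable_mult_L2[OF L2_nullD(1)[OF d] w L2_nullD(2)[OF d] wi])
  have "(\<integral>x. (e n x)\<^sup>2 \<partial>M) = (\<integral>x. (e n x - w x)\<^sup>2 \<partial>M) + (2 * (\<integral>x. (e n x - w x) * w x + (w x)\<^sup>2 \<partial>M) - (\<integral>x. (w x)\<^sup>2 \<partial>M))" for n
  proof -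
    have "(e n x)\<^sup>2 = (e n x - w x)\<^sup>2 + (2 * ((e n x - w x) * w x + (w x)\<^sup>2) - (w x)\<^sup>2)" for x
      by (simp add: power2_eq_square algebra_simps)
    then show ?thesis using L2_nullD(2)[OF d, of n] ewi[of n] wi by simp
  qed
  moreover have "(\<lambda>n. (\<integral>x. (e n x - w x)\<^sup>2 \<partial>M) + (2 * (\<integral>x. (e n x - w x) * w x + (w x)\<^sup>2 \<partial>M) - (\<integral>x. (w x)\<^sup>2 \<partial>M)))
     \<longlonglongrightarrow> 0 + (2 * (\<integral>x. (w x)\<^sup>2 \<partial>M) - (\<integral>x. (w x)\<^sup>2 \<partial>M))"
    by (intro tendsto_intros 1 L2_nullD(3)[OF d])
  ultimately show "(\<lambda>n. \<integral>x. (e n x)\<^sup>2 \<partial>M) \<longlonglongrightarrow> (\<integral>x. (w x)\<^sup>2 \<partial>M)" by simp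
qed

section \<open>The degenerate quadratic form\<close>

lemma Lp_2_iff:
  fixes f :: "'a \<Rightarrow> 'b::euclidean_space"
  shows "f \<in> Lp M 2 \<longleftrightarrow> f \<in> borel_measurable M \<and> integrable M (\<lambda>x. (norm (f x))\<^sup>2)"
  by (simp add: Lp_def)

lemma Lp_norm_2:
  fixes f :: "'a \<Rightarrow> 'b::euclidean_space"
  shows "Lp_norm M 2 f = sqrt (\<integral>x. (norm (f x))\<^sup>2 \<partial>M)"
  by (simp add: Lp_norm_def powr_half_sqrt)

locale degenerate_form =
  fixes \<Omega> :: "(real^'n) set" and v :: "real^'n \<Rightarrow> real" and Q :: "real^'n \<Rightarrow> real^'n^'n" and c :: real
  assumes bounded_\<Omega>: "bounded \<Omega>" and open_\<Omega>: "open \<Omega>"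
    and v_integrable: "integrable (lebesgue_on \<Omega>) v" and v_nonneg: "\<And>x. x \<in> \<Omega> \<Longrightarrow> 0 \<le> v x"
    and Q_measurable: "Q \<in> borel_measurable (lebesgue_on \<Omega>)"
    and Q_sym: "\<And>x. x \<in> \<Omega> \<Longrightarrow> sym_nonneg (Q x)"
    and Q_le: "\<And>x \<xi>. x \<in> \<Omega> \<Longrightarrow> (Q x *v \<xi>) \<bullet> \<xi> \<le> c * v x * (norm \<xi>)\<^sup>2"
begin

abbreviation M :: "(real^'n) measure" where "M \<equiv> wmeasure \<Omega> v"

lemma sets_M [simp, measurable_cong]: "sets M = sets (lebesgue_on \<Omega>)"
  by (simp add: wmeasure_def)

lemma space_M [simp]: "space M = \<Omega>"
  by (simp add: wmeasure_def space_restrict_space)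

lemma measurable_M_iff: "f \<in> borel_measurable M \<longleftrightarrow> f \<in> borel_measurable (lebesgue_on \<Omega>)"
  by (simp cong: measurable_cong_sets)

lemma v_measurable [measurable]: "v \<in> borel_measurable M"
  using borel_measurable_integrable[OF v_integrable] by (simp add: measurable_M_iff)

lemma Omega_lebesgue [simp]: "\<Omega> \<in> sets lebesgue"
  using open_\<Omega> by auto

lemma AE_v_nonneg: "AE x in lebesgue_on \<Omega>. 0 \<le> v x"
  by (rule AE_I2) (simp add: v_nonneg space_restrict_space)

lemma finite_measure_M: "finite_measure M"
proof (rule finite_measureI)
  have "emeasure M (space M) = (\<integral>\<^sup>+x. ennreal (v x) \<partial>lebesgue_on \<Omega>)"
    unfolding wmeasure_def by (subst emeasure_density) (auto intro!: nn_integral_cong simp: space_restrict_space)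
  also have "\<dots> = ennreal (\<integral>x. v x \<partial>lebesgue_on \<Omega>)"
    by (rule nn_integral_eq_integral[OF v_integrable AE_v_nonneg])
  finally show "emeasure M (space M) \<noteq> \<infinity>" by simp
qed

text \<open>Statements that hold almost everywhere for \<open>M\<close> concern only points with
  \<open>v x > 0\<close>. This is what makes division by \<open>sqrt (v x)\<close> harmless in
  everything formulated through \<open>nrm\<close>.\<close>

lemma AE_M_iff: "(AE x in M. P x) \<longleftrightarrow> (AE x in lebesgue. x \<in> \<Omega> \<longrightarrow> 0 < v x \<longrightarrow> P x)"
  unfolding wmeasure_def by (subst AE_density) (auto simp: AE_restrict_space_iff)

lemma AE_MI: "AE x in lebesgue. x \<in> \<Omega> \<longrightarrow> P x \<Longrightarrow> AE x in M. P x"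
  unfolding AE_M_iff by (elim eventually_mono) auto

lemma AE_M_space: "AE x in M. x \<in> \<Omega> \<and> 0 < v x"
  unfolding AE_M_iff by simp

text \<open>Both forms are taken relative to the measure \<open>v dx\<close>. Where \<open>v = 0\<close> they are \<open>0\<close>, as is \<open>Q\<close>.\<close>

definition nrm :: "real^'n \<Rightarrow> real^'n \<Rightarrow> real" where
  "nrm x \<xi> = norm (mat_sqrt (Q x) *v \<xi>) / sqrt (v x)"

definition bil :: "real^'n \<Rightarrow> real^'n \<Rightarrow> real^'n \<Rightarrow> real" where
  "bil x \<xi> \<eta> = (\<xi> \<bullet> (Q x *v \<eta>)) / v x"

lemma inner_Q:
  assumes "x \<in> \<Omega>"
  shows "\<xi> \<bullet> (Q x *v \<eta>) = (mat_sqrt (Q x) *v \<xi>) \<bullet> (mat_sqrt (Q x) *v \<eta>)"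
proof -
  note s = sym_nonneg_mat_sqrt[OF Q_sym[OF assms]]
  have "\<xi> \<bullet> (Q x *v \<eta>) = \<xi> \<bullet> (mat_sqrt (Q x) *v (mat_sqrt (Q x) *v \<eta>))"
    using s by (simp add: matrix_vector_mul_assoc)
  then show ?thesis using sym_nonneg_symmetric[of "mat_sqrt (Q x)"] s by simp
qed

lemma mat_sqrt_Q_le:
  assumes "x \<in> \<Omega>"
  shows "norm (mat_sqrt (Q x) *v \<xi>) \<le> sqrt (max c 0) * sqrt (v x) * norm \<xi>"
proof -
  have "(norm (mat_sqrt (Q x) *v \<xi>))\<^sup>2 \<le> c * v x * (norm \<xi>)\<^sup>2"
    using norm_mat_sqrt[OF Q_sym[OF assms], of \<xi>] Q_le[OF assms, of \<xi>] by (simp add: inner_commute)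
  \<comment> \<open>The constant \<open>c\<close> is an arbitrary real number, so its non-negative
    part is taken before extracting the root.\<close>
  also have "\<dots> \<le> max c 0 * v x * (norm \<xi>)\<^sup>2"
    using v_nonneg[OF assms] by (intro mult_right_mono) auto
  finally have "norm (mat_sqrt (Q x) *v \<xi>) \<le> sqrt (max c 0 * v x * (norm \<xi>)\<^sup>2)"
    by (rule real_le_rsqrt)
  then show ?thesis by (simp add: real_sqrt_mult)
qed

lemma nrm_square: "x \<in> \<Omega> \<Longrightarrow> (nrm x \<xi>)\<^sup>2 = bil x \<xi> \<xi>"
  using norm_mat_sqrt[OF Q_sym, of x \<xi>] v_nonneg[of x]
  by (simp add: nrm_def bil_def power_divide)

lemma nrm_nonneg [simp]: "x \<in> \<Omega> \<Longrightarrow> 0 \<le> nrm x \<xi>"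
  using v_nonneg by (simp add: nrm_def)

lemma nrm_zero [simp]: "nrm x 0 = 0"
  by (simp add: nrm_def)

lemma nrm_add: "x \<in> \<Omega> \<Longrightarrow> nrm x (\<xi> + \<eta>) \<le> nrm x \<xi> + nrm x \<eta>"
  using v_nonneg[of x] norm_triangle_ineq[of "mat_sqrt (Q x) *v \<xi>" "mat_sqrt (Q x) *v \<eta>"]
  by (simp add: nrm_def matrix_vector_right_distrib divide_right_mono flip: add_divide_distrib)

lemma nrm_scale [simp]: "nrm x (a *\<^sub>R \<xi>) = \<bar>a\<bar> * nrm x \<xi>"
  by (simp add: nrm_def matrix_vector_mult_scaleR)

lemma nrm_minus_commute: "nrm x (\<xi> - \<eta>) = nrm x (\<eta> - \<xi>)"
  using nrm_scale[of x "-1" "\<eta> - \<xi>"] by simp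

lemma nrm_diff: "x \<in> \<Omega> \<Longrightarrow> \<bar>nrm x \<xi> - nrm x \<eta>\<bar> \<le> nrm x (\<xi> - \<eta>)"
  using nrm_add[of x "\<xi> - \<eta>" \<eta>] nrm_add[of x "\<eta> - \<xi>" \<xi>] by (simp add: nrm_minus_commute[of x \<eta>])

lemma nrm_le:
  assumes "x \<in> \<Omega>"
  shows "nrm x \<xi> \<le> sqrt (max c 0) * norm \<xi>"
proof (cases "v x = 0")
  case False
  then have "0 < sqrt (v x)" using v_nonneg[OF assms] by simp
  then show ?thesis
    using mat_sqrt_Q_le[OF assms, of \<xi>] by (simp add: nrm_def pos_divide_le_eq mult.assoc mult.commute mult.left_commute)
qed (simp add: nrm_def)

lemma bil_le: "x \<in> \<Omega> \<Longrightarrow> \<bar>bil x \<xi> \<eta>\<bar> \<le> nrm x \<xi> * nrm x \<eta>"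
proof -
  assume x: "x \<in> \<Omega>"
  have "\<bar>bil x \<xi> \<eta>\<bar> = \<bar>(mat_sqrt (Q x) *v \<xi>) \<bullet> (mat_sqrt (Q x) *v \<eta>)\<bar> / v x"
    using v_nonneg[OF x] by (simp add: bil_def inner_Q[OF x])
  also have "\<dots> \<le> (norm (mat_sqrt (Q x) *v \<xi>) * norm (mat_sqrt (Q x) *v \<eta>)) / v x"
    using v_nonneg[OF x] by (intro divide_right_mono Cauchy_Schwarz_ineq2)
  also have "\<dots> = nrm x \<xi> * nrm x \<eta>"
    using v_nonneg[OF x] by (simp add: nrm_def flip: real_sqrt_mult)
  finally show ?thesis .
qed

lemma bil_add_left: "bil x (\<xi> + \<xi>') \<eta> = bil x \<xi> \<eta> + bil x \<xi>' \<eta>"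
  by (simp add: bil_def inner_add_left add_divide_distrib)

lemma bil_diff_left: "bil x (\<xi> - \<xi>') \<eta> = bil x \<xi> \<eta> - bil x \<xi>' \<eta>"
  by (simp add: bil_def inner_diff_left diff_divide_distrib)

lemma bil_scale_left: "bil x (a *\<^sub>R \<xi>) \<eta> = a * bil x \<xi> \<eta>"
  by (simp add: bil_def)

lemma bil_sym: "x \<in> \<Omega> \<Longrightarrow> bil x \<xi> \<eta> = bil x \<eta> \<xi>"
  by (simp add: bil_def inner_Q inner_commute)

lemma Q_mult_measurable [measurable]:
  assumes "h \<in> borel_measurable M"
  shows "(\<lambda>x. Q x *v h x) \<in> borel_measurable M"
proof (rule borel_measurable_continuous_Pair[where f = Q and g = h and H = "(*v)"])
  show "Q \<in> borel_measurable M" using Q_measurable by (simp add: measurable_M_iff)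
  show "continuous_on UNIV (\<lambda>x :: (real^'n^'n) \<times> (real^'n). fst x *v snd x)"
    unfolding matrix_vector_mult_def by (intro continuous_intros)
qed fact

lemma bil_measurable [measurable]:
  assumes [measurable]: "h \<in> borel_measurable M" "k \<in> borel_measurable M"
  shows "(\<lambda>x. bil x (h x) (k x)) \<in> borel_measurable M"
  unfolding bil_def by measurable

lemma nrm_measurable [measurable]:
  assumes [measurable]: "h \<in> borel_measurable M"
  shows "(\<lambda>x. nrm x (h x)) \<in> borel_measurable M"
proof -
  have "(\<lambda>x. sqrt (bil x (h x) (h x))) \<in> borel_measurable M" by measurable
  moreover have "nrm x (h x) = sqrt (bil x (h x) (h x))" if "x \<in> space M" for x
    using that nrm_nonneg[of x "h x"] by (simp flip: nrm_square)
  ultimately show ?thesis by (subst measurable_cong) auto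
qed

lemma integral_M: "f \<in> borel_measurable M \<Longrightarrow> (\<integral>x. f x \<partial>M) = (\<integral>x. v x * f x \<partial>lebesgue_on \<Omega>)" for f :: "real^'n \<Rightarrow> real"
  unfolding measurable_M_iff wmeasure_def using AE_v_nonneg by (subst integral_density) auto

lemma integrable_M_iff: "f \<in> borel_measurable M \<Longrightarrow> integrable M f \<longleftrightarrow> integrable (lebesgue_on \<Omega>) (\<lambda>x. v x * f x)" for f :: "real^'n \<Rightarrow> real"
  unfolding measurable_M_iff wmeasure_def using AE_v_nonneg by (subst integrable_density) auto

text \<open>Where \<open>v x = 0\<close> the bound \<open>Q \<le> c v\<close> forces
  \<open>mat_sqrt (Q x) *v \<xi> = 0\<close>, so both sides vanish although \<open>bil\<close>
  divides by zero. Hence integrals against \<open>dx\<close> containing \<open>Q\<close> become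
  integrals of \<open>bil\<close> against \<open>v dx\<close>.\<close>

lemma v_bil: "x \<in> \<Omega> \<Longrightarrow> v x * bil x \<xi> \<eta> = \<xi> \<bullet> (Q x *v \<eta>)"
  using mat_sqrt_Q_le[of x \<xi>] by (cases "v x = 0") (auto simp: bil_def inner_Q)

lemma integral_bil:
  assumes "a \<in> borel_measurable M" "b \<in> borel_measurable M"
  shows "(\<integral>x. a x \<bullet> (Q x *v b x) \<partial>lebesgue_on \<Omega>) = (\<integral>x. bil x (a x) (b x) \<partial>M)"
  using bil_measurable[OF assms]
  by (simp add: integral_M) (auto intro!: Bochner_Integration.integral_cong simp: v_bil space_restrict_space)

lemma norm_mat_sqrt_nrm: "x \<in> \<Omega> \<Longrightarrow> (norm (mat_sqrt (Q x) *v \<xi>))\<^sup>2 = v x * (nrm x \<xi>)\<^sup>2"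
  by (simp add: nrm_square v_bil norm_mat_sqrt Q_sym)

lemma QL2_iff: "h \<in> QL2 \<Omega> Q \<longleftrightarrow> h \<in> borel_measurable M \<and> integrable M (\<lambda>x. (nrm x (h x))\<^sup>2)"
proof -
  have "integrable (lebesgue_on \<Omega>) (\<lambda>x. (norm (mat_sqrt (Q x) *v h x))\<^sup>2) \<longleftrightarrow> integrable M (\<lambda>x. (nrm x (h x))\<^sup>2)"
    if [measurable]: "h \<in> borel_measurable M"
    by (subst integrable_M_iff, measurable)
       (auto intro!: Bochner_Integration.integrable_cong simp: norm_mat_sqrt_nrm space_restrict_space)
  then show ?thesis by (auto simp: QL2_def measurable_M_iff)
qed

lemma QL2_norm_eq:
  assumes [measurable]: "h \<in> borel_measurable M"
  shows "QL2_norm \<Omega> Q h = sqrt (\<integral>x. (nrm x (h x))\<^sup>2 \<partial>M)"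
  unfolding QL2_norm_def
  by (subst integral_M, measurable)
     (auto intro!: arg_cong[where f = sqrt] Bochner_Integration.integral_cong simp: norm_mat_sqrt_nrm space_restrict_space)

lemma Lip_loc_measurable: "f \<in> Lip_loc \<Omega> \<Longrightarrow> f \<in> borel_measurable M"
  unfolding measurable_M_iff
  by (intro continuous_imp_measurable_on_sets_lebesgue Lip_loc_continuous_on open_\<Omega>) auto

lemma grad_measurable_M: "f \<in> Lip_loc \<Omega> \<Longrightarrow> grad f \<in> borel_measurable M"
  unfolding measurable_M_iff by (rule grad_measurable[OF _ open_\<Omega>])

lemma integrable_bounded_M:
  fixes f :: "real^'n \<Rightarrow> real"
  assumes "f \<in> borel_measurable M" "\<And>x. x \<in> \<Omega> \<Longrightarrow> \<bar>f x\<bar> \<le> B"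
  shows "integrable M f"
proof -
  interpret finite_measure M by (rule finite_measure_M)
  show ?thesis by (rule integrable_const_bound[of _ B]) (use assms in auto)
qed

text \<open>Finiteness comes from the finite measure \<open>v dx\<close> together with bounds for
  the function and its gradient; the energy also uses \<open>Q \<le> c v\<close>.\<close>

lemma Lip0_L2:
  assumes f: "f \<in> Lip0 \<Omega>"
  shows "f \<in> borel_measurable M" "grad f \<in> borel_measurable M"
    "integrable M (\<lambda>x. (f x)\<^sup>2)" "integrable M (\<lambda>x. (nrm x (grad f x))\<^sup>2)"
proof -
  show fm[measurable]: "f \<in> borel_measurable M" and gm[measurable]: "grad f \<in> borel_measurable M"
    using Lip0_imp_Lip_loc[OF f] by (auto intro: Lip_loc_measurable grad_measurable_M)
  obtain B where B: "\<And>x. x \<in> \<Omega> \<Longrightarrow> \<bar>f x\<bar> \<le> B" by (rule Lip0_bounded[OF f open_\<Omega>]) blast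
  obtain L where L: "\<And>x. x \<in> \<Omega> \<Longrightarrow> norm (grad f x) \<le> L" by (rule Lip0_grad_bounded[OF f open_\<Omega>]) blast
  show "integrable M (\<lambda>x. (f x)\<^sup>2)"
  proof (rule integrable_bounded_M[of _ "B\<^sup>2"])
    show "\<bar>(f x)\<^sup>2\<bar> \<le> B\<^sup>2" if "x \<in> \<Omega>" for x using power_mono[OF B[OF that], of 2] by simp
  qed measurable
  show "integrable M (\<lambda>x. (nrm x (grad f x))\<^sup>2)"
  proof (rule integrable_bounded_M[of _ "(sqrt (max c 0) * L)\<^sup>2"])
    show "\<bar>(nrm x (grad f x))\<^sup>2\<bar> \<le> (sqrt (max c 0) * L)\<^sup>2" if "x \<in> \<Omega>" for x
    proof -
      have "nrm x (grad f x) \<le> sqrt (max c 0) * L"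
        using nrm_le[OF that, of "grad f x"] mult_left_mono[OF L[OF that], of "sqrt (max c 0)"] by simp
      then show ?thesis using that by (simp add: power_mono)
    qed
  qed measurable
qed

text \<open>The definition provides convergence in norm only; a subsequence is taken so that the
  functions converge almost everywhere as well, which compositions with continuous functions
  require.\<close>

lemma QH_completionE:
  assumes "(u, g) \<in> QH_completion \<Omega> v Q X"
    and X: "\<And>\<phi>. \<phi> \<in> X \<Longrightarrow> \<phi> \<in> Lp M 2 \<and> grad \<phi> \<in> QL2 \<Omega> Q"
  obtains \<phi> where "\<And>k. \<phi> k \<in> X" "L2_null M (\<lambda>k x. \<phi> k x - u x)"
    "L2_null M (\<lambda>k x. nrm x (grad (\<phi> k) x - g x))" "AE x in M. (\<lambda>k. \<phi> k x) \<longlonglongrightarrow> u x"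
proof -
  obtain \<phi> where \<phi>: "\<And>k. \<phi> k \<in> X" and u: "u \<in> Lp M 2" and g: "g \<in> QL2 \<Omega> Q"
    and c1: "(\<lambda>k. Lp_norm M 2 (\<lambda>x. \<phi> k x - u x)) \<longlonglongrightarrow> 0"
    and c2: "(\<lambda>k. QL2_norm \<Omega> Q (\<lambda>x. grad (\<phi> k) x - g x)) \<longlonglongrightarrow> 0"
    using assms(1) unfolding QH_completion_def by auto
  have um[measurable]: "u \<in> borel_measurable M" and ui: "integrable M (\<lambda>x. (u x)\<^sup>2)"
    using u by (auto simp: Lp_2_iff)
  have gm[measurable]: "g \<in> borel_measurable M" and gi: "integrable M (\<lambda>x. (nrm x (g x))\<^sup>2)"
    using g by (auto simp: QL2_iff)
  have pm[measurable]: "\<phi> k \<in> borel_measurable M" and pi: "integrable M (\<lambda>x. (\<phi> k x)\<^sup>2)" for k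
    using X[OF \<phi>[of k]] by (auto simp: Lp_2_iff)
  have qm[measurable]: "grad (\<phi> k) \<in> borel_measurable M" and qi: "integrable M (\<lambda>x. (nrm x (grad (\<phi> k) x))\<^sup>2)" for k
    using X[OF \<phi>[of k]] by (auto simp: QL2_iff)
  have i1: "integrable M (\<lambda>x. (\<phi> k x - u x)\<^sup>2)" for k
    using integrable_square_add[of "\<phi> k" M "\<lambda>x. - u x"] pi ui by simp
  have i2: "integrable M (\<lambda>x. (nrm x (grad (\<phi> k) x - g x))\<^sup>2)" for k
  proof (rule Bochner_Integration.integrable_bound)
    show "integrable M (\<lambda>x. (nrm x (grad (\<phi> k) x) + nrm x (g x))\<^sup>2)"
      by (rule integrable_square_add[OF _ _ qi gi]) measurable
    have "nrm x (grad (\<phi> k) x - g x) \<le> nrm x (grad (\<phi> k) x) + nrm x (g x)" if "x \<in> \<Omega>" for x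
      using nrm_add[OF that, of "grad (\<phi> k) x" "- g x"] nrm_scale[of x "-1" "g x"] by simp
    then show "AE x in M. norm ((nrm x (grad (\<phi> k) x - g x))\<^sup>2) \<le> norm ((nrm x (grad (\<phi> k) x) + nrm x (g x))\<^sup>2)"
      by (intro AE_I2) (simp add: power_mono)
  qed measurable
  have l1: "L2_null M (\<lambda>k x. \<phi> k x - u x)"
    using i1 tendsto_power[OF c1, of 2] by (simp add: L2_null_def Lp_norm_2)
  have l2: "L2_null M (\<lambda>k x. nrm x (grad (\<phi> k) x - g x))"
    using i2 tendsto_power[OF c2, of 2] by (simp add: L2_null_def QL2_norm_eq)
  obtain \<tau> :: "nat \<Rightarrow> nat" where \<tau>: "strict_mono \<tau>" "AE x in M. (\<lambda>n. \<phi> (\<tau> n) x - u x) \<longlonglongrightarrow> 0"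
    using L2_null_AE_subseq[OF l1] by blast
  show ?thesis
  proof (rule that[of "\<lambda>k. \<phi> (\<tau> k)"])
    show "AE x in M. (\<lambda>k. \<phi> (\<tau> k) x) \<longlonglongrightarrow> u x"
      using \<tau>(2) by (rule eventually_mono) (simp add: LIM_zero_iff)
  qed (use \<phi> L2_null_subseq[OF l1 \<tau>(1)] L2_null_subseq[OF l2 \<tau>(1)] in auto)
qed

end

section \<open>Subunit vector fields\<close>

text \<open>\<open>vfs\<close> with the vector frozen: \<open>svec S x\<close> is a linear map for
  each \<open>x\<close>, so an inequality for it at \<open>x\<close> can be applied to any vector,
  in particular to the gradient component of a pair.\<close>

definition svec :: "('m \<Rightarrow> real^'n \<Rightarrow> real^'n) \<Rightarrow> real^'n \<Rightarrow> real^'n \<Rightarrow> real^'m" where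
  "svec S x \<xi> = (\<chi> i. S i x \<bullet> \<xi>)"

lemma vfs_eq_svec: "vfs S g x = svec S x (g x)"
  by (simp add: vfs_def vf_def svec_def)

lemma svec_add: "svec S x (\<xi> + \<eta>) = svec S x \<xi> + svec S x \<eta>"
  by (simp add: svec_def vec_eq_iff inner_add_right)

lemma svec_diff: "svec S x (\<xi> - \<eta>) = svec S x \<xi> - svec S x \<eta>"
  by (simp add: svec_def vec_eq_iff inner_diff_right)

lemma svec_scale: "svec S x (a *\<^sub>R \<xi>) = a *\<^sub>R svec S x \<xi>"
  by (simp add: svec_def vec_eq_iff)

lemma compact_Lipschitz_cutoff:
  fixes K :: "'a::euclidean_space set"
  assumes "compact K" "K \<subseteq> \<Omega>" "open \<Omega>"
  obtains \<zeta> :: "'a \<Rightarrow> real" and L T where "L-lipschitz_on UNIV \<zeta>" "\<And>x. 0 \<le> \<zeta> x \<and> \<zeta> x \<le> 1" "compact T" "T \<subseteq> \<Omega>"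
    "\<And>x. x \<notin> T \<Longrightarrow> \<zeta> x = 0" "\<And>x. x \<in> K \<Longrightarrow> \<zeta> x = 1"
proof (cases "K = {}")
  case True
  have "0-lipschitz_on UNIV (\<lambda>_::'a. 0::real)" by (rule lipschitz_onI) auto
  then show ?thesis using that[of 0 "\<lambda>_. 0" "{}"] True by auto
next
  case False
  obtain e where e: "e > 0" "{x. infdist x K \<le> e} \<subseteq> \<Omega>"
    by (rule compact_in_open_separated[OF False assms(1,3,2)])
  have cT: "compact {x. infdist x K \<le> e}" by (rule compact_infdist_le[OF False assms(1) e(1)])
  define \<zeta> where "\<zeta> x = max 0 (1 - infdist x K / e)" for x
  have "(1/e)-lipschitz_on UNIV \<zeta>"
  proof (rule lipschitz_onI)
    fix x y
    have "\<bar>infdist x K / e - infdist y K / e\<bar> = \<bar>infdist x K - infdist y K\<bar> / e"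
      using e(1) by (simp add: diff_divide_distrib[symmetric])
    also have "\<dots> \<le> dist x y / e" using e(1) infdist_triangle_abs[of x K y] by (simp add: divide_right_mono)
    finally have le: "\<bar>infdist x K / e - infdist y K / e\<bar> \<le> dist x y / e" .
    show "dist (\<zeta> x) (\<zeta> y) \<le> (1/e) * dist x y"
    proof -
      have "\<bar>\<zeta> x - \<zeta> y\<bar> \<le> \<bar>infdist x K / e - infdist y K / e\<bar>" unfolding \<zeta>_def by linarith
      then show ?thesis using le by (simp add: dist_real_def)
    qed
  qed (use e(1) in simp)
  then show ?thesis
  proof (rule that)
    show "0 \<le> \<zeta> x \<and> \<zeta> x \<le> 1" for x using e(1) by (simp add: \<zeta>_def infdist_nonneg)
    show "\<zeta> x = 0" if "x \<notin> {x. infdist x K \<le> e}" for x using that e(1) by (simp add: \<zeta>_def)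
    show "\<zeta> x = 1" if "x \<in> K" for x using that by (simp add: \<zeta>_def)
  qed (use cT e(2) in auto)
qed

lemma grad_inner: "grad (\<lambda>x. \<xi> \<bullet> x) x = \<xi>"
  by (rule grad_eqI) (auto simp: gderiv_def inner_commute intro!: derivative_eq_intros)

lemma inner_in_Lip_loc: "(\<lambda>x. \<xi> \<bullet> x) \<in> Lip_loc \<Omega>"
proof (rule lipschitz_imp_Lip_loc)
  show "(norm \<xi>)-lipschitz_on UNIV (\<lambda>x. \<xi> \<bullet> x)"
    by (rule lipschitz_onI) (auto simp: dist_norm inner_diff_right[symmetric] intro: Cauchy_Schwarz_ineq2)
qed

context degenerate_form
begin

lemma svec_measurable [measurable]:
  assumes S: "\<And>i. S i \<in> borel_measurable (lebesgue_on \<Omega>)" and [measurable]: "h \<in> borel_measurable M"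
  shows "(\<lambda>x. svec S x (h x)) \<in> borel_measurable M"
proof -
  have [measurable]: "S i \<in> borel_measurable M" for i using S by (simp add: measurable_M_iff)
  show ?thesis
    by (rule borel_measurable_euclidean_space[THEN iffD2])
       (auto simp: Basis_vec_def inner_axis svec_def)
qed

lemma bil_add_right: "bil x \<xi> (\<eta> + \<eta>') = bil x \<xi> \<eta> + bil x \<xi> \<eta>'"
  by (simp add: bil_def matrix_vector_right_distrib inner_add_right add_divide_distrib)

lemma bil_scale_right: "bil x \<xi> (a *\<^sub>R \<eta>) = a * bil x \<xi> \<eta>"
  by (simp add: bil_def matrix_vector_mult_scaleR)

lemma nrm_square_combination:
  assumes "x \<in> \<Omega>"
  shows "(nrm x (a *\<^sub>R \<xi> + b *\<^sub>R \<eta>))\<^sup>2 = a\<^sup>2 * (nrm x \<xi>)\<^sup>2 + 2 * a * b * bil x \<xi> \<eta> + b\<^sup>2 * (nrm x \<eta>)\<^sup>2"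
  unfolding nrm_square[OF assms] bil_add_left bil_scale_left bil_add_right bil_scale_right
  by (simp add: bil_sym[OF assms, of \<eta> \<xi>] power2_eq_square algebra_simps)

lemma svec_square_combination:
  "(norm (svec S x (a *\<^sub>R \<xi> + b *\<^sub>R \<eta>)))\<^sup>2
     = a\<^sup>2 * (norm (svec S x \<xi>))\<^sup>2 + 2 * a * b * (svec S x \<xi> \<bullet> svec S x \<eta>) + b\<^sup>2 * (norm (svec S x \<eta>))\<^sup>2"
  unfolding svec_add svec_scale power2_norm_eq_inner inner_add_left inner_add_right
  by (simp add: inner_commute[of "svec S x \<eta>" "svec S x \<xi>"] power2_eq_square algebra_simps)

lemma subunit_const_square:
  assumes C: "subunit_const \<Omega> v Q S C" and \<phi>: "\<phi> \<in> Lip0 \<Omega>"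
  shows "integrable M (\<lambda>x. (norm (svec S x (grad \<phi> x)))\<^sup>2)"
    "(\<integral>x. (norm (svec S x (grad \<phi> x)))\<^sup>2 \<partial>M)
       \<le> C\<^sup>2 * (sqrt (\<integral>x. (\<phi> x)\<^sup>2 \<partial>M) + sqrt (\<integral>x. (nrm x (grad \<phi> x))\<^sup>2 \<partial>M))\<^sup>2"
proof -
  have *: "vfs S (grad \<phi>) \<in> Lp M 2" "Lp_norm M 2 (vfs S (grad \<phi>)) \<le> C * QH1_norm \<Omega> v Q \<phi>"
    using C \<phi> by (auto simp: subunit_const_def)
  show "integrable M (\<lambda>x. (norm (svec S x (grad \<phi> x)))\<^sup>2)"
    using *(1) by (simp add: Lp_2_iff vfs_eq_svec)
  have "sqrt (\<integral>x. (norm (svec S x (grad \<phi> x)))\<^sup>2 \<partial>M)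
      \<le> C * (sqrt (\<integral>x. (\<phi> x)\<^sup>2 \<partial>M) + sqrt (\<integral>x. (nrm x (grad \<phi> x))\<^sup>2 \<partial>M))"
    using *(2) Lip0_L2(2)[OF \<phi>] by (simp add: QH1_norm_def Lp_norm_2 QL2_norm_eq vfs_eq_svec)
  then have "(sqrt (\<integral>x. (norm (svec S x (grad \<phi> x)))\<^sup>2 \<partial>M))\<^sup>2
      \<le> (C * (sqrt (\<integral>x. (\<phi> x)\<^sup>2 \<partial>M) + sqrt (\<integral>x. (nrm x (grad \<phi> x))\<^sup>2 \<partial>M)))\<^sup>2"
    by (intro power_mono real_sqrt_ge_zero Bochner_Integration.integral_nonneg) auto
  then show "(\<integral>x. (norm (svec S x (grad \<phi> x)))\<^sup>2 \<partial>M)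
       \<le> C\<^sup>2 * (sqrt (\<integral>x. (\<phi> x)\<^sup>2 \<partial>M) + sqrt (\<integral>x. (nrm x (grad \<phi> x))\<^sup>2 \<partial>M))\<^sup>2"
    by (simp add: power_mult_distrib)
qed

section \<open>Pointwise bounds from oscillating test functions\<close>

lemma oscillating_test:
  assumes \<zeta>: "\<zeta> \<in> Lip0 \<Omega>" and k: "\<And>s. (k has_real_derivative k' s) (at s)" "\<And>s. \<bar>k' s\<bar> \<le> 1"
  shows "(\<lambda>x. \<zeta> x * k (\<xi> \<bullet> x)) \<in> Lip0 \<Omega>"
    "AE x in M. grad (\<lambda>x. \<zeta> x * k (\<xi> \<bullet> x)) x = (\<zeta> x * k' (\<xi> \<bullet> x)) *\<^sub>R \<xi> + k (\<xi> \<bullet> x) *\<^sub>R grad \<zeta> x"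
proof -
  have lip: "1-lipschitz_on UNIV k" by (rule lipschitz_if_derivative_bounded[OF k])
  have kl: "(\<lambda>x. k (\<xi> \<bullet> x)) \<in> Lip_loc \<Omega>" by (rule Lip_loc_compose[OF lip inner_in_Lip_loc])
  show "(\<lambda>x. \<zeta> x * k (\<xi> \<bullet> x)) \<in> Lip0 \<Omega>" by (rule Lip0_mult[OF \<zeta> kl open_\<Omega> bounded_\<Omega>])
  show "AE x in M. grad (\<lambda>x. \<zeta> x * k (\<xi> \<bullet> x)) x = (\<zeta> x * k' (\<xi> \<bullet> x)) *\<^sub>R \<xi> + k (\<xi> \<bullet> x) *\<^sub>R grad \<zeta> x"
    using AE_MI[OF grad_mult_AE[OF Lip0_imp_Lip_loc[OF \<zeta>] kl open_\<Omega>]]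
      AE_MI[OF grad_compose_AE[OF inner_in_Lip_loc k(1) open_\<Omega>, of \<xi>]]
    by eventually_elim (simp add: grad_inner)
qed

text \<open>Testing with \<open>\<zeta> sin(N \<xi>\<cdot>x) / N\<close> and \<open>\<zeta> cos(N \<xi>\<cdot>x) / N\<close> and adding, all cross terms cancel; as
  \<open>N \<rightarrow> \<infinity>\<close> only the terms in which the oscillating factor was differentiated survive.\<close>

lemma subunit_test:
  fixes S :: "'m::finite \<Rightarrow> real^'n \<Rightarrow> real^'n"
  assumes S: "\<And>i. S i \<in> borel_measurable (lebesgue_on \<Omega>)" and C: "subunit_const \<Omega> v Q S C"
    and \<zeta>: "\<zeta> \<in> Lip0 \<Omega>" "\<And>x. \<bar>\<zeta> x\<bar> \<le> 1"
  shows "integrable M (\<lambda>x. (\<zeta> x)\<^sup>2 * (norm (svec S x \<xi>))\<^sup>2)" (is "integrable M ?s")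
    "integrable M (\<lambda>x. (\<zeta> x)\<^sup>2 * (nrm x \<xi>)\<^sup>2)" (is "integrable M ?e")
    "(\<integral>x. (\<zeta> x)\<^sup>2 * (norm (svec S x \<xi>))\<^sup>2 \<partial>M) \<le> C\<^sup>2 * (\<integral>x. (\<zeta> x)\<^sup>2 * (nrm x \<xi>)\<^sup>2 \<partial>M)"
proof -
  note \<zeta>L2 = Lip0_L2[OF \<zeta>(1)]
  note [measurable] = \<zeta>L2(1,2)
  define \<phi>1 where "\<phi>1 n x = \<zeta> x * (sin (real (Suc n) * (\<xi> \<bullet> x)) / real (Suc n))" for n x
  define \<phi>2 where "\<phi>2 n x = \<zeta> x * (cos (real (Suc n) * (\<xi> \<bullet> x)) / real (Suc n))" for n x
  have d1: "((\<lambda>s. sin (real (Suc n) * s) / real (Suc n)) has_real_derivative cos (real (Suc n) * s)) (at s)" for n s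
    by (auto intro!: derivative_eq_intros simp del: of_nat_Suc)
  have d2: "((\<lambda>s. cos (real (Suc n) * s) / real (Suc n)) has_real_derivative - sin (real (Suc n) * s)) (at s)" for n s
    by (auto intro!: derivative_eq_intros simp del: of_nat_Suc)
  have L1: "\<phi>1 n \<in> Lip0 \<Omega>" for n
    unfolding \<phi>1_def by (rule oscillating_test(1)[OF \<zeta>(1) d1]) simp
  have L2: "\<phi>2 n \<in> Lip0 \<Omega>" for n
    unfolding \<phi>2_def by (rule oscillating_test(1)[OF \<zeta>(1) d2]) simp
  have g1: "AE x in M. grad (\<phi>1 n) x = (\<zeta> x * cos (real (Suc n) * (\<xi> \<bullet> x))) *\<^sub>R \<xi> + (sin (real (Suc n) * (\<xi> \<bullet> x)) / real (Suc n)) *\<^sub>R grad \<zeta> x" for n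
    unfolding \<phi>1_def by (rule oscillating_test(2)[OF \<zeta>(1) d1]) simp
  have g2: "AE x in M. grad (\<phi>2 n) x = (\<zeta> x * - sin (real (Suc n) * (\<xi> \<bullet> x))) *\<^sub>R \<xi> + (cos (real (Suc n) * (\<xi> \<bullet> x)) / real (Suc n)) *\<^sub>R grad \<zeta> x" for n
    unfolding \<phi>2_def by (rule oscillating_test(2)[OF \<zeta>(1) d2]) simp
  have alg: "(z * co)\<^sup>2 * X + 2 * (z * co) * (si / N) * Y + (si / N)\<^sup>2 * W
      + ((z * - si)\<^sup>2 * X + 2 * (z * - si) * (co / N) * Y + (co / N)\<^sup>2 * W) = z\<^sup>2 * X + W / N\<^sup>2"
    if "si\<^sup>2 + co\<^sup>2 = 1" for z co si X Y W N :: real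
  proof -
    have "(z * co)\<^sup>2 * X + 2 * (z * co) * (si / N) * Y + (si / N)\<^sup>2 * W
      + ((z * - si)\<^sup>2 * X + 2 * (z * - si) * (co / N) * Y + (co / N)\<^sup>2 * W)
      = (si\<^sup>2 + co\<^sup>2) * (z\<^sup>2 * X) + (si\<^sup>2 + co\<^sup>2) * (W / N\<^sup>2)"
      by (simp add: power_mult_distrib power_divide algebra_simps add_divide_distrib)
    then show ?thesis by (simp add: that)
  qed
  have sums: "AE x in M. (norm (svec S x (grad (\<phi>1 n) x)))\<^sup>2 + (norm (svec S x (grad (\<phi>2 n) x)))\<^sup>2
      = ?s x + (norm (svec S x (grad \<zeta> x)))\<^sup>2 / (real (Suc n))\<^sup>2" for n
    using g1[of n] g2[of n] by eventually_elim (simp only: svec_square_combination alg sin_cos_squared_add)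
  have sume: "AE x in M. (nrm x (grad (\<phi>1 n) x))\<^sup>2 + (nrm x (grad (\<phi>2 n) x))\<^sup>2
      = ?e x + (nrm x (grad \<zeta> x))\<^sup>2 / (real (Suc n))\<^sup>2" for n
    using g1[of n] g2[of n] AE_M_space
    by eventually_elim (simp only: nrm_square_combination alg sin_cos_squared_add)
  note sq = subunit_const_square[OF C]
  have Sm[measurable]: "(\<lambda>x. svec S x \<xi>) \<in> borel_measurable M"
    by (rule svec_measurable[OF S]) simp
  have sint: "integrable M (\<lambda>x. (norm (svec S x (grad \<zeta> x)))\<^sup>2)" by (rule sq(1)[OF \<zeta>(1)])
  \<comment> \<open>Frequency \<open>1\<close>, that is \<open>n = 0\<close>, isolates
    \<open>\<zeta>\<^sup>2 |S \<xi>|\<^sup>2\<close> as a combination of functions already known to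
    be integrable; the fields themselves are only measurable.\<close>
  have "integrable M (\<lambda>x. (norm (svec S x (grad (\<phi>1 0) x)))\<^sup>2 + (norm (svec S x (grad (\<phi>2 0) x)))\<^sup>2
      - (norm (svec S x (grad \<zeta> x)))\<^sup>2)"
    using sq(1)[OF L1] sq(1)[OF L2] sint by simp
  then show s_int: "integrable M ?s"
  proof (rule integrable_cong_AE[THEN iffD1, rotated -1])
    show "AE x in M. (norm (svec S x (grad (\<phi>1 0) x)))\<^sup>2 + (norm (svec S x (grad (\<phi>2 0) x)))\<^sup>2
      - (norm (svec S x (grad \<zeta> x)))\<^sup>2 = ?s x"
      using sums[of 0] by eventually_elim simp
    show "(\<lambda>x. (norm (svec S x (grad (\<phi>1 0) x)))\<^sup>2 + (norm (svec S x (grad (\<phi>2 0) x)))\<^sup>2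
      - (norm (svec S x (grad \<zeta> x)))\<^sup>2) \<in> borel_measurable M"
      using sq(1)[OF L1] sq(1)[OF L2] sint by (intro borel_measurable_add borel_measurable_diff borel_measurable_integrable)
  qed measurable
  have em[measurable]: "(\<lambda>x. nrm x \<xi>) \<in> borel_measurable M" by (rule nrm_measurable) simp
  have eint: "integrable M (\<lambda>x. (nrm x (grad \<zeta> x))\<^sup>2)" by (rule \<zeta>L2(4))
  have "integrable M (\<lambda>x. (nrm x (grad (\<phi>1 0) x))\<^sup>2 + (nrm x (grad (\<phi>2 0) x))\<^sup>2 - (nrm x (grad \<zeta> x))\<^sup>2)"
    using Lip0_L2(4)[OF L1] Lip0_L2(4)[OF L2] eint by simp
  then show e_int: "integrable M ?e"
  proof (rule integrable_cong_AE[THEN iffD1, rotated -1])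
    show "AE x in M. (nrm x (grad (\<phi>1 0) x))\<^sup>2 + (nrm x (grad (\<phi>2 0) x))\<^sup>2 - (nrm x (grad \<zeta> x))\<^sup>2 = ?e x"
      using sume[of 0] by eventually_elim simp
    show "(\<lambda>x. (nrm x (grad (\<phi>1 0) x))\<^sup>2 + (nrm x (grad (\<phi>2 0) x))\<^sup>2 - (nrm x (grad \<zeta> x))\<^sup>2) \<in> borel_measurable M"
      using Lip0_L2(4)[OF L1] Lip0_L2(4)[OF L2] eint by (intro borel_measurable_add borel_measurable_diff borel_measurable_integrable)
  qed measurable
  define J where "J = (\<integral>x. ?s x \<partial>M)"
  define A where "A = (\<integral>x. ?e x \<partial>M)"
  define B where "B = (\<integral>x. (nrm x (grad \<zeta> x))\<^sup>2 \<partial>M)"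
  define m where "m = (\<integral>x. (1::real) \<partial>M)"
  have AB: "0 \<le> A" "0 \<le> B" "0 \<le> m" by (auto simp: A_def B_def m_def)
  have one_int: "integrable M (\<lambda>x. 1::real)" by (rule integrable_bounded_M[of _ 1]) auto
  have P: "(\<integral>x. (\<phi> x)\<^sup>2 \<partial>M) \<le> m / (real (Suc n))\<^sup>2"
    if "\<phi> \<in> Lip0 \<Omega>" "\<And>x. \<bar>\<phi> x\<bar> \<le> 1 / real (Suc n)" for \<phi> n
  proof -
    have "(\<integral>x. (\<phi> x)\<^sup>2 \<partial>M) \<le> (\<integral>x. 1 / (real (Suc n))\<^sup>2 \<partial>M)"
    proof (rule integral_mono[OF Lip0_L2(3)[OF that(1)]])
      show "integrable M (\<lambda>x. 1 / (real (Suc n))\<^sup>2)" using one_int by (rule integrable_divide)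
      show "(\<phi> x)\<^sup>2 \<le> 1 / (real (Suc n))\<^sup>2" for x
        using power_mono[OF that(2)[of x], of 2] by (simp add: power_divide)
    qed
    also have "\<dots> = m / (real (Suc n))\<^sup>2" unfolding m_def by (rule integral_divide_zero)
    finally show ?thesis .
  qed
  have bd1: "\<bar>\<phi>1 n x\<bar> \<le> 1 / real (Suc n)" and bd2: "\<bar>\<phi>2 n x\<bar> \<le> 1 / real (Suc n)" for n x
  proof -
    have "\<bar>\<zeta> x\<bar> * \<bar>sin (real (Suc n) * (\<xi> \<bullet> x))\<bar> \<le> 1 * 1" "\<bar>\<zeta> x\<bar> * \<bar>cos (real (Suc n) * (\<xi> \<bullet> x))\<bar> \<le> 1 * 1"
      using \<zeta>(2) by (intro mult_mono; simp)+
    then show "\<bar>\<phi>1 n x\<bar> \<le> 1 / real (Suc n)" "\<bar>\<phi>2 n x\<bar> \<le> 1 / real (Suc n)"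
      by (simp_all add: \<phi>1_def \<phi>2_def abs_mult divide_right_mono del: of_nat_Suc)
  qed
  \<comment> \<open>The \<open>L\<^sup>2\<close> norms of both test functions are
    \<open>O(1/N)\<close>. After the subunit bound is squared, the zeroth-order term and the mixed
    term therefore carry \<open>1/N\<^sup>2\<close> and \<open>1/N\<close>, and only
    \<open>A\<close> survives in the limit.\<close>
  have est: "J \<le> C\<^sup>2 * (2 * (m / (real (Suc n))\<^sup>2) + (A + B / (real (Suc n))\<^sup>2) + 4 * (sqrt (m * (A + B)) / real (Suc n)))" for n
  proof -
    let ?N = "real (Suc n)"
    define I1 where "I1 = (\<integral>x. (norm (svec S x (grad (\<phi>1 n) x)))\<^sup>2 \<partial>M)"
    define I2 where "I2 = (\<integral>x. (norm (svec S x (grad (\<phi>2 n) x)))\<^sup>2 \<partial>M)"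
    define E1 where "E1 = (\<integral>x. (nrm x (grad (\<phi>1 n) x))\<^sup>2 \<partial>M)"
    define E2 where "E2 = (\<integral>x. (nrm x (grad (\<phi>2 n) x))\<^sup>2 \<partial>M)"
    have E0: "0 \<le> E1" "0 \<le> E2" by (auto simp: E1_def E2_def)
    have "E1 + E2 = (\<integral>x. (nrm x (grad (\<phi>1 n) x))\<^sup>2 + (nrm x (grad (\<phi>2 n) x))\<^sup>2 \<partial>M)"
      unfolding E1_def E2_def using Lip0_L2(4)[OF L1] Lip0_L2(4)[OF L2] by simp
    also have "\<dots> = (\<integral>x. ?e x + (nrm x (grad \<zeta> x))\<^sup>2 / ?N\<^sup>2 \<partial>M)"
      by (rule integral_cong_AE[OF _ _ sume])
         (use borel_measurable_integrable[OF Lip0_L2(4)[OF L1]] borel_measurable_integrable[OF Lip0_L2(4)[OF L2]] in measurable)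
    also have "\<dots> = A + B / ?N\<^sup>2" unfolding A_def B_def using e_int eint by simp
    finally have E12: "E1 + E2 = A + B / ?N\<^sup>2" .
    have "1 \<le> ?N\<^sup>2" by (rule one_le_power) simp
    \<comment> \<open>Since \<open>N \<ge> 1\<close>, both energies are at most \<open>A + B\<close>
      uniformly in \<open>n\<close>, which bounds the mixed term.\<close>
    then have "B / ?N\<^sup>2 \<le> B / 1" using AB by (intro divide_left_mono) auto
    then have Eb: "E1 \<le> A + B" "E2 \<le> A + B" using E12 E0 by linarith+
    have "J + (\<integral>x. (norm (svec S x (grad \<zeta> x)))\<^sup>2 \<partial>M) / ?N\<^sup>2 = (\<integral>x. ?s x + (norm (svec S x (grad \<zeta> x)))\<^sup>2 / ?N\<^sup>2 \<partial>M)"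
      unfolding J_def using s_int sint by simp
    also have "\<dots> = (\<integral>x. (norm (svec S x (grad (\<phi>1 n) x)))\<^sup>2 + (norm (svec S x (grad (\<phi>2 n) x)))\<^sup>2 \<partial>M)"
      by (rule integral_cong_AE[symmetric, OF _ _ sums])
         (use borel_measurable_integrable[OF sq(1)[OF L1]] borel_measurable_integrable[OF sq(1)[OF L2]]
            borel_measurable_integrable[OF sint] borel_measurable_integrable[OF s_int] in measurable)
    also have "\<dots> = I1 + I2" unfolding I1_def I2_def using sq(1)[OF L1] sq(1)[OF L2] by simp
    finally have "J + (\<integral>x. (norm (svec S x (grad \<zeta> x)))\<^sup>2 \<partial>M) / ?N\<^sup>2 = I1 + I2" .
    moreover have "0 \<le> (\<integral>x. (norm (svec S x (grad \<zeta> x)))\<^sup>2 \<partial>M) / ?N\<^sup>2" by simp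
    ultimately have JI: "J \<le> I1 + I2" by linarith
    have one: "I \<le> C\<^sup>2 * (m / ?N\<^sup>2 + E + 2 * (sqrt (m * (A + B)) / ?N))"
      if "I \<le> C\<^sup>2 * (sqrt P + sqrt E)\<^sup>2" "0 \<le> P" "P \<le> m / ?N\<^sup>2" "0 \<le> E" "E \<le> A + B" for I P E
    proof -
      have "sqrt P * sqrt E \<le> sqrt (m / ?N\<^sup>2) * sqrt (A + B)"
        using that by (intro mult_mono) auto
      also have "\<dots> = sqrt (m * (A + B)) / ?N" by (simp add: real_sqrt_mult real_sqrt_divide del: of_nat_Suc)
      finally have "(sqrt P + sqrt E)\<^sup>2 \<le> m / ?N\<^sup>2 + E + 2 * (sqrt (m * (A + B)) / ?N)"
        using that by (simp add: power2_sum)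
      then have "C\<^sup>2 * (sqrt P + sqrt E)\<^sup>2 \<le> C\<^sup>2 * (m / ?N\<^sup>2 + E + 2 * (sqrt (m * (A + B)) / ?N))"
        by (intro mult_left_mono) auto
      with that(1) show ?thesis by linarith
    qed
    have "I1 \<le> C\<^sup>2 * (m / ?N\<^sup>2 + E1 + 2 * (sqrt (m * (A + B)) / ?N))"
      by (rule one[OF sq(2)[OF L1[of n], folded I1_def E1_def]]) (use P[OF L1 bd1] E0 Eb in auto)
    moreover have "I2 \<le> C\<^sup>2 * (m / ?N\<^sup>2 + E2 + 2 * (sqrt (m * (A + B)) / ?N))"
      by (rule one[OF sq(2)[OF L2[of n], folded I2_def E2_def]]) (use P[OF L2 bd2] E0 Eb in auto)
    ultimately have "J \<le> C\<^sup>2 * (m / ?N\<^sup>2 + E1 + 2 * (sqrt (m * (A + B)) / ?N)) + C\<^sup>2 * (m / ?N\<^sup>2 + E2 + 2 * (sqrt (m * (A + B)) / ?N))"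
      using JI by linarith
    also have "\<dots> = C\<^sup>2 * (2 * (m / ?N\<^sup>2) + (E1 + E2) + 4 * (sqrt (m * (A + B)) / ?N))"
      by (simp add: algebra_simps del: of_nat_Suc)
    finally show ?thesis unfolding E12 .
  qed
  have N0: "(\<lambda>n. 1 / real (Suc n)) \<longlonglongrightarrow> 0" by (rule LIMSEQ_Suc[OF lim_1_over_n])
  have "(\<lambda>n. C\<^sup>2 * (2 * (m * (1 / real (Suc n))\<^sup>2) + (A + B * (1 / real (Suc n))\<^sup>2) + 4 * (sqrt (m * (A + B)) * (1 / real (Suc n)))))
      \<longlonglongrightarrow> C\<^sup>2 * (2 * (m * 0\<^sup>2) + (A + B * 0\<^sup>2) + 4 * (sqrt (m * (A + B)) * 0))"
    by (intro tendsto_intros N0)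
  then have "(\<lambda>n. C\<^sup>2 * (2 * (m / (real (Suc n))\<^sup>2) + (A + B / (real (Suc n))\<^sup>2) + 4 * (sqrt (m * (A + B)) / real (Suc n)))) \<longlonglongrightarrow> C\<^sup>2 * A"
    by (simp add: power_divide del: of_nat_Suc)
  then have "J \<le> C\<^sup>2 * A" by (rule LIMSEQ_le_const) (use est in auto)
  then show "(\<integral>x. ?s x \<partial>M) \<le> C\<^sup>2 * (\<integral>x. ?e x \<partial>M)" by (simp add: J_def A_def)
qed

text \<open>The defect \<open>d = C\<^sup>2 |\<xi>|\<^sup>2 - |S \<xi>|\<^sup>2\<close> has
  non-negative integral against every \<open>\<zeta>\<^sup>2\<close>, by the oscillation argument,
  so it is non-negative almost everywhere. The function \<open>h\<close> is \<open>v d\<close>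
  extended by zero, which turns integrals against \<open>v dx\<close> into Lebesgue
  integrals.\<close>

lemma subunit_pointwise_single:
  fixes S :: "'m::finite \<Rightarrow> real^'n \<Rightarrow> real^'n"
  assumes S: "\<And>i. S i \<in> borel_measurable (lebesgue_on \<Omega>)" and C: "subunit_const \<Omega> v Q S C"
  shows "AE x in M. norm (svec S x \<xi>) \<le> C * nrm x \<xi>"
proof -
  define d where "d x = C\<^sup>2 * (nrm x \<xi>)\<^sup>2 - (norm (svec S x \<xi>))\<^sup>2" for x
  define h where "h x = indicator \<Omega> x *\<^sub>R (v x * d x)" for x
  have Sm[measurable]: "(\<lambda>x. svec S x \<xi>) \<in> borel_measurable M" by (rule svec_measurable[OF S]) simp
  have em[measurable]: "(\<lambda>x. nrm x \<xi>) \<in> borel_measurable M" by (rule nrm_measurable) simp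
  have dm[measurable]: "d \<in> borel_measurable M" unfolding d_def by measurable
  have hm: "h \<in> borel_measurable lebesgue"
  proof -
    have "(\<lambda>x. v x * d x) \<in> borel_measurable M" by measurable
    then have "(\<lambda>x. v x * d x) \<in> borel_measurable (lebesgue_on \<Omega>)" by (simp only: measurable_M_iff)
    then show ?thesis unfolding h_def by (subst (asm) borel_measurable_restrict_space_iff) auto
  qed
  have d_int: "integrable M (\<lambda>x. (\<zeta> x)\<^sup>2 * d x)" "0 \<le> (\<integral>x. (\<zeta> x)\<^sup>2 * d x \<partial>M)"
    if "\<zeta> \<in> Lip0 \<Omega>" "\<And>x. \<bar>\<zeta> x\<bar> \<le> 1" for \<zeta>
  proof -
    note t = subunit_test[OF S C that, of \<xi>]
    have eq: "(\<zeta> x)\<^sup>2 * d x = C\<^sup>2 * ((\<zeta> x)\<^sup>2 * (nrm x \<xi>)\<^sup>2) - (\<zeta> x)\<^sup>2 * (norm (svec S x \<xi>))\<^sup>2" for x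
      by (simp add: d_def algebra_simps)
    show "integrable M (\<lambda>x. (\<zeta> x)\<^sup>2 * d x)" unfolding eq using t(1,2) by simp
    show "0 \<le> (\<integral>x. (\<zeta> x)\<^sup>2 * d x \<partial>M)" unfolding eq using t by simp
  qed
  have Lip0I: "\<zeta> \<in> Lip0 \<Omega>"
    if "L-lipschitz_on UNIV \<zeta>" "compact T" "T \<subseteq> \<Omega>" "\<And>x. x \<notin> T \<Longrightarrow> \<zeta> x = 0" for \<zeta> L T
    by (rule Lip_loc_compact_support_imp_Lip0[OF lipschitz_imp_Lip_loc[OF that(1)] open_\<Omega> bounded_\<Omega> that(2,3)]) (use that(4) in auto)
  have conv: "integrable lebesgue (\<lambda>x. (\<zeta> x)\<^sup>2 * h x) \<and> (\<integral>x. (\<zeta> x)\<^sup>2 * h x \<partial>lebesgue) = (\<integral>x. (\<zeta> x)\<^sup>2 * d x \<partial>M)"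
    if "\<zeta> \<in> Lip0 \<Omega>" "\<And>x. \<bar>\<zeta> x\<bar> \<le> 1" for \<zeta>
  proof -
    note [measurable] = Lip0_L2(1)[OF that(1)]
    have m: "(\<lambda>x. (\<zeta> x)\<^sup>2 * d x) \<in> borel_measurable M" by measurable
    have eq: "(\<zeta> x)\<^sup>2 * h x = indicator \<Omega> x *\<^sub>R (v x * ((\<zeta> x)\<^sup>2 * d x))" for x by (simp add: h_def)
    have "integrable (lebesgue_on \<Omega>) (\<lambda>x. v x * ((\<zeta> x)\<^sup>2 * d x))"
      using d_int(1)[OF that] m by (simp add: integrable_M_iff)
    then have "integrable lebesgue (\<lambda>x. (\<zeta> x)\<^sup>2 * h x)"
      unfolding eq by (subst (asm) integrable_restrict_space) auto
    moreover have "(\<integral>x. (\<zeta> x)\<^sup>2 * h x \<partial>lebesgue) = (\<integral>x. (\<zeta> x)\<^sup>2 * d x \<partial>M)"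
      unfolding eq integral_M[OF m] by (subst integral_restrict_space) auto
    ultimately show ?thesis by blast
  qed
  have "AE x in lebesgue. x \<in> \<Omega> \<longrightarrow> 0 \<le> h x"
  proof (rule nonneg_AE_if_test_nonneg[OF open_\<Omega> hm])
    fix K assume K: "compact K" "K \<subseteq> \<Omega>"
    obtain \<zeta> L T where \<zeta>: "L-lipschitz_on UNIV \<zeta>" "\<And>x. 0 \<le> \<zeta> x \<and> \<zeta> x \<le> 1" "compact T" "T \<subseteq> \<Omega>"
      "\<And>x. x \<notin> T \<Longrightarrow> \<zeta> x = (0::real)" "\<And>x. x \<in> K \<Longrightarrow> \<zeta> x = 1"
      using compact_Lipschitz_cutoff[OF K open_\<Omega>] by metis
    have "integrable lebesgue (\<lambda>x. (\<zeta> x)\<^sup>2 * h x)"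
      using conv[OF Lip0I[OF \<zeta>(1,3,4,5)]] \<zeta>(2) by simp
    then have "set_integrable lebesgue K (\<lambda>x. (\<zeta> x)\<^sup>2 * h x)"
      unfolding set_integrable_def using K(1) by (intro integrable_mult_indicator) (auto simp: compact_imp_closed)
    moreover have "indicator K x *\<^sub>R ((\<zeta> x)\<^sup>2 * h x) = indicator K x *\<^sub>R h x" for x
      using \<zeta>(6)[of x] by (simp add: indicator_def)
    ultimately show "set_integrable lebesgue K h" unfolding set_integrable_def by (simp only:)
  next
    fix \<zeta> :: "real^'n \<Rightarrow> real" and L T
    assume \<zeta>: "L-lipschitz_on UNIV \<zeta>" "\<And>x. 0 \<le> \<zeta> x \<and> \<zeta> x \<le> 1" "compact T" "T \<subseteq> \<Omega>" "\<And>x. x \<notin> T \<Longrightarrow> \<zeta> x = 0"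
    have l: "\<zeta> \<in> Lip0 \<Omega>" by (rule Lip0I[OF \<zeta>(1,3,4,5)])
    have b: "\<bar>\<zeta> x\<bar> \<le> 1" for x using \<zeta>(2)[of x] by simp
    show "0 \<le> (\<integral>x. (\<zeta> x)\<^sup>2 * h x \<partial>lebesgue)" using conv[OF l b] d_int(2)[OF l b] by simp
  qed
  then have "AE x in M. 0 \<le> h x" by (rule AE_MI)
  with AE_M_space show ?thesis
  proof eventually_elim
    case (elim x)
    then have "0 \<le> d x" by (simp add: h_def zero_le_mult_iff)
    then have "(norm (svec S x \<xi>))\<^sup>2 \<le> (C * nrm x \<xi>)\<^sup>2" by (simp add: d_def power_mult_distrib)
    moreover have "0 \<le> C * nrm x \<xi>" using C elim by (simp add: subunit_const_def)
    ultimately show ?case by (rule power2_le_imp_le)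
  qed
qed

text \<open>The exceptional set may depend on \<open>\<xi>\<close>. A countable dense set of vectors
  has a common one, and both sides are continuous in \<open>\<xi>\<close>; only after this may
  \<open>\<xi>\<close> depend on \<open>x\<close>, as \<open>\<nabla>u(x)\<close> does.\<close>

lemma subunit_pointwise:
  fixes S :: "'m::finite \<Rightarrow> real^'n \<Rightarrow> real^'n"
  assumes S: "\<And>i. S i \<in> borel_measurable (lebesgue_on \<Omega>)" and C: "subunit_const \<Omega> v Q S C"
  shows "AE x in M. \<forall>\<xi>. norm (svec S x \<xi>) \<le> C * nrm x \<xi>"
proof -
  obtain D :: "(real^'n) set" where D: "countable D" "\<And>X. open X \<Longrightarrow> X \<noteq> {} \<Longrightarrow> \<exists>d\<in>D. d \<in> X"
    using countable_dense_setE by blast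
  have "AE x in M. \<forall>\<xi>\<in>D. norm (svec S x \<xi>) \<le> C * nrm x \<xi>"
    by (intro AE_ball_countable[THEN iffD2] D(1) ballI subunit_pointwise_single[OF S C])
  with AE_M_space show ?thesis
  proof eventually_elim
    case (elim x)
    then have "sqrt (v x) \<noteq> 0" by simp
    then have "open {\<xi>. C * nrm x \<xi> < norm (svec S x \<xi>)}"
      unfolding nrm_def svec_def by (intro open_Collect_less continuous_intros matrix_vector_mult_linear_continuous_on) auto
    then have "{\<xi>. C * nrm x \<xi> < norm (svec S x \<xi>)} = {}" using D(2) elim by fastforce
    then show ?case by (auto simp: not_less)
  qed
qed

text \<open>In the first two alternatives any joint constant will do; the root of the sum of the
  squares of the individual constants is one.\<close>

lemma subunit_imp_subunit_const:
  fixes S :: "'m::finite \<Rightarrow> real^'n \<Rightarrow> real^'n"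
  assumes S: "\<And>i. subunit \<Omega> v Q (S i)"
  obtains C where "subunit_const \<Omega> v Q S C"
proof -
  have "\<forall>i. \<exists>C>0. \<forall>\<phi>\<in>Lip0 \<Omega>. vf (S i) (grad \<phi>) \<in> Lp M 2 \<and> Lp_norm M 2 (vf (S i) (grad \<phi>)) \<le> C * QH1_norm \<Omega> v Q \<phi>"
    using S by (auto simp: subunit_def)
  then obtain C where C: "\<And>i. C i > 0" "\<And>i \<phi>. \<phi> \<in> Lip0 \<Omega> \<Longrightarrow> vf (S i) (grad \<phi>) \<in> Lp M 2"
    "\<And>i \<phi>. \<phi> \<in> Lip0 \<Omega> \<Longrightarrow> Lp_norm M 2 (vf (S i) (grad \<phi>)) \<le> C i * QH1_norm \<Omega> v Q \<phi>"
    by metis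
  define C' where "C' = sqrt (\<Sum>i\<in>UNIV. (C i)\<^sup>2)"
  have "subunit_const \<Omega> v Q S C'"
    unfolding subunit_const_def
  proof (intro conjI ballI)
    have "0 < (\<Sum>i\<in>UNIV. (C i)\<^sup>2)" using C(1) by (intro sum_pos zero_less_power) auto
    then show "0 < C'" by (simp add: C'_def)
    fix \<phi> assume \<phi>: "\<phi> \<in> Lip0 \<Omega>"
    have eq: "(norm (vfs S (grad \<phi>) x))\<^sup>2 = (\<Sum>i\<in>UNIV. (vf (S i) (grad \<phi>) x)\<^sup>2)" for x
      unfolding power2_norm_eq_inner vfs_def by (simp add: inner_vec_def power2_eq_square)
    have int: "integrable M (\<lambda>x. (vf (S i) (grad \<phi>) x)\<^sup>2)" for i
      using C(2)[OF \<phi>, of i] by (simp add: Lp_2_iff)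
    have "S i \<in> borel_measurable (lebesgue_on \<Omega>)" for i using S[of i] by (simp add: subunit_def)
    then have "vfs S (grad \<phi>) \<in> borel_measurable M"
      unfolding vfs_eq_svec[abs_def] using Lip0_L2(2)[OF \<phi>] by (rule svec_measurable)
    then show "vfs S (grad \<phi>) \<in> Lp M 2" unfolding Lp_2_iff eq using int by simp
    have q0: "0 \<le> QH1_norm \<Omega> v Q \<phi>" by (simp add: QH1_norm_def Lp_norm_def QL2_norm_def)
    have "(\<integral>x. (norm (vfs S (grad \<phi>) x))\<^sup>2 \<partial>M) = (\<Sum>i\<in>UNIV. \<integral>x. (vf (S i) (grad \<phi>) x)\<^sup>2 \<partial>M)"
      unfolding eq using int by simp
    also have "\<dots> \<le> (\<Sum>i\<in>UNIV. (C i * QH1_norm \<Omega> v Q \<phi>)\<^sup>2)"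
    proof (rule sum_mono)
      fix i
      have "sqrt (\<integral>x. (vf (S i) (grad \<phi>) x)\<^sup>2 \<partial>M) \<le> C i * QH1_norm \<Omega> v Q \<phi>"
        using C(3)[OF \<phi>, of i] by (simp add: Lp_norm_2)
      then have "(sqrt (\<integral>x. (vf (S i) (grad \<phi>) x)\<^sup>2 \<partial>M))\<^sup>2 \<le> (C i * QH1_norm \<Omega> v Q \<phi>)\<^sup>2"
        by (intro power_mono) auto
      then show "(\<integral>x. (vf (S i) (grad \<phi>) x)\<^sup>2 \<partial>M) \<le> (C i * QH1_norm \<Omega> v Q \<phi>)\<^sup>2" by simp
    qed
    also have "\<dots> = (\<Sum>i\<in>UNIV. (C i)\<^sup>2) * (QH1_norm \<Omega> v Q \<phi>)\<^sup>2"
      by (simp add: power_mult_distrib sum_distrib_right)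
    finally have "sqrt (\<integral>x. (norm (vfs S (grad \<phi>) x))\<^sup>2 \<partial>M) \<le> sqrt ((\<Sum>i\<in>UNIV. (C i)\<^sup>2) * (QH1_norm \<Omega> v Q \<phi>)\<^sup>2)"
      by (rule real_sqrt_le_mono)
    then show "Lp_norm M 2 (vfs S (grad \<phi>)) \<le> C' * QH1_norm \<Omega> v Q \<phi>"
      using q0 by (simp add: Lp_norm_2 real_sqrt_mult C'_def)
  qed
  then show ?thesis by (rule that)
qed

end

section \<open>Composition with functions in the degenerate Sobolev space\<close>

lemma nn_integral_le_if_AE_tendsto:
  fixes f :: "nat \<Rightarrow> 'a \<Rightarrow> ennreal"
  assumes [measurable]: "\<And>n. f n \<in> borel_measurable M" "f' \<in> borel_measurable M"
    and lim: "AE x in M. (\<lambda>n. f n x) \<longlonglongrightarrow> f' x"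
    and le: "\<And>n. (\<integral>\<^sup>+x. f n x \<partial>M) \<le> ennreal (e n)" and e: "e \<longlonglongrightarrow> E"
  shows "(\<integral>\<^sup>+x. f' x \<partial>M) \<le> ennreal E"
proof -
  have "(\<integral>\<^sup>+x. f' x \<partial>M) = (\<integral>\<^sup>+x. liminf (\<lambda>n. f n x) \<partial>M)"
    by (rule nn_integral_cong_AE) (use lim in eventually_elim, auto simp: lim_imp_Liminf)
  also have "\<dots> \<le> liminf (\<lambda>n. \<integral>\<^sup>+x. f n x \<partial>M)" by (rule nn_integral_liminf) measurable
  also have "\<dots> \<le> liminf (\<lambda>n. ennreal (e n))" by (rule Liminf_mono) (use le in simp)
  also have "\<dots> = ennreal E" by (rule lim_imp_Liminf) (use e in auto)
  finally show ?thesis .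
qed

text \<open>The gradient component \<open>g\<close> is an independent datum, since \<open>u\<close>
  does not determine it; its relation to \<open>u\<close> is expressed only through the sequence
  \<open>U\<close>.\<close>

locale approximated_pair = degenerate_form \<Omega> v Q c
  for \<Omega> :: "(real^'n) set" and v :: "real^'n \<Rightarrow> real" and Q :: "real^'n \<Rightarrow> real^'n^'n" and c :: real +
  fixes u :: "real^'n \<Rightarrow> real" and g :: "real^'n \<Rightarrow> real^'n" and U :: "nat \<Rightarrow> real^'n \<Rightarrow> real"
  assumes u_measurable [measurable]: "u \<in> borel_measurable M" and u_L2: "integrable M (\<lambda>x. (u x)\<^sup>2)"
    and g_measurable [measurable]: "g \<in> borel_measurable M" and g_L2: "integrable M (\<lambda>x. (nrm x (g x))\<^sup>2)"
    and U_Lip: "\<And>n. U n \<in> Lip_loc \<Omega>"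
    and U_L2: "L2_null M (\<lambda>n x. U n x - u x)"
    and U_grad: "L2_null M (\<lambda>n x. nrm x (grad (U n) x - g x))"
    and U_AE: "AE x in M. (\<lambda>n. U n x) \<longlonglongrightarrow> u x"
begin

lemma U_measurable [measurable]: "U n \<in> borel_measurable M" "grad (U n) \<in> borel_measurable M"
  using U_Lip by (auto intro: Lip_loc_measurable grad_measurable_M)

lemma nrm_g_measurable [measurable]: "(\<lambda>x. nrm x (g x)) \<in> borel_measurable M"
  by measurable

text \<open>The gradient of \<open>\<psi>(u) \<Theta>\<close> by the product rule, with \<open>\<rho> = \<psi>'\<close>.\<close>

definition pgrad :: "(real \<Rightarrow> real) \<Rightarrow> (real \<Rightarrow> real) \<Rightarrow> (real^'n \<Rightarrow> real) \<Rightarrow> real^'n \<Rightarrow> real^'n" where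
  "pgrad \<psi> \<rho> \<Theta> x = (\<rho> (u x) * \<Theta> x) *\<^sub>R g x + \<psi> (u x) *\<^sub>R grad \<Theta> x"

context
  fixes \<psi> \<rho> :: "real \<Rightarrow> real" and \<Theta> :: "real^'n \<Rightarrow> real" and B :: real
  assumes \<psi>: "\<And>s. (\<psi> has_real_derivative \<rho> s) (at s)" and \<rho>_cont: "continuous_on UNIV \<rho>"
    and \<rho>_le: "\<And>s. \<bar>\<rho> s\<bar> \<le> B" and \<Theta>: "\<Theta> \<in> Lip0 \<Omega>"
begin

lemma \<psi>_Lipschitz: "B-lipschitz_on UNIV \<psi>"
  by (rule lipschitz_if_derivative_bounded[OF \<psi> \<rho>_le])

lemma B_nonneg: "0 \<le> B"
  using \<rho>_le[of 0] by linarith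

lemma \<psi>\<rho>_measurable [measurable]: "\<psi> \<in> borel_measurable borel" "\<rho> \<in> borel_measurable borel"
  using lipschitz_on_continuous_on[OF \<psi>_Lipschitz] \<rho>_cont by (auto intro: borel_measurable_continuous_onI)

lemma \<Theta>_measurable [measurable]: "\<Theta> \<in> borel_measurable M" "grad \<Theta> \<in> borel_measurable M"
  using Lip0_L2(1,2)[OF \<Theta>] .

lemma product_Lip0: "(\<lambda>x. \<psi> (U n x) * \<Theta> x) \<in> Lip0 \<Omega>"
  using Lip0_mult[OF \<Theta> Lip_loc_compose[OF \<psi>_Lipschitz U_Lip] open_\<Omega> bounded_\<Omega>] by (simp add: mult.commute)

lemma product_grad: "AE x in M. grad (\<lambda>x. \<psi> (U n x) * \<Theta> x) x = (\<rho> (U n x) * \<Theta> x) *\<^sub>R grad (U n) x + \<psi> (U n x) *\<^sub>R grad \<Theta> x"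
  using AE_MI[OF grad_mult_AE[OF Lip_loc_compose[OF \<psi>_Lipschitz U_Lip[of n]] Lip0_imp_Lip_loc[OF \<Theta>] open_\<Omega>]]
    AE_MI[OF grad_compose_AE[OF U_Lip[of n] \<psi> open_\<Omega>]]
  by eventually_elim (simp add: mult.commute)

lemma product_AE: "AE x in M. (\<lambda>n. \<psi> (U n x) * \<Theta> x) \<longlonglongrightarrow> \<psi> (u x) * \<Theta> x"
  using U_AE
proof eventually_elim
  case (elim x)
  have "continuous_on UNIV \<psi>" by (rule lipschitz_on_continuous_on[OF \<psi>_Lipschitz])
  from continuous_on_tendsto_compose[OF this elim] show ?case by (intro tendsto_mult tendsto_const) simp
qed

lemma \<rho>_AE: "AE x in M. (\<lambda>n. \<rho> (U n x)) \<longlonglongrightarrow> \<rho> (u x)"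
  using U_AE
proof eventually_elim
  case (elim x)
  from continuous_on_tendsto_compose[OF \<rho>_cont elim] show ?case by simp
qed

lemma \<psi>_diff: "\<bar>\<psi> s - \<psi> t\<bar> \<le> B * \<bar>s - t\<bar>"
  using lipschitz_onD[OF \<psi>_Lipschitz, of s t] by (simp add: dist_real_def)

lemma product_L2: "L2_null M (\<lambda>n x. \<psi> (U n x) * \<Theta> x - \<psi> (u x) * \<Theta> x)"
proof -
  obtain T where T: "0 < T" "\<And>x. x \<in> \<Omega> \<Longrightarrow> \<bar>\<Theta> x\<bar> \<le> T" by (rule Lip0_bounded[OF \<Theta> open_\<Omega>]) blast
  show ?thesis
  proof (rule L2_null_bound[OF U_L2, where K = "B * T"])
    have "\<bar>\<psi> (U n x) * \<Theta> x - \<psi> (u x) * \<Theta> x\<bar> \<le> B * T * \<bar>U n x - u x\<bar>" if "x \<in> \<Omega>" for n x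
    proof -
      have "\<bar>\<psi> (U n x) * \<Theta> x - \<psi> (u x) * \<Theta> x\<bar> = \<bar>\<psi> (U n x) - \<psi> (u x)\<bar> * \<bar>\<Theta> x\<bar>"
        by (simp add: left_diff_distrib[symmetric] abs_mult)
      also have "\<dots> \<le> (B * \<bar>U n x - u x\<bar>) * T"
        using \<psi>_diff T that B_nonneg by (intro mult_mono) auto
      finally show ?thesis by (simp add: mult.assoc mult.commute mult.left_commute)
    qed
    then show "AE x in M. \<bar>\<psi> (U n x) * \<Theta> x - \<psi> (u x) * \<Theta> x\<bar> \<le> B * T * \<bar>U n x - u x\<bar>" for n
      by (intro AE_I2) simp
  qed measurable
qed

text \<open>Write the difference as \<open>\<rho> (U n) (\<nabla>U n - g) + (\<rho> (U n) - \<rho>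
  (u)) g\<close>. The first part is a bounded multiple of a null sequence; the second is dominated
  by \<open>2 B |g|\<close> and tends to zero because \<open>\<rho>\<close> is continuous. A jump of
  \<open>\<rho>\<close> at a level that \<open>u\<close> attains on a set of positive measure could
  destroy this.\<close>

lemma \<rho>_grad_L2: "L2_null M (\<lambda>n x. nrm x (\<rho> (U n x) *\<^sub>R grad (U n) x - \<rho> (u x) *\<^sub>R g x))"
proof -
  have 1: "L2_null M (\<lambda>n x. B * nrm x (grad (U n) x - g x))"
    by (rule L2_null_bound[OF U_grad, where K = B]) (use B_nonneg in \<open>auto simp: abs_mult\<close>)
  have 2: "L2_null M (\<lambda>n x. \<bar>\<rho> (U n x) - \<rho> (u x)\<bar> * nrm x (g x))"
  proof (rule L2_null_dominated[where w = "\<lambda>x. (2 * B) * nrm x (g x)"])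
    show "AE x in M. (\<lambda>n. \<bar>\<rho> (U n x) - \<rho> (u x)\<bar> * nrm x (g x)) \<longlonglongrightarrow> 0"
      using \<rho>_AE by eventually_elim (auto intro!: tendsto_mult_left_zero tendsto_rabs_zero simp: LIM_zero_iff)
    have "\<bar>\<rho> (U n x) - \<rho> (u x)\<bar> \<le> 2 * B" for n x
      using \<rho>_le[of "U n x"] \<rho>_le[of "u x"] by linarith
    then show "AE x in M. \<bar>\<bar>\<rho> (U n x) - \<rho> (u x)\<bar> * nrm x (g x)\<bar> \<le> (2 * B) * nrm x (g x)" for n
      by (intro AE_I2) (simp add: abs_mult mult_right_mono)
    show "integrable M (\<lambda>x. ((2 * B) * nrm x (g x))\<^sup>2)" using g_L2 by (simp add: power_mult_distrib)
  qed measurable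
  show ?thesis
  proof (rule L2_null_bound[OF L2_null_add[OF 1 2], where K = 1])
    fix n
    have "nrm x (\<rho> (U n x) *\<^sub>R grad (U n) x - \<rho> (u x) *\<^sub>R g x) \<le> B * nrm x (grad (U n) x - g x) + \<bar>\<rho> (U n x) - \<rho> (u x)\<bar> * nrm x (g x)"
      if x: "x \<in> \<Omega>" for x
    proof -
      have "\<rho> (U n x) *\<^sub>R grad (U n) x - \<rho> (u x) *\<^sub>R g x = \<rho> (U n x) *\<^sub>R (grad (U n) x - g x) + (\<rho> (U n x) - \<rho> (u x)) *\<^sub>R g x"
        by (simp add: algebra_simps)
      then have "nrm x (\<rho> (U n x) *\<^sub>R grad (U n) x - \<rho> (u x) *\<^sub>R g x)
          \<le> \<bar>\<rho> (U n x)\<bar> * nrm x (grad (U n) x - g x) + \<bar>\<rho> (U n x) - \<rho> (u x)\<bar> * nrm x (g x)"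
        using nrm_add[OF x] by (metis nrm_scale)
      also have "\<dots> \<le> B * nrm x (grad (U n) x - g x) + \<bar>\<rho> (U n x) - \<rho> (u x)\<bar> * nrm x (g x)"
        using \<rho>_le x by (intro add_right_mono mult_right_mono) auto
      finally show ?thesis .
    qed
    then show "AE x in M. \<bar>nrm x (\<rho> (U n x) *\<^sub>R grad (U n) x - \<rho> (u x) *\<^sub>R g x)\<bar>
        \<le> 1 * \<bar>B * nrm x (grad (U n) x - g x) + \<bar>\<rho> (U n x) - \<rho> (u x)\<bar> * nrm x (g x)\<bar>"
      by (intro AE_I2) (auto intro: order_trans[OF _ abs_ge_self])
  qed measurable
qed

lemma pgrad_measurable [measurable]: "pgrad \<psi> \<rho> \<Theta> \<in> borel_measurable M"
  unfolding pgrad_def by measurable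

text \<open>Identifies \<open>pgrad\<close> as the gradient component of
  \<open>\<psi>(u) \<Theta>\<close>: the approximants \<open>\<psi>(U n) \<Theta>\<close> are
  genuine \<open>Lip0\<close> functions, so inequalities assumed on \<open>Lip0\<close> can be
  carried over.\<close>

lemma product_grad_L2: "L2_null M (\<lambda>n x. nrm x (grad (\<lambda>x. \<psi> (U n x) * \<Theta> x) x - pgrad \<psi> \<rho> \<Theta> x))"
proof -
  obtain T where T: "0 < T" "\<And>x. x \<in> \<Omega> \<Longrightarrow> \<bar>\<Theta> x\<bar> \<le> T" by (rule Lip0_bounded[OF \<Theta> open_\<Omega>]) blast
  obtain L where L: "0 \<le> L" "\<And>x. x \<in> \<Omega> \<Longrightarrow> norm (grad \<Theta> x) \<le> L" by (rule Lip0_grad_bounded[OF \<Theta> open_\<Omega>]) blast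
  let ?c = "sqrt (max c 0)"
  have 1: "L2_null M (\<lambda>n x. T * nrm x (\<rho> (U n x) *\<^sub>R grad (U n) x - \<rho> (u x) *\<^sub>R g x))"
    by (rule L2_null_bound[OF \<rho>_grad_L2, where K = T]) (use T(1) in \<open>auto simp: abs_mult\<close>)
  have 2: "L2_null M (\<lambda>n x. (B * (?c * L)) * \<bar>U n x - u x\<bar>)"
    by (rule L2_null_bound[OF U_L2, where K = "B * (?c * L)"]) (use B_nonneg L(1) in \<open>auto simp: abs_mult\<close>)
  show ?thesis
  proof (rule L2_null_bound[OF L2_null_add[OF 1 2], where K = 1])
    fix n
    have [measurable]: "grad (\<lambda>x. \<psi> (U n x) * \<Theta> x) \<in> borel_measurable M"
      by (rule Lip0_L2(2)[OF product_Lip0])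
    show "(\<lambda>x. nrm x (grad (\<lambda>x. \<psi> (U n x) * \<Theta> x) x - pgrad \<psi> \<rho> \<Theta> x)) \<in> borel_measurable M" by measurable
    show "AE x in M. \<bar>nrm x (grad (\<lambda>x. \<psi> (U n x) * \<Theta> x) x - pgrad \<psi> \<rho> \<Theta> x)\<bar>
        \<le> 1 * \<bar>T * nrm x (\<rho> (U n x) *\<^sub>R grad (U n) x - \<rho> (u x) *\<^sub>R g x) + (B * (?c * L)) * \<bar>U n x - u x\<bar>\<bar>"
      using product_grad[of n] AE_M_space
    proof eventually_elim
      case (elim x)
      then have x: "x \<in> \<Omega>" by simp
      have "grad (\<lambda>x. \<psi> (U n x) * \<Theta> x) x - pgrad \<psi> \<rho> \<Theta> x
          = \<Theta> x *\<^sub>R (\<rho> (U n x) *\<^sub>R grad (U n) x - \<rho> (u x) *\<^sub>R g x) + (\<psi> (U n x) - \<psi> (u x)) *\<^sub>R grad \<Theta> x"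
        unfolding elim(1) pgrad_def by (simp add: algebra_simps)
      then have "nrm x (grad (\<lambda>x. \<psi> (U n x) * \<Theta> x) x - pgrad \<psi> \<rho> \<Theta> x)
          \<le> \<bar>\<Theta> x\<bar> * nrm x (\<rho> (U n x) *\<^sub>R grad (U n) x - \<rho> (u x) *\<^sub>R g x) + \<bar>\<psi> (U n x) - \<psi> (u x)\<bar> * nrm x (grad \<Theta> x)"
        using nrm_add[OF x] by (metis nrm_scale)
      also have "\<dots> \<le> T * nrm x (\<rho> (U n x) *\<^sub>R grad (U n) x - \<rho> (u x) *\<^sub>R g x) + (B * \<bar>U n x - u x\<bar>) * (?c * L)"
      proof (intro add_mono mult_mono)
        show "nrm x (grad \<Theta> x) \<le> ?c * L"
          using nrm_le[OF x, of "grad \<Theta> x"] mult_left_mono[OF L(2)[OF x], of ?c] by simp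
      qed (use T x \<psi>_diff B_nonneg in auto)
      finally show ?case using x by (simp add: mult.assoc mult.commute mult.left_commute)
    qed
  qed
qed

lemma pgrad_L2: "integrable M (\<lambda>x. (nrm x (pgrad \<psi> \<rho> \<Theta> x))\<^sup>2)"
proof (rule Bochner_Integration.integrable_bound)
  let ?a = "\<lambda>x. nrm x (grad (\<lambda>x. \<psi> (U 0 x) * \<Theta> x) x - pgrad \<psi> \<rho> \<Theta> x)"
  let ?b = "\<lambda>x. nrm x (grad (\<lambda>x. \<psi> (U 0 x) * \<Theta> x) x)"
  have [measurable]: "grad (\<lambda>x. \<psi> (U 0 x) * \<Theta> x) \<in> borel_measurable M"
    by (rule Lip0_L2(2)[OF product_Lip0])
  show "integrable M (\<lambda>x. (?a x + ?b x)\<^sup>2)"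
    by (rule integrable_square_add[OF _ _ L2_nullD(2)[OF product_grad_L2] Lip0_L2(4)[OF product_Lip0]]) measurable
  have "nrm x (pgrad \<psi> \<rho> \<Theta> x) \<le> ?a x + ?b x" if "x \<in> \<Omega>" for x
    using nrm_diff[OF that, of "grad (\<lambda>x. \<psi> (U 0 x) * \<Theta> x) x" "pgrad \<psi> \<rho> \<Theta> x"] by linarith
  then show "AE x in M. norm ((nrm x (pgrad \<psi> \<rho> \<Theta> x))\<^sup>2) \<le> norm ((?a x + ?b x)\<^sup>2)"
    by (intro AE_I2) (simp add: power_mono)
qed measurable

text \<open>Fatou on the left, convergence of energies on the right. The weight
  \<open>\<kappa>\<close> is kept general: in the applications it is \<open>|G|\<^sup>2\<close>, the
  constant \<open>1\<close>, or \<open>K\<^sup>2\<close> restricted to a set.\<close>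

lemma product_Sobolev:
  fixes \<kappa> :: "real^'n \<Rightarrow> real"
  assumes [measurable]: "\<kappa> \<in> borel_measurable M"
    and Sob: "\<And>\<phi>. \<phi> \<in> Lip0 \<Omega> \<Longrightarrow> (\<integral>\<^sup>+x. ennreal (\<kappa> x * (\<phi> x)\<^sup>2) \<partial>M) \<le> ennreal (\<Lambda> * (\<integral>x. (nrm x (grad \<phi> x))\<^sup>2 \<partial>M))"
  shows "(\<integral>\<^sup>+x. ennreal (\<kappa> x * (\<psi> (u x) * \<Theta> x)\<^sup>2) \<partial>M) \<le> ennreal (\<Lambda> * (\<integral>x. (nrm x (pgrad \<psi> \<rho> \<Theta> x))\<^sup>2 \<partial>M))"
proof (rule nn_integral_le_if_AE_tendsto)
  have [measurable]: "grad (\<lambda>x. \<psi> (U n x) * \<Theta> x) \<in> borel_measurable M" for n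
    by (rule Lip0_L2(2)[OF product_Lip0])
  show "AE x in M. (\<lambda>n. ennreal (\<kappa> x * (\<psi> (U n x) * \<Theta> x)\<^sup>2)) \<longlonglongrightarrow> ennreal (\<kappa> x * (\<psi> (u x) * \<Theta> x)\<^sup>2)"
    using product_AE by eventually_elim (rule tendsto_ennrealI[OF tendsto_mult[OF tendsto_const tendsto_power]])
  show "(\<integral>\<^sup>+x. ennreal (\<kappa> x * (\<psi> (U n x) * \<Theta> x)\<^sup>2) \<partial>M) \<le> ennreal (\<Lambda> * (\<integral>x. (nrm x (grad (\<lambda>x. \<psi> (U n x) * \<Theta> x) x))\<^sup>2 \<partial>M))" for n
    by (rule Sob[OF product_Lip0])
  have "(\<lambda>n. \<integral>x. (nrm x (grad (\<lambda>x. \<psi> (U n x) * \<Theta> x) x))\<^sup>2 \<partial>M) \<longlonglongrightarrow> (\<integral>x. (nrm x (pgrad \<psi> \<rho> \<Theta> x))\<^sup>2 \<partial>M)"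
  proof (rule L2_null_energy_tendsto(2)[OF product_grad_L2 _ _ pgrad_L2])
    show "AE x in M. \<bar>nrm x (grad (\<lambda>x. \<psi> (U n x) * \<Theta> x) x) - nrm x (pgrad \<psi> \<rho> \<Theta> x)\<bar>
        \<le> \<bar>nrm x (grad (\<lambda>x. \<psi> (U n x) * \<Theta> x) x - pgrad \<psi> \<rho> \<Theta> x)\<bar>" for n
      by (intro AE_I2) (simp add: nrm_diff)
  qed measurable
  then show "(\<lambda>n. \<Lambda> * (\<integral>x. (nrm x (grad (\<lambda>x. \<psi> (U n x) * \<Theta> x) x))\<^sup>2 \<partial>M)) \<longlonglongrightarrow> \<Lambda> * (\<integral>x. (nrm x (pgrad \<psi> \<rho> \<Theta> x))\<^sup>2 \<partial>M)"
    by (intro tendsto_intros)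
qed measurable

end

declare \<psi>\<rho>_measurable [measurable del] \<Theta>_measurable [measurable del] pgrad_measurable [measurable del]

end

section \<open>Subsolutions\<close>

locale weak_subsolution = approximated_pair \<Omega> v Q c u g U
  for \<Omega> :: "(real^'n) set" and v :: "real^'n \<Rightarrow> real" and Q :: "real^'n \<Rightarrow> real^'n^'n" and c :: real
    and u :: "real^'n \<Rightarrow> real" and g :: "real^'n \<Rightarrow> real^'n" and U :: "nat \<Rightarrow> real^'n \<Rightarrow> real" +
  fixes F :: "real^'n \<Rightarrow> real" and G H :: "real^'n \<Rightarrow> real^'m" and R S :: "'m::finite \<Rightarrow> real^'n \<Rightarrow> real^'n"
    and C \<Lambda> k :: real and V :: "nat \<Rightarrow> real^'n \<Rightarrow> real"
  assumes F_measurable [measurable]: "F \<in> borel_measurable M" and F_L2: "integrable M (\<lambda>x. (F x)\<^sup>2)"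
    and G_measurable [measurable]: "G \<in> borel_measurable M" and G_L2: "integrable M (\<lambda>x. (norm (G x))\<^sup>2)"
    and H_measurable [measurable]: "H \<in> borel_measurable M" and H_L2: "integrable M (\<lambda>x. (norm (H x))\<^sup>2)"
    and R_measurable: "\<And>i. R i \<in> borel_measurable (lebesgue_on \<Omega>)"
    and S_measurable: "\<And>i. S i \<in> borel_measurable (lebesgue_on \<Omega>)"
    and C_nonneg: "0 \<le> C"
    and R_le: "AE x in M. \<forall>\<xi>. norm (svec R x \<xi>) \<le> C * nrm x \<xi>"
    and S_le: "AE x in M. \<forall>\<xi>. norm (svec S x \<xi>) \<le> C * nrm x \<xi>"
    and compat: "\<And>\<phi>. \<phi> \<in> Lip0 \<Omega> \<Longrightarrow> (\<And>x. x \<in> \<Omega> \<Longrightarrow> 0 \<le> \<phi> x) \<Longrightarrow>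
          0 \<le> (\<integral>x. G x \<bullet> vfs S (grad \<phi>) x + F x * \<phi> x \<partial>M)"
    and weak_le: "weak_le0 \<Omega> v Q F G H R S (u, g)"
    and Sobolev_G: "\<And>\<phi>. \<phi> \<in> Lip0 \<Omega> \<Longrightarrow>
          (\<integral>\<^sup>+x. ennreal ((norm (G x))\<^sup>2 * (\<phi> x)\<^sup>2) \<partial>M) \<le> ennreal (\<Lambda> * (\<integral>x. (nrm x (grad \<phi> x))\<^sup>2 \<partial>M))"
    and k_nonneg: "0 \<le> k"
    and V_Lip0: "\<And>n. V n \<in> Lip0 \<Omega>"
    and V_grad: "L2_null M (\<lambda>n x. nrm x (grad (V n) x - (if u x > k then g x else 0)))"
    and V_AE: "AE x in M. (\<lambda>n. V n x) \<longlonglongrightarrow> max (u x - k) 0"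
begin

lemma svec_measurable_RS [measurable]:
  "h \<in> borel_measurable M \<Longrightarrow> (\<lambda>x. svec R x (h x)) \<in> borel_measurable M"
  "h \<in> borel_measurable M \<Longrightarrow> (\<lambda>x. svec S x (h x)) \<in> borel_measurable M"
  using svec_measurable R_measurable S_measurable by auto

lemma inner_S_le: "AE x in M. \<forall>\<xi> y. \<bar>y \<bullet> svec S x \<xi>\<bar> \<le> norm y * (C * nrm x \<xi>)"
  using S_le
proof eventually_elim
  case (elim x)
  then show ?case
    by (intro allI order_trans[OF Cauchy_Schwarz_ineq2] mult_left_mono) auto
qed

lemma inner_R_le: "AE x in M. \<forall>\<xi> y. \<bar>y \<bullet> svec R x \<xi>\<bar> \<le> norm y * (C * nrm x \<xi>)"
  using R_le
proof eventually_elim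
  case (elim x)
  then show ?case
    by (intro allI order_trans[OF Cauchy_Schwarz_ineq2] mult_left_mono) auto
qed

lemma integrable_weight_nrm:
  assumes [measurable]: "w \<in> borel_measurable M" and w: "integrable M (\<lambda>x. (w x)\<^sup>2)"
    and [measurable]: "h \<in> borel_measurable M" and h: "integrable M (\<lambda>x. (nrm x (h x))\<^sup>2)"
    and [measurable]: "X \<in> borel_measurable M" and X: "AE x in M. \<bar>X x\<bar> \<le> K * \<bar>w x\<bar> * nrm x (h x)"
  shows "integrable M X"
proof (rule Bochner_Integration.integrable_bound)
  have "integrable M (\<lambda>x. \<bar>w x\<bar> * nrm x (h x))"
    by (rule integrable_mult_L2) (use w h in auto)
  then show "integrable M (\<lambda>x. K * (\<bar>w x\<bar> * nrm x (h x)))" by simp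
  show "AE x in M. norm (X x) \<le> norm (K * (\<bar>w x\<bar> * nrm x (h x)))"
    using X by eventually_elim (auto simp: mult.assoc intro: order_trans[OF _ abs_ge_self])
qed measurable

lemma integrable_G_S: "integrable M (\<lambda>x. G x \<bullet> svec S x (g x))"
  and integrable_H_R: "integrable M (\<lambda>x. H x \<bullet> svec R x (g x))"
proof -
  show "integrable M (\<lambda>x. G x \<bullet> svec S x (g x))"
  proof (rule integrable_weight_nrm[where w = "\<lambda>x. norm (G x)" and h = g and K = C])
    show "AE x in M. \<bar>G x \<bullet> svec S x (g x)\<bar> \<le> C * \<bar>norm (G x)\<bar> * nrm x (g x)"
      using inner_S_le by eventually_elim (simp add: mult.assoc mult.left_commute)
  qed (use G_L2 g_L2 in measurable)
  show "integrable M (\<lambda>x. H x \<bullet> svec R x (g x))"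
  proof (rule integrable_weight_nrm[where w = "\<lambda>x. norm (H x)" and h = g and K = C])
    show "AE x in M. \<bar>H x \<bullet> svec R x (g x)\<bar> \<le> C * \<bar>norm (H x)\<bar> * nrm x (g x)"
      using inner_R_le by eventually_elim (simp add: mult.assoc mult.left_commute)
  qed (use H_L2 g_L2 in measurable)
qed

section \<open>Testing with truncations of the subsolution and a fixed cutoff\<close>

context
  fixes \<psi> \<rho> :: "real \<Rightarrow> real" and B B0 B1 :: real
  assumes \<psi>: "\<And>s. (\<psi> has_real_derivative \<rho> s) (at s)" and \<rho>_cont: "continuous_on UNIV \<rho>"
    and \<rho>_le: "\<And>s. \<bar>\<rho> s\<bar> \<le> B" and \<psi>_nonneg: "\<And>s. 0 \<le> \<psi> s" and \<psi>_le: "\<And>s. \<psi> s \<le> B0"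
    and s\<rho>_le: "\<And>s. \<bar>s * \<rho> s\<bar> \<le> B1" and \<psi>_neg: "\<And>s. s \<le> 0 \<Longrightarrow> \<psi> s = 0"
begin

lemma \<psi>\<rho>_measurable' [measurable]: "\<psi> \<in> borel_measurable borel" "\<rho> \<in> borel_measurable borel"
  using lipschitz_on_continuous_on[OF lipschitz_if_derivative_bounded[OF \<psi> \<rho>_le]] \<rho>_cont
  by (auto intro: borel_measurable_continuous_onI)

lemma B0_nonneg: "0 \<le> B0"
  using \<psi>_nonneg[of 0] \<psi>_le[of 0] by linarith

text \<open>\<open>s * \<psi> s\<close> is the profile for the compatibility condition. Its
  derivative stays bounded although \<open>s\<close> does not, because \<open>s * \<rho> s\<close>
  is assumed bounded; \<open>\<psi> = 0\<close> for \<open>s \<le> 0\<close> makes the profile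
  non-negative.\<close>

lemma times_deriv: "((\<lambda>s. s * \<psi> s) has_real_derivative (\<psi> s + s * \<rho> s)) (at s)"
  by (rule derivative_eq_intros \<psi> refl)+ simp

lemma times_deriv_cont: "continuous_on UNIV (\<lambda>s. \<psi> s + s * \<rho> s)"
  using \<rho>_cont \<psi> by (intro continuous_intros) (auto intro!: continuous_at_imp_continuous_on DERIV_isCont)

lemma times_deriv_le: "\<bar>\<psi> s + s * \<rho> s\<bar> \<le> B0 + B1"
  using \<psi>_nonneg[of s] \<psi>_le[of s] s\<rho>_le[of s] by linarith

context
  fixes \<Theta> :: "real^'n \<Rightarrow> real"
  assumes \<Theta>: "\<Theta> \<in> Lip0 \<Omega>" and \<Theta>_nonneg: "\<And>x. 0 \<le> \<Theta> x"
begin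

abbreviation "P \<equiv> pgrad \<psi> \<rho> \<Theta>"

lemma P_measurable [measurable]: "P \<in> borel_measurable M"
  by (rule pgrad_measurable[OF \<psi> \<rho>_cont \<rho>_le \<Theta>])

lemma P_L2: "integrable M (\<lambda>x. (nrm x (P x))\<^sup>2)"
  by (rule pgrad_L2[OF \<psi> \<rho>_cont \<rho>_le \<Theta>])

lemma \<Theta>_meas [measurable]: "\<Theta> \<in> borel_measurable M" "grad \<Theta> \<in> borel_measurable M"
  using Lip0_L2(1,2)[OF \<Theta>] .

lemma product_meas [measurable]: "grad (\<lambda>x. \<psi> (U n x) * \<Theta> x) \<in> borel_measurable M"
  by (rule Lip0_L2(2)[OF product_Lip0[OF \<psi> \<rho>_cont \<rho>_le \<Theta>]])

lemma bil_limit: "(\<lambda>n. \<integral>x. bil x (grad (\<lambda>x. \<psi> (U n x) * \<Theta> x) x) (g x) \<partial>M) \<longlonglongrightarrow> (\<integral>x. bil x (P x) (g x) \<partial>M)"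
proof (rule L2_null_integral_tendsto(2)[OF product_grad_L2[OF \<psi> \<rho>_cont \<rho>_le \<Theta>] nrm_g_measurable g_L2])
  show "integrable M (\<lambda>x. bil x (P x) (g x))"
  proof (rule integrable_weight_nrm[where w = "\<lambda>x. nrm x (P x)" and h = g and K = 1])
    show "AE x in M. \<bar>bil x (P x) (g x)\<bar> \<le> 1 * \<bar>nrm x (P x)\<bar> * nrm x (g x)"
      using AE_M_space by eventually_elim (simp add: bil_le)
  qed (use P_L2 g_L2 in measurable)
  show "AE x in M. \<bar>bil x (grad (\<lambda>x. \<psi> (U n x) * \<Theta> x) x) (g x) - bil x (P x) (g x)\<bar>
      \<le> \<bar>nrm x (grad (\<lambda>x. \<psi> (U n x) * \<Theta> x) x - P x) * nrm x (g x)\<bar>" for n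
    using AE_M_space
    by eventually_elim (simp add: bil_diff_left[symmetric] bil_le)
qed measurable

lemma weak_product:
  "(\<integral>x. bil x (grad (\<lambda>x. \<psi> (U n x) * \<Theta> x) x) (g x) \<partial>M)
   + (\<integral>x. \<psi> (U n x) * \<Theta> x * (H x \<bullet> svec R x (g x)) \<partial>M)
   + (\<integral>x. u x * (G x \<bullet> svec S x (grad (\<lambda>x. \<psi> (U n x) * \<Theta> x) x)) \<partial>M)
   + (\<integral>x. F x * (\<psi> (U n x) * \<Theta> x) * u x \<partial>M) \<le> 0"
proof -
  let ?\<Phi> = "\<lambda>x. \<psi> (U n x) * \<Theta> x"
  have "weak_form \<Omega> v Q F G H R S (u, g) ?\<Phi> \<le> 0"
    using weak_le product_Lip0[OF \<psi> \<rho>_cont \<rho>_le \<Theta>, of n] \<psi>_nonneg \<Theta>_nonneg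
    unfolding weak_le0_def by simp
  moreover have "(\<integral>x. grad ?\<Phi> x \<bullet> (Q x *v g x) \<partial>lebesgue_on \<Omega>) = (\<integral>x. bil x (grad ?\<Phi> x) (g x) \<partial>M)"
    by (rule integral_bil) measurable
  ultimately show ?thesis by (simp add: weak_form_def vfs_eq_svec)
qed

text \<open>Here \<open>X\<close> is merely integrable, so the bounds of \<open>\<psi>\<close> and
  \<open>\<Theta>\<close> have to supply the domination.\<close>

lemma bounded_factor_limit:
  assumes X: "integrable M X"
  shows "(\<lambda>n. \<integral>x. \<psi> (U n x) * \<Theta> x * X x \<partial>M) \<longlonglongrightarrow> (\<integral>x. \<psi> (u x) * \<Theta> x * X x \<partial>M)"
proof -
  note [measurable] = borel_measurable_integrable[OF X]
  obtain T where T: "0 < T" "\<And>x. x \<in> \<Omega> \<Longrightarrow> \<bar>\<Theta> x\<bar> \<le> T" by (rule Lip0_bounded[OF \<Theta> open_\<Omega>]) blast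
  show ?thesis
  proof (rule integral_dominated_convergence[where w = "\<lambda>x. B0 * T * \<bar>X x\<bar>"])
    show "integrable M (\<lambda>x. B0 * T * \<bar>X x\<bar>)" using X by simp
    show "AE x in M. (\<lambda>n. \<psi> (U n x) * \<Theta> x * X x) \<longlonglongrightarrow> \<psi> (u x) * \<Theta> x * X x"
      using product_AE[OF \<psi> \<rho>_cont \<rho>_le \<Theta>] by eventually_elim (rule tendsto_mult_right)
    show "AE x in M. norm (\<psi> (U n x) * \<Theta> x * X x) \<le> B0 * T * \<bar>X x\<bar>" for n
      using AE_M_space
    proof eventually_elim
      case (elim x)
      have "\<psi> (U n x) * \<bar>\<Theta> x\<bar> \<le> B0 * T"
        using \<psi>_le \<psi>_nonneg T elim B0_nonneg by (intro mult_mono) auto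
      then show ?case using \<psi>_nonneg[of "U n x"] by (simp add: abs_mult mult_right_mono)
    qed
  qed measurable
qed

text \<open>The Sobolev inequality weighted with \<open>|G|\<^sup>2\<close>, applied to
  \<open>u \<Theta>\<close>, that is with the identity as \<open>\<psi>\<close>. It compensates for
  the unbounded factor \<open>u\<close>, since \<open>u G\<close> alone is only known to be
  integrable.\<close>

lemma local_Sobolev: "integrable M (\<lambda>x. (u x * \<Theta> x * norm (G x))\<^sup>2)"
proof (rule integrableI_nonneg)
  have id: "((\<lambda>s. s) has_real_derivative 1) (at s)" for s :: real by (rule DERIV_ident)
  have "(\<integral>\<^sup>+x. ennreal ((norm (G x))\<^sup>2 * (u x * \<Theta> x)\<^sup>2) \<partial>M) \<le> ennreal (\<Lambda> * (\<integral>x. (nrm x (pgrad (\<lambda>s. s) (\<lambda>_. 1) \<Theta> x))\<^sup>2 \<partial>M))"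
    by (rule product_Sobolev[OF id _ _ \<Theta>, where B = 1]) (auto simp: Sobolev_G)
  also have "\<dots> < \<infinity>" by simp
  finally show "(\<integral>\<^sup>+x. ennreal ((u x * \<Theta> x * norm (G x))\<^sup>2) \<partial>M) < \<infinity>"
    by (simp add: power_mult_distrib mult.commute mult.left_commute)
qed auto

text \<open>By the product rule one part has the weight \<open>u \<Theta> G\<close>, square
  integrable by \<open>local_Sobolev\<close>, against gradients that converge in mean square. In the
  other part \<open>\<nabla>\<Theta>\<close> is bounded and \<open>u |G|\<close> integrable, so the
  boundedness of \<open>\<psi>\<close> gives dominated convergence.\<close>

lemma uG_limit:
  "integrable M (\<lambda>x. u x * (G x \<bullet> svec S x (P x)))"
  "(\<lambda>n. \<integral>x. u x * (G x \<bullet> svec S x (grad (\<lambda>x. \<psi> (U n x) * \<Theta> x) x)) \<partial>M) \<longlonglongrightarrow> (\<integral>x. u x * (G x \<bullet> svec S x (P x)) \<partial>M)"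
proof -
  obtain L where L: "0 \<le> L" "\<And>x. x \<in> \<Omega> \<Longrightarrow> norm (grad \<Theta> x) \<le> L" by (rule Lip0_grad_bounded[OF \<Theta> open_\<Omega>]) blast
  define w where "w x = C * (u x * \<Theta> x * norm (G x))" for x
  have [measurable]: "w \<in> borel_measurable M" unfolding w_def by measurable
  have w2: "integrable M (\<lambda>x. (w x)\<^sup>2)" unfolding w_def power_mult_distrib[of C] using local_Sobolev by simp
  define Ya where "Ya n x = u x * \<Theta> x * (G x \<bullet> svec S x (\<rho> (U n x) *\<^sub>R grad (U n) x))" for n x
  define Y where "Y x = u x * \<Theta> x * (G x \<bullet> svec S x (\<rho> (u x) *\<^sub>R g x))" for x
  have [measurable]: "Ya n \<in> borel_measurable M" "Y \<in> borel_measurable M" for n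
    unfolding Ya_def Y_def by measurable
  have le: "AE x in M. \<forall>\<xi>. \<bar>u x * \<Theta> x * (G x \<bullet> svec S x \<xi>)\<bar> \<le> \<bar>nrm x \<xi> * w x\<bar>"
    using inner_S_le AE_M_space
  proof eventually_elim
    case (elim x)
    show ?case
    proof
      fix \<xi>
      have "\<bar>u x * \<Theta> x\<bar> * \<bar>G x \<bullet> svec S x \<xi>\<bar> \<le> \<bar>u x * \<Theta> x\<bar> * (norm (G x) * (C * nrm x \<xi>))"
        using elim by (intro mult_left_mono) auto
      then show "\<bar>u x * \<Theta> x * (G x \<bullet> svec S x \<xi>)\<bar> \<le> \<bar>nrm x \<xi> * w x\<bar>"
        using C_nonneg elim(2) by (simp add: w_def abs_mult mult.assoc mult.commute mult.left_commute)
    qed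
  qed
  have Y_int: "integrable M Y"
  proof (rule integrable_weight_nrm[where w = w and h = "\<lambda>x. \<rho> (u x) *\<^sub>R g x" and K = 1])
    show "integrable M (\<lambda>x. (nrm x (\<rho> (u x) *\<^sub>R g x))\<^sup>2)"
    proof (rule Bochner_Integration.integrable_bound)
      show "integrable M (\<lambda>x. B\<^sup>2 * (nrm x (g x))\<^sup>2)" using g_L2 by simp
      show "AE x in M. norm ((nrm x (\<rho> (u x) *\<^sub>R g x))\<^sup>2) \<le> norm (B\<^sup>2 * (nrm x (g x))\<^sup>2)"
      proof (rule AE_I2)
        fix x
        have "(\<rho> (u x))\<^sup>2 \<le> B\<^sup>2" using power_mono[OF \<rho>_le[of "u x"], of 2] by simp
        then show "norm ((nrm x (\<rho> (u x) *\<^sub>R g x))\<^sup>2) \<le> norm (B\<^sup>2 * (nrm x (g x))\<^sup>2)"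
          by (simp add: power_mult_distrib mult_right_mono)
      qed
    qed measurable
    show "AE x in M. \<bar>Y x\<bar> \<le> 1 * \<bar>w x\<bar> * nrm x (\<rho> (u x) *\<^sub>R g x)"
      using le AE_M_space
    proof eventually_elim
      case (elim x)
      have "\<bar>Y x\<bar> \<le> \<bar>nrm x (\<rho> (u x) *\<^sub>R g x) * w x\<bar>" unfolding Y_def using elim(1) by blast
      then show ?case using elim(2) by (simp add: abs_mult mult.commute del: nrm_scale)
    qed
  qed (use w2 in measurable)
  have Ya_lim: "integrable M (Ya n)" "(\<lambda>n. \<integral>x. Ya n x \<partial>M) \<longlonglongrightarrow> (\<integral>x. Y x \<partial>M)" for n
  proof -
    have d: "AE x in M. \<bar>Ya n x - Y x\<bar> \<le> \<bar>nrm x (\<rho> (U n x) *\<^sub>R grad (U n) x - \<rho> (u x) *\<^sub>R g x) * w x\<bar>" for n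
      using le
    proof eventually_elim
      case (elim x)
      have "Ya n x - Y x = u x * \<Theta> x * (G x \<bullet> svec S x (\<rho> (U n x) *\<^sub>R grad (U n) x - \<rho> (u x) *\<^sub>R g x))"
        by (simp add: Ya_def Y_def svec_diff inner_diff_right right_diff_distrib)
      then show ?case using elim by simp
    qed
    show "integrable M (Ya n)" "(\<lambda>n. \<integral>x. Ya n x \<partial>M) \<longlonglongrightarrow> (\<integral>x. Y x \<partial>M)"
      by (rule L2_null_integral_tendsto[OF \<rho>_grad_L2[OF \<psi> \<rho>_cont \<rho>_le \<Theta>] _ w2 _ Y_int d]; measurable)+
  qed
  define X where "X x = u x * (G x \<bullet> svec S x (grad \<Theta> x))" for x
  have [measurable]: "X \<in> borel_measurable M" unfolding X_def by measurable
  have X_int: "integrable M X"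
  proof (rule Bochner_Integration.integrable_bound)
    have "integrable M (\<lambda>x. u x * norm (G x))" by (rule integrable_mult_L2) (use u_L2 G_L2 in auto)
    then show "integrable M (\<lambda>x. (C * (sqrt (max c 0) * L)) * (u x * norm (G x)))" by simp
    show "AE x in M. norm (X x) \<le> norm ((C * (sqrt (max c 0) * L)) * (u x * norm (G x)))"
      using inner_S_le AE_M_space
    proof eventually_elim
      case (elim x)
      then have x: "x \<in> \<Omega>" by simp
      have "nrm x (grad \<Theta> x) \<le> sqrt (max c 0) * L"
        using nrm_le[OF x, of "grad \<Theta> x"] mult_left_mono[OF L(2)[OF x], of "sqrt (max c 0)"] by simp
      then have "norm (G x) * (C * nrm x (grad \<Theta> x)) \<le> norm (G x) * (C * (sqrt (max c 0) * L))"
        using C_nonneg by (intro mult_left_mono) auto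
      with elim(1) have "\<bar>G x \<bullet> svec S x (grad \<Theta> x)\<bar> \<le> norm (G x) * (C * (sqrt (max c 0) * L))"
        by (meson order_trans)
      then have "\<bar>u x\<bar> * \<bar>G x \<bullet> svec S x (grad \<Theta> x)\<bar> \<le> \<bar>u x\<bar> * (norm (G x) * (C * (sqrt (max c 0) * L)))"
        by (rule mult_left_mono) simp
      then show ?case using C_nonneg L(1) by (simp add: X_def abs_mult mult.assoc mult.commute mult.left_commute)
    qed
  qed measurable
  obtain T where T: "0 < T" "\<And>x. x \<in> \<Omega> \<Longrightarrow> \<bar>\<Theta> x\<bar> \<le> T" by (rule Lip0_bounded[OF \<Theta> open_\<Omega>]) blast
  have bX: "integrable M (\<lambda>x. \<psi> (w x) * X x)" if [measurable]: "w \<in> borel_measurable M" for w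
  proof (rule Bochner_Integration.integrable_bound)
    show "integrable M (\<lambda>x. B0 * X x)" using X_int by simp
    show "AE x in M. norm (\<psi> (w x) * X x) \<le> norm (B0 * X x)"
      using \<psi>_nonneg \<psi>_le B0_nonneg by (intro AE_I2) (simp add: abs_mult mult_right_mono)
  qed measurable
  have lim2: "(\<lambda>n. \<integral>x. \<psi> (U n x) * X x \<partial>M) \<longlonglongrightarrow> (\<integral>x. \<psi> (u x) * X x \<partial>M)"
  proof (rule integral_dominated_convergence[where w = "\<lambda>x. B0 * \<bar>X x\<bar>"])
    show "integrable M (\<lambda>x. B0 * \<bar>X x\<bar>)" using X_int by simp
    have c\<psi>: "continuous_on UNIV \<psi>" using \<psi> by (auto intro!: continuous_at_imp_continuous_on DERIV_isCont)
    show "AE x in M. (\<lambda>n. \<psi> (U n x) * X x) \<longlonglongrightarrow> \<psi> (u x) * X x"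
      using U_AE by eventually_elim (use continuous_on_tendsto_compose[OF c\<psi>] in \<open>auto intro!: tendsto_mult_right\<close>)
    show "AE x in M. norm (\<psi> (U n x) * X x) \<le> B0 * \<bar>X x\<bar>" for n
      using \<psi>_nonneg \<psi>_le by (intro AE_I2) (simp add: abs_mult mult_right_mono)
  qed measurable
  have eqP: "u x * (G x \<bullet> svec S x (P x)) = Y x + \<psi> (u x) * X x" for x
    by (simp add: pgrad_def Y_def X_def svec_add svec_scale inner_add_right algebra_simps)
  show "integrable M (\<lambda>x. u x * (G x \<bullet> svec S x (P x)))"
    unfolding eqP using Y_int bX[of u] by simp
  have "(\<integral>x. u x * (G x \<bullet> svec S x (grad (\<lambda>x. \<psi> (U n x) * \<Theta> x) x)) \<partial>M) = (\<integral>x. Ya n x \<partial>M) + (\<integral>x. \<psi> (U n x) * X x \<partial>M)" for n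
  proof -
    have "(\<integral>x. u x * (G x \<bullet> svec S x (grad (\<lambda>x. \<psi> (U n x) * \<Theta> x) x)) \<partial>M) = (\<integral>x. Ya n x + \<psi> (U n x) * X x \<partial>M)"
    proof (rule integral_cong_AE)
      show "AE x in M. u x * (G x \<bullet> svec S x (grad (\<lambda>x. \<psi> (U n x) * \<Theta> x) x)) = Ya n x + \<psi> (U n x) * X x"
        using product_grad[OF \<psi> \<rho>_cont \<rho>_le \<Theta>, of n]
        by eventually_elim (simp add: Ya_def X_def svec_add svec_scale inner_add_right algebra_simps)
    qed measurable
    then show ?thesis using Ya_lim(1) bX[of "U n"] by simp
  qed
  moreover have "(\<integral>x. u x * (G x \<bullet> svec S x (P x)) \<partial>M) = (\<integral>x. Y x \<partial>M) + (\<integral>x. \<psi> (u x) * X x \<partial>M)"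
    unfolding eqP using Y_int bX[of u] by simp
  ultimately show "(\<lambda>n. \<integral>x. u x * (G x \<bullet> svec S x (grad (\<lambda>x. \<psi> (U n x) * \<Theta> x) x)) \<partial>M) \<longlonglongrightarrow> (\<integral>x. u x * (G x \<bullet> svec S x (P x)) \<partial>M)"
    using tendsto_add[OF Ya_lim(2) lim2] by simp
qed

text \<open>The test function \<open>U n * \<psi> (U n) * \<Theta>\<close> is admissible because
  \<open>\<psi>\<close> vanishes on negative values. Lipschitz continuity of
  \<open>s * \<psi> s\<close> yields convergence in mean square of the test functions and their
  gradients, which suffices for \<open>F\<close> and \<open>G\<close> in
  \<open>L\<^sup>2\<close>.\<close>

lemma compat_limit:
  "0 \<le> (\<integral>x. G x \<bullet> svec S x (pgrad (\<lambda>s. s * \<psi> s) (\<lambda>s. \<psi> s + s * \<rho> s) \<Theta> x) \<partial>M) + (\<integral>x. F x * (u x * \<psi> (u x) * \<Theta> x) \<partial>M)"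
  "integrable M (\<lambda>x. G x \<bullet> svec S x (pgrad (\<lambda>s. s * \<psi> s) (\<lambda>s. \<psi> s + s * \<rho> s) \<Theta> x))"
proof -
  note pk = times_deriv times_deriv_cont times_deriv_le \<Theta>
  let ?P = "pgrad (\<lambda>s. s * \<psi> s) (\<lambda>s. \<psi> s + s * \<rho> s) \<Theta>"
  let ?\<Phi> = "\<lambda>n x. U n x * \<psi> (U n x) * \<Theta> x"
  have Lip: "?\<Phi> n \<in> Lip0 \<Omega>" for n using product_Lip0[OF pk] by simp
  note [measurable] = Lip0_L2(1,2)[OF Lip] pgrad_measurable[OF pk]
  have Pi: "integrable M (\<lambda>x. G x \<bullet> svec S x (?P x))"
  proof (rule integrable_weight_nrm[where w = "\<lambda>x. norm (G x)" and h = ?P and K = C])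
    show "AE x in M. \<bar>G x \<bullet> svec S x (?P x)\<bar> \<le> C * \<bar>norm (G x)\<bar> * nrm x (?P x)"
      using inner_S_le by eventually_elim (simp add: mult.assoc mult.left_commute)
  qed (use G_L2 pgrad_L2[OF pk] in measurable)
  then show "integrable M (\<lambda>x. G x \<bullet> svec S x (?P x))" .
  have G1: "integrable M (\<lambda>x. (C * norm (G x))\<^sup>2)" using G_L2 by (simp add: power_mult_distrib)
  have d1: "AE x in M. \<bar>G x \<bullet> svec S x (grad (?\<Phi> n) x) - G x \<bullet> svec S x (?P x)\<bar> \<le> \<bar>nrm x (grad (?\<Phi> n) x - ?P x) * (C * norm (G x))\<bar>" for n
    using inner_S_le
  proof eventually_elim
    case (elim x)
    have "\<bar>G x \<bullet> svec S x (grad (?\<Phi> n) x - ?P x)\<bar> \<le> norm (G x) * (C * nrm x (grad (?\<Phi> n) x - ?P x))" using elim by blast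
    also have "\<dots> \<le> \<bar>nrm x (grad (?\<Phi> n) x - ?P x) * (C * norm (G x))\<bar>"
      by (rule order_trans[OF _ abs_ge_self]) (simp add: mult.assoc mult.commute mult.left_commute)
    finally show ?case by (simp add: svec_diff inner_diff_right)
  qed
  note l1 = L2_null_integral_tendsto[OF product_grad_L2[OF pk] _ G1 _ Pi d1]
  have F1: "integrable M (\<lambda>x. F x * (u x * \<psi> (u x) * \<Theta> x))"
  proof (rule integrable_mult_L2[OF F_measurable _ F_L2])
    have "integrable M (\<lambda>x. ((u x * \<psi> (u x) * \<Theta> x - ?\<Phi> 0 x) + ?\<Phi> 0 x)\<^sup>2)"
      using L2_nullD(2)[OF product_L2[OF pk], of 0] Lip0_L2(3)[OF Lip[of 0]]
      by (intro integrable_square_add) (auto simp: power2_commute)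
    then show "integrable M (\<lambda>x. (u x * \<psi> (u x) * \<Theta> x)\<^sup>2)" by simp
  qed measurable
  have d2: "AE x in M. \<bar>F x * ?\<Phi> n x - F x * (u x * \<psi> (u x) * \<Theta> x)\<bar> \<le> \<bar>(?\<Phi> n x - u x * \<psi> (u x) * \<Theta> x) * F x\<bar>" for n
    by (intro AE_I2) (simp add: right_diff_distrib[symmetric] abs_mult mult.commute)
  note l2 = L2_null_integral_tendsto[OF product_L2[OF pk] F_measurable F_L2 _ F1 d2]
  have i1: "integrable M (\<lambda>x. G x \<bullet> svec S x (grad (?\<Phi> n) x))" for n by (rule l1(1)) measurable
  have i2: "integrable M (\<lambda>x. F x * ?\<Phi> n x)" for n by (rule l2(1)) measurable
  have "0 \<le> (\<integral>x. G x \<bullet> svec S x (grad (?\<Phi> n) x) \<partial>M) + (\<integral>x. F x * ?\<Phi> n x \<partial>M)" for n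
  proof -
    have "0 \<le> ?\<Phi> n x" for x using \<psi>_nonneg[of "U n x"] \<psi>_neg[of "U n x"] \<Theta>_nonneg[of x] by (cases "U n x \<le> 0") auto
    then have "0 \<le> (\<integral>x. G x \<bullet> vfs S (grad (?\<Phi> n)) x + F x * ?\<Phi> n x \<partial>M)" by (intro compat Lip) auto
    then show ?thesis using i1[of n] i2[of n] by (simp add: vfs_eq_svec)
  qed
  moreover have "(\<lambda>n. (\<integral>x. G x \<bullet> svec S x (grad (?\<Phi> n) x) \<partial>M) + (\<integral>x. F x * ?\<Phi> n x \<partial>M))
      \<longlonglongrightarrow> (\<integral>x. G x \<bullet> svec S x (?P x) \<partial>M) + (\<integral>x. F x * (u x * \<psi> (u x) * \<Theta> x) \<partial>M)"
    by (intro tendsto_add l1(2) l2(2)) measurable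
  ultimately show "0 \<le> (\<integral>x. G x \<bullet> svec S x (?P x) \<partial>M) + (\<integral>x. F x * (u x * \<psi> (u x) * \<Theta> x) \<partial>M)"
    by (intro LIMSEQ_le_const) auto
qed

text \<open>The terms containing \<open>u G\<close>, which need not be integrable up to the boundary, cancel against the
  compatibility condition tested with \<open>u \<psi>(u) \<Theta>\<close>.\<close>

lemma localized_inequality:
  "(\<integral>x. bil x (P x) (g x) \<partial>M) + (\<integral>x. \<psi> (u x) * \<Theta> x * (H x \<bullet> svec R x (g x)) \<partial>M)
     \<le> (\<integral>x. \<psi> (u x) * \<Theta> x * (G x \<bullet> svec S x (g x)) \<partial>M)"
proof -
  have Fu: "integrable M (\<lambda>x. F x * u x)" by (rule integrable_mult_L2) (use F_L2 u_L2 in auto)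
  have "(\<integral>x. bil x (P x) (g x) \<partial>M) + (\<integral>x. \<psi> (u x) * \<Theta> x * (H x \<bullet> svec R x (g x)) \<partial>M)
      + (\<integral>x. u x * (G x \<bullet> svec S x (P x)) \<partial>M) + (\<integral>x. \<psi> (u x) * \<Theta> x * (F x * u x) \<partial>M) \<le> 0"
  proof (rule LIMSEQ_le_const2)
    show "(\<lambda>n. (\<integral>x. bil x (grad (\<lambda>x. \<psi> (U n x) * \<Theta> x) x) (g x) \<partial>M)
        + (\<integral>x. \<psi> (U n x) * \<Theta> x * (H x \<bullet> svec R x (g x)) \<partial>M)
        + (\<integral>x. u x * (G x \<bullet> svec S x (grad (\<lambda>x. \<psi> (U n x) * \<Theta> x) x)) \<partial>M)
        + (\<integral>x. \<psi> (U n x) * \<Theta> x * (F x * u x) \<partial>M)) \<longlonglongrightarrow>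
      (\<integral>x. bil x (P x) (g x) \<partial>M) + (\<integral>x. \<psi> (u x) * \<Theta> x * (H x \<bullet> svec R x (g x)) \<partial>M)
      + (\<integral>x. u x * (G x \<bullet> svec S x (P x)) \<partial>M) + (\<integral>x. \<psi> (u x) * \<Theta> x * (F x * u x) \<partial>M)"
      by (intro tendsto_add bil_limit bounded_factor_limit integrable_H_R uG_limit(2) Fu)
    show "\<exists>N. \<forall>n\<ge>N. (\<integral>x. bil x (grad (\<lambda>x. \<psi> (U n x) * \<Theta> x) x) (g x) \<partial>M)
        + (\<integral>x. \<psi> (U n x) * \<Theta> x * (H x \<bullet> svec R x (g x)) \<partial>M)
        + (\<integral>x. u x * (G x \<bullet> svec S x (grad (\<lambda>x. \<psi> (U n x) * \<Theta> x) x)) \<partial>M)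
        + (\<integral>x. \<psi> (U n x) * \<Theta> x * (F x * u x) \<partial>M) \<le> 0"
      using weak_product by (simp add: mult.assoc mult.commute mult.left_commute)
  qed
  \<comment> \<open>Product rule for \<open>u * \<psi> u * \<Theta>\<close>: its gradient is
    \<open>u\<close> times that of \<open>\<psi> u * \<Theta>\<close> plus
    \<open>\<psi> u * \<Theta>\<close> times \<open>\<nabla>u\<close>. The first part is the
    \<open>G\<close> term of the weak form; the second is the right-hand side that remains.\<close>
  moreover have "(\<integral>x. G x \<bullet> svec S x (pgrad (\<lambda>s. s * \<psi> s) (\<lambda>s. \<psi> s + s * \<rho> s) \<Theta> x) \<partial>M)
      = (\<integral>x. u x * (G x \<bullet> svec S x (P x)) \<partial>M) + (\<integral>x. \<psi> (u x) * \<Theta> x * (G x \<bullet> svec S x (g x)) \<partial>M)"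
  proof -
    have eq: "G x \<bullet> svec S x (pgrad (\<lambda>s. s * \<psi> s) (\<lambda>s. \<psi> s + s * \<rho> s) \<Theta> x)
        = u x * (G x \<bullet> svec S x (P x)) + \<psi> (u x) * \<Theta> x * (G x \<bullet> svec S x (g x))" for x
      by (simp add: pgrad_def svec_add svec_scale inner_add_right algebra_simps)
    have "integrable M (\<lambda>x. G x \<bullet> svec S x (pgrad (\<lambda>s. s * \<psi> s) (\<lambda>s. \<psi> s + s * \<rho> s) \<Theta> x) - u x * (G x \<bullet> svec S x (P x)))"
      using compat_limit(2) uG_limit(1) by (rule Bochner_Integration.integrable_diff)
    then have "integrable M (\<lambda>x. \<psi> (u x) * \<Theta> x * (G x \<bullet> svec S x (g x)))" unfolding eq by simp
    then show ?thesis unfolding eq using uG_limit(1) by (rule Bochner_Integration.integral_add[rotated])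
  qed
  moreover have "(\<integral>x. F x * (u x * \<psi> (u x) * \<Theta> x) \<partial>M) = (\<integral>x. \<psi> (u x) * \<Theta> x * (F x * u x) \<partial>M)"
    by (simp add: mult.assoc mult.commute mult.left_commute)
  ultimately show ?thesis using compat_limit(1) by linarith
qed

end

declare P_measurable [measurable del] \<Theta>_meas [measurable del] product_meas [measurable del]

end

declare \<psi>\<rho>_measurable' [measurable del]

end

section \<open>Truncation at a level above the boundary supremum\<close>

text \<open>The Taylor remainder is at most \<open>(y - x)\<^sup>2\<close>, whatever the signs of
  \<open>x\<close> and \<open>y\<close>. Combinations of these squares are the piecewise quadratic
  \<open>C\<^sup>1\<close> truncations used below.\<close>

lemma DERIV_square_max:
  "((\<lambda>s. (max 0 (s - a))\<^sup>2) has_real_derivative 2 * max 0 (s - a)) (at s)" for a s :: real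
proof -
  have rem: "\<bar>(max 0 y)\<^sup>2 - (max 0 x)\<^sup>2 - 2 * max 0 x * (y - x)\<bar> \<le> (y - x)\<^sup>2" for x y :: real
  proof -
    consider "0 \<le> x" "0 \<le> y" | "0 \<le> x" "y < 0" | "x < 0" "0 \<le> y" | "x < 0" "y < 0" by linarith
    then show ?thesis
    proof cases
      case 1
      then have "(max 0 y)\<^sup>2 - (max 0 x)\<^sup>2 - 2 * max 0 x * (y - x) = (y - x)\<^sup>2"
        by (simp add: power2_eq_square algebra_simps)
      then show ?thesis by simp
    next
      case 2
      then have "x * y \<le> 0" by (intro mult_nonneg_nonpos) auto
      have "\<bar>(max 0 y)\<^sup>2 - (max 0 x)\<^sup>2 - 2 * max 0 x * (y - x)\<bar> = \<bar>x\<^sup>2 - 2 * (x * y)\<bar>"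
        using 2 by (simp add: power2_eq_square algebra_simps)
      also have "\<dots> = x\<^sup>2 - 2 * (x * y)"
        by (rule abs_of_nonneg) (use \<open>x * y \<le> 0\<close> zero_le_power2[of x] in linarith)
      also have "\<dots> \<le> (y - x)\<^sup>2" by (simp add: power2_diff mult.commute)
      finally show ?thesis .
    next
      case 3
      then have "y\<^sup>2 \<le> (y - x)\<^sup>2" by (intro power_mono) auto
      then show ?thesis using 3 by simp
    qed simp
  qed
  have "((\<lambda>h. ((max 0 (s + h - a))\<^sup>2 - (max 0 (s - a))\<^sup>2) / h - 2 * max 0 (s - a)) \<longlongrightarrow> 0) (at 0)"
  proof (rule Lim_null_comparison)
    show "\<forall>\<^sub>F h in at 0. norm (((max 0 (s + h - a))\<^sup>2 - (max 0 (s - a))\<^sup>2) / h - 2 * max 0 (s - a)) \<le> \<bar>h\<bar>"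
      unfolding eventually_at_filter
    proof (intro always_eventually allI impI)
      fix h :: real assume "h \<noteq> 0"
      have "((max 0 (s + h - a))\<^sup>2 - (max 0 (s - a))\<^sup>2) / h - 2 * max 0 (s - a)
          = ((max 0 (s + h - a))\<^sup>2 - (max 0 (s - a))\<^sup>2 - 2 * max 0 (s - a) * ((s + h - a) - (s - a))) / h"
        using \<open>h \<noteq> 0\<close> by (simp add: field_simps)
      also have "\<bar>\<dots>\<bar> \<le> ((s + h - a) - (s - a))\<^sup>2 / \<bar>h\<bar>"
        unfolding abs_divide by (rule divide_right_mono[OF rem]) simp
      also have "\<dots> = \<bar>h\<bar>" using \<open>h \<noteq> 0\<close> by (simp add: power2_eq_square abs_if)
      finally show "norm (((max 0 (s + h - a))\<^sup>2 - (max 0 (s - a))\<^sup>2) / h - 2 * max 0 (s - a)) \<le> \<bar>h\<bar>" by simp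
    qed
    show "((\<lambda>h. \<bar>h\<bar>) \<longlongrightarrow> 0) (at (0::real))" by (auto intro!: tendsto_eq_intros)
  qed
  then show ?thesis unfolding DERIV_def by (simp add: LIM_zero_iff)
qed

text \<open>A \<open>C\<^sup>1\<close> approximation of \<open>(s - t)\<^sup>+\<close> with slope \<open>1\<close> on \<open>[t + r, b]\<close>, constant from \<open>b + 1\<close> on.\<close>

definition ramp_deriv :: "real \<Rightarrow> real \<Rightarrow> real \<Rightarrow> real \<Rightarrow> real" where
  "ramp_deriv t r b s = (max 0 (s - t) - max 0 (s - (t + r))) / r - (max 0 (s - b) - max 0 (s - (b + 1)))"

definition ramp :: "real \<Rightarrow> real \<Rightarrow> real \<Rightarrow> real \<Rightarrow> real" where
  "ramp t r b s = ((max 0 (s - t))\<^sup>2 - (max 0 (s - (t + r)))\<^sup>2) / (2 * r)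
     - ((max 0 (s - b))\<^sup>2 - (max 0 (s - (b + 1)))\<^sup>2) / 2"

lemma ramp_has_derivative: "0 < r \<Longrightarrow> (ramp t r b has_real_derivative ramp_deriv t r b s) (at s)"
  unfolding ramp_def ramp_deriv_def
  by (rule derivative_eq_intros DERIV_square_max refl | simp add: diff_divide_distrib)+

lemma ramp_deriv_continuous: "continuous_on UNIV (ramp_deriv t r b)"
  unfolding ramp_deriv_def divide_inverse by (intro continuous_intros)

lemma ramp_deriv_range:
  assumes "0 < r" "t + r \<le> b"
  shows "0 \<le> ramp_deriv t r b s" "ramp_deriv t r b s \<le> 1"
proof -
  let ?a = "(max 0 (s - t) - max 0 (s - (t + r))) / r"
  have "0 \<le> max 0 (s - t) - max 0 (s - (t + r))" "max 0 (s - t) - max 0 (s - (t + r)) \<le> r" using assms by auto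
  then have a: "0 \<le> ?a" "?a \<le> 1" using assms by (auto simp: divide_le_eq)
  show "ramp_deriv t r b s \<le> 1" using a by (simp add: ramp_deriv_def)
  show "0 \<le> ramp_deriv t r b s"
  proof (cases "s \<le> b")
    case False
    then have "?a = 1" using assms by simp
    then show ?thesis by (simp add: ramp_deriv_def)
  qed (use a in \<open>simp add: ramp_deriv_def\<close>)
qed

lemma ramp_below: "0 < r \<Longrightarrow> t + r \<le> b \<Longrightarrow> s \<le> t \<Longrightarrow> ramp t r b s = 0 \<and> ramp_deriv t r b s = 0"
  by (simp add: ramp_def ramp_deriv_def)

lemma ramp_deriv_above: "0 < r \<Longrightarrow> t + r \<le> b \<Longrightarrow> b + 1 \<le> s \<Longrightarrow> ramp_deriv t r b s = 0"
  by (simp add: ramp_deriv_def)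

lemma ramp_mid: "0 < r \<Longrightarrow> t + r \<le> s \<Longrightarrow> s \<le> b \<Longrightarrow> ramp t r b s = s - t - r / 2 \<and> ramp_deriv t r b s = 1"
  by (simp add: ramp_def ramp_deriv_def power2_eq_square field_simps)

lemma ramp_range:
  assumes "0 < r" "t + r \<le> b"
  shows "0 \<le> ramp t r b s" "ramp t r b s \<le> max 0 (s - t)" "ramp t r b s \<le> b + 1 - t"
proof -
  note d = ramp_has_derivative[OF assms(1), of t b]
  have z: "ramp t r b t = 0" using ramp_below[OF assms, of t] by simp
  show nn: "0 \<le> ramp t r b s" for s
  proof (cases "s \<le> t")
    case False
    have "ramp t r b t \<le> ramp t r b s"
    proof (rule DERIV_nonneg_imp_nondecreasing[where f = "ramp t r b"])
      show "\<exists>y. (ramp t r b has_real_derivative y) (at x) \<and> 0 \<le> y" for x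
        using d[of x] ramp_deriv_range(1)[OF assms, of x] by blast
    qed (use False in simp)
    then show ?thesis using z by simp
  qed (use ramp_below[OF assms] in simp)
  have "1-lipschitz_on UNIV (ramp t r b)"
  proof (rule lipschitz_if_derivative_bounded[OF d])
    show "\<bar>ramp_deriv t r b s\<bar> \<le> 1" for s using ramp_deriv_range[OF assms, of s] by linarith
  qed
  from lipschitz_onD[OF this, of _ t] have le: "ramp t r b s \<le> \<bar>s - t\<bar>" for s
    using z by (simp add: dist_real_def abs_le_iff)
  show "ramp t r b s \<le> max 0 (s - t)"
    using le[of s] ramp_below[OF assms, of s] by (cases "s \<le> t") auto
  show "ramp t r b s \<le> b + 1 - t"
  proof (cases "s \<le> b + 1")
    case True
    then show ?thesis using le[of s] ramp_below[OF assms, of s] assms by (cases "s \<le> t") auto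
  next
    case False
    then have "ramp t r b s = b - t - r / 2 + 1 / 2"
      using assms by (simp add: ramp_def power2_eq_square field_simps)
    then show ?thesis using assms by simp
  qed
qed

text \<open>A tent over \<open>[0, d]\<close> with peak \<open>2/d\<close> at \<open>d/2\<close>, so
  of integral \<open>1\<close>; its primitive \<open>step d\<close> rises from \<open>0\<close> at
  \<open>0\<close> to \<open>1\<close> at \<open>d\<close> and is \<open>C\<^sup>1\<close>. Writing
  \<open>s - 0\<close> lets \<open>DERIV_square_max\<close> apply verbatim.\<close>

definition step_deriv :: "real \<Rightarrow> real \<Rightarrow> real" where
  "step_deriv d s = 4 / d\<^sup>2 * (max 0 (s - 0) - 2 * max 0 (s - d / 2) + max 0 (s - d))"

definition step :: "real \<Rightarrow> real \<Rightarrow> real" where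
  "step d s = 2 / d\<^sup>2 * ((max 0 (s - 0))\<^sup>2 - 2 * (max 0 (s - d / 2))\<^sup>2 + (max 0 (s - d))\<^sup>2)"

lemma step_has_derivative: "(step d has_real_derivative step_deriv d s) (at s)"
  unfolding step_def step_deriv_def
  by (rule DERIV_cong[OF DERIV_cmult[OF DERIV_add[OF DERIV_diff[OF DERIV_square_max DERIV_cmult[OF DERIV_square_max]] DERIV_square_max]]])
     (simp add: algebra_simps add_divide_distrib)

lemma step_deriv_continuous: "continuous_on UNIV (step_deriv d)"
  unfolding step_deriv_def by (intro continuous_intros)

lemma step_deriv_range:
  assumes "0 < d"
  shows "0 \<le> step_deriv d s" "step_deriv d s \<le> 4 / d\<^sup>2 * d"
proof -
  have "0 \<le> max 0 (s - 0) - 2 * max 0 (s - d / 2) + max 0 (s - d)" "max 0 (s - 0) - 2 * max 0 (s - d / 2) + max 0 (s - d) \<le> d"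
    using assms by (auto simp: max_def)
  then show "0 \<le> step_deriv d s" "step_deriv d s \<le> 4 / d\<^sup>2 * d"
    unfolding step_deriv_def by (intro mult_nonneg_nonneg mult_left_mono; simp)+
qed

lemma step_below: "s \<le> 0 \<Longrightarrow> 0 < d \<Longrightarrow> step d s = 0"
  by (simp add: step_def)

lemma step_above: "0 < d \<Longrightarrow> d \<le> s \<Longrightarrow> step d s = 1 \<and> step_deriv d s = 0"
  by (simp add: step_def step_deriv_def power2_eq_square field_simps)

lemma step_range:
  assumes "0 < d"
  shows "0 \<le> step d s" "step d s \<le> 1"
proof -
  have mono: "step d a \<le> step d b" if "a \<le> b" for a b
  proof (rule DERIV_nonneg_imp_nondecreasing[where f = "step d", OF that])
    show "\<exists>y. (step d has_real_derivative y) (at s) \<and> 0 \<le> y" for s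
      using step_has_derivative[of d s] step_deriv_range(1)[OF assms, of s] by blast
  qed
  show "0 \<le> step d s" using mono[of "min s 0" s] step_below[of "min s 0" d] assms by simp
  show "step d s \<le> 1" using mono[of s "max s d"] step_above[of d "max s d"] assms by simp
qed

section \<open>Removing the cutoff\<close>

context weak_subsolution
begin

text \<open>\<open>V n\<close> lies in \<open>Lip0\<close> and tends to
  \<open>(u - k)\<^sup>+\<close>, so this is a compactly supported cutoff that tends to
  \<open>1\<close> on \<open>{u > t}\<close>, the set that carries test functions vanishing for
  \<open>u \<le> t\<close>. The gap \<open>t - k > 0\<close> leaves room for the step.\<close>

definition cutoff :: "real \<Rightarrow> nat \<Rightarrow> real^'n \<Rightarrow> real" where
  "cutoff t n x = step (t - k) (V n x)"

lemma V_measurable [measurable]: "V n \<in> borel_measurable M" "grad (V n) \<in> borel_measurable M"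
  using Lip0_L2(1,2)[OF V_Lip0] .

context
  fixes \<psi> \<rho> :: "real \<Rightarrow> real" and B B0 B1 t :: real
  assumes \<psi>: "\<And>s. (\<psi> has_real_derivative \<rho> s) (at s)" and \<rho>_cont: "continuous_on UNIV \<rho>"
    and \<rho>_le: "\<And>s. \<bar>\<rho> s\<bar> \<le> B" and \<psi>_nonneg: "\<And>s. 0 \<le> \<psi> s" and \<psi>_le: "\<And>s. \<psi> s \<le> B0"
    and s\<rho>_le: "\<And>s. \<bar>s * \<rho> s\<bar> \<le> B1" and \<psi>_below: "\<And>s. s \<le> t \<Longrightarrow> \<psi> s = 0 \<and> \<rho> s = 0"
    and kt: "k < t"
begin

lemma \<psi>_neg: "s \<le> 0 \<Longrightarrow> \<psi> s = 0"
  using \<psi>_below[of s] kt k_nonneg by simp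

lemma step_Lipschitz: "(4 / (t - k)\<^sup>2 * (t - k))-lipschitz_on UNIV (step (t - k))"
proof (rule lipschitz_if_derivative_bounded[OF step_has_derivative])
  have d: "0 < t - k" using kt by simp
  show "\<bar>step_deriv (t - k) s\<bar> \<le> 4 / (t - k)\<^sup>2 * (t - k)" for s
    using step_deriv_range[OF d, of s] by linarith
qed

lemma cut_Lip0: "cutoff t n \<in> Lip0 \<Omega>"
  unfolding cutoff_def[abs_def]
  by (rule Lip0_compose[OF V_Lip0 step_Lipschitz _ open_\<Omega> bounded_\<Omega>]) (use kt in \<open>simp add: step_below\<close>)

lemma cut_range: "0 \<le> cutoff t n x" "cutoff t n x \<le> 1"
  using step_range[of "t - k"] kt by (auto simp: cutoff_def)

lemma cut_grad: "AE x in M. grad (cutoff t n) x = step_deriv (t - k) (V n x) *\<^sub>R grad (V n) x"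
  unfolding cutoff_def[abs_def]
  by (rule AE_MI[OF grad_compose_AE[OF Lip0_imp_Lip_loc[OF V_Lip0] step_has_derivative open_\<Omega>]])

text \<open>Above level \<open>t\<close> the limit \<open>u - k\<close> lies beyond
  \<open>t - k\<close>, where \<open>step\<close> is already constant; that its derivative tends to
  \<open>0\<close> there makes the gradient of the cutoff disappear.\<close>

lemma cut_AE: "AE x in M. t < u x \<longrightarrow> (\<lambda>n. cutoff t n x) \<longlonglongrightarrow> 1 \<and> (\<lambda>n. step_deriv (t - k) (V n x)) \<longlonglongrightarrow> 0"
  using V_AE
proof eventually_elim
  case (elim x)
  show ?case
  proof
    assume "t < u x"
    then have m: "max (u x - k) 0 = u x - k" and ge: "t - k \<le> u x - k" using kt by auto
    have c: "continuous_on UNIV (step (t - k))"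
      by (rule lipschitz_on_continuous_on[OF step_Lipschitz])
    show "(\<lambda>n. cutoff t n x) \<longlonglongrightarrow> 1 \<and> (\<lambda>n. step_deriv (t - k) (V n x)) \<longlonglongrightarrow> 0"
      using continuous_on_tendsto_compose[OF c elim] continuous_on_tendsto_compose[OF step_deriv_continuous elim, of "t - k"]
        step_above[OF _ ge] kt by (simp add: cutoff_def m)
  qed
qed

lemma cut_measurable [measurable]: "cutoff t n \<in> borel_measurable M" "grad (cutoff t n) \<in> borel_measurable M"
  using Lip0_L2(1,2)[OF cut_Lip0] .

lemma \<psi>\<rho>_meas [measurable]: "\<psi> \<in> borel_measurable borel" "\<rho> \<in> borel_measurable borel"
  using lipschitz_on_continuous_on[OF lipschitz_if_derivative_bounded[OF \<psi> \<rho>_le]] \<rho>_cont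
  by (auto intro: borel_measurable_continuous_onI)

lemma pgrad_cut_measurable [measurable]: "pgrad \<psi> \<rho> (cutoff t n) \<in> borel_measurable M"
  by (rule pgrad_measurable[OF \<psi> \<rho>_cont \<rho>_le cut_Lip0])

lemma cut_factor_AE: "AE x in M. (\<lambda>n. \<psi> (u x) * cutoff t n x) \<longlonglongrightarrow> \<psi> (u x) \<and> (\<lambda>n. \<rho> (u x) * cutoff t n x) \<longlonglongrightarrow> \<rho> (u x)"
  using cut_AE
proof eventually_elim
  case (elim x)
  show ?case
  proof (cases "t < u x")
    case True
    then have c: "(\<lambda>n. cutoff t n x) \<longlonglongrightarrow> 1" using elim by blast
    show ?thesis using tendsto_mult_left[OF c, of "\<psi> (u x)"] tendsto_mult_left[OF c, of "\<rho> (u x)"] by simp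
  qed (use \<psi>_below[of "u x"] in simp)
qed

text \<open>Three errors: \<open>\<rho>(u) (\<Theta> - 1) g\<close>, and the gradient of the cutoff
  with \<open>\<nabla>V n\<close> split into \<open>\<nabla>V n - h\<close> and \<open>h\<close>.
  The first and third vanish by domination, since a factor tends to zero where \<open>u > t\<close>
  while \<open>\<psi>\<close> and \<open>\<rho>\<close> vanish elsewhere; the second uses the mean
  square convergence of \<open>\<nabla>V n\<close> to \<open>h\<close>. The slope of the step blows
  up as \<open>t\<close> approaches \<open>k\<close>, but \<open>t\<close> stays fixed.\<close>

lemma pgrad_cut_L2: "L2_null M (\<lambda>n x. nrm x (pgrad \<psi> \<rho> (cutoff t n) x - \<rho> (u x) *\<^sub>R g x))"
proof -
  define D where "D = 4 / (t - k)\<^sup>2 * (t - k)"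
  define h where "h x = (if u x > k then g x else 0)" for x
  have [measurable]: "h \<in> borel_measurable M" unfolding h_def by measurable
  have [measurable]: "step_deriv (t - k) \<in> borel_measurable borel"
    by (rule borel_measurable_continuous_onI[OF step_deriv_continuous])
  have D2: "\<bar>step_deriv (t - k) s\<bar> \<le> D" for s
  proof -
    have d: "0 < t - k" using kt by simp
    show ?thesis unfolding D_def using step_deriv_range[OF d, of s] by linarith
  qed
  have D: "0 \<le> D" "\<And>s. \<bar>step_deriv (t - k) s\<bar> \<le> D"
    using D2 order_trans[OF abs_ge_zero D2[of 0]] by blast+
  have B0: "0 \<le> B0" using \<psi>_nonneg[of 0] \<psi>_le[of 0] by linarith
  have B: "0 \<le> B" using \<rho>_le[of 0] by linarith
  have 1: "L2_null M (\<lambda>n x. \<bar>\<rho> (u x) * cutoff t n x - \<rho> (u x)\<bar> * nrm x (g x))"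
  proof (rule L2_null_dominated[where w = "\<lambda>x. B * nrm x (g x)"])
    show "AE x in M. (\<lambda>n. \<bar>\<rho> (u x) * cutoff t n x - \<rho> (u x)\<bar> * nrm x (g x)) \<longlonglongrightarrow> 0"
      using cut_factor_AE by eventually_elim (auto intro!: tendsto_mult_left_zero tendsto_rabs_zero simp: LIM_zero_iff)
    show "integrable M (\<lambda>x. (B * nrm x (g x))\<^sup>2)" using g_L2 by (simp add: power_mult_distrib)
    show "AE x in M. \<bar>\<bar>\<rho> (u x) * cutoff t n x - \<rho> (u x)\<bar> * nrm x (g x)\<bar> \<le> B * nrm x (g x)" for n
      using AE_M_space
    proof eventually_elim
      case (elim x)
      have "\<bar>\<rho> (u x) * cutoff t n x - \<rho> (u x)\<bar> = \<bar>\<rho> (u x)\<bar> * \<bar>cutoff t n x - 1\<bar>"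
        by (simp add: abs_mult[symmetric] algebra_simps)
      also have "\<dots> \<le> B * 1" using \<rho>_le cut_range[of n x] B by (intro mult_mono) auto
      finally show ?case using elim by (simp add: abs_mult mult_right_mono)
    qed
  qed measurable
  have 2: "L2_null M (\<lambda>n x. (B0 * D) * nrm x (grad (V n) x - h x))"
  proof (rule L2_null_bound[where K = "B0 * D"])
    show "L2_null M (\<lambda>n x. nrm x (grad (V n) x - h x))" unfolding h_def by (rule V_grad)
  qed (use B0 D(1) in \<open>auto simp: abs_mult\<close>)
  have 3: "L2_null M (\<lambda>n x. \<bar>\<psi> (u x) * step_deriv (t - k) (V n x)\<bar> * nrm x (h x))"
  proof (rule L2_null_dominated[where w = "\<lambda>x. (B0 * D) * nrm x (g x)"])
    show "AE x in M. (\<lambda>n. \<bar>\<psi> (u x) * step_deriv (t - k) (V n x)\<bar> * nrm x (h x)) \<longlonglongrightarrow> 0"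
      using cut_AE
    proof eventually_elim
      case (elim x)
      show ?case
      proof (cases "t < u x")
        case True
        then have "(\<lambda>n. step_deriv (t - k) (V n x)) \<longlonglongrightarrow> 0" using elim by blast
        from tendsto_mult_right[OF tendsto_rabs[OF tendsto_mult_left[OF this, of "\<psi> (u x)"]], of "nrm x (h x)"]
        show ?thesis by simp
      qed (use \<psi>_below[of "u x"] in simp)
    qed
    show "integrable M (\<lambda>x. ((B0 * D) * nrm x (g x))\<^sup>2)" using g_L2 by (simp add: power_mult_distrib)
    show "AE x in M. \<bar>\<bar>\<psi> (u x) * step_deriv (t - k) (V n x)\<bar> * nrm x (h x)\<bar> \<le> (B0 * D) * nrm x (g x)" for n
      using AE_M_space
    proof eventually_elim
      case (elim x)
      have "\<bar>\<psi> (u x) * step_deriv (t - k) (V n x)\<bar> \<le> B0 * D"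
        unfolding abs_mult using \<psi>_nonneg \<psi>_le D B0 by (intro mult_mono) auto
      moreover have "nrm x (h x) \<le> nrm x (g x)" using elim by (simp add: h_def)
      ultimately have "\<bar>\<psi> (u x) * step_deriv (t - k) (V n x)\<bar> * nrm x (h x) \<le> (B0 * D) * nrm x (g x)"
        using elim B0 D(1) by (intro mult_mono) auto
      then show ?case using elim by (simp add: abs_mult)
    qed
  qed measurable
  show ?thesis
  proof (rule L2_null_bound[OF L2_null_add[OF L2_null_add[OF 1 2] 3], where K = 1])
    fix n
    show "AE x in M. \<bar>nrm x (pgrad \<psi> \<rho> (cutoff t n) x - \<rho> (u x) *\<^sub>R g x)\<bar>
       \<le> 1 * \<bar>\<bar>\<rho> (u x) * cutoff t n x - \<rho> (u x)\<bar> * nrm x (g x) + (B0 * D) * nrm x (grad (V n) x - h x)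
            + \<bar>\<psi> (u x) * step_deriv (t - k) (V n x)\<bar> * nrm x (h x)\<bar>"
      using cut_grad[of n] AE_M_space
    proof eventually_elim
      case (elim x)
      then have x: "x \<in> \<Omega>" by simp
      let ?s = "\<psi> (u x) * step_deriv (t - k) (V n x)"
      have eq: "pgrad \<psi> \<rho> (cutoff t n) x - \<rho> (u x) *\<^sub>R g x
          = (\<rho> (u x) * cutoff t n x - \<rho> (u x)) *\<^sub>R g x + (?s *\<^sub>R (grad (V n) x - h x) + ?s *\<^sub>R h x)"
        unfolding pgrad_def elim(1) by (simp add: algebra_simps)
      have "nrm x (pgrad \<psi> \<rho> (cutoff t n) x - \<rho> (u x) *\<^sub>R g x) \<le> nrm x ((\<rho> (u x) * cutoff t n x - \<rho> (u x)) *\<^sub>R g x) + nrm x (?s *\<^sub>R (grad (V n) x - h x) + ?s *\<^sub>R h x)"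
        unfolding eq by (rule nrm_add[OF x])
      also have "\<dots> \<le> nrm x ((\<rho> (u x) * cutoff t n x - \<rho> (u x)) *\<^sub>R g x) + (nrm x (?s *\<^sub>R (grad (V n) x - h x)) + nrm x (?s *\<^sub>R h x))"
        by (intro add_left_mono nrm_add[OF x])
      also have "\<dots> = \<bar>\<rho> (u x) * cutoff t n x - \<rho> (u x)\<bar> * nrm x (g x) + (\<bar>?s\<bar> * nrm x (grad (V n) x - h x) + \<bar>?s\<bar> * nrm x (h x))"
        by (simp only: nrm_scale)
      also have "\<dots> \<le> \<bar>\<rho> (u x) * cutoff t n x - \<rho> (u x)\<bar> * nrm x (g x) + ((B0 * D) * nrm x (grad (V n) x - h x) + \<bar>?s\<bar> * nrm x (h x))"
      proof (intro add_left_mono add_right_mono mult_right_mono)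
        show "\<bar>?s\<bar> \<le> B0 * D" unfolding abs_mult using \<psi>_nonneg \<psi>_le D B0 by (intro mult_mono) auto
      qed (use x in auto)
      finally show ?case using x by simp
    qed
  qed measurable
qed

lemma limit_energy_integrable: "integrable M (\<lambda>x. (nrm x (\<rho> (u x) *\<^sub>R g x))\<^sup>2)"
proof (rule Bochner_Integration.integrable_bound)
  show "integrable M (\<lambda>x. B\<^sup>2 * (nrm x (g x))\<^sup>2)" using g_L2 by simp
  show "AE x in M. norm ((nrm x (\<rho> (u x) *\<^sub>R g x))\<^sup>2) \<le> norm (B\<^sup>2 * (nrm x (g x))\<^sup>2)"
  proof (rule AE_I2)
    fix x
    have "(\<rho> (u x))\<^sup>2 \<le> B\<^sup>2" using power_mono[OF \<rho>_le[of "u x"], of 2] by simp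
    then show "norm ((nrm x (\<rho> (u x) *\<^sub>R g x))\<^sup>2) \<le> norm (B\<^sup>2 * (nrm x (g x))\<^sup>2)"
      by (simp add: power_mult_distrib mult_right_mono)
  qed
qed measurable

lemma \<psi>_factor_limit:
  assumes X: "integrable M X"
  shows "(\<lambda>n. \<integral>x. \<psi> (u x) * cutoff t n x * X x \<partial>M) \<longlonglongrightarrow> (\<integral>x. \<psi> (u x) * X x \<partial>M)"
proof -
  note [measurable] = borel_measurable_integrable[OF X]
  show ?thesis
  proof (rule integral_dominated_convergence[where w = "\<lambda>x. B0 * \<bar>X x\<bar>"])
    show "integrable M (\<lambda>x. B0 * \<bar>X x\<bar>)" using X by simp
    show "AE x in M. (\<lambda>n. \<psi> (u x) * cutoff t n x * X x) \<longlonglongrightarrow> \<psi> (u x) * X x"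
      using cut_factor_AE by eventually_elim (intro tendsto_mult_right, blast)
    show "AE x in M. norm (\<psi> (u x) * cutoff t n x * X x) \<le> B0 * \<bar>X x\<bar>" for n
    proof (rule AE_I2)
      fix x
      have "\<psi> (u x) * cutoff t n x \<le> B0 * 1"
        using \<psi>_nonneg[of "u x"] \<psi>_le[of "u x"] cut_range[of n x] by (intro mult_mono) auto
      then show "norm (\<psi> (u x) * cutoff t n x * X x) \<le> B0 * \<bar>X x\<bar>"
        using \<psi>_nonneg[of "u x"] cut_range[of n x] by (simp add: abs_mult mult_right_mono)
    qed
  qed measurable
qed

text \<open>This is what formal testing with \<open>\<psi>(u)\<close> would give after the
  \<open>u G\<close> and \<open>F\<close> terms have cancelled; the cancellation took place before
  the cutoff was sent to \<open>1\<close>.\<close>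

lemma limit_inequality:
  "(\<integral>x. \<rho> (u x) * (nrm x (g x))\<^sup>2 \<partial>M) + (\<integral>x. \<psi> (u x) * (H x \<bullet> svec R x (g x)) \<partial>M)
     \<le> (\<integral>x. \<psi> (u x) * (G x \<bullet> svec S x (g x)) \<partial>M)"
proof -
  have int: "integrable M (\<lambda>x. bil x (\<rho> (u x) *\<^sub>R g x) (g x))"
  proof (rule integrable_weight_nrm[where w = "\<lambda>x. nrm x (\<rho> (u x) *\<^sub>R g x)" and h = g and K = 1])
    show "AE x in M. \<bar>bil x (\<rho> (u x) *\<^sub>R g x) (g x)\<bar> \<le> 1 * \<bar>nrm x (\<rho> (u x) *\<^sub>R g x)\<bar> * nrm x (g x)"
      using AE_M_space by eventually_elim (simp add: bil_le del: nrm_scale)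
  qed (use limit_energy_integrable g_L2 in measurable)
  have d: "AE x in M. \<bar>bil x (pgrad \<psi> \<rho> (cutoff t n) x) (g x) - bil x (\<rho> (u x) *\<^sub>R g x) (g x)\<bar>
      \<le> \<bar>nrm x (pgrad \<psi> \<rho> (cutoff t n) x - \<rho> (u x) *\<^sub>R g x) * nrm x (g x)\<bar>" for n
    using AE_M_space by eventually_elim (simp add: bil_diff_left[symmetric] bil_le)
  have lim: "(\<lambda>n. \<integral>x. bil x (pgrad \<psi> \<rho> (cutoff t n) x) (g x) \<partial>M) \<longlonglongrightarrow> (\<integral>x. bil x (\<rho> (u x) *\<^sub>R g x) (g x) \<partial>M)"
    by (rule L2_null_integral_tendsto(2)[OF pgrad_cut_L2 nrm_g_measurable g_L2 _ int d]) measurable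
  have "(\<integral>x. bil x (\<rho> (u x) *\<^sub>R g x) (g x) \<partial>M) + (\<integral>x. \<psi> (u x) * (H x \<bullet> svec R x (g x)) \<partial>M)
     \<le> (\<integral>x. \<psi> (u x) * (G x \<bullet> svec S x (g x)) \<partial>M)"
  proof (rule LIMSEQ_le)
    show "(\<lambda>n. (\<integral>x. bil x (pgrad \<psi> \<rho> (cutoff t n) x) (g x) \<partial>M) + (\<integral>x. \<psi> (u x) * cutoff t n x * (H x \<bullet> svec R x (g x)) \<partial>M))
      \<longlonglongrightarrow> (\<integral>x. bil x (\<rho> (u x) *\<^sub>R g x) (g x) \<partial>M) + (\<integral>x. \<psi> (u x) * (H x \<bullet> svec R x (g x)) \<partial>M)"
      by (intro tendsto_add lim \<psi>_factor_limit integrable_H_R)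
    show "(\<lambda>n. \<integral>x. \<psi> (u x) * cutoff t n x * (G x \<bullet> svec S x (g x)) \<partial>M) \<longlonglongrightarrow> (\<integral>x. \<psi> (u x) * (G x \<bullet> svec S x (g x)) \<partial>M)"
      by (rule \<psi>_factor_limit[OF integrable_G_S])
    show "\<exists>N. \<forall>n\<ge>N. (\<integral>x. bil x (pgrad \<psi> \<rho> (cutoff t n) x) (g x) \<partial>M) + (\<integral>x. \<psi> (u x) * cutoff t n x * (H x \<bullet> svec R x (g x)) \<partial>M)
        \<le> (\<integral>x. \<psi> (u x) * cutoff t n x * (G x \<bullet> svec S x (g x)) \<partial>M)"
      using localized_inequality[OF \<psi> \<rho>_cont \<rho>_le \<psi>_nonneg \<psi>_le s\<rho>_le \<psi>_neg cut_Lip0 cut_range(1)] by blast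
  qed
  moreover have "(\<integral>x. bil x (\<rho> (u x) *\<^sub>R g x) (g x) \<partial>M) = (\<integral>x. \<rho> (u x) * (nrm x (g x))\<^sup>2 \<partial>M)"
    by (rule Bochner_Integration.integral_cong) (auto simp: bil_scale_left nrm_square)
  ultimately show ?thesis by simp
qed

lemma limit_Sobolev:
  fixes \<kappa> :: "real^'n \<Rightarrow> real"
  assumes [measurable]: "\<kappa> \<in> borel_measurable M"
    and Sob: "\<And>\<phi>. \<phi> \<in> Lip0 \<Omega> \<Longrightarrow> (\<integral>\<^sup>+x. ennreal (\<kappa> x * (\<phi> x)\<^sup>2) \<partial>M) \<le> ennreal (\<Lambda>' * (\<integral>x. (nrm x (grad \<phi> x))\<^sup>2 \<partial>M))"
  shows "(\<integral>\<^sup>+x. ennreal (\<kappa> x * (\<psi> (u x))\<^sup>2) \<partial>M) \<le> ennreal (\<Lambda>' * (\<integral>x. (\<rho> (u x))\<^sup>2 * (nrm x (g x))\<^sup>2 \<partial>M))"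
proof (rule nn_integral_le_if_AE_tendsto)
  show "AE x in M. (\<lambda>n. ennreal (\<kappa> x * (\<psi> (u x) * cutoff t n x)\<^sup>2)) \<longlonglongrightarrow> ennreal (\<kappa> x * (\<psi> (u x))\<^sup>2)"
    using cut_factor_AE
  proof eventually_elim
    case (elim x)
    then have a: "(\<lambda>n. \<psi> (u x) * cutoff t n x) \<longlonglongrightarrow> \<psi> (u x)" by (rule conjunct1)
    show ?case by (rule tendsto_ennrealI[OF tendsto_mult[OF tendsto_const tendsto_power[OF a]]])
  qed
  show "(\<integral>\<^sup>+x. ennreal (\<kappa> x * (\<psi> (u x) * cutoff t n x)\<^sup>2) \<partial>M) \<le> ennreal (\<Lambda>' * (\<integral>x. (nrm x (pgrad \<psi> \<rho> (cutoff t n) x))\<^sup>2 \<partial>M))" for n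
    by (rule product_Sobolev[OF \<psi> \<rho>_cont \<rho>_le cut_Lip0 assms(1) Sob])
  have "(\<lambda>n. \<integral>x. (nrm x (pgrad \<psi> \<rho> (cutoff t n) x))\<^sup>2 \<partial>M) \<longlonglongrightarrow> (\<integral>x. (nrm x (\<rho> (u x) *\<^sub>R g x))\<^sup>2 \<partial>M)"
  proof (rule L2_null_energy_tendsto(2)[OF pgrad_cut_L2 _ _ limit_energy_integrable])
    show "AE x in M. \<bar>nrm x (pgrad \<psi> \<rho> (cutoff t n) x) - nrm x (\<rho> (u x) *\<^sub>R g x)\<bar>
        \<le> \<bar>nrm x (pgrad \<psi> \<rho> (cutoff t n) x - \<rho> (u x) *\<^sub>R g x)\<bar>" for n
      by (intro AE_I2) (simp add: nrm_diff del: nrm_scale)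
  qed measurable
  moreover have "(\<integral>x. (nrm x (\<rho> (u x) *\<^sub>R g x))\<^sup>2 \<partial>M) = (\<integral>x. (\<rho> (u x))\<^sup>2 * (nrm x (g x))\<^sup>2 \<partial>M)"
    by (simp add: power_mult_distrib)
  ultimately have "(\<lambda>n. \<integral>x. (nrm x (pgrad \<psi> \<rho> (cutoff t n) x))\<^sup>2 \<partial>M) \<longlonglongrightarrow> (\<integral>x. (\<rho> (u x))\<^sup>2 * (nrm x (g x))\<^sup>2 \<partial>M)"
    by (simp only:)
  then show "(\<lambda>n. \<Lambda>' * (\<integral>x. (nrm x (pgrad \<psi> \<rho> (cutoff t n) x))\<^sup>2 \<partial>M)) \<longlonglongrightarrow> \<Lambda>' * (\<integral>x. (\<rho> (u x))\<^sup>2 * (nrm x (g x))\<^sup>2 \<partial>M)"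
    by (rule tendsto_mult_left)
qed measurable

end

declare cut_measurable [measurable del] \<psi>\<rho>_meas [measurable del] pgrad_cut_measurable [measurable del]

end

section \<open>The energy above a level\<close>

context weak_subsolution
begin

definition K :: "real^'n \<Rightarrow> real" where "K x = norm (G x) + norm (H x)"

lemma K_measurable [measurable]: "K \<in> borel_measurable M"
  unfolding K_def by measurable

lemma K_nonneg: "0 \<le> K x"
  by (simp add: K_def)

lemma K_L2: "integrable M (\<lambda>x. (K x)\<^sup>2)"
  unfolding K_def by (rule integrable_square_add) (use G_L2 H_L2 in auto)

lemma lower_order_le: "AE x in M. G x \<bullet> svec S x (g x) - H x \<bullet> svec R x (g x) \<le> C * K x * nrm x (g x)"
  using inner_S_le inner_R_le
proof eventually_elim
  case (elim x)
  have "\<bar>G x \<bullet> svec S x (g x)\<bar> \<le> norm (G x) * (C * nrm x (g x))" "\<bar>H x \<bullet> svec R x (g x)\<bar> \<le> norm (H x) * (C * nrm x (g x))"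
    using elim by blast+
  moreover have "C * K x * nrm x (g x) = norm (G x) * (C * nrm x (g x)) + norm (H x) * (C * nrm x (g x))"
    by (simp add: K_def algebra_simps)
  ultimately show ?case by linarith
qed

definition excess :: "real \<Rightarrow> real^'n \<Rightarrow> real" where
  "excess t x = max 0 (u x - t)"

definition energy :: "real \<Rightarrow> real" where
  "energy t = (\<integral>x. indicator {x. t < u x} x * (nrm x (g x))\<^sup>2 \<partial>M)"

lemma excess_measurable [measurable]: "excess t \<in> borel_measurable M"
  unfolding excess_def by measurable

lemma superlevel_measurable [measurable]: "(\<lambda>x. indicator {x. t < u x} x :: real) \<in> borel_measurable M"
proof -
  have "(\<lambda>x. if t < u x then 1 else 0 :: real) \<in> borel_measurable M" by measurable
  then show ?thesis by (simp add: indicator_def)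
qed

lemma superlevel_energy_integrable: "integrable M (\<lambda>x. indicator {x. t < u x} x * (nrm x (g x))\<^sup>2)"
  by (rule Bochner_Integration.integrable_bound[OF g_L2]) (auto simp: indicator_def)

lemma energy_nonneg: "0 \<le> energy t"
  unfolding energy_def by (intro Bochner_Integration.integral_nonneg) (auto simp: indicator_def)

context
  fixes t :: real
  assumes kt: "k < t"
begin

text \<open>Letting \<open>r n\<close> tend to \<open>0\<close> sharpens the corner at
  \<open>t\<close>, and letting \<open>b n\<close> tend to infinity removes the upper truncation;
  \<open>t + r n \<le> b n\<close> holds because \<open>r n \<le> 1 \<le> b n - t\<close>.\<close>

abbreviation r :: "nat \<Rightarrow> real" where "r n \<equiv> 1 / real (Suc n)"
abbreviation b :: "nat \<Rightarrow> real" where "b n \<equiv> t + real (Suc n)"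

lemma ramp_params: "0 < r n" "t + r n \<le> b n"
proof -
  have "r n \<le> 1" "1 \<le> real (Suc n)" by simp_all
  then show "0 < r n" "t + r n \<le> b n" by (simp, linarith)
qed

lemma b_pos: "0 \<le> b n + 1"
  using kt k_nonneg by simp

text \<open>Supplies the bound \<open>B1\<close> on \<open>s * \<rho> s\<close>: the ramp has slope
  only between \<open>t > 0\<close> and \<open>b n + 1\<close>.\<close>

lemma ramp_times_le: "\<bar>s * ramp_deriv t (r n) (b n) s\<bar> \<le> b n + 1"
proof -
  consider "s \<le> t" | "t < s" "s < b n + 1" | "b n + 1 \<le> s" by linarith
  then show ?thesis
  proof cases
    case 2
    have "\<bar>s\<bar> * \<bar>ramp_deriv t (r n) (b n) s\<bar> \<le> (b n + 1) * 1"
      using 2 kt k_nonneg ramp_deriv_range[OF ramp_params, of n s] by (intro mult_mono) auto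
    then show ?thesis by (simp add: abs_mult)
  qed (use b_pos ramp_below[OF ramp_params, of s n] ramp_deriv_above[OF ramp_params, of n s] in auto)
qed

lemmas ramp_deriv_facts = ramp_has_derivative[OF ramp_params(1)] ramp_deriv_continuous

lemma ramp_deriv_abs_le: "\<bar>ramp_deriv t (r n) (b n) s\<bar> \<le> 1"
  using ramp_deriv_range[OF ramp_params, of n s] by linarith

lemma ramp_inequality:
  "(\<integral>x. ramp_deriv t (r n) (b n) (u x) * (nrm x (g x))\<^sup>2 \<partial>M) + (\<integral>x. ramp t (r n) (b n) (u x) * (H x \<bullet> svec R x (g x)) \<partial>M)
     \<le> (\<integral>x. ramp t (r n) (b n) (u x) * (G x \<bullet> svec S x (g x)) \<partial>M)"
  by (rule limit_inequality[OF ramp_deriv_facts ramp_deriv_abs_le ramp_range(1,3)[OF ramp_params] ramp_times_le ramp_below[OF ramp_params] kt])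

lemma ramp_Sobolev:
  fixes \<kappa> :: "real^'n \<Rightarrow> real"
  assumes "\<kappa> \<in> borel_measurable M"
    and "\<And>\<phi>. \<phi> \<in> Lip0 \<Omega> \<Longrightarrow> (\<integral>\<^sup>+x. ennreal (\<kappa> x * (\<phi> x)\<^sup>2) \<partial>M) \<le> ennreal (\<Lambda>' * (\<integral>x. (nrm x (grad \<phi> x))\<^sup>2 \<partial>M))"
  shows "(\<integral>\<^sup>+x. ennreal (\<kappa> x * (ramp t (r n) (b n) (u x))\<^sup>2) \<partial>M)
     \<le> ennreal (\<Lambda>' * (\<integral>x. (ramp_deriv t (r n) (b n) (u x))\<^sup>2 * (nrm x (g x))\<^sup>2 \<partial>M))"
  by (rule limit_Sobolev[OF ramp_deriv_facts ramp_deriv_abs_le ramp_range(1,3)[OF ramp_params] ramp_times_le ramp_below[OF ramp_params] kt assms])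

lemma ramp_limits:
  "(\<lambda>n. ramp t (r n) (b n) s) \<longlonglongrightarrow> max 0 (s - t)"
  "(\<lambda>n. ramp_deriv t (r n) (b n) s) \<longlonglongrightarrow> indicator {t<..} s"
proof -
  have r0: "r \<longlonglongrightarrow> 0" by (rule LIMSEQ_Suc[OF lim_1_over_n])
  have "(\<lambda>n. ramp t (r n) (b n) s) \<longlonglongrightarrow> max 0 (s - t) \<and> (\<lambda>n. ramp_deriv t (r n) (b n) s) \<longlonglongrightarrow> indicator {t<..} s"
  proof (cases "s \<le> t")
    case True
    then show ?thesis using ramp_below[OF ramp_params True] by simp
  next
    case False
    then have st: "0 < s - t" by simp
    have e1: "\<forall>\<^sub>F n in sequentially. r n < s - t" by (rule order_tendstoD(2)[OF r0 st])
    have "filterlim (\<lambda>n. real (Suc n)) at_top sequentially"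
      using filterlim_real_sequentially filterlim_sequentially_Suc by blast
    then have e2: "\<forall>\<^sub>F n in sequentially. s - t \<le> real (Suc n)" by (simp only: filterlim_at_top)
    have ev: "\<forall>\<^sub>F n in sequentially. s - t - r n / 2 = ramp t (r n) (b n) s \<and> 1 = ramp_deriv t (r n) (b n) s"
      using e1 e2
    proof eventually_elim
      case (elim n)
      then show ?case using ramp_mid[OF ramp_params(1), of t n s "b n"] by simp
    qed
    have "(\<lambda>n. s - t - r n / 2) \<longlonglongrightarrow> s - t - 0 / 2" by (intro tendsto_intros r0) simp
    then have l1: "(\<lambda>n. s - t - r n / 2) \<longlonglongrightarrow> s - t" by (simp only: div_0 diff_zero)
    have "(\<lambda>n. ramp t (r n) (b n) s) \<longlonglongrightarrow> s - t"
      by (rule Lim_transform_eventually[OF l1]) (use ev in \<open>rule eventually_mono\<close>, blast)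
    moreover have "(\<lambda>n. ramp_deriv t (r n) (b n) s) \<longlonglongrightarrow> 1"
      by (rule tendsto_eventually) (use ev in \<open>auto elim: eventually_mono\<close>)
    ultimately show ?thesis using st by simp
  qed
  then show "(\<lambda>n. ramp t (r n) (b n) s) \<longlonglongrightarrow> max 0 (s - t)"
    "(\<lambda>n. ramp_deriv t (r n) (b n) s) \<longlonglongrightarrow> indicator {t<..} s" by blast+
qed

lemma ramp_measurable [measurable]: "ramp t (r n) (b n) \<in> borel_measurable borel" "ramp_deriv t (r n) (b n) \<in> borel_measurable borel"
  using ramp_deriv_continuous by (auto simp: ramp_def[abs_def] intro: borel_measurable_continuous_onI)

text \<open>Exponent \<open>1\<close> serves the tested inequality, exponent \<open>2\<close> the
  Sobolev inequality; the limits agree because an indicator equals its square.\<close>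

lemma ramp_energy_limit:
  assumes p: "p = 1 \<or> p = 2"
  shows "(\<lambda>n. \<integral>x. (ramp_deriv t (r n) (b n) (u x))^p * (nrm x (g x))\<^sup>2 \<partial>M) \<longlonglongrightarrow> energy t"
  unfolding energy_def
proof (rule integral_dominated_convergence[OF _ _ g_L2])
  show "AE x in M. (\<lambda>n. (ramp_deriv t (r n) (b n) (u x))^p * (nrm x (g x))\<^sup>2) \<longlonglongrightarrow> indicator {x. t < u x} x * (nrm x (g x))\<^sup>2"
  proof (rule AE_I2)
    fix x
    have "(\<lambda>n. (ramp_deriv t (r n) (b n) (u x))^p * (nrm x (g x))\<^sup>2) \<longlonglongrightarrow> (indicator {t<..} (u x))^p * (nrm x (g x))\<^sup>2"
      by (intro tendsto_intros ramp_limits)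
    moreover have "(indicator {t<..} (u x) :: real)^p = indicator {x. t < u x} x" using p by (auto simp: indicator_def)
    ultimately show "(\<lambda>n. (ramp_deriv t (r n) (b n) (u x))^p * (nrm x (g x))\<^sup>2) \<longlonglongrightarrow> indicator {x. t < u x} x * (nrm x (g x))\<^sup>2"
      by simp
  qed
  show "AE x in M. norm ((ramp_deriv t (r n) (b n) (u x))^p * (nrm x (g x))\<^sup>2) \<le> (nrm x (g x))\<^sup>2" for n
  proof (rule AE_I2)
    fix x
    have "\<bar>ramp_deriv t (r n) (b n) (u x)\<bar>^p \<le> 1" by (rule power_le_one) (use ramp_deriv_abs_le in auto)
    then show "norm ((ramp_deriv t (r n) (b n) (u x))^p * (nrm x (g x))\<^sup>2) \<le> (nrm x (g x))\<^sup>2"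
      by (simp add: abs_mult power_abs mult_left_le_one_le)
  qed
qed measurable

lemma excess_Sobolev:
  fixes \<kappa> :: "real^'n \<Rightarrow> real"
  assumes [measurable]: "\<kappa> \<in> borel_measurable M"
    and Sob: "\<And>\<phi>. \<phi> \<in> Lip0 \<Omega> \<Longrightarrow> (\<integral>\<^sup>+x. ennreal (\<kappa> x * (\<phi> x)\<^sup>2) \<partial>M) \<le> ennreal (\<Lambda>' * (\<integral>x. (nrm x (grad \<phi> x))\<^sup>2 \<partial>M))"
  shows "(\<integral>\<^sup>+x. ennreal (\<kappa> x * (excess t x)\<^sup>2) \<partial>M) \<le> ennreal (\<Lambda>' * energy t)"
proof (rule nn_integral_le_if_AE_tendsto)
  show "AE x in M. (\<lambda>n. ennreal (\<kappa> x * (ramp t (r n) (b n) (u x))\<^sup>2)) \<longlonglongrightarrow> ennreal (\<kappa> x * (excess t x)\<^sup>2)"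
    unfolding excess_def by (intro AE_I2 tendsto_ennrealI tendsto_mult tendsto_const tendsto_power ramp_limits)
  show "(\<integral>\<^sup>+x. ennreal (\<kappa> x * (ramp t (r n) (b n) (u x))\<^sup>2) \<partial>M)
     \<le> ennreal (\<Lambda>' * (\<integral>x. (ramp_deriv t (r n) (b n) (u x))\<^sup>2 * (nrm x (g x))\<^sup>2 \<partial>M))" for n
    by (rule ramp_Sobolev[OF assms])
  show "(\<lambda>n. \<Lambda>' * (\<integral>x. (ramp_deriv t (r n) (b n) (u x))\<^sup>2 * (nrm x (g x))\<^sup>2 \<partial>M)) \<longlonglongrightarrow> \<Lambda>' * energy t"
    by (intro tendsto_intros ramp_energy_limit) simp
qed measurable

text \<open>The ramps lie below \<open>(u - t)\<^sup>+\<close>, so the right-hand side can be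
  estimated before the limit; square integrability of \<open>K (u - t)\<^sup>+\<close> makes the
  estimate finite.\<close>

lemma energy_le:
  assumes K_Sob: "integrable M (\<lambda>x. (K x * excess t x)\<^sup>2)"
  shows "integrable M (\<lambda>x. excess t x * K x * nrm x (g x))"
    "energy t \<le> C * (\<integral>x. excess t x * K x * nrm x (g x) \<partial>M)"
proof -
  have int: "integrable M (\<lambda>x. K x * excess t x * nrm x (g x))"
    by (rule integrable_mult_L2[OF _ _ K_Sob g_L2]) measurable
  then show int': "integrable M (\<lambda>x. excess t x * K x * nrm x (g x))" by (simp add: mult.commute)
  have bd: "integrable M (\<lambda>x. ramp t (r n) (b n) (u x) * X x)" if X: "integrable M X" for X n
  proof -
    note [measurable] = borel_measurable_integrable[OF X]
    show ?thesis
    proof (rule Bochner_Integration.integrable_bound)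
      show "integrable M (\<lambda>x. (b n + 1 - t) * X x)" using X by simp
      show "AE x in M. norm (ramp t (r n) (b n) (u x) * X x) \<le> norm ((b n + 1 - t) * X x)"
      proof (rule AE_I2)
        fix x
        have "\<bar>ramp t (r n) (b n) (u x)\<bar> \<le> \<bar>b n + 1 - t\<bar>"
          using ramp_range(1,3)[OF ramp_params, of n "u x"] by linarith
        then show "norm (ramp t (r n) (b n) (u x) * X x) \<le> norm ((b n + 1 - t) * X x)"
          unfolding real_norm_def abs_mult by (rule mult_right_mono) simp
      qed
    qed measurable
  qed
  have "(\<integral>x. (ramp_deriv t (r n) (b n) (u x))^1 * (nrm x (g x))\<^sup>2 \<partial>M) \<le> C * (\<integral>x. excess t x * K x * nrm x (g x) \<partial>M)" for n
  proof -
    have "(\<integral>x. ramp_deriv t (r n) (b n) (u x) * (nrm x (g x))\<^sup>2 \<partial>M)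
      \<le> (\<integral>x. ramp t (r n) (b n) (u x) * (G x \<bullet> svec S x (g x)) - ramp t (r n) (b n) (u x) * (H x \<bullet> svec R x (g x)) \<partial>M)"
      using ramp_inequality[of n] bd[OF integrable_G_S, of n] bd[OF integrable_H_R, of n] by simp
    also have "\<dots> \<le> (\<integral>x. C * (excess t x * K x * nrm x (g x)) \<partial>M)"
    proof (rule integral_mono_AE)
      show "integrable M (\<lambda>x. ramp t (r n) (b n) (u x) * (G x \<bullet> svec S x (g x)) - ramp t (r n) (b n) (u x) * (H x \<bullet> svec R x (g x)))"
        using bd[OF integrable_G_S] bd[OF integrable_H_R] by simp
      show "integrable M (\<lambda>x. C * (excess t x * K x * nrm x (g x)))" using int' by simp
      show "AE x in M. ramp t (r n) (b n) (u x) * (G x \<bullet> svec S x (g x)) - ramp t (r n) (b n) (u x) * (H x \<bullet> svec R x (g x))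
          \<le> C * (excess t x * K x * nrm x (g x))"
        using lower_order_le AE_M_space
      proof eventually_elim
        case (elim x)
        let ?p = "ramp t (r n) (b n) (u x)"
        have p: "0 \<le> ?p" "?p \<le> excess t x" using ramp_range(1,2)[OF ramp_params, of n "u x"] by (auto simp: excess_def)
        have "?p * (G x \<bullet> svec S x (g x)) - ?p * (H x \<bullet> svec R x (g x)) \<le> ?p * (C * K x * nrm x (g x))"
          using mult_left_mono[OF elim(1) p(1)] by (simp add: right_diff_distrib)
        also have "\<dots> \<le> excess t x * (C * K x * nrm x (g x))"
          using p(2) C_nonneg K_nonneg elim(2) by (intro mult_right_mono) auto
        finally show ?case by (simp add: mult.assoc mult.commute mult.left_commute)
      qed
    qed
    finally show ?thesis by simp
  qed
  then show "energy t \<le> C * (\<integral>x. excess t x * K x * nrm x (g x) \<partial>M)"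
    by (intro LIMSEQ_le_const2[OF ramp_energy_limit[of 1]]) auto
qed

end

declare ramp_measurable [measurable del]

text \<open>The energy above a level \<open>t\<close> close to the essential supremum is controlled by itself with a constant
  less than \<open>1\<close>. If the supremum \<open>m\<close> is finite then \<open>\<nabla>u\<close> vanishes on \<open>{u = m}\<close> because
  \<open>energy t \<le> C (m - t) \<integral> K |\<nabla>u| \<rightarrow> 0\<close>; without this the set where \<open>K\<close> is integrated would not shrink.\<close>

lemma subsolution_bounded:
  fixes Z :: "real^'n \<Rightarrow> real" and \<theta> \<Lambda>0 :: real
  assumes Z: "integrable M Z" "\<And>x. 0 \<le> Z x" and \<theta>: "0 \<le> \<theta>" "C\<^sup>2 * \<theta> < 1"
    and Sob_K: "\<And>\<phi> B. \<phi> \<in> Lip0 \<Omega> \<Longrightarrow> B \<in> sets M \<Longrightarrow>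
      (\<integral>\<^sup>+x. ennreal (indicator B x * (K x)\<^sup>2 * (\<phi> x)\<^sup>2) \<partial>M)
        \<le> ennreal ((\<theta> + (\<integral>x. indicator B x * Z x \<partial>M)) * (\<integral>x. (nrm x (grad \<phi> x))\<^sup>2 \<partial>M))"
    and Sob: "\<And>\<phi>. \<phi> \<in> Lip0 \<Omega> \<Longrightarrow> (\<integral>\<^sup>+x. ennreal ((\<phi> x)\<^sup>2) \<partial>M) \<le> ennreal (\<Lambda>0 * (\<integral>x. (nrm x (grad \<phi> x))\<^sup>2 \<partial>M))"
  shows "esssup M (\<lambda>x. ereal (u x)) \<le> ereal k"
proof (rule ccontr)
  define m where "m = esssup M (\<lambda>x. ereal (u x))"
  assume "\<not> esssup M (\<lambda>x. ereal (u x)) \<le> ereal k"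
  then have km: "ereal k < m" by (simp add: m_def)
  have um: "AE x in M. ereal (u x) \<le> m" unfolding m_def by (rule esssup_AE)
  have um': "(\<lambda>x. ereal (u x)) \<in> borel_measurable M" by measurable
  have not_le: "\<not> (AE x in M. u x \<le> t)" if "ereal t < m" for t
  proof
    assume "AE x in M. u x \<le> t"
    then have "m \<le> ereal t" unfolding m_def by (intro esssup_I um') simp
    then show False using that by simp
  qed
  obtain t where t: "\<And>n. k < t n" "\<And>n. ereal (t n) < m" "(\<lambda>n. ereal (t n)) \<longlonglongrightarrow> m"
  proof (cases m)
    case (real s)
    then have ks: "k < s" using km by simp
    \<comment> \<open>The factor \<open>(s - k) / 2\<close> keeps all levels at or above the
      midpoint of \<open>k\<close> and \<open>s\<close>, hence above \<open>k\<close>.\<close>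
    define r where "r n = (s - k) / 2 * (1 / real (Suc n))" for n
    define t where "t n = s - r n" for n
    have pos: "0 < r n" for n using ks by (simp add: r_def)
    have "r n \<le> (s - k) / 2 * 1" for n
      unfolding r_def using ks by (intro mult_left_mono) auto
    then have le: "r n \<le> (s - k) / 2" for n by simp
    have "k < t n" for n using le[of n] ks unfolding t_def by (simp add: field_simps)
    moreover have "t n < s" for n using pos[of n] unfolding t_def by linarith
    moreover have "t \<longlonglongrightarrow> s - (s - k) / 2 * 0" unfolding t_def r_def
      by (intro tendsto_intros LIMSEQ_Suc[OF lim_1_over_n])
    ultimately show ?thesis using real by (intro that[of t]) auto
  next
    case PInf
    have "filterlim (\<lambda>n. k + real (Suc n)) at_top sequentially"
      by (rule filterlim_tendsto_add_at_top[OF tendsto_const])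
         (use filterlim_real_sequentially filterlim_sequentially_Suc in blast)
    then have "(\<lambda>n. ereal (k + real (Suc n))) \<longlonglongrightarrow> \<infinity>" by (simp add: tendsto_PInfty_eq_at_top)
    then show ?thesis using PInf by (intro that[of "\<lambda>n. k + real (Suc n)"]) auto
  next
    case MInf
    then show ?thesis using km by simp
  qed
  define tot where "tot = (\<integral>x. indicator \<Omega> x * Z x \<partial>M)"
  have Om: "\<Omega> \<in> sets M" using sets.top[of M] by simp
  have tot0: "0 \<le> tot" unfolding tot_def using Z(2) by (intro Bochner_Integration.integral_nonneg) (auto simp: indicator_def)
  have excK: "(\<integral>\<^sup>+x. ennreal (indicator B x * (K x)\<^sup>2 * (excess s x)\<^sup>2) \<partial>M) \<le> ennreal ((\<theta> + (\<integral>x. indicator B x * Z x \<partial>M)) * energy s)"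
    if [measurable]: "B \<in> sets M" and "k < s" for B s
    by (rule excess_Sobolev[OF \<open>k < s\<close> _ Sob_K[OF _ that(1)]]) measurable
  have K_Sob: "integrable M (\<lambda>x. (K x * excess s x)\<^sup>2)" if "k < s" for s
  proof (rule integrableI_nonneg)
    have "(\<integral>\<^sup>+x. ennreal ((K x * excess s x)\<^sup>2) \<partial>M) = (\<integral>\<^sup>+x. ennreal (indicator \<Omega> x * (K x)\<^sup>2 * (excess s x)\<^sup>2) \<partial>M)"
      by (rule nn_integral_cong) (simp add: power_mult_distrib)
    also have "\<dots> \<le> ennreal ((\<theta> + tot) * energy s)" unfolding tot_def by (rule excK[OF Om that])
    also have "\<dots> < \<infinity>" by simp
    finally show "(\<integral>\<^sup>+x. ennreal ((K x * excess s x)\<^sup>2) \<partial>M) < \<infinity>" .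
  qed auto
  have top_level: "AE x in M. ereal (u x) = m \<longrightarrow> nrm x (g x) = 0"
  proof (cases m)
    case (real s)
    have KN: "integrable M (\<lambda>x. K x * nrm x (g x))" by (rule integrable_mult_L2[OF _ _ K_L2 g_L2]) measurable
    define I where "I = (\<integral>x. K x * nrm x (g x) \<partial>M)"
    have e: "energy (t n) \<le> C * ((s - t n) * I)" for n
    proof -
      note el = energy_le[OF t(1)[of n] K_Sob[OF t(1)[of n]]]
      have "(\<integral>x. excess (t n) x * K x * nrm x (g x) \<partial>M) \<le> (\<integral>x. (s - t n) * (K x * nrm x (g x)) \<partial>M)"
      proof (rule integral_mono_AE[OF el(1)])
        show "integrable M (\<lambda>x. (s - t n) * (K x * nrm x (g x)))" using KN by simp
        show "AE x in M. excess (t n) x * K x * nrm x (g x) \<le> (s - t n) * (K x * nrm x (g x))"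
          using um AE_M_space
        proof eventually_elim
          case (elim x)
          have "t n < s" using t(2)[of n] real by simp
          then have "excess (t n) x \<le> s - t n" using elim(1) real by (simp add: excess_def)
          then have "excess (t n) x * (K x * nrm x (g x)) \<le> (s - t n) * (K x * nrm x (g x))"
            using K_nonneg elim(2) by (intro mult_right_mono) auto
          then show ?case by (simp add: mult.assoc)
        qed
      qed
      also have "\<dots> = (s - t n) * I" by (simp add: I_def)
      finally have "C * (\<integral>x. excess (t n) x * K x * nrm x (g x) \<partial>M) \<le> C * ((s - t n) * I)"
        using C_nonneg by (rule mult_left_mono)
      with el(2) show ?thesis by linarith
    qed
    have [measurable]: "(\<lambda>x. if u x = s then 1 else 0 :: real) \<in> borel_measurable M" by measurable
    have li: "integrable M (\<lambda>x. (if u x = s then 1 else 0) * (nrm x (g x))\<^sup>2)"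
      by (rule Bochner_Integration.integrable_bound[OF g_L2]) auto
    have "(\<integral>x. (if u x = s then 1 else 0) * (nrm x (g x))\<^sup>2 \<partial>M) \<le> C * ((s - t n) * I)" for n
    proof -
      have "(\<integral>x. (if u x = s then 1 else 0) * (nrm x (g x))\<^sup>2 \<partial>M) \<le> energy (t n)"
        unfolding energy_def
        by (rule integral_mono[OF li superlevel_energy_integrable]) (use t(2)[of n] real in \<open>auto simp: indicator_def\<close>)
      with e[of n] show ?thesis by linarith
    qed
    moreover have "(\<lambda>n. C * ((s - t n) * I)) \<longlonglongrightarrow> C * ((s - s) * I)"
      using t(3) real by (intro tendsto_intros) simp
    ultimately have "(\<integral>x. (if u x = s then 1 else 0) * (nrm x (g x))\<^sup>2 \<partial>M) \<le> C * ((s - s) * I)"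
      by (intro LIMSEQ_le_const) auto
    moreover have "0 \<le> (\<integral>x. (if u x = s then 1 else 0) * (nrm x (g x))\<^sup>2 \<partial>M)"
      by (intro Bochner_Integration.integral_nonneg) auto
    ultimately have "(\<integral>x. (if u x = s then 1 else 0) * (nrm x (g x))\<^sup>2 \<partial>M) = 0" by simp
    then have "AE x in M. (if u x = s then 1 else 0) * (nrm x (g x))\<^sup>2 = 0"
      by (subst (asm) integral_nonneg_eq_0_iff_AE[OF li]) auto
    then show ?thesis by (rule eventually_mono) (auto simp: real split: if_splits)
  qed auto
  \<comment> \<open>For infinite \<open>m\<close> the second condition is vacuous. Every point
    leaves \<open>B n\<close> eventually, so the integral of \<open>Z\<close> over it tends to
    zero.\<close>
  define B where "B n = {x \<in> space M. t n < u x \<and> ereal (u x) < m}" for n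
  have [measurable]: "B n \<in> sets M" for n unfolding B_def by measurable
  have "(\<lambda>n. \<integral>x. indicator (B n) x * Z x \<partial>M) \<longlonglongrightarrow> (\<integral>x. 0 \<partial>M)"
  proof (rule integral_dominated_convergence[OF _ _ Z(1)])
    show "AE x in M. (\<lambda>n. indicator (B n) x * Z x) \<longlonglongrightarrow> 0"
    proof (rule AE_I2)
      fix x
      have "\<forall>\<^sub>F n in sequentially. indicator (B n) x * Z x = 0"
      proof (cases "ereal (u x) < m")
        case True
        from order_tendstoD(1)[OF t(3) this] show ?thesis by eventually_elim (simp add: B_def indicator_def)
      qed (simp add: B_def)
      then show "(\<lambda>n. indicator (B n) x * Z x) \<longlonglongrightarrow> 0" by (rule tendsto_eventually)
    qed
  qed (use Z borel_measurable_integrable[OF Z(1)] in \<open>auto simp: indicator_def\<close>)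
  then have "(\<lambda>n. C\<^sup>2 * (\<theta> + (\<integral>x. indicator (B n) x * Z x \<partial>M))) \<longlonglongrightarrow> C\<^sup>2 * (\<theta> + 0)"
    by (intro tendsto_intros) simp
  then have "\<forall>\<^sub>F n in sequentially. C\<^sup>2 * (\<theta> + (\<integral>x. indicator (B n) x * Z x \<partial>M)) < 1"
    using \<theta>(2) by (intro order_tendstoD(2)) simp_all
  then obtain n where n: "C\<^sup>2 * (\<theta> + (\<integral>x. indicator (B n) x * Z x \<partial>M)) < 1"
    by (auto simp: eventually_sequentially)
  define \<kappa> where "\<kappa> = \<theta> + (\<integral>x. indicator (B n) x * Z x \<partial>M)"
  define A where "A = (\<integral>x. indicator (B n) x * (K x)\<^sup>2 * (excess (t n) x)\<^sup>2 \<partial>M)"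
  have \<kappa>0: "0 \<le> \<kappa>" unfolding \<kappa>_def using \<theta>(1) Z(2)
    by (intro add_nonneg_nonneg Bochner_Integration.integral_nonneg) (auto simp: indicator_def)
  have Ai: "integrable M (\<lambda>x. indicator (B n) x * (K x)\<^sup>2 * (excess (t n) x)\<^sup>2)"
    by (rule Bochner_Integration.integrable_bound[OF K_Sob[OF t(1)[of n]]])
       (auto simp: indicator_def power_mult_distrib)
  have A_le: "A \<le> \<kappa> * energy (t n)"
  proof -
    have "ennreal A = (\<integral>\<^sup>+x. ennreal (indicator (B n) x * (K x)\<^sup>2 * (excess (t n) x)\<^sup>2) \<partial>M)"
      unfolding A_def using Ai by (intro nn_integral_eq_integral[symmetric]) auto
    also have "\<dots> \<le> ennreal (\<kappa> * energy (t n))" unfolding \<kappa>_def by (rule excK[OF _ t(1)]) measurable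
    finally show ?thesis using \<kappa>0 energy_nonneg by (simp add: ennreal_le_iff)
  qed
  have "energy (t n) \<le> C * (\<integral>x. excess (t n) x * K x * nrm x (g x) \<partial>M)"
    by (rule energy_le(2)[OF t(1) K_Sob[OF t(1)]])
  also have "\<dots> = (\<integral>x. C * (excess (t n) x * K x * nrm x (g x)) \<partial>M)" by simp
  \<comment> \<open>\<open>2 a b \<le> a\<^sup>2 + b\<^sup>2\<close> with
    \<open>a = C K (u - t n)\<^sup>+\<close> and \<open>b = |\<nabla>u|\<close> on
    \<open>B n\<close>; off \<open>B n\<close> the left-hand side is zero almost everywhere. Half of
    the energy can be absorbed, which leaves
    \<open>energy (t n) \<le> C\<^sup>2 * A\<close>.\<close>
  also have "\<dots> \<le> (\<integral>x. 1/2 * (C\<^sup>2 * (indicator (B n) x * (K x)\<^sup>2 * (excess (t n) x)\<^sup>2) + indicator {x. t n < u x} x * (nrm x (g x))\<^sup>2) \<partial>M)"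
  proof (rule integral_mono_AE)
    show "integrable M (\<lambda>x. C * (excess (t n) x * K x * nrm x (g x)))"
      using energy_le(1)[OF t(1) K_Sob[OF t(1)]] by simp
    show "integrable M (\<lambda>x. 1/2 * (C\<^sup>2 * (indicator (B n) x * (K x)\<^sup>2 * (excess (t n) x)\<^sup>2) + indicator {x. t n < u x} x * (nrm x (g x))\<^sup>2))"
      using Ai superlevel_energy_integrable by simp
    show "AE x in M. C * (excess (t n) x * K x * nrm x (g x))
        \<le> 1/2 * (C\<^sup>2 * (indicator (B n) x * (K x)\<^sup>2 * (excess (t n) x)\<^sup>2) + indicator {x. t n < u x} x * (nrm x (g x))\<^sup>2)"
      using top_level um AE_M_space
    proof eventually_elim
      case (elim x)
      show ?case
      proof (cases "x \<in> B n")
        case True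
        then have "indicator {x. t n < u x} x = (1::real)" by (simp add: B_def)
        moreover have "2 * (C * K x * excess (t n) x) * nrm x (g x) \<le> (C * K x * excess (t n) x)\<^sup>2 + (nrm x (g x))\<^sup>2"
          by (rule sum_squares_bound)
        ultimately show ?thesis using True by (simp add: power_mult_distrib algebra_simps)
      next
        case False
        then have "u x \<le> t n \<or> ereal (u x) = m" using elim(2,3) by (auto simp: B_def not_less)
        then have "excess (t n) x = 0 \<or> nrm x (g x) = 0" using elim(1) by (auto simp: excess_def)
        then show ?thesis by (auto simp: indicator_def)
      qed
    qed
  qed
  also have "\<dots> = 1/2 * (C\<^sup>2 * A + energy (t n))"
    unfolding A_def energy_def using Ai superlevel_energy_integrable by simp
  finally have "energy (t n) \<le> C\<^sup>2 * A" by simp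
  also have "\<dots> \<le> C\<^sup>2 * (\<kappa> * energy (t n))" using A_le by (intro mult_left_mono) auto
  finally have "energy (t n) \<le> (C\<^sup>2 * \<kappa>) * energy (t n)" by (simp add: mult.assoc)
  moreover have "(C\<^sup>2 * \<kappa>) * energy (t n) < 1 * energy (t n)" if "0 < energy (t n)"
    using that n by (intro mult_strict_right_mono) (auto simp: \<kappa>_def)
  ultimately have "energy (t n) = 0" using energy_nonneg[of "t n"] by fastforce
  moreover have "(\<integral>\<^sup>+x. ennreal (1 * (excess (t n) x)\<^sup>2) \<partial>M) \<le> ennreal (\<Lambda>0 * energy (t n))"
    by (rule excess_Sobolev[OF t(1)]) (use Sob in auto)
  ultimately have "(\<integral>\<^sup>+x. ennreal ((excess (t n) x)\<^sup>2) \<partial>M) = 0" by simp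
  then have "AE x in M. ennreal ((excess (t n) x)\<^sup>2) = 0" by (subst (asm) nn_integral_0_iff_AE) auto
  then have "AE x in M. u x \<le> t n"
    by (rule eventually_mono) (auto simp: excess_def max_def split: if_splits)
  then show False using not_le[OF t(2)] by blast
qed

end

section \<open>The three alternatives\<close>

context degenerate_form
begin

text \<open>The part \<open>\<theta>\<close> is fixed, while the integral of \<open>Z\<close>
  becomes small with \<open>B\<close>; that is why the inequality is required for every measurable
  \<open>B\<close> with the same \<open>Z\<close>. With \<open>K = 1\<close> and
  \<open>B = \<Omega>\<close> it is the Poincare inequality that ends the argument.\<close>

definition absorbs :: "(real^'n \<Rightarrow> real) \<Rightarrow> real \<Rightarrow> (real^'n \<Rightarrow> real) \<Rightarrow> bool" where
  "absorbs K \<theta> Z \<longleftrightarrow> integrable M Z \<and> (\<forall>x. 0 \<le> Z x) \<and> 0 \<le> \<theta> \<and>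
     (\<forall>\<phi>\<in>Lip0 \<Omega>. \<forall>B\<in>sets M. (\<integral>\<^sup>+x. ennreal (indicator B x * (K x)\<^sup>2 * (\<phi> x)\<^sup>2) \<partial>M)
        \<le> ennreal ((\<theta> + (\<integral>x. indicator B x * Z x \<partial>M)) * (\<integral>x. (nrm x (grad \<phi> x))\<^sup>2 \<partial>M)))"

text \<open>A normalised statement suffices: for energy at most \<open>1\<close> there is a density
  \<open>W \<phi>\<close> of mass at most \<open>1\<close> with
  \<open>K\<^sup>2 \<phi>\<^sup>2 \<le> \<theta> W + Z\<close>. Integrating over \<open>B\<close>
  and scaling \<open>\<phi>\<close> give the quadratic inequality. In the applications
  \<open>W\<close> is the Sobolev or Orlicz density, and \<open>Z\<close> bounds the product where
  that density is too small.\<close>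

lemma absorbs_if_pointwise:
  assumes Z: "integrable M Z" "\<And>x. 0 \<le> Z x" and "0 \<le> \<theta>" and K[measurable]: "K \<in> borel_measurable M"
    and norm: "\<And>\<phi>. \<phi> \<in> Lip0 \<Omega> \<Longrightarrow> (\<integral>x. (nrm x (grad \<phi> x))\<^sup>2 \<partial>M) \<le> 1 \<Longrightarrow>
        W \<phi> \<in> borel_measurable M \<and> (\<forall>x. 0 \<le> W \<phi> x) \<and> (\<integral>\<^sup>+x. ennreal (W \<phi> x) \<partial>M) \<le> 1 \<and>
        (AE x in M. (K x)\<^sup>2 * (\<phi> x)\<^sup>2 \<le> \<theta> * W \<phi> x + Z x)"
  shows "absorbs K \<theta> Z"
  unfolding absorbs_def
proof (intro conjI allI ballI)
  fix \<phi> B assume \<phi>: "\<phi> \<in> Lip0 \<Omega>" and B[measurable]: "B \<in> sets M"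
  note [measurable] = Lip0_L2(1,2)[OF \<phi>] borel_measurable_integrable[OF Z(1)]
  define e where "e = (\<integral>x. (nrm x (grad \<phi> x))\<^sup>2 \<partial>M)"
  define I where "I = (\<integral>\<^sup>+x. ennreal (indicator B x * (K x)\<^sup>2 * (\<phi> x)\<^sup>2) \<partial>M)"
  define \<kappa> where "\<kappa> = \<theta> + (\<integral>x. indicator B x * Z x \<partial>M)"
  have BZ: "integrable M (\<lambda>x. indicator B x * Z x)"
    by (rule Bochner_Integration.integrable_bound[OF Z(1)]) (auto simp: indicator_def)
  have BZ0: "0 \<le> (\<integral>x. indicator B x * Z x \<partial>M)"
    using Z(2) by (intro Bochner_Integration.integral_nonneg) (auto simp: indicator_def)
  have \<kappa>0: "0 \<le> \<kappa>" using BZ0 \<open>0 \<le> \<theta>\<close> by (simp add: \<kappa>_def)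
  \<comment> \<open>The bound is stated for all positive \<open>b \<ge> e\<close> because the energy
    \<open>e\<close> may be zero; letting \<open>b\<close> tend to \<open>0\<close> then replaces
    division by \<open>e\<close>.\<close>
  have scaled: "I \<le> ennreal (b * \<kappa>)" if b: "0 < b" and "e \<le> b" for b
  proof -
    define a where "a = 1 / sqrt b"
    have a0: "0 < a" "a\<^sup>2 = 1 / b" using b by (auto simp: a_def power_divide)
    define \<phi>' where "\<phi>' x = a * \<phi> x" for x
    have da: "((\<lambda>s. a * s) has_real_derivative a) (at s)" for s by (auto intro!: derivative_eq_intros)
    have \<phi>'L: "\<phi>' \<in> Lip0 \<Omega>" unfolding \<phi>'_def[abs_def]
    proof (rule Lip0_compose[OF \<phi> _ _ open_\<Omega> bounded_\<Omega>])
      show "\<bar>a\<bar>-lipschitz_on UNIV ((*) a)" by (rule lipschitz_if_derivative_bounded[OF da]) simp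
    qed simp
    have g: "AE x in M. grad \<phi>' x = a *\<^sub>R grad \<phi> x" unfolding \<phi>'_def[abs_def]
      by (rule AE_MI[OF grad_compose_AE[OF Lip0_imp_Lip_loc[OF \<phi>] da open_\<Omega>]])
    have "(\<integral>x. (nrm x (grad \<phi>' x))\<^sup>2 \<partial>M) = (\<integral>x. a\<^sup>2 * (nrm x (grad \<phi> x))\<^sup>2 \<partial>M)"
    proof (rule integral_cong_AE)
      show "AE x in M. (nrm x (grad \<phi>' x))\<^sup>2 = a\<^sup>2 * (nrm x (grad \<phi> x))\<^sup>2"
        using g by eventually_elim (simp add: power_mult_distrib)
      show "(\<lambda>x. (nrm x (grad \<phi>' x))\<^sup>2) \<in> borel_measurable M"
        using Lip0_L2(4)[OF \<phi>'L] by (rule borel_measurable_integrable)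
    qed measurable
    also have "\<dots> \<le> 1" using b \<open>e \<le> b\<close> a0(2) by (simp add: e_def)
    finally have W: "W \<phi>' \<in> borel_measurable M" "\<And>x. 0 \<le> W \<phi>' x" "(\<integral>\<^sup>+x. ennreal (W \<phi>' x) \<partial>M) \<le> 1"
      "AE x in M. (K x)\<^sup>2 * (\<phi>' x)\<^sup>2 \<le> \<theta> * W \<phi>' x + Z x"
      using norm[OF \<phi>'L] by auto
    note [measurable] = W(1)
    have "(\<integral>\<^sup>+x. ennreal (indicator B x * (K x)\<^sup>2 * (\<phi>' x)\<^sup>2) \<partial>M)
        \<le> (\<integral>\<^sup>+x. ennreal \<theta> * ennreal (W \<phi>' x) + ennreal (indicator B x * Z x) \<partial>M)"
    proof (rule nn_integral_mono_AE)
      show "AE x in M. ennreal (indicator B x * (K x)\<^sup>2 * (\<phi>' x)\<^sup>2) \<le> ennreal \<theta> * ennreal (W \<phi>' x) + ennreal (indicator B x * Z x)"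
        using W(4)
      proof eventually_elim
        case (elim x)
        have "indicator B x * (K x)\<^sup>2 * (\<phi>' x)\<^sup>2 \<le> \<theta> * W \<phi>' x + indicator B x * Z x"
          using elim W(2)[of x] \<open>0 \<le> \<theta>\<close> by (auto simp: indicator_def)
        then have "ennreal (indicator B x * (K x)\<^sup>2 * (\<phi>' x)\<^sup>2) \<le> ennreal (\<theta> * W \<phi>' x + indicator B x * Z x)"
          by (rule ennreal_leI)
        also have "\<dots> = ennreal \<theta> * ennreal (W \<phi>' x) + ennreal (indicator B x * Z x)"
          using W(2)[of x] Z(2)[of x] \<open>0 \<le> \<theta>\<close> by (subst ennreal_plus) (auto simp: ennreal_mult indicator_def)
        finally show ?case .
      qed
    qed
    also have "\<dots> = ennreal \<theta> * (\<integral>\<^sup>+x. ennreal (W \<phi>' x) \<partial>M) + (\<integral>\<^sup>+x. ennreal (indicator B x * Z x) \<partial>M)"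
      by (subst nn_integral_add) (auto simp: nn_integral_cmult)
    also have "(\<integral>\<^sup>+x. ennreal (indicator B x * Z x) \<partial>M) = ennreal (\<integral>x. indicator B x * Z x \<partial>M)"
      by (rule nn_integral_eq_integral[OF BZ]) (use Z(2) in \<open>auto simp: indicator_def\<close>)
    also have "ennreal \<theta> * (\<integral>\<^sup>+x. ennreal (W \<phi>' x) \<partial>M) + ennreal (\<integral>x. indicator B x * Z x \<partial>M)
        \<le> ennreal \<theta> * 1 + ennreal (\<integral>x. indicator B x * Z x \<partial>M)"
      using W(3) by (intro add_right_mono mult_left_mono) auto
    also have "\<dots> = ennreal \<kappa>"
      using \<open>0 \<le> \<theta>\<close> BZ0 by (simp add: \<kappa>_def)
    finally have le: "(\<integral>\<^sup>+x. ennreal (indicator B x * (K x)\<^sup>2 * (\<phi>' x)\<^sup>2) \<partial>M) \<le> ennreal \<kappa>" .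
    have "I = (\<integral>\<^sup>+x. ennreal b * ennreal (indicator B x * (K x)\<^sup>2 * (\<phi>' x)\<^sup>2) \<partial>M)"
      unfolding I_def
    proof (rule nn_integral_cong)
      fix x
      have "indicator B x * (K x)\<^sup>2 * (\<phi> x)\<^sup>2 = b * (indicator B x * (K x)\<^sup>2 * (\<phi>' x)\<^sup>2)"
        using b a0(2) by (simp add: \<phi>'_def power_mult_distrib)
      then show "ennreal (indicator B x * (K x)\<^sup>2 * (\<phi> x)\<^sup>2) = ennreal b * ennreal (indicator B x * (K x)\<^sup>2 * (\<phi>' x)\<^sup>2)"
        using ennreal_mult'[OF less_imp_le[OF b]] by metis
    qed
    also have "\<dots> = ennreal b * (\<integral>\<^sup>+x. ennreal (indicator B x * (K x)\<^sup>2 * (\<phi>' x)\<^sup>2) \<partial>M)"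
      unfolding \<phi>'_def by (rule nn_integral_cmult) measurable
    also have "\<dots> \<le> ennreal b * ennreal \<kappa>"
      using le by (rule mult_left_mono) simp
    also have "\<dots> = ennreal (b * \<kappa>)"
      using b by (simp add: ennreal_mult'[symmetric])
    finally show ?thesis .
  qed
  have "I \<le> ennreal (\<kappa> * e)"
  proof (cases "e = 0")
    case False
    then have "0 < e" by (simp add: e_def less_le)
    then show ?thesis using scaled[of e] by (simp add: mult.commute)
  next
    case True
    have "(\<lambda>n. ennreal (1 / real (Suc n) * \<kappa>)) \<longlonglongrightarrow> ennreal (0 * \<kappa>)"
      by (intro tendsto_intros LIMSEQ_Suc[OF lim_1_over_n])
    moreover have "I \<le> ennreal (1 / real (Suc n) * \<kappa>)" for n by (rule scaled) (use True in simp_all)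
    ultimately have "I \<le> ennreal (0 * \<kappa>)" by (intro LIMSEQ_le_const) auto
    then show ?thesis using True by simp
  qed
  then show "(\<integral>\<^sup>+x. ennreal (indicator B x * (K x)\<^sup>2 * (\<phi> x)\<^sup>2) \<partial>M)
      \<le> ennreal ((\<theta> + (\<integral>x. indicator B x * Z x \<partial>M)) * (\<integral>x. (nrm x (grad \<phi> x))\<^sup>2 \<partial>M))"
    by (simp add: I_def \<kappa>_def e_def)
qed (use assms in auto)

lemma absorbs_one:
  assumes "absorbs (\<lambda>_. 1) \<theta> Z" and \<phi>: "\<phi> \<in> Lip0 \<Omega>"
  shows "(\<integral>\<^sup>+x. ennreal ((\<phi> x)\<^sup>2) \<partial>M) \<le> ennreal ((\<theta> + (\<integral>x. indicator \<Omega> x * Z x \<partial>M)) * (\<integral>x. (nrm x (grad \<phi> x))\<^sup>2 \<partial>M))"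
proof -
  have "\<Omega> \<in> sets M" using sets.top[of M] by simp
  then have "(\<integral>\<^sup>+x. ennreal (indicator \<Omega> x * 1\<^sup>2 * (\<phi> x)\<^sup>2) \<partial>M) \<le> ennreal ((\<theta> + (\<integral>x. indicator \<Omega> x * Z x \<partial>M)) * (\<integral>x. (nrm x (grad \<phi> x))\<^sup>2 \<partial>M))"
    using assms unfolding absorbs_def by blast
  moreover have "(\<integral>\<^sup>+x. ennreal (indicator \<Omega> x * 1\<^sup>2 * (\<phi> x)\<^sup>2) \<partial>M) = (\<integral>\<^sup>+x. ennreal ((\<phi> x)\<^sup>2) \<partial>M)"
    by (rule nn_integral_cong) simp
  ultimately show ?thesis by simp
qed

text \<open>Compare \<open>K\<^sup>2\<close> with
  \<open>a * |\<phi>| powr (2 * \<sigma> - 2)\<close>. If it is at most that, the product is at most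
  \<open>a * |\<phi>| powr (2 * \<sigma>)\<close>; otherwise \<open>\<phi>\<^sup>2\<close> is at
  most a constant times \<open>K powr (2 / (\<sigma> - 1))\<close>, and the product is at most
  \<open>Z\<close>. The exponent \<open>2 * \<sigma> / (\<sigma> - 1)\<close> is
  \<open>2 * \<sigma>'\<close>.\<close>

lemma absorbs_power:
  assumes "1 < \<sigma>" "0 < K0"
    and Sob: "\<And>\<phi>. \<phi> \<in> Lip0 \<Omega> \<Longrightarrow> Lp_norm M (2 * \<sigma>) \<phi> \<le> K0 * QL2_norm \<Omega> Q (grad \<phi>)"
    and [measurable]: "K \<in> borel_measurable M" and K: "\<And>x. 0 \<le> K x" "integrable M (\<lambda>x. K x powr (2 * \<sigma> / (\<sigma> - 1)))"
    and "0 < \<theta>"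
  shows "\<exists>Z. absorbs K \<theta> Z"
proof -
  let ?s = "2 * \<sigma>"
  \<comment> \<open>Chosen so that \<open>a * |\<phi>| powr (2 * \<sigma>)\<close> is
    \<open>\<theta>\<close> times
    \<open>|\<phi>| powr (2 * \<sigma>) / K0 powr (2 * \<sigma>)\<close>, a density whose mass is at
    most \<open>1\<close> when the energy is.\<close>
  define a where "a = \<theta> / K0 powr ?s"
  have a0: "0 < a" using assms by (simp add: a_def)
  define Z where "Z x = (1 / a) powr (1 / (\<sigma> - 1)) * K x powr (2 * \<sigma> / (\<sigma> - 1))" for x
  have point: "(K x)\<^sup>2 * y\<^sup>2 \<le> a * \<bar>y\<bar> powr ?s + Z x" for x y
  proof (cases "y = 0 \<or> K x = 0")
    case True
    then show ?thesis using a0 K(1)[of x] by (auto simp: Z_def)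
  next
    case False
    then have y: "0 < \<bar>y\<bar>" and Kx: "0 < K x" using K(1)[of x] by auto
    have Z0: "0 \<le> Z x" using a0 by (simp add: Z_def)
    have y2: "\<bar>y\<bar> powr 2 = y\<^sup>2" using y by simp
    have K2: "K x powr 2 = (K x)\<^sup>2" using Kx by simp
    show ?thesis
    proof (cases "(K x)\<^sup>2 \<le> a * \<bar>y\<bar> powr (?s - 2)")
      case True
      then have "(K x)\<^sup>2 * y\<^sup>2 \<le> a * \<bar>y\<bar> powr (?s - 2) * y\<^sup>2" by (rule mult_right_mono) simp
      also have "\<dots> = a * (\<bar>y\<bar> powr (?s - 2) * \<bar>y\<bar> powr 2)" by (simp only: y2 mult.assoc)
      also have "\<dots> = a * \<bar>y\<bar> powr ?s" by (simp only: powr_add[symmetric] diff_add_cancel)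
      finally show ?thesis using Z0 by linarith
    next
      case False
      then have "\<bar>y\<bar> powr (2 * (\<sigma> - 1)) \<le> (1 / a) * (K x)\<^sup>2"
        using a0 by (simp add: field_simps)
      then have "(\<bar>y\<bar> powr (2 * (\<sigma> - 1))) powr (1 / (\<sigma> - 1)) \<le> ((1 / a) * (K x)\<^sup>2) powr (1 / (\<sigma> - 1))"
        using \<open>1 < \<sigma>\<close> by (intro powr_mono2) auto
      moreover have "(\<bar>y\<bar> powr (2 * (\<sigma> - 1))) powr (1 / (\<sigma> - 1)) = y\<^sup>2"
      proof -
        have "2 * (\<sigma> - 1) * (1 / (\<sigma> - 1)) = 2" using \<open>1 < \<sigma>\<close> by (simp add: field_simps)
        then show ?thesis by (simp only: powr_powr y2)
      qed
      moreover have "((1 / a) * (K x)\<^sup>2) powr (1 / (\<sigma> - 1)) = (1 / a) powr (1 / (\<sigma> - 1)) * K x powr (2 / (\<sigma> - 1))"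
        unfolding K2[symmetric] by (simp only: powr_mult powr_powr times_divide_eq_right mult_1_right)
      ultimately have yle: "y\<^sup>2 \<le> (1 / a) powr (1 / (\<sigma> - 1)) * K x powr (2 / (\<sigma> - 1))" by simp
      have "(K x)\<^sup>2 * y\<^sup>2 \<le> (K x)\<^sup>2 * ((1 / a) powr (1 / (\<sigma> - 1)) * K x powr (2 / (\<sigma> - 1)))"
        using yle by (rule mult_left_mono) simp
      also have "\<dots> = (1 / a) powr (1 / (\<sigma> - 1)) * (K x powr 2 * K x powr (2 / (\<sigma> - 1)))"
        unfolding K2 by simp
      also have "\<dots> = Z x"
      proof -
        have "2 + 2 / (\<sigma> - 1) = 2 * \<sigma> / (\<sigma> - 1)" using \<open>1 < \<sigma>\<close> by (simp add: field_simps)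
        then show ?thesis by (simp add: Z_def powr_add[symmetric])
      qed
      finally show ?thesis using a0 by (smt (verit) powr_ge_zero mult_nonneg_nonneg)
    qed
  qed
  have int: "integrable M (\<lambda>x. \<bar>\<phi> x\<bar> powr ?s)" if \<phi>: "\<phi> \<in> Lip0 \<Omega>" for \<phi>
  proof -
    obtain B where B: "0 < B" "\<And>x. x \<in> \<Omega> \<Longrightarrow> \<bar>\<phi> x\<bar> \<le> B" by (rule Lip0_bounded[OF \<phi> open_\<Omega>]) blast
    note [measurable] = Lip0_L2(1)[OF \<phi>]
    show ?thesis
      by (rule integrable_bounded_M[of _ "B powr ?s"]) (use B \<open>1 < \<sigma>\<close> in \<open>auto intro: powr_mono2\<close>)
  qed
  have Sob': "(\<integral>x. \<bar>\<phi> x\<bar> powr ?s \<partial>M) \<le> (K0 * sqrt (\<integral>x. (nrm x (grad \<phi> x))\<^sup>2 \<partial>M)) powr ?s" if \<phi>: "\<phi> \<in> Lip0 \<Omega>" for \<phi>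
  proof -
    let ?I = "\<integral>x. \<bar>\<phi> x\<bar> powr ?s \<partial>M"
    have "?I powr (1 / ?s) \<le> K0 * sqrt (\<integral>x. (nrm x (grad \<phi> x))\<^sup>2 \<partial>M)"
      using Sob[OF \<phi>] Lip0_L2(2)[OF \<phi>] by (simp add: Lp_norm_def QL2_norm_eq)
    then have "(?I powr (1 / ?s)) powr ?s \<le> (K0 * sqrt (\<integral>x. (nrm x (grad \<phi> x))\<^sup>2 \<partial>M)) powr ?s"
      using \<open>1 < \<sigma>\<close> by (intro powr_mono2) auto
    moreover have "0 \<le> ?I" by simp
    ultimately show ?thesis using \<open>1 < \<sigma>\<close> by (simp add: powr_powr)
  qed
  have "absorbs K \<theta> Z"
  proof (rule absorbs_if_pointwise[where W = "\<lambda>\<phi> x. \<bar>\<phi> x\<bar> powr ?s / K0 powr ?s"])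
    show "integrable M Z" unfolding Z_def using K(2) by simp
    show "0 \<le> Z x" for x using a0 by (simp add: Z_def)
    show "0 \<le> \<theta>" using \<open>0 < \<theta>\<close> by simp
    fix \<phi> assume \<phi>: "\<phi> \<in> Lip0 \<Omega>"
    note [measurable] = Lip0_L2(1)[OF \<phi>]
    assume le1: "(\<integral>x. (nrm x (grad \<phi> x))\<^sup>2 \<partial>M) \<le> 1"
    have "(\<integral>\<^sup>+x. ennreal (\<bar>\<phi> x\<bar> powr ?s / K0 powr ?s) \<partial>M) = ennreal (\<integral>x. \<bar>\<phi> x\<bar> powr ?s / K0 powr ?s \<partial>M)"
      using int[OF \<phi>] by (intro nn_integral_eq_integral) auto
    also have "\<dots> \<le> 1"
    proof -
      have "(\<integral>x. \<bar>\<phi> x\<bar> powr ?s \<partial>M) \<le> (K0 * sqrt (\<integral>x. (nrm x (grad \<phi> x))\<^sup>2 \<partial>M)) powr ?s" by (rule Sob'[OF \<phi>])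
      also have "\<dots> \<le> K0 powr ?s"
        using le1 \<open>0 < K0\<close> \<open>1 < \<sigma>\<close> by (intro powr_mono2) (auto intro: mult_left_le)
      finally have "(\<integral>x. \<bar>\<phi> x\<bar> powr ?s / K0 powr ?s \<partial>M) \<le> 1" using \<open>0 < K0\<close> by (simp add: divide_le_eq)
      then show ?thesis using ennreal_leI[of _ 1] by simp
    qed
    finally have W1: "(\<integral>\<^sup>+x. ennreal (\<bar>\<phi> x\<bar> powr ?s / K0 powr ?s) \<partial>M) \<le> 1" .
    have "(K x)\<^sup>2 * (\<phi> x)\<^sup>2 \<le> \<theta> * (\<bar>\<phi> x\<bar> powr ?s / K0 powr ?s) + Z x" for x
      using point[of x "\<phi> x"] by (simp add: a_def)
    with W1 show "(\<lambda>x. \<bar>\<phi> x\<bar> powr ?s / K0 powr ?s) \<in> borel_measurable M \<and> (\<forall>x. 0 \<le> \<bar>\<phi> x\<bar> powr ?s / K0 powr ?s) \<and>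
        (\<integral>\<^sup>+x. ennreal (\<bar>\<phi> x\<bar> powr ?s / K0 powr ?s) \<partial>M) \<le> 1 \<and>
        (AE x in M. (K x)\<^sup>2 * (\<phi> x)\<^sup>2 \<le> \<theta> * (\<bar>\<phi> x\<bar> powr ?s / K0 powr ?s) + Z x)"
      by auto
  qed measurable
  then show ?thesis by blast
qed

end

section \<open>Orlicz norms and exponential integrability\<close>

text \<open>Strictness matters: the infimum is not known to be attained, but some admissible
  \<open>a\<close> below \<open>l\<close> exists, and monotonicity of \<open>A\<close> passes from
  \<open>a\<close> to \<open>l\<close>.\<close>

lemma Orlicz_norm_less_imp:
  fixes f :: "'a \<Rightarrow> 'b::euclidean_space"
  assumes "Orlicz_norm M A f < ennreal l" and mono: "\<And>s t. 0 \<le> s \<Longrightarrow> s \<le> t \<Longrightarrow> A s \<le> A t"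
  shows "(\<integral>\<^sup>+x. ennreal (A (norm (f x) / l)) \<partial>M) \<le> 1"
proof -
  obtain a where a: "0 < a" "(\<integral>\<^sup>+x. ennreal (A (norm (f x) / a)) \<partial>M) \<le> 1" "ennreal a < ennreal l"
    using assms(1) unfolding Orlicz_norm_def Inf_less_iff by auto
  then have "a < l" by (simp add: ennreal_less_iff)
  have "(\<integral>\<^sup>+x. ennreal (A (norm (f x) / l)) \<partial>M) \<le> (\<integral>\<^sup>+x. ennreal (A (norm (f x) / a)) \<partial>M)"
    using \<open>0 < a\<close> \<open>a < l\<close> by (intro nn_integral_mono ennreal_leI mono divide_left_mono) auto
  with a(2) show ?thesis by simp
qed

text \<open>\<open>s\<^sup>2\<close> is absorbed into \<open>exp ((2 / r) * s powr r)\<close>, which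
  explains \<open>D'\<close>. The bound \<open>D' * s powr r \<le> C + s powr p\<close> holds
  because either \<open>D' \<le> s powr (p - r)\<close>, or \<open>s\<close> is at most
  \<open>D' powr (1 / (p - r))\<close>, which explains \<open>C\<close>.\<close>

lemma square_exp_powr_le:
  assumes "0 < r" "r < p" "0 \<le> (D::real)"
  obtains C where "\<And>s. 0 \<le> s \<Longrightarrow> s\<^sup>2 * exp (D * s powr r) \<le> C * exp (s powr p)"
proof -
  define D' where "D' = D + 2 / r"
  define C where "C = D' * (D' powr (1 / (p - r))) powr r"
  have D': "0 < D'" using assms by (simp add: D'_def add_nonneg_pos)
  have "s\<^sup>2 * exp (D * s powr r) \<le> exp C * exp (s powr p)" if s: "0 \<le> s" for s
  proof (cases "s = 0")
    case False
    then have s: "0 < s" using that by simp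
    have "r * ln s = ln (s powr r)" using s by (simp add: ln_powr)
    also have "\<dots> \<le> s powr r" using s ln_le_minus_one[of "s powr r"] by simp
    finally have "2 * ln s \<le> (2 / r) * s powr r" using \<open>0 < r\<close> by (simp add: field_simps)
    then have ln: "2 * ln s + D * s powr r \<le> D' * s powr r" by (simp add: D'_def distrib_right)
    have "D' * s powr r \<le> C + s powr p"
    proof (cases "D' \<le> s powr (p - r)")
      case True
      then have "D' * s powr r \<le> s powr (p - r) * s powr r" by (rule mult_right_mono) simp
      also have "\<dots> = s powr p" by (simp only: powr_add[symmetric] diff_add_cancel)
      finally show ?thesis using D' by (simp add: C_def add_increasing)
    next
      case False
      then have "(s powr (p - r)) powr (1 / (p - r)) \<le> D' powr (1 / (p - r))"
        using assms by (intro powr_mono2) auto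
      moreover have "(s powr (p - r)) powr (1 / (p - r)) = s" using assms s by (simp add: powr_powr)
      ultimately have "s powr r \<le> (D' powr (1 / (p - r))) powr r"
        using s \<open>0 < r\<close> by (intro powr_mono2) auto
      then have "D' * s powr r \<le> C" unfolding C_def using D' by (intro mult_left_mono) auto
      then show ?thesis by (simp add: add_increasing2)
    qed
    with ln have "exp (2 * ln s + D * s powr r) \<le> exp (C + s powr p)" by simp
    moreover have "s\<^sup>2 = exp (2 * ln s)" using s by (simp add: exp_double)
    ultimately show ?thesis by (simp add: exp_add)
  qed simp
  then show ?thesis by (rule that)
qed

text \<open>The strict inequality \<open>r < p\<close>, which comes from
  \<open>\<lambda> < 1\<close>, makes the exponential of any multiple \<open>D\<close> of the
  smaller power integrable, whatever the Luxemburg norm of \<open>f\<close> is.\<close>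

lemma integrable_exp_Orlicz:
  fixes f :: "'a \<Rightarrow> 'b::euclidean_space"
  assumes fin: "finite_measure M" and f: "f \<in> Orlicz M (\<lambda>t. exp (t powr p) - 1)" and r: "0 < r" "r < p" "0 \<le> D"
  shows "integrable M (\<lambda>x. (norm (f x))\<^sup>2 * exp (D * norm (f x) powr r))"
proof -
  interpret finite_measure M by fact
  have [measurable]: "f \<in> borel_measurable M" using f by (simp add: Orlicz_def)
  have "Inf {ennreal l |l. 0 < l \<and> (\<integral>\<^sup>+x. ennreal (exp ((norm (f x) / l) powr p) - 1) \<partial>M) \<le> 1} < top"
    using f by (simp add: Orlicz_def Orlicz_norm_def)
  then obtain a where a: "0 < a" "(\<integral>\<^sup>+x. ennreal (exp ((norm (f x) / a) powr p) - 1) \<partial>M) \<le> 1"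
    unfolding Inf_less_iff by auto
  have "integrable M (\<lambda>x. exp ((norm (f x) / a) powr p) - 1)"
  proof (rule integrableI_nonneg)
    show "(\<integral>\<^sup>+x. ennreal (exp ((norm (f x) / a) powr p) - 1) \<partial>M) < \<infinity>"
      using a(2) by (rule order_le_less_trans) simp
  qed auto
  then have "integrable M (\<lambda>x. (exp ((norm (f x) / a) powr p) - 1) + 1)"
    by (rule Bochner_Integration.integrable_add) simp
  then have E: "integrable M (\<lambda>x. exp ((norm (f x) / a) powr p))" by simp
  obtain C where C: "\<And>s. 0 \<le> s \<Longrightarrow> s\<^sup>2 * exp (D * a powr r * s powr r) \<le> C * exp (s powr p)"
    by (rule square_exp_powr_le[of r p "D * a powr r"]) (use r in auto)
  show ?thesis
  proof (rule Bochner_Integration.integrable_bound)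
    show "integrable M (\<lambda>x. a\<^sup>2 * (C * exp ((norm (f x) / a) powr p)))" using E by simp
    show "AE x in M. norm ((norm (f x))\<^sup>2 * exp (D * norm (f x) powr r)) \<le> norm (a\<^sup>2 * (C * exp ((norm (f x) / a) powr p)))"
    proof (rule AE_I2)
      fix x
      have "norm (f x) powr r = a powr r * (norm (f x) / a) powr r"
        using a(1) by (simp add: powr_divide)
      then have "(norm (f x))\<^sup>2 * exp (D * norm (f x) powr r)
          = a\<^sup>2 * ((norm (f x) / a)\<^sup>2 * exp (D * a powr r * (norm (f x) / a) powr r))"
        using a(1) by (simp add: power_divide mult.assoc)
      also have "\<dots> \<le> a\<^sup>2 * (C * exp ((norm (f x) / a) powr p))"
        using C[of "norm (f x) / a"] a(1) by (intro mult_left_mono) auto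
      finally show "norm ((norm (f x))\<^sup>2 * exp (D * norm (f x) powr r)) \<le> norm (a\<^sup>2 * (C * exp ((norm (f x) / a) powr p)))"
        by simp
    qed
  qed measurable
qed

text \<open>\<open>a + b\<close> is at most twice the larger of the two. This passes integrability
  from \<open>|G|\<close> and \<open>|H|\<close> separately to functions of their sum.\<close>

lemma mono_sum_le:
  fixes f :: "real \<Rightarrow> real"
  assumes "\<And>s t. 0 \<le> s \<Longrightarrow> s \<le> t \<Longrightarrow> f s \<le> f t" "\<And>s. 0 \<le> f s" "0 \<le> a" "0 \<le> b"
  shows "f (a + b) \<le> f (2 * a) + f (2 * b)"
proof (cases "a \<le> b")
  case True
  then show ?thesis using assms(1)[of "a + b" "2 * b"] assms(2)[of "2 * a"] assms(3,4) by auto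
next
  case False
  then show ?thesis using assms(1)[of "a + b" "2 * a"] assms(2)[of "2 * b"] assms(3,4) by auto
qed

context degenerate_form
begin

text \<open>The density is \<open>\<phi>\<^sup>2 / K0\<^sup>2\<close>, and \<open>Z = 0\<close>:
  nothing becomes small with \<open>B\<close>, so smallness must come from
  \<open>\<theta> = b\<^sup>2 * K0\<^sup>2\<close> itself.\<close>

lemma absorbs_bounded:
  assumes "0 < K0"
    and Sob: "\<And>\<phi>. \<phi> \<in> Lip0 \<Omega> \<Longrightarrow> Lp_norm M 2 \<phi> \<le> K0 * QL2_norm \<Omega> Q (grad \<phi>)"
    and K: "K \<in> borel_measurable M" "AE x in M. \<bar>K x\<bar> \<le> b"
  shows "absorbs K (b\<^sup>2 * K0\<^sup>2) (\<lambda>_. 0)"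
proof (rule absorbs_if_pointwise[where W = "\<lambda>\<phi> x. (\<phi> x)\<^sup>2 / K0\<^sup>2"])
  fix \<phi> assume \<phi>: "\<phi> \<in> Lip0 \<Omega>" and le1: "(\<integral>x. (nrm x (grad \<phi> x))\<^sup>2 \<partial>M) \<le> 1"
  note [measurable] = Lip0_L2(1)[OF \<phi>]
  have "sqrt (\<integral>x. (\<phi> x)\<^sup>2 \<partial>M) \<le> K0 * sqrt (\<integral>x. (nrm x (grad \<phi> x))\<^sup>2 \<partial>M)"
    using Sob[OF \<phi>] Lip0_L2(2)[OF \<phi>] by (simp add: Lp_norm_2 QL2_norm_eq)
  also have "\<dots> \<le> K0" using le1 \<open>0 < K0\<close> by (intro mult_left_le) auto
  finally have "(\<integral>x. (\<phi> x)\<^sup>2 \<partial>M) \<le> K0\<^sup>2" by (rule sqrt_le_D)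
  then have "(\<integral>x. (\<phi> x)\<^sup>2 / K0\<^sup>2 \<partial>M) \<le> 1" using \<open>0 < K0\<close> by (simp add: divide_le_eq)
  then have "ennreal (\<integral>x. (\<phi> x)\<^sup>2 / K0\<^sup>2 \<partial>M) \<le> 1" using ennreal_leI[of _ 1] by simp
  moreover have "(\<integral>\<^sup>+x. ennreal ((\<phi> x)\<^sup>2 / K0\<^sup>2) \<partial>M) = ennreal (\<integral>x. (\<phi> x)\<^sup>2 / K0\<^sup>2 \<partial>M)"
    using Lip0_L2(3)[OF \<phi>] by (intro nn_integral_eq_integral) auto
  moreover have "AE x in M. (K x)\<^sup>2 * (\<phi> x)\<^sup>2 \<le> b\<^sup>2 * K0\<^sup>2 * ((\<phi> x)\<^sup>2 / K0\<^sup>2) + 0"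
    using K(2)
  proof eventually_elim
    case (elim x)
    then have "(K x)\<^sup>2 \<le> b\<^sup>2" by (metis abs_ge_zero power2_abs power_mono)
    then show ?case using \<open>0 < K0\<close> by (simp add: mult_right_mono)
  qed
  ultimately show "(\<lambda>x. (\<phi> x)\<^sup>2 / K0\<^sup>2) \<in> borel_measurable M \<and> (\<forall>x. 0 \<le> (\<phi> x)\<^sup>2 / K0\<^sup>2) \<and>
      (\<integral>\<^sup>+x. ennreal ((\<phi> x)\<^sup>2 / K0\<^sup>2) \<partial>M) \<le> 1 \<and>
      (AE x in M. (K x)\<^sup>2 * (\<phi> x)\<^sup>2 \<le> b\<^sup>2 * K0\<^sup>2 * ((\<phi> x)\<^sup>2 / K0\<^sup>2) + 0)"
    by simp
qed (use K(1) in auto)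

text \<open>With \<open>X = |\<phi>| / l\<close>, compare \<open>K\<^sup>2 * l\<^sup>2\<close> with
  \<open>\<theta> * ln (exp 1 + X) powr \<sigma>\<close>. If it is at most that, the product is at
  most \<open>\<theta> * A(X)\<close>; otherwise the logarithm is at most a multiple of
  \<open>K powr (2 / \<sigma>)\<close>, so \<open>X\<close> is at most an exponential of it, and the
  product is at most \<open>Z\<close>.\<close>

lemma absorbs_Orlicz:
  assumes "0 < \<sigma>" "0 < K0"
    and Sob: "\<And>\<phi>. \<phi> \<in> Lip0 \<Omega> \<Longrightarrow> Orlicz_norm M (\<lambda>t. t\<^sup>2 * ln (exp 1 + t) powr \<sigma>) \<phi>
                \<le> ennreal (K0 * QL2_norm \<Omega> Q (grad \<phi>))"
    and K_measurable[measurable]: "K \<in> borel_measurable M" and K: "\<And>x. 0 \<le> K x"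
    and K_exp: "\<And>D. 0 \<le> D \<Longrightarrow> integrable M (\<lambda>x. (K x)\<^sup>2 * exp (D * K x powr (2 / \<sigma>)))"
    and "0 < \<theta>"
  shows "\<exists>Z. absorbs K \<theta> Z"
proof -
  let ?A = "\<lambda>t. t\<^sup>2 * ln (exp 1 + t) powr \<sigma>"
  \<comment> \<open>Twice the Sobolev constant, because \<open>Orlicz_norm_less_imp\<close> requires
    a strict inequality.\<close>
  define l where "l = 2 * K0"
  have l0: "0 < l" "K0 < l" using \<open>0 < K0\<close> by (auto simp: l_def)
  \<comment> \<open>\<open>l\<^sup>2 / \<theta>\<close> is the factor in the comparison with the
    logarithm, the power \<open>1 / \<sigma>\<close> undoes \<open>powr \<sigma>\<close>, and the
    \<open>2\<close> comes from squaring \<open>X\<close>.\<close>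
  define D where "D = 2 * (l\<^sup>2 / \<theta>) powr (1 / \<sigma>)"
  define Z where "Z x = l\<^sup>2 * ((K x)\<^sup>2 * exp (D * K x powr (2 / \<sigma>)))" for x
  have ln1: "1 \<le> ln (exp 1 + t)" if "0 \<le> t" for t :: real
    using that by (subst ln_ge_iff) (auto intro: add_pos_nonneg)
  have A_mono: "?A s \<le> ?A t" if "0 \<le> s" "s \<le> t" for s t
    using that ln1[OF that(1)] \<open>0 < \<sigma>\<close> by (intro mult_mono power_mono powr_mono2) (auto intro!: ln_mono add_pos_nonneg)
  have point: "(K x)\<^sup>2 * y\<^sup>2 \<le> \<theta> * ?A (\<bar>y\<bar> / l) + Z x" for x y
  proof -
    define X where "X = \<bar>y\<bar> / l"
    have X0: "0 \<le> X" using l0 by (simp add: X_def)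
    have y: "y\<^sup>2 = l\<^sup>2 * X\<^sup>2" using l0 by (simp add: X_def power_divide)
    have Z0: "0 \<le> Z x" by (simp add: Z_def)
    have "(K x)\<^sup>2 * (l\<^sup>2 * X\<^sup>2) \<le> \<theta> * ?A X + Z x"
    proof (cases "(K x)\<^sup>2 * l\<^sup>2 \<le> \<theta> * ln (exp 1 + X) powr \<sigma>")
      case True
      then have "(K x)\<^sup>2 * l\<^sup>2 * X\<^sup>2 \<le> \<theta> * ln (exp 1 + X) powr \<sigma> * X\<^sup>2" by (rule mult_right_mono) simp
      then show ?thesis using Z0 by (simp add: algebra_simps)
    next
      case False
      then have Kx: "0 < K x" using K[of x] \<open>0 < \<theta>\<close> by (cases "K x = 0") (auto simp: mult_nonneg_nonneg)
      have K2: "(K x)\<^sup>2 = K x powr 2" using Kx by simp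
      have "ln (exp 1 + X) powr \<sigma> \<le> (l\<^sup>2 / \<theta>) * K x powr 2"
        using False \<open>0 < \<theta>\<close> unfolding K2[symmetric] by (simp add: field_simps)
      then have "(ln (exp 1 + X) powr \<sigma>) powr (1 / \<sigma>) \<le> ((l\<^sup>2 / \<theta>) * K x powr 2) powr (1 / \<sigma>)"
        using \<open>0 < \<sigma>\<close> by (intro powr_mono2) auto
      moreover have "(ln (exp 1 + X) powr \<sigma>) powr (1 / \<sigma>) = ln (exp 1 + X)"
        using \<open>0 < \<sigma>\<close> ln1[OF X0] by (simp add: powr_powr)
      moreover have "((l\<^sup>2 / \<theta>) * K x powr 2) powr (1 / \<sigma>) = (l\<^sup>2 / \<theta>) powr (1 / \<sigma>) * K x powr (2 / \<sigma>)"
        by (simp only: powr_mult powr_powr times_divide_eq_right mult_1_right)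
      ultimately have ln: "ln (exp 1 + X) \<le> (l\<^sup>2 / \<theta>) powr (1 / \<sigma>) * K x powr (2 / \<sigma>)" by simp
      have "X \<le> exp (ln (exp 1 + X))" using X0 by (simp add: add_pos_nonneg)
      also have "\<dots> \<le> exp ((l\<^sup>2 / \<theta>) powr (1 / \<sigma>) * K x powr (2 / \<sigma>))" using ln by simp
      finally have "X\<^sup>2 \<le> (exp ((l\<^sup>2 / \<theta>) powr (1 / \<sigma>) * K x powr (2 / \<sigma>)))\<^sup>2" using X0 by (rule power_mono)
      also have "\<dots> = exp (D * K x powr (2 / \<sigma>))" by (simp add: D_def mult.assoc flip: exp_double)
      finally have "(K x)\<^sup>2 * (l\<^sup>2 * X\<^sup>2) \<le> (K x)\<^sup>2 * (l\<^sup>2 * exp (D * K x powr (2 / \<sigma>)))"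
        by (intro mult_left_mono) auto
      also have "\<dots> = Z x" by (simp add: Z_def)
      finally show ?thesis using \<open>0 < \<theta>\<close> by (simp add: add_increasing)
    qed
    then show ?thesis unfolding y X_def[symmetric] .
  qed
  have "absorbs K \<theta> Z"
  proof (rule absorbs_if_pointwise[where W = "\<lambda>\<phi> x. ?A (\<bar>\<phi> x\<bar> / l)"])
    show "integrable M Z" unfolding Z_def using K_exp[of D] by (simp add: D_def)
    show "0 \<le> Z x" for x by (simp add: Z_def)
    show "0 \<le> \<theta>" using \<open>0 < \<theta>\<close> by simp
    fix \<phi> assume \<phi>: "\<phi> \<in> Lip0 \<Omega>" and le1: "(\<integral>x. (nrm x (grad \<phi> x))\<^sup>2 \<partial>M) \<le> 1"
    note [measurable] = Lip0_L2(1)[OF \<phi>]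
    have "Orlicz_norm M ?A \<phi> \<le> ennreal (K0 * QL2_norm \<Omega> Q (grad \<phi>))" by (rule Sob[OF \<phi>])
    also have "\<dots> \<le> ennreal K0"
      using le1 \<open>0 < K0\<close> Lip0_L2(2)[OF \<phi>] by (intro ennreal_leI mult_left_le) (auto simp: QL2_norm_eq)
    also have "\<dots> < ennreal l" using l0 \<open>0 < K0\<close> by (intro ennreal_lessI) auto
    finally have "(\<integral>\<^sup>+x. ennreal (?A (norm (\<phi> x) / l)) \<partial>M) \<le> 1"
      by (rule Orlicz_norm_less_imp) (rule A_mono)
    moreover have "(K x)\<^sup>2 * (\<phi> x)\<^sup>2 \<le> \<theta> * ?A (\<bar>\<phi> x\<bar> / l) + Z x" for x by (rule point)
    ultimately show "(\<lambda>x. ?A (\<bar>\<phi> x\<bar> / l)) \<in> borel_measurable M \<and> (\<forall>x. 0 \<le> ?A (\<bar>\<phi> x\<bar> / l)) \<and>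
        (\<integral>\<^sup>+x. ennreal (?A (\<bar>\<phi> x\<bar> / l)) \<partial>M) \<le> 1 \<and>
        (AE x in M. (K x)\<^sup>2 * (\<phi> x)\<^sup>2 \<le> \<theta> * ?A (\<bar>\<phi> x\<bar> / l) + Z x)"
      by auto
  qed measurable
  then show ?thesis by blast
qed

end

section \<open>The maximum principle\<close>

lemma GDERIV_uminus_iff: "GDERIV (\<lambda>x. - f x) x :> D \<longleftrightarrow> GDERIV f x :> - D"
  using GDERIV_minus[of f x "- D"] GDERIV_minus[of "\<lambda>x. - f x" x D] by auto

text \<open>Valid at every point, including those without a gradient, where both sides take the
  default value \<open>0\<close>.\<close>

lemma grad_uminus: "grad (\<lambda>x. - f x) x = - grad f x"
proof (cases "\<exists>D. GDERIV f x :> D")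
  case True
  then obtain D where D: "GDERIV f x :> D" by blast
  then have "GDERIV (\<lambda>x. - f x) x :> - D" by (rule GDERIV_minus)
  then show ?thesis using D by (simp add: grad_eqI)
next
  case False
  then show ?thesis unfolding grad_def GDERIV_uminus_iff by auto
qed

lemma Lip_loc_uminus: "f \<in> Lip_loc \<Omega> \<Longrightarrow> (\<lambda>x. - f x) \<in> Lip_loc \<Omega>"
  by (rule Lip_loc_compose[where M = 1]) (auto intro!: lipschitz_onI simp: dist_minus)

lemma Lp_2_uminus: "f \<in> Lp M 2 \<Longrightarrow> (\<lambda>x. - f x) \<in> Lp M 2"
  by (simp add: Lp_2_iff)

context degenerate_form
begin

lemma QL2_uminus: "h \<in> QL2 \<Omega> Q \<Longrightarrow> (\<lambda>x. - h x) \<in> QL2 \<Omega> Q"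
  using nrm_scale[of _ "-1"] by (simp add: QL2_iff)

lemma QH12_uminus:
  assumes "(u, g) \<in> QH12 \<Omega> v Q"
  shows "((\<lambda>x. - u x), (\<lambda>x. - g x)) \<in> QH12 \<Omega> v Q"
proof -
  let ?X = "Lip_loc \<Omega> \<inter> QH1_finite \<Omega> v Q"
  obtain \<phi> :: "nat \<Rightarrow> real^'n \<Rightarrow> real" where \<phi>: "\<And>k. \<phi> k \<in> ?X" and u: "u \<in> Lp M 2" and g: "g \<in> QL2 \<Omega> Q"
    and lim: "(\<lambda>k. Lp_norm M 2 (\<lambda>x. \<phi> k x - u x)) \<longlonglongrightarrow> 0"
      "(\<lambda>k. QL2_norm \<Omega> Q (\<lambda>x. grad (\<phi> k) x - g x)) \<longlonglongrightarrow> 0"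
    using assms unfolding QH12_def QH_completion_def by auto
  have "norm (- a - - b) = norm (a - b)" for a b :: real by simp
  then have "Lp_norm M 2 (\<lambda>x. - \<phi> k x - - u x) = Lp_norm M 2 (\<lambda>x. \<phi> k x - u x)" for k
    unfolding Lp_norm_def by presburger
  moreover have "norm (A *v (- \<xi> - - \<eta>)) = norm (A *v (\<xi> - \<eta>))" for A :: "real^'n^'n" and \<xi> \<eta>
    by (simp add: matrix_vector_mult_diff_distrib norm_minus_commute)
  then have "QL2_norm \<Omega> Q (\<lambda>x. grad (\<lambda>y. - \<phi> k y) x - - g x) = QL2_norm \<Omega> Q (\<lambda>x. grad (\<phi> k) x - g x)" for k
    unfolding QL2_norm_def grad_uminus by presburger
  moreover have "(\<lambda>x. - \<phi> k x) \<in> ?X" for k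
    using \<phi>[of k] Lip_loc_uminus Lp_2_uminus[of "\<phi> k"] QL2_uminus[of "grad (\<phi> k)"]
    by (auto simp: QH1_finite_def grad_uminus[abs_def])
  ultimately have "\<exists>\<psi> :: nat \<Rightarrow> real^'n \<Rightarrow> real. (\<forall>k. \<psi> k \<in> ?X) \<and>
      (\<lambda>k. Lp_norm M 2 (\<lambda>x. \<psi> k x - - u x)) \<longlonglongrightarrow> 0 \<and>
      (\<lambda>k. QL2_norm \<Omega> Q (\<lambda>x. grad (\<psi> k) x - - g x)) \<longlonglongrightarrow> 0"
    using lim by (intro exI[of _ "\<lambda>k x. - \<phi> k x"]) presburger
  then show ?thesis
    using Lp_2_uminus[OF u] QL2_uminus[OF g] unfolding QH12_def QH_completion_def by blast
qed

text \<open>Linearity in the pair turns supersolutions into subsolutions of the same operator, with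
  unchanged coefficients and compatibility condition.\<close>

lemma weak_form_uminus:
  "weak_form \<Omega> v Q F G H R S ((\<lambda>x. - u x), (\<lambda>x. - g x)) \<phi> = - weak_form \<Omega> v Q F G H R S (u, g) \<phi>"
proof -
  have "svec R x (- \<xi>) = - svec R x \<xi>" for x \<xi> using svec_scale[of R x "-1" \<xi>] by simp
  moreover have "A *v (- \<xi>) = - (A *v \<xi>)" for A :: "real^'n^'n" and \<xi>
    using matrix_vector_mult_scaleR[of A "-1" \<xi>] by simp
  ultimately show ?thesis by (simp add: weak_form_def vfs_eq_svec)
qed

text \<open>It suffices to bound \<open>u\<close> by each admissible level \<open>k\<close>; if
  there is none, the infimum is infinite and nothing is claimed. Admissibility of \<open>k\<close>
  supplies the sequence \<open>V\<close>, membership of the pair in \<open>QH12\<close> the sequence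
  \<open>U\<close>.\<close>

lemma subsolution_le_boundary:
  fixes G H :: "real^'n \<Rightarrow> real^'m" and R S :: "'m::finite \<Rightarrow> real^'n \<Rightarrow> real^'n"
  assumes F: "F \<in> Lp M 2" and G: "G \<in> Lp M 2" and H: "H \<in> Lp M 2"
    and RS: "\<And>i. R i \<in> borel_measurable (lebesgue_on \<Omega>)" "\<And>i. S i \<in> borel_measurable (lebesgue_on \<Omega>)"
    and C: "subunit_const \<Omega> v Q R C\<^sub>R" "subunit_const \<Omega> v Q S C\<^sub>S"
    and compat: "\<And>\<phi>. \<phi> \<in> Lip0 \<Omega> \<Longrightarrow> (\<And>x. x \<in> \<Omega> \<Longrightarrow> 0 \<le> \<phi> x) \<Longrightarrow>
          0 \<le> (\<integral>x. G x \<bullet> vfs S (grad \<phi>) x + F x * \<phi> x \<partial>M)"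
    and abs: "absorbs (\<lambda>x. norm (G x) + norm (H x)) \<theta> Z" "absorbs (\<lambda>_. 1) \<theta>' Z'"
    and small: "(max C\<^sub>R C\<^sub>S)\<^sup>2 * \<theta> < 1"
    and u: "(u, g) \<in> QH12 \<Omega> v Q" and le: "weak_le0 \<Omega> v Q F G H R S (u, g)"
  shows "esssup M (\<lambda>x. ereal (u x)) \<le> bdry_sup_pos \<Omega> v Q (u, g)"
  unfolding bdry_sup_pos_def prod.case
proof (rule Inf_greatest, clarify)
  fix k :: real
  assume k: "0 \<le> k" and bdry: "((\<lambda>x. max (u x - k) 0), (\<lambda>x. if u x > k then g x else 0)) \<in> QH12_0 \<Omega> v Q"
  obtain U where U: "\<And>n. U n \<in> Lip_loc \<Omega> \<inter> QH1_finite \<Omega> v Q" "L2_null M (\<lambda>n x. U n x - u x)"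
    "L2_null M (\<lambda>n x. nrm x (grad (U n) x - g x))" "AE x in M. (\<lambda>n. U n x) \<longlonglongrightarrow> u x"
    by (rule QH_completionE[OF u[unfolded QH12_def]]) (auto simp: QH1_finite_def)
  obtain V where V: "\<And>n. V n \<in> Lip0 \<Omega>"
    "L2_null M (\<lambda>n x. nrm x (grad (V n) x - (if u x > k then g x else 0)))"
    "AE x in M. (\<lambda>n. V n x) \<longlonglongrightarrow> max (u x - k) 0"
    by (rule QH_completionE[OF bdry[unfolded QH12_0_def]]) (use Lip0_L2 in \<open>auto simp: Lp_2_iff QL2_iff\<close>)
  have uL: "u \<in> Lp M 2" "g \<in> QL2 \<Omega> Q"
    using u by (auto simp: QH12_def QH_completion_def)
  let ?K = "\<lambda>x. norm (G x) + norm (H x)" and ?C = "max C\<^sub>R C\<^sub>S" and ?\<Lambda> = "\<theta> + (\<integral>x. indicator \<Omega> x * Z x \<partial>M)"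
  have nn: "AE x in M. \<forall>\<xi>. 0 \<le> nrm x \<xi>"
    using AE_M_space by eventually_elim simp
  have Om: "\<Omega> \<in> sets M" using sets.top[of M] by simp
  \<comment> \<open>The weight \<open>|G|\<^sup>2\<close> is at most the square of
    \<open>|G| + |H|\<close>, so absorption with \<open>B = \<Omega>\<close> provides the constant
    \<open>\<Lambda>\<close>.\<close>
  interpret weak_subsolution \<Omega> v Q c u g U F G H R S ?C ?\<Lambda> k V
  proof
    show "AE x in M. \<forall>\<xi>. norm (svec R x \<xi>) \<le> ?C * nrm x \<xi>"
      using subunit_pointwise[OF RS(1) C(1)] nn
      by eventually_elim (meson max.cobounded1 mult_right_mono order_trans)
    show "AE x in M. \<forall>\<xi>. norm (svec S x \<xi>) \<le> ?C * nrm x \<xi>"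
      using subunit_pointwise[OF RS(2) C(2)] nn
      by eventually_elim (meson max.cobounded2 mult_right_mono order_trans)
    show "0 \<le> ?C" using C by (auto simp: subunit_const_def)
    fix \<phi> assume \<phi>: "\<phi> \<in> Lip0 \<Omega>"
    have "(norm (G x))\<^sup>2 \<le> (?K x)\<^sup>2" for x by (rule power_mono) auto
    then have "(\<integral>\<^sup>+x. ennreal ((norm (G x))\<^sup>2 * (\<phi> x)\<^sup>2) \<partial>M) \<le> (\<integral>\<^sup>+x. ennreal (indicator \<Omega> x * (?K x)\<^sup>2 * (\<phi> x)\<^sup>2) \<partial>M)"
      by (intro nn_integral_mono ennreal_leI) (simp add: mult_right_mono)
    also have "\<dots> \<le> ennreal (?\<Lambda> * (\<integral>x. (nrm x (grad \<phi> x))\<^sup>2 \<partial>M))"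
      using abs(1) \<phi> Om unfolding absorbs_def by blast
    finally show "(\<integral>\<^sup>+x. ennreal ((norm (G x))\<^sup>2 * (\<phi> x)\<^sup>2) \<partial>M) \<le> ennreal (?\<Lambda> * (\<integral>x. (nrm x (grad \<phi> x))\<^sup>2 \<partial>M))" .
  qed (use F G H uL RS compat le k U V in \<open>auto simp: Lp_2_iff QL2_iff\<close>)
  show "esssup M (\<lambda>x. ereal (u x)) \<le> ereal k"
  proof (rule subsolution_bounded)
    show "integrable M Z" "\<And>x. 0 \<le> Z x" "0 \<le> \<theta>" using abs(1) by (auto simp: absorbs_def)
    show "?C\<^sup>2 * \<theta> < 1" by (rule small)
    show "(\<integral>\<^sup>+x. ennreal (indicator B x * (K x)\<^sup>2 * (\<phi> x)\<^sup>2) \<partial>M)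
        \<le> ennreal ((\<theta> + (\<integral>x. indicator B x * Z x \<partial>M)) * (\<integral>x. (nrm x (grad \<phi> x))\<^sup>2 \<partial>M))"
      if "\<phi> \<in> Lip0 \<Omega>" "B \<in> sets M" for \<phi> B
      using abs(1) that unfolding absorbs_def K_def by blast
    show "(\<integral>\<^sup>+x. ennreal ((\<phi> x)\<^sup>2) \<partial>M) \<le> ennreal ((\<theta>' + (\<integral>x. indicator \<Omega> x * Z' x \<partial>M)) * (\<integral>x. (nrm x (grad \<phi> x))\<^sup>2 \<partial>M))"
      if "\<phi> \<in> Lip0 \<Omega>" for \<phi>
      by (rule absorbs_one[OF abs(2) that])
  qed
qed

lemma supersolution_ge_boundary:
  assumes "esssup M (\<lambda>x. ereal (- u x)) \<le> bdry_sup_pos \<Omega> v Q ((\<lambda>x. - u x), (\<lambda>x. - g x))"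
  shows "bdry_inf_neg \<Omega> v Q (u, g) \<le> essinf M (\<lambda>x. ereal (u x))"
proof -
  have "AE x in M. ereal (- u x) \<le> esssup M (\<lambda>x. ereal (- u x))" by (rule esssup_AE)
  then have "AE x in M. - esssup M (\<lambda>x. ereal (- u x)) \<le> ereal (u x)"
    by (rule eventually_mono) (simp add: ereal_uminus_le_reorder)
  then have "- esssup M (\<lambda>x. ereal (- u x)) \<le> essinf M (\<lambda>x. ereal (u x))"
    unfolding essinf_def by (intro Sup_upper) simp
  moreover have "bdry_inf_neg \<Omega> v Q (u, g) \<le> - esssup M (\<lambda>x. ereal (- u x))"
    using assms by (simp add: bdry_inf_neg_def)
  ultimately show ?thesis by (rule order_trans[rotated])
qed

end

section \<open>From the three alternatives to absorption\<close>

lemma Linf_norm_boundE: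
  fixes f :: "'a \<Rightarrow> 'b::euclidean_space"
  assumes "f \<in> Linf M"
  obtains b where "0 \<le> b" "Linf_norm M f = ennreal b" "AE x in M. norm (f x) \<le> b"
proof -
  have "Linf_norm M f < top" using assms by (simp add: Linf_def)
  then obtain b where b: "0 \<le> b" "Linf_norm M f = ennreal b" by (cases "Linf_norm M f") auto
  have "AE x in M. ennreal (norm (f x)) \<le> Linf_norm M f" unfolding Linf_norm_def by (rule esssup_AE)
  then have "AE x in M. norm (f x) \<le> b" by (rule eventually_mono) (simp add: b)
  then show ?thesis using b by (intro that)
qed

lemma integrable_powr_le:
  fixes f :: "'a \<Rightarrow> 'b::euclidean_space"
  assumes "finite_measure M" "f \<in> Lp M q" "0 \<le> r" "r \<le> q"
  shows "integrable M (\<lambda>x. norm (f x) powr r)"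
proof -
  interpret finite_measure M by fact
  have [measurable]: "f \<in> borel_measurable M" and f: "integrable M (\<lambda>x. norm (f x) powr q)"
    using assms(2) by (auto simp: Lp_def)
  show ?thesis
  proof (rule Bochner_Integration.integrable_bound)
    show "integrable M (\<lambda>x. 1 + norm (f x) powr q)" using f by simp
    have "t powr r \<le> 1 + t powr q" if "0 \<le> t" for t :: real
    proof (cases "t \<le> 1")
      case True
      then have "t powr r \<le> 1" using that assms(3) by (intro powr_le1) auto
      then show ?thesis by (simp add: add_increasing2)
    next
      case False
      then have "t powr r \<le> t powr q" using assms(4) by (intro powr_mono) auto
      then show ?thesis by simp
    qed
    then show "AE x in M. norm (norm (f x) powr r) \<le> norm (1 + norm (f x) powr q)" by simp
  qed measurable
qed

text \<open>All three alternatives end in the same two absorption statements. The constants of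
  \<open>R\<close> and \<open>S\<close> belong to the conclusion because the third alternative
  prescribes them, while the others leave the choice open.\<close>

lemma (in degenerate_form) absorption_alternatives:
  fixes G H :: "real^'n \<Rightarrow> real^'m" and R S :: "'m::finite \<Rightarrow> real^'n \<Rightarrow> real^'n"
  assumes [measurable]: "G \<in> borel_measurable M" "H \<in> borel_measurable M"
    and R: "\<And>i. subunit \<Omega> v Q (R i)" and S: "\<And>i. subunit \<Omega> v Q (S i)"
    and alternatives:
      "(\<exists>\<sigma>>1. (\<exists>K>0. \<forall>\<phi>\<in>Lip0 \<Omega>. Lp_norm M (2 * \<sigma>) \<phi> \<le> K * QL2_norm \<Omega> Q (grad \<phi>)) \<and>
               (\<exists>\<sigma>' q. 1 / \<sigma> + 1 / \<sigma>' = 1 \<and> 2 * \<sigma>' < q \<and> G \<in> Lp M q \<and> H \<in> Lp M q))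
       \<or> (\<exists>\<sigma>>0. (\<exists>K>0. \<forall>\<phi>\<in>Lip0 \<Omega>. Orlicz_norm M (\<lambda>t. t\<^sup>2 * ln (exp 1 + t) powr \<sigma>) \<phi>
                    \<le> ennreal (K * QL2_norm \<Omega> Q (grad \<phi>))) \<and>
               (\<exists>l. 0 < l \<and> l < 1 \<and> G \<in> Orlicz M (\<lambda>t. exp (t powr (2 / (l * \<sigma>))) - 1) \<and>
                  H \<in> Orlicz M (\<lambda>t. exp (t powr (2 / (l * \<sigma>))) - 1)))
       \<or> (\<exists>K>0. (\<forall>\<phi>\<in>Lip0 \<Omega>. Lp_norm M 2 \<phi> \<le> K * QL2_norm \<Omega> Q (grad \<phi>)) \<and>
               G \<in> Linf M \<and> H \<in> Linf M \<and>
               (\<exists>C\<^sub>R C\<^sub>S. subunit_const \<Omega> v Q R C\<^sub>R \<and> subunit_const \<Omega> v Q S C\<^sub>S \<and>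
                  ennreal (max C\<^sub>R C\<^sub>S * K) * (Linf_norm M G + Linf_norm M H) < 1))"
  obtains C\<^sub>R C\<^sub>S \<theta> Z \<theta>' Z' where "subunit_const \<Omega> v Q R C\<^sub>R" "subunit_const \<Omega> v Q S C\<^sub>S"
    "(max C\<^sub>R C\<^sub>S)\<^sup>2 * \<theta> < 1" "absorbs (\<lambda>x. norm (G x) + norm (H x)) \<theta> Z" "absorbs (\<lambda>_. 1) \<theta>' Z'"
proof -
  let ?K = "\<lambda>x. norm (G x) + norm (H x)"
  interpret finite_measure M by (rule finite_measure_M)
  have K_integrable: "integrable M (\<lambda>x. f (?K x))"
    if "\<And>s t. 0 \<le> s \<Longrightarrow> s \<le> t \<Longrightarrow> f s \<le> f t" "\<And>s. 0 \<le> f s" "f \<in> borel_measurable borel"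
      "integrable M (\<lambda>x. f (2 * norm (G x)))" "integrable M (\<lambda>x. f (2 * norm (H x)))" for f :: "real \<Rightarrow> real"
  proof (rule Bochner_Integration.integrable_bound)
    note [measurable] = that(3)
    show "integrable M (\<lambda>x. f (2 * norm (G x)) + f (2 * norm (H x)))" using that(4,5) by simp
    show "(\<lambda>x. f (?K x)) \<in> borel_measurable M" by measurable
    have "f (?K x) \<le> f (2 * norm (G x)) + f (2 * norm (H x))" for x
      by (rule mono_sum_le) (use that in auto)
    then show "AE x in M. norm (f (?K x)) \<le> norm (f (2 * norm (G x)) + f (2 * norm (H x)))"
      using that(2) by simp
  qed
  note witness = that
  \<comment> \<open>When \<open>\<theta>\<close> may be arbitrarily small, the constants are fixed
    beforehand and \<open>\<theta> = 1 / (C\<^sup>2 + 1)\<close> meets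
    \<open>C\<^sup>2 * \<theta> < 1\<close>.\<close>
  have reduce: thesis if all: "\<And>\<theta>. 0 < \<theta> \<Longrightarrow> \<exists>Z. absorbs ?K \<theta> Z" and one: "\<exists>Z'. absorbs (\<lambda>_. 1) 1 Z'"
  proof -
    obtain C\<^sub>R where R': "subunit_const \<Omega> v Q R C\<^sub>R" by (rule subunit_imp_subunit_const[OF R])
    obtain C\<^sub>S where S': "subunit_const \<Omega> v Q S C\<^sub>S" by (rule subunit_imp_subunit_const[OF S])
    define C where "C = max C\<^sub>R C\<^sub>S"
    have "0 < 1 / (C\<^sup>2 + 1)" by (simp add: add_nonneg_pos)
    then obtain Z where "absorbs ?K (1 / (C\<^sup>2 + 1)) Z" using all by blast
    moreover obtain Z' where "absorbs (\<lambda>_. 1) 1 Z'" using one by blast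
    moreover have "C\<^sup>2 * (1 / (C\<^sup>2 + 1)) < 1" by (simp add: add_nonneg_pos)
    ultimately show thesis using R' S' unfolding C_def by (intro witness)
  qed
  from alternatives show thesis
  proof (elim disjE exE conjE)
    fix \<sigma> K0 \<sigma>' q :: real
    assume \<sigma>: "1 < \<sigma>" and K0: "0 < K0"
      and Sob: "\<forall>\<phi>\<in>Lip0 \<Omega>. Lp_norm M (2 * \<sigma>) \<phi> \<le> K0 * QL2_norm \<Omega> Q (grad \<phi>)"
      and \<sigma>': "1 / \<sigma> + 1 / \<sigma>' = 1" and q: "2 * \<sigma>' < q" and GH: "G \<in> Lp M q" "H \<in> Lp M q"
    \<comment> \<open>This is \<open>2 * \<sigma>'\<close>, so \<open>q > 2 * \<sigma>'\<close> and
      the finiteness of the measure give integrability of the power \<open>r\<close>.\<close>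
    define r where "r = 2 * \<sigma> / (\<sigma> - 1)"
    have "1 / \<sigma>' = (\<sigma> - 1) / \<sigma>" using \<sigma> \<sigma>' by (simp add: field_simps)
    then have "\<sigma>' = \<sigma> / (\<sigma> - 1)" by (metis div_by_1 divide_divide_eq_right mult_1)
    then have r: "0 \<le> r" "r \<le> q" using \<sigma> q by (auto simp: r_def)
    have "integrable M (\<lambda>x. ?K x powr r)"
    proof (rule K_integrable)
      show "integrable M (\<lambda>x. (2 * norm (G x)) powr r)" "integrable M (\<lambda>x. (2 * norm (H x)) powr r)"
        using GH r integrable_powr_le[OF finite_measure_M] by (auto simp: powr_mult)
    qed (use r in \<open>auto intro: powr_mono2\<close>)
    then have "\<exists>Z. absorbs ?K \<theta> Z" if "0 < \<theta>" for \<theta>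
      using \<sigma> K0 Sob that unfolding r_def by (intro absorbs_power[of \<sigma> K0]) auto
    moreover have "\<exists>Z. absorbs (\<lambda>_. 1) 1 Z"
      using \<sigma> K0 Sob by (intro absorbs_power[of \<sigma> K0]) auto
    ultimately show thesis by (rule reduce)
  next
    fix \<sigma> K0 l :: real
    assume \<sigma>: "0 < \<sigma>" and K0: "0 < K0" and l: "0 < l" "l < 1"
      and Sob: "\<forall>\<phi>\<in>Lip0 \<Omega>. Orlicz_norm M (\<lambda>t. t\<^sup>2 * ln (exp 1 + t) powr \<sigma>) \<phi> \<le> ennreal (K0 * QL2_norm \<Omega> Q (grad \<phi>))"
      and GH: "G \<in> Orlicz M (\<lambda>t. exp (t powr (2 / (l * \<sigma>))) - 1)" "H \<in> Orlicz M (\<lambda>t. exp (t powr (2 / (l * \<sigma>))) - 1)"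
    \<comment> \<open>Here \<open>l\<close> is the number \<open>\<lambda>\<close> of the second
      alternative; \<open>l < 1\<close> makes the exponent available in \<open>L\<^sup>C\<close>
      strictly larger than \<open>2 / \<sigma>\<close>.\<close>
    have p: "0 < 2 / \<sigma>" "2 / \<sigma> < 2 / (l * \<sigma>)" using \<sigma> l by (auto intro!: divide_strict_left_mono)
    have "integrable M (\<lambda>x. (?K x)\<^sup>2 * exp (D * ?K x powr (2 / \<sigma>)))" if "0 \<le> D" for D
    proof (rule K_integrable)
      define D' where "D' = D * 2 powr (2 / \<sigma>)"
      have "0 \<le> D'" using that by (simp add: D'_def)
      note i = GH[THEN integrable_exp_Orlicz[OF finite_measure_M _ p this]]
      have eq: "(2 * s)\<^sup>2 * exp (D * (2 * s) powr (2 / \<sigma>)) = 4 * (s\<^sup>2 * exp (D' * s powr (2 / \<sigma>)))" for s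
        by (simp add: D'_def powr_mult power_mult_distrib mult.assoc)
      show "integrable M (\<lambda>x. (2 * norm (G x))\<^sup>2 * exp (D * (2 * norm (G x)) powr (2 / \<sigma>)))"
        "integrable M (\<lambda>x. (2 * norm (H x))\<^sup>2 * exp (D * (2 * norm (H x)) powr (2 / \<sigma>)))"
        unfolding eq using i by simp_all
    qed (use that \<sigma> in \<open>auto intro!: mult_mono power_mono mult_left_mono powr_mono2\<close>)
    then have "\<exists>Z. absorbs ?K \<theta> Z" if "0 < \<theta>" for \<theta>
      using \<sigma> K0 Sob that by (intro absorbs_Orlicz[of \<sigma> K0]) auto
    moreover have "\<exists>Z. absorbs (\<lambda>_. 1) 1 Z"
      using \<sigma> K0 Sob by (intro absorbs_Orlicz[of \<sigma> K0]) auto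
    ultimately show thesis by (rule reduce)
  next
    fix K0 C\<^sub>R C\<^sub>S :: real
    assume K0: "0 < K0" and Sob: "\<forall>\<phi>\<in>Lip0 \<Omega>. Lp_norm M 2 \<phi> \<le> K0 * QL2_norm \<Omega> Q (grad \<phi>)"
      and GH: "G \<in> Linf M" "H \<in> Linf M"
      and C: "subunit_const \<Omega> v Q R C\<^sub>R" "subunit_const \<Omega> v Q S C\<^sub>S"
      and small: "ennreal (max C\<^sub>R C\<^sub>S * K0) * (Linf_norm M G + Linf_norm M H) < 1"
    obtain g where g: "0 \<le> g" "Linf_norm M G = ennreal g" "AE x in M. norm (G x) \<le> g" by (rule Linf_norm_boundE[OF GH(1)])
    obtain h where h: "0 \<le> h" "Linf_norm M H = ennreal h" "AE x in M. norm (H x) \<le> h" by (rule Linf_norm_boundE[OF GH(2)])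
    define C where "C = max C\<^sub>R C\<^sub>S"
    have C0: "0 < C" using C by (auto simp: C_def subunit_const_def less_max_iff_disj)
    have "ennreal (C * K0 * (g + h)) < 1"
      using small g h C0 K0 by (simp add: ennreal_mult' C_def)
    then have "C * K0 * (g + h) < 1" using ennreal_less_iff[of "C * K0 * (g + h)" 1] C0 K0 g h by simp
    \<comment> \<open>The smallness hypothesis, squared, is exactly
      \<open>C\<^sup>2 * \<theta> < 1\<close> for
      \<open>\<theta> = (g + h)\<^sup>2 * K0\<^sup>2\<close>.\<close>
    then have "(C * K0 * (g + h))\<^sup>2 < 1\<^sup>2" using C0 K0 g h by (intro power_strict_mono) auto
    then have C1: "C\<^sup>2 * ((g + h)\<^sup>2 * K0\<^sup>2) < 1" by (simp add: power_mult_distrib ac_simps)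
    have "AE x in M. \<bar>?K x\<bar> \<le> g + h" using g(3) h(3) by eventually_elim simp
    then have "absorbs ?K ((g + h)\<^sup>2 * K0\<^sup>2) (\<lambda>_. 0)"
      using K0 Sob by (intro absorbs_bounded) auto
    moreover have "absorbs (\<lambda>_. 1) (1\<^sup>2 * K0\<^sup>2) (\<lambda>_. 0)"
      using K0 Sob by (intro absorbs_bounded) auto
    ultimately show thesis using C C1 unfolding C_def by (intro witness)
  qed
qed

theorem theorem4p3:
  fixes \<Omega> :: "(real^'n) set"
    and v :: "real^'n \<Rightarrow> real"
    and Q :: "real^'n \<Rightarrow> real^'n^'n"
    and c :: real
    and F :: "real^'n \<Rightarrow> real"
    and G H :: "real^'n \<Rightarrow> real^'m"
    and R S :: "'m::finite \<Rightarrow> real^'n \<Rightarrow> real^'n"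
    and u :: "real^'n \<Rightarrow> real"
    and Du :: "real^'n \<Rightarrow> real^'n"
  assumes "bounded \<Omega>" "connected \<Omega>" "open \<Omega>"
    and "integrable (lebesgue_on \<Omega>) v" "\<And>x. x \<in> \<Omega> \<Longrightarrow> 0 \<le> v x"
    and "Q \<in> borel_measurable (lebesgue_on \<Omega>)" "\<And>x. x \<in> \<Omega> \<Longrightarrow> sym_nonneg (Q x)"
    and "\<And>x \<xi>. x \<in> \<Omega> \<Longrightarrow> (Q x *v \<xi>) \<bullet> \<xi> \<le> c * v x * (norm \<xi>)\<^sup>2"
    and "F \<in> Lp (wmeasure \<Omega> v) 2" "G \<in> Lp (wmeasure \<Omega> v) 2" "H \<in> Lp (wmeasure \<Omega> v) 2"
    and "\<And>i. subunit \<Omega> v Q (R i)" "\<And>i. subunit \<Omega> v Q (S i)"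
    and compatibility: "\<And>\<phi>. \<phi> \<in> Lip0 \<Omega> \<Longrightarrow> (\<And>x. x \<in> \<Omega> \<Longrightarrow> 0 \<le> \<phi> x) \<Longrightarrow>
          0 \<le> (\<integral>x. G x \<bullet> vfs S (grad \<phi>) x + F x * \<phi> x \<partial>wmeasure \<Omega> v)"
    and alternatives:
      "(\<exists>\<sigma>>1. (\<exists>K>0. \<forall>\<phi>\<in>Lip0 \<Omega>.
                  Lp_norm (wmeasure \<Omega> v) (2 * \<sigma>) \<phi> \<le> K * QL2_norm \<Omega> Q (grad \<phi>)) \<and>
               (\<exists>\<sigma>' q. 1 / \<sigma> + 1 / \<sigma>' = 1 \<and> 2 * \<sigma>' < q \<and>
                  G \<in> Lp (wmeasure \<Omega> v) q \<and> H \<in> Lp (wmeasure \<Omega> v) q \<and>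
                  F \<in> Lp (wmeasure \<Omega> v) (q / 2)))
       \<or> (\<exists>\<sigma>>0. (\<exists>K>0. \<forall>\<phi>\<in>Lip0 \<Omega>.
                  Orlicz_norm (wmeasure \<Omega> v) (\<lambda>t. t\<^sup>2 * ln (exp 1 + t) powr \<sigma>) \<phi>
                    \<le> ennreal (K * QL2_norm \<Omega> Q (grad \<phi>))) \<and>
               (\<exists>l. 0 < l \<and> l < 1 \<and>
                  G \<in> Orlicz (wmeasure \<Omega> v) (\<lambda>t. exp (t powr (2 / (l * \<sigma>))) - 1) \<and>
                  H \<in> Orlicz (wmeasure \<Omega> v) (\<lambda>t. exp (t powr (2 / (l * \<sigma>))) - 1) \<and>
                  F \<in> Orlicz (wmeasure \<Omega> v) (\<lambda>t. exp (t powr (1 / (l * \<sigma>))) - 1)))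
       \<or> (\<exists>K>0. (\<forall>\<phi>\<in>Lip0 \<Omega>. Lp_norm (wmeasure \<Omega> v) 2 \<phi> \<le> K * QL2_norm \<Omega> Q (grad \<phi>)) \<and>
               F \<in> Linf (wmeasure \<Omega> v) \<and> G \<in> Linf (wmeasure \<Omega> v) \<and> H \<in> Linf (wmeasure \<Omega> v) \<and>
               (\<exists>C\<^sub>R C\<^sub>S. subunit_const \<Omega> v Q R C\<^sub>R \<and> subunit_const \<Omega> v Q S C\<^sub>S \<and>
                  ennreal (max C\<^sub>R C\<^sub>S * K) *
                    (Linf_norm (wmeasure \<Omega> v) G + Linf_norm (wmeasure \<Omega> v) H) < 1))"
    and "(u, Du) \<in> QH12 \<Omega> v Q"
  shows "(weak_le0 \<Omega> v Q F G H R S (u, Du) \<longrightarrow>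
            esssup (wmeasure \<Omega> v) (\<lambda>x. ereal (u x)) \<le> bdry_sup_pos \<Omega> v Q (u, Du)) \<and>
         (weak_ge0 \<Omega> v Q F G H R S (u, Du) \<longrightarrow>
            essinf (wmeasure \<Omega> v) (\<lambda>x. ereal (u x)) \<ge> bdry_inf_neg \<Omega> v Q (u, Du))"
proof -
  interpret degenerate_form \<Omega> v Q c
    by unfold_locales (fact assms)+
  have mG: "G \<in> borel_measurable M" and mH: "H \<in> borel_measurable M"
    using assms(10,11) by (auto simp: Lp_2_iff)
  have mR: "R i \<in> borel_measurable (lebesgue_on \<Omega>)" and mS: "S i \<in> borel_measurable (lebesgue_on \<Omega>)" for i
    using assms(12,13)[of i] by (auto simp: subunit_def)
  obtain C\<^sub>R C\<^sub>S \<theta> Z \<theta>' Z' where C: "subunit_const \<Omega> v Q R C\<^sub>R" "subunit_const \<Omega> v Q S C\<^sub>S"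
      and small: "(max C\<^sub>R C\<^sub>S)\<^sup>2 * \<theta> < 1"
      and abs: "absorbs (\<lambda>x. norm (G x) + norm (H x)) \<theta> Z" "absorbs (\<lambda>_. 1) \<theta>' Z'"
    by (rule absorption_alternatives[where R = R and S = S, OF mG mH assms(12,13)]) (use alternatives in blast)
  \<comment> \<open>Stated for an arbitrary pair, so that it applies to \<open>(u, Du)\<close> as
    well as to its negative.\<close>
  have sub: "esssup M (\<lambda>x. ereal (w x)) \<le> bdry_sup_pos \<Omega> v Q (w, Dw)"
    if "(w, Dw) \<in> QH12 \<Omega> v Q" "weak_le0 \<Omega> v Q F G H R S (w, Dw)" for w Dw
    by (rule subsolution_le_boundary[OF assms(9-11) mR mS C compatibility abs small that])
  show ?thesis
  proof (intro conjI impI)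
    assume "weak_le0 \<Omega> v Q F G H R S (u, Du)"
    then show "esssup M (\<lambda>x. ereal (u x)) \<le> bdry_sup_pos \<Omega> v Q (u, Du)" by (intro sub assms(16))
  next
    assume "weak_ge0 \<Omega> v Q F G H R S (u, Du)"
    then have "weak_le0 \<Omega> v Q F G H R S ((\<lambda>x. - u x), (\<lambda>x. - Du x))"
      by (simp add: weak_ge0_def weak_le0_def weak_form_uminus)
    then show "bdry_inf_neg \<Omega> v Q (u, Du) \<le> essinf M (\<lambda>x. ereal (u x))"
      by (intro supersolution_ge_boundary sub QH12_uminus assms(16))
  qed
qed

end
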